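(* Let $\mathbb F\in\{\mathbb R,\mathbb C,\mathbb H\}$, $d:=\dim_{\mathbb R}\mathbb F$, and $k\ge 2$. Let $\nu$ be a probability measure on $[0,\infty[$ with $\nu\neq\delta_0$ and finite second moment. For $j\in\mathbb N$ let $M_j:=\int_0^\infty m_j(t)\,d\nu(t)$ be the modified moments of $\nu$, where $M_1,M_2<\infty$ by the assumption on $\nu$. Then $$\frac{\mathrm{dist}(S_n^{(k,1)},eK)-nM_1}{\sqrt n}$$ tends in distribution, as $n\to\infty$, to the normal distribution $N(0,M_2-M_1^2)$, where $M_2-M_1^2>0$. Moreover, if $\nu$ in addition has a finite third moment, then the distribution functions of the random variables above tend uniformly on $\mathbb R$ to the distribution function of $N(0,M_2-M_1^2)$ with order $n^{-1/3}$, i.e. the supremum over $\mathbb R$ of the absolute difference of the distribution functions is $O(n^{-1/3})$.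
   Context: Hyperbolic spaces. $H_k(\mathbb F)=G/K$ with $G=SO_o(1,k)$, $K=SO(k)$ for $\mathbb F=\mathbb R$; $G=SU(1,k)$, $K=S(U(1)\times U(k))$ for $\mathbb F=\mathbb C$; $G=Sp(1,k)$, $K=Sp(1)\times Sp(k)$ for $\mathbb F=\mathbb H$. For $t\ge 0$ let $$a_t=\begin{pmatrix}\cosh t&0&\sinh t\\0&I_{k-1}&0\\ \sinh t&0&\cosh t\end{pmatrix}\in G$$ (of size $(k+1)\times(k+1)$). Every double coset in $G//K$ equals $Ka_tK$ for a unique $t\in[0,\infty[$. The hyperbolic distance on $G/K$ is $\mathrm{dist}(xK,yK):=t$ where $Ky^{-1}xK=Ka_tK$. $G$ acts isometrically on $H_k(\mathbb F)$. Radial random walks. A radial random walk on $H_k(\mathbb F)$ is a time-homogeneous Markov chain $(S_n)_{n\ge0}$ on $H_k(\mathbb F)$ started at $eK$ whose transition kernel $K_k$ is $G$-invariant: $K_k(g(x),g(A))=K_k(x,A)$ for all $g\in G$, $x\in H_k(\mathbb F)$ and Borel sets $A\subset H_k(\mathbb F)$. The distribution $\nu$ on $[0,\infty[$ of $\mathrm{dist}(S_n,S_{n+1})$ does not depend on $n$, and each probability measure $\nu$ on $[0,\infty[$ determines a unique such kernel; the walk is called associated with $\nu$. The walk $(S_n^{(k,1)})_{n\ge0}$ is the radial random walk on $H_k(\mathbb F)$ associated with $\nu$ itself (no compression). Modified moment functions. For $j\in\mathbb N$ and $t\ge0$, $$m_j(t):=\int_0^1\int_0^\pi\bigl(\ln|\cosh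 t+re^{i\phi}\sinh t|\bigr)^j\,dm_{\alpha,\beta}(r,\phi),\qquad \alpha=dk/2-1,\ \beta=d/2-1,$$ where $m_{\alpha,\beta}$ is the probability measure on $[0,1]\times[0,\pi]$ given for $\alpha>\beta>-1/2$ by $$dm_{\alpha,\beta}(r,\phi)=\frac{2\Gamma(\alpha+1)}{\Gamma(1/2)\Gamma(\alpha-\beta)\Gamma(\beta+1/2)}(1-r^2)^{\alpha-\beta-1}(r\sin\phi)^{2\beta}\,r\,dr\,d\phi,$$ and for $\alpha>\beta=-1/2$ by $$dm_{\alpha,-1/2}(r,\phi)=\frac{2\Gamma(\alpha+1)}{\Gamma(1/2)\Gamma(\alpha+1/2)}(1-r^2)^{\alpha-1/2}\,dr\cdot\tfrac12\,d(\delta_0+\delta_\pi)(\phi).$$ *)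

theory Defs
  imports "HOL-Probability.Probability"
begin

section \<open>Quaternions\<close>

datatype quat = Quat (qre: real) (qi: real) (qj: real) (qk: real)

lemma quat_eq_iff: "x = y \<longleftrightarrow> qre x = qre y \<and> qi x = qi y \<and> qj x = qj y \<and> qk x = qk y"
  by (cases x; cases y) auto

instantiation quat :: ring_1
begin

definition "0 = Quat 0 0 0 0"
definition "1 = Quat 1 0 0 0"
definition "x + y = Quat (qre x + qre y) (qi x + qi y) (qj x + qj y) (qk x + qk y)"
definition "x - y = Quat (qre x - qre y) (qi x - qi y) (qj x - qj y) (qk x - qk y)"
definition "- x = Quat (- qre x) (- qi x) (- qj x) (- qk x)"
definition "x * y = Quat
  (qre x * qre y - qi x * qi y - qj x * qj y - qk x * qk y)
  (qre x * qi y + qi x * qre y + qj x * qk y - qk x * qj y)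
  (qre x * qj y - qi x * qk y + qj x * qre y + qk x * qi y)
  (qre x * qk y + qi x * qj y - qj x * qi y + qk x * qre y)"

instance
  by standard
    (simp_all add: quat_eq_iff zero_quat_def one_quat_def plus_quat_def minus_quat_def
      uminus_quat_def times_quat_def algebra_simps)

end

instantiation quat :: real_algebra_1
begin

definition "r *\<^sub>R x = Quat (r * qre x) (r * qi x) (r * qj x) (r * qk x)"

instance
  by standard
    (simp_all add: quat_eq_iff plus_quat_def times_quat_def scaleR_quat_def algebra_simps)

end

instantiation quat :: real_inner
begin

definition "inner x y = qre x * qre y + qi x * qi y + qj x * qj y + qk x * qk y"
definition "norm (x :: quat) = sqrt (inner x x)"
definition "sgn (x :: quat) = x /\<^sub>R norm x"
definition "dist x y = norm (x - y :: quat)"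
definition uniformity_quat_def [code del]:
  "(uniformity :: (quat \<times> quat) filter) = (INF e\<in>{0 <..}. principal {(x, y). dist x y < e})"
definition open_quat_def [code del]:
  "open (U :: quat set) \<longleftrightarrow> (\<forall>x\<in>U. eventually (\<lambda>(x', y). x' = x \<longrightarrow> y \<in> U) uniformity)"

instance
proof
  fix x y z :: quat and a b :: real
  show "0 \<le> inner x x"
    by (simp add: inner_quat_def)
  show "inner x x = 0 \<longleftrightarrow> x = 0"
  proof
    assume "inner x x = 0"
    hence s: "(qre x)\<^sup>2 + (qi x)\<^sup>2 + (qj x)\<^sup>2 + (qk x)\<^sup>2 = 0"
      by (simp add: inner_quat_def power2_eq_square)
    have "(qre x)\<^sup>2 = 0 \<and> (qi x)\<^sup>2 = 0 \<and> (qj x)\<^sup>2 = 0 \<and> (qk x)\<^sup>2 = 0"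
      using s zero_le_power2[of "qre x"] zero_le_power2[of "qi x"] zero_le_power2[of "qj x"]
        zero_le_power2[of "qk x"] by linarith
    thus "x = 0" by (simp add: quat_eq_iff zero_quat_def)
  qed (simp add: inner_quat_def zero_quat_def)
  show "(x + y) \<bullet> z = x \<bullet> z + y \<bullet> z" by (simp add: inner_quat_def plus_quat_def algebra_simps)
  show "(a *\<^sub>R x) \<bullet> z = a * (x \<bullet> z)" by (simp add: inner_quat_def scaleR_quat_def algebra_simps)
  show "x \<bullet> y = y \<bullet> x" by (simp add: inner_quat_def algebra_simps)
qed (rule norm_quat_def sgn_quat_def dist_quat_def open_quat_def uniformity_quat_def)+

end

instantiation quat :: euclidean_space
begin

definition "Basis = {Quat 1 0 0 0, Quat 0 1 0 0, Quat 0 0 1 0, Quat 0 0 0 1}"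

instance
proof
  fix u v x :: quat
  show "(Basis :: quat set) \<noteq> {}" "finite (Basis :: quat set)"
    by (simp_all add: Basis_quat_def)
  show "u \<bullet> v = (if u = v then 1 else 0)" if "u \<in> Basis" "v \<in> Basis"
    using that unfolding Basis_quat_def by (elim insertE emptyE) (simp_all add: inner_quat_def)
  show "(\<forall>u\<in>Basis. x \<bullet> u = 0) \<longleftrightarrow> x = 0"
    by (cases x) (simp add: Basis_quat_def inner_quat_def zero_quat_def)
qed

end

definition quat_cnj :: "quat \<Rightarrow> quat" where
  "quat_cnj x = Quat (qre x) (- qi x) (- qj x) (- qk x)"

definition quat_of_real :: "real \<Rightarrow> quat" where
  "quat_of_real x = Quat x 0 0 0"

definition quat_of_complex :: "complex \<Rightarrow> quat" where
  "quat_of_complex z = Quat (Re z) (Im z) 0 0"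

type_synonym ('f, 'n) sqmat = "'f^'n^'n"

section \<open>The groups and the hyperbolic spaces\<close>

text \<open>
  The matrices are indexed by a finite linearly ordered type of size \<open>k + 1\<close>, whose least and
  greatest elements play the role of the first and last row (column).
\<close>

definition ix0 :: "'n::{finite,linorder}" where "ix0 = Min UNIV"

definition ix1 :: "'n::{finite,linorder}" where "ix1 = Max UNIV"

definition lorentz_form :: "('f::ring_1, 'n::{finite,linorder}) sqmat" where
  "lorentz_form = (\<chi> i j. if i = j then (if i = ix0 then 1 else - 1) else 0)"

definition adjoint_mat :: "('f \<Rightarrow> 'f) \<Rightarrow> ('f, 'n::finite) sqmat \<Rightarrow> ('f, 'n) sqmat" where
  "adjoint_mat c A = (\<chi> i j. c (A $ j $ i))"

text \<open>Matrices preserving the sesquilinear form of signature \<open>(1, k)\<close>; \<open>c\<close> is the conjugation.\<close>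

definition preserves_form :: "('f::ring_1 \<Rightarrow> 'f) \<Rightarrow> ('f, 'n::{finite,linorder}) sqmat \<Rightarrow> bool" where
  "preserves_form c A \<longleftrightarrow> adjoint_mat c A ** lorentz_form ** A = lorentz_form"

definition unitary_mat :: "('f::ring_1 \<Rightarrow> 'f) \<Rightarrow> ('f, 'n::finite) sqmat \<Rightarrow> bool" where
  "unitary_mat c A \<longleftrightarrow> adjoint_mat c A ** A = mat 1 \<and> A ** adjoint_mat c A = mat 1"

definition block_diag :: "('f::zero, 'n::{finite,linorder}) sqmat \<Rightarrow> bool" where
  "block_diag A \<longleftrightarrow> (\<forall>i. i \<noteq> ix0 \<longrightarrow> A $ ix0 $ i = 0 \<and> A $ i $ ix0 = 0)"

definition SO1 :: "((real, 'n::{finite,linorder}) sqmat) set" where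
  "SO1 = {A. preserves_form id A \<and> det A = 1}"

definition SO1o :: "((real, 'n::{finite,linorder}) sqmat) set" where
  "SO1o = connected_component_set SO1 (mat 1)"

definition SU1 :: "((complex, 'n::{finite,linorder}) sqmat) set" where
  "SU1 = {A. preserves_form cnj A \<and> det A = 1}"

definition Sp1 :: "((quat, 'n::{finite,linorder}) sqmat) set" where
  "Sp1 = {A. preserves_form quat_cnj A}"

text \<open>\<open>SO(k)\<close>, embedded as \<open>diag(1, SO(k))\<close>.\<close>

definition K_SO :: "((real, 'n::{finite,linorder}) sqmat) set" where
  "K_SO = {A. block_diag A \<and> A $ ix0 $ ix0 = 1 \<and> unitary_mat id A \<and> det A = 1}"

definition K_SU :: "((complex, 'n::{finite,linorder}) sqmat) set" where
  "K_SU = {A. block_diag A \<and> unitary_mat cnj A \<and> det A = 1}"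

definition K_Sp :: "((quat, 'n::{finite,linorder}) sqmat) set" where
  "K_Sp = {A. block_diag A \<and> unitary_mat quat_cnj A}"

datatype base_field = F_real | F_complex | F_quat

fun real_dim :: "base_field \<Rightarrow> nat" where
  "real_dim F_real = DIM(real)"
| "real_dim F_complex = DIM(complex)"
| "real_dim F_quat = DIM(quat)"

definition mat_map :: "('f \<Rightarrow> 'g) \<Rightarrow> ('f, 'n::finite) sqmat \<Rightarrow> ('g, 'n) sqmat" where
  "mat_map f A = (\<chi> i j. f (A $ i $ j))"

text \<open>
  In order to treat the three cases by a variable of type \<open>base_field\<close>, real and complex
  matrices are viewed as quaternionic matrices via the inclusion of the reals and the complex
  numbers into the quaternions (a topological embedding and a ring homomorphism).
\<close>

fun Ggrp :: "base_field \<Rightarrow> ((quat, 'n::{finite,linorder}) sqmat) set" where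
  "Ggrp F_real = mat_map quat_of_real ` SO1o"
| "Ggrp F_complex = mat_map quat_of_complex ` SU1"
| "Ggrp F_quat = Sp1"

fun Kgrp :: "base_field \<Rightarrow> ((quat, 'n::{finite,linorder}) sqmat) set" where
  "Kgrp F_real = mat_map quat_of_real ` K_SO"
| "Kgrp F_complex = mat_map quat_of_complex ` K_SU"
| "Kgrp F_quat = K_Sp"

definition a_mat :: "real \<Rightarrow> (quat, 'n::{finite,linorder}) sqmat" where
  "a_mat t = (\<chi> i j. quat_of_real (
     if i = j then (if i = ix0 \<or> i = ix1 then cosh t else 1)
     else if {i, j} = {ix0, ix1} then sinh t else 0))"

definition lcoset :: "base_field \<Rightarrow> (quat, 'n::{finite,linorder}) sqmat \<Rightarrow> ((quat, 'n) sqmat) set" where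
  "lcoset F g = (\<lambda>h. g ** h) ` Kgrp F"

definition dcoset :: "base_field \<Rightarrow> (quat, 'n::{finite,linorder}) sqmat \<Rightarrow> ((quat, 'n) sqmat) set" where
  "dcoset F g = {h1 ** g ** h2 | h1 h2. h1 \<in> Kgrp F \<and> h2 \<in> Kgrp F}"

definition hyp_space :: "base_field \<Rightarrow> ((quat, 'n::{finite,linorder}) sqmat) set set" where
  "hyp_space F = lcoset F ` Ggrp F"

definition hyp_origin :: "base_field \<Rightarrow> ((quat, 'n::{finite,linorder}) sqmat) set" where
  "hyp_origin F = lcoset F (mat 1)"

definition hyp_act :: "(quat, 'n::finite) sqmat \<Rightarrow> ((quat, 'n) sqmat) set \<Rightarrow> ((quat, 'n) sqmat) set" where
  "hyp_act g P = (\<lambda>x. g ** x) ` P"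

definition hyp_dist ::
  "base_field \<Rightarrow> ((quat, 'n::{finite,linorder}) sqmat) set \<Rightarrow> ((quat, 'n) sqmat) set \<Rightarrow> real" where
  "hyp_dist F P Q = (THE t. 0 \<le> t \<and> (\<exists>x\<in>Ggrp F. \<exists>y\<in>Ggrp F.
     P = lcoset F x \<and> Q = lcoset F y \<and> dcoset F (matrix_inv y ** x) = dcoset F (a_mat t)))"

text \<open>
  The Borel \<open>\<sigma>\<close>-algebra of the quotient topology on \<open>G/K\<close>: for a set \<open>U\<close> of cosets, \<open>\<Union>U\<close> is the
  preimage of \<open>U\<close> under the canonical projection.
\<close>

definition hyp_borel :: "base_field \<Rightarrow> ((quat, 'n::{finite,linorder}) sqmat) set measure" where
  "hyp_borel F = sigma (hyp_space F)
     {U. U \<subseteq> hyp_space F \<and> openin (top_of_set (Ggrp F)) (\<Union>U)}"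

section \<open>Radial random walks\<close>

definition history :: "'w measure \<Rightarrow> 'p measure \<Rightarrow> (nat \<Rightarrow> 'w \<Rightarrow> 'p) \<Rightarrow> nat \<Rightarrow> 'w measure" where
  "history M N S n =
     vimage_algebra (space M) (\<lambda>w. \<lambda>i\<in>{..n}. S i w) (\<Pi>\<^sub>M i\<in>{..n}. N)"

definition markov_chain ::
  "'w measure \<Rightarrow> 'p measure \<Rightarrow> ('p \<Rightarrow> 'p measure) \<Rightarrow> (nat \<Rightarrow> 'w \<Rightarrow> 'p) \<Rightarrow> bool" where
  "markov_chain M N \<kappa> S \<longleftrightarrow>
     prob_space M \<and> \<kappa> \<in> N \<rightarrow>\<^sub>M prob_algebra N \<and> (\<forall>n. S n \<in> M \<rightarrow>\<^sub>M N) \<and>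
     (\<forall>n. \<forall>A\<in>sets N. AE w in M.
        real_cond_exp M (history M N S n) (indicat_real {v \<in> space M. S (Suc n) v \<in> A}) w
        = measure (\<kappa> (S n w)) A)"

definition radial_random_walk ::
  "base_field \<Rightarrow> 'w measure \<Rightarrow> (nat \<Rightarrow> 'w \<Rightarrow> ((quat, 'n::{finite,linorder}) sqmat) set) \<Rightarrow> bool" where
  "radial_random_walk F M S \<longleftrightarrow> (\<exists>\<kappa>.
     markov_chain M (hyp_borel F) \<kappa> S \<and>
     (AE w in M. S 0 w = hyp_origin F) \<and>
     (\<forall>g\<in>Ggrp F. \<forall>x\<in>hyp_space F. \<forall>A\<in>sets (hyp_borel F).
        emeasure (\<kappa> (hyp_act g x)) (hyp_act g ` A) = emeasure (\<kappa> x) A))"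

definition walk_associated_with ::
  "base_field \<Rightarrow> 'w measure \<Rightarrow> (nat \<Rightarrow> 'w \<Rightarrow> ((quat, 'n::{finite,linorder}) sqmat) set)
    \<Rightarrow> real measure \<Rightarrow> bool" where
  "walk_associated_with F M S \<nu> \<longleftrightarrow>
     (\<forall>n. distr M borel (\<lambda>w. hyp_dist F (S n w) (S (Suc n) w)) = \<nu>)"

section \<open>Modified moments\<close>

text \<open>In the case \<open>\<beta> = -1/2\<close> the second factor is the measure \<open>(\<delta>\<^sub>0 + \<delta>\<^sub>\<pi>)/2\<close>. The convention
  \<open>0 powr 0 = 0\<close> only affects null sets.\<close>

definition m_meas :: "real \<Rightarrow> real \<Rightarrow> (real \<times> real) measure" where
  "m_meas \<alpha> \<beta> =
    (if \<beta> = - 1/2 then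
       density lborel (\<lambda>r. ennreal (indicator {0..1} r *
         (2 * Gamma (\<alpha> + 1) / (Gamma (1/2) * Gamma (\<alpha> + 1/2)) * (1 - r\<^sup>2) powr (\<alpha> - 1/2))))
       \<Otimes>\<^sub>M distr (measure_pmf (pmf_of_set {0, pi})) borel (\<lambda>\<phi>. \<phi>)
     else
       density (lborel \<Otimes>\<^sub>M lborel) (\<lambda>(r, \<phi>). ennreal (indicator ({0..1} \<times> {0..pi}) (r, \<phi>) *
         (2 * Gamma (\<alpha> + 1) / (Gamma (1/2) * Gamma (\<alpha> - \<beta>) * Gamma (\<beta> + 1/2))
          * (1 - r\<^sup>2) powr (\<alpha> - \<beta> - 1) * (r * sin \<phi>) powr (2 * \<beta>) * r))))"

definition moment_fun :: "base_field \<Rightarrow> nat \<Rightarrow> nat \<Rightarrow> real \<Rightarrow> real" where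
  "moment_fun F k j t =
    (LINT (r, \<phi>) | m_meas (real (real_dim F) * real k / 2 - 1) (real (real_dim F) / 2 - 1).
       (ln (cmod (of_real (cosh t) + of_real r * exp (\<i> * of_real \<phi>) * of_real (sinh t)))) ^ j)"

definition mod_moment :: "base_field \<Rightarrow> nat \<Rightarrow> real measure \<Rightarrow> nat \<Rightarrow> real" where
  "mod_moment F k \<nu> j = (LINT t | \<nu>. moment_fun F k j t)"

end

theory Submission
  imports Defs
begin

text \<open>
  The distance from the origin is compared with the Busemann function of a fixed boundary point.
  Written on the group, this function is \<open>B(g K) = ln |g_00 + g_10|\<close>. It has two advantages over the
  distance.

  First, it is additive along the walk in law. Every point has a representative \<open>g\<close> with
  \<open>B(g y) = B(g K) + B(y)\<close> for all points \<open>y\<close> (\<open>busemann_cocycle\<close>), and the kernel is invariant, so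
  the step from the current position adds to \<open>B\<close> an increment whose law \<open>\<rho>\<close> does not depend on the
  position. Hence the characteristic function of \<open>B(S n)\<close> is the \<open>n\<close>-th power of that of \<open>\<rho>\<close>
  (\<open>char_buslaw\<close>), and the central limit theorem and a rate of convergence follow for \<open>B(S n)\<close> from
  its characteristic functions alone (\<open>clt_of_char_powers\<close>, \<open>rate_of_char_powers\<close>).

  Second, its law is explicit. All laws that occur are invariant under \<open>K\<close>, which acts transitively on
  the boundary sphere. So the boundary point may be averaged over this sphere, and a coordinate of a
  uniformly distributed unit vector is distributed as \<open>r e^{i \<phi>}\<close> under the measure that defines
  the modified moments (\<open>nn_integral_fsphere_marginal\<close>). Conditionally on the distance \<open>t\<close> of a point,
  \<open>B\<close> is therefore distributed as \<open>ln |cosh t + r e^{i \<phi>} sinh t|\<close> (\<open>K_average\<close>). Applied to the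
  first step this shows that \<open>M1\<close> and \<open>M2\<close> are the first two moments of \<open>\<rho>\<close>. Applied to \<open>S n\<close> it
  shows that the difference between the distance and \<open>B\<close>, which is nonnegative, has exponential
  tails that are uniform in \<open>n\<close> (\<open>defect_tail\<close>).

  The normalised distance is thus squeezed between the normalised Busemann function and a translate
  of it by \<open>n^(-1/3)\<close>, up to probability \<open>O(n^(-1/3))\<close> (\<open>sandwich\<close>). The variance of \<open>\<rho>\<close> is positive
  because for \<open>t > 0\<close> the function \<open>|cosh t + r e^{i \<phi>} sinh t|\<close> takes each value only for finitely
  many \<open>r\<close>.

  The three families of groups are handled together. The facts used about them, above all that \<open>K\<close> is
  the stabiliser of the base point and acts transitively on unit directions, are proved for each
  family in its own matrix algebra and transferred to quaternionic matrices (\<open>hyp_base\<close>,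
  \<open>hyp_groups\<close>). The real case needs in addition that \<open>SO(k)\<close> lies in the identity component, which
  is shown by joining products of two reflections to the identity.
\<close>

section \<open>Polar coordinates and Beta integrals\<close>

lemma nn_integral_tan_substitution:
  fixes h :: "real \<Rightarrow> ennreal"
  assumes [measurable]: "h \<in> borel_measurable borel"
  shows "(\<integral>\<^sup>+c. h c \<partial>lborel) =
    (\<integral>\<^sup>+x. h (tan x) * ennreal (1 / (cos x)\<^sup>2) * indicator {-(pi/2)<..<pi/2} x \<partial>lborel)"
proof -
  have [measurable]: "(tan :: real \<Rightarrow> real) \<in> borel_measurable borel"
    by (simp add: tan_def[abs_def])
  have eq: "(\<integral>\<^sup>+c. h c * indicator {-real (Suc n)..real (Suc n)} c \<partial>lborel) =
    (\<integral>\<^sup>+x. h (tan x) * ennreal (1 / (cos x)\<^sup>2) * indicator {-arctan (Suc n)..arctan (Suc n)} x \<partial>lborel)" for n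
  proof -
    have pos: "x \<in> {-arctan (Suc n)..arctan (Suc n)} \<Longrightarrow> cos x > 0" for x
      using arctan_bounded[of "real (Suc n)"] by (intro cos_gt_zero_pi) auto
    have "(\<integral>\<^sup>+c. h c * indicator {tan (-arctan (Suc n))..tan (arctan (Suc n))} c \<partial>lborel) =
      (\<integral>\<^sup>+x. h (tan x) * ennreal (1 / (cos x)\<^sup>2) * indicator {-arctan (Suc n)..arctan (Suc n)} x \<partial>lborel)"
    proof (rule nn_integral_substitution_aux)
      fix x assume "x \<in> {-arctan (Suc n)..arctan (Suc n)}"
      from pos[OF this] show "(tan has_real_derivative (1 / (cos x)\<^sup>2)) (at x)"
        by (auto intro!: derivative_eq_intros simp: inverse_eq_divide)
    next
      show "continuous_on {-arctan (Suc n)..arctan (Suc n)} (\<lambda>x. 1 / (cos x)\<^sup>2)"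
        using pos by (intro continuous_intros) force
    qed auto
    then show ?thesis by (simp add: tan_minus tan_arctan)
  qed
  have l: "(\<lambda>n. \<integral>\<^sup>+c. h c * indicator {-real (Suc n)..real (Suc n)} c \<partial>lborel) \<longlonglongrightarrow> (\<integral>\<^sup>+c. h c \<partial>lborel)"
  proof (rule nn_integral_LIMSEQ)
    show "incseq (\<lambda>n c. h c * indicator {-real (Suc n)..real (Suc n)} c)"
      by (intro incseq_SucI le_funI mult_left_mono) (auto split: split_indicator)
    fix x :: real
    obtain N where N: "\<bar>x\<bar> < real N" using reals_Archimedean2 by blast
    show "(\<lambda>n. h x * indicator {-real (Suc n)..real (Suc n)} x) \<longlonglongrightarrow> h x"
      by (rule tendsto_eventually, rule eventually_sequentiallyI[of N]) (use N in \<open>auto split: split_indicator\<close>)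
  qed measurable
  have r: "(\<lambda>n. \<integral>\<^sup>+x. h (tan x) * ennreal (1 / (cos x)\<^sup>2) * indicator {-arctan (Suc n)..arctan (Suc n)} x \<partial>lborel)
    \<longlonglongrightarrow> (\<integral>\<^sup>+x. h (tan x) * ennreal (1 / (cos x)\<^sup>2) * indicator {-(pi/2)<..<pi/2} x \<partial>lborel)"
  proof (rule nn_integral_LIMSEQ)
    show "incseq (\<lambda>n x. h (tan x) * ennreal (1 / (cos x)\<^sup>2) * indicator {-arctan (Suc n)..arctan (Suc n)} x)"
    proof (intro incseq_SucI le_funI mult_left_mono)
      fix n and x :: real
      have "arctan (Suc n) \<le> arctan (Suc (Suc n))" by (simp add: arctan_le_iff)
      then show "indicator {-arctan (Suc n)..arctan (Suc n)} x
          \<le> (indicator {-arctan (Suc (Suc n))..arctan (Suc (Suc n))} x :: ennreal)"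
        by (auto split: split_indicator)
    qed auto
    fix x :: real
    show "(\<lambda>n. h (tan x) * ennreal (1 / (cos x)\<^sup>2) * indicator {-arctan (Suc n)..arctan (Suc n)} x)
       \<longlonglongrightarrow> h (tan x) * ennreal (1 / (cos x)\<^sup>2) * indicator {-(pi/2)<..<pi/2} x"
    proof (cases "x \<in> {-(pi/2)<..<pi/2}")
      case True
      obtain N where N: "\<bar>tan x\<bar> < real N" using reals_Archimedean2 by blast
      have "x \<in> {-arctan (Suc n)..arctan (Suc n)}" if "n \<ge> N" for n
      proof -
        have "arctan (- real (Suc n)) \<le> arctan (tan x)" "arctan (tan x) \<le> arctan (Suc n)"
          using N that by (auto simp: arctan_le_iff)
        then show ?thesis using True
          unfolding arctan_minus by (auto simp: arctan_tan)
      qed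
      then show ?thesis
        by (intro tendsto_eventually eventually_sequentiallyI[of N]) (use True in simp)
    next
      case False
      have "x \<notin> {-arctan (Suc n)..arctan (Suc n)}" for n
        using arctan_bounded[of "real (Suc n)"] False by auto
      then show ?thesis using False by simp
    qed
  qed measurable
  from l r show ?thesis unfolding eq using LIMSEQ_unique by blast
qed

text \<open>
  Polar coordinates with the angle measured from the positive \<open>p\<close>-axis: scaling \<open>y = p c\<close>,
  \<open>c = tan x\<close> and then \<open>p = s cos x\<close> turns the iterated integral into the one on the right. Only
  one-dimensional substitutions occur, which avoids a two-dimensional change of variables.
\<close>

lemma nn_integral_half_plane_polar:
  fixes g :: "real \<Rightarrow> real \<Rightarrow> ennreal"
  assumes [measurable]: "(\<lambda>(y, p). g y p) \<in> borel_measurable (borel \<Otimes>\<^sub>M borel)"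
  shows "(\<integral>\<^sup>+p. (\<integral>\<^sup>+y. g y p \<partial>lborel) * indicator {0<..} p \<partial>lborel) =
    (\<integral>\<^sup>+x. (\<integral>\<^sup>+s. g (s * sin x) (s * cos x) * ennreal s * indicator {0<..} s \<partial>lborel)
        * indicator {-(pi/2)<..<pi/2} x \<partial>lborel)"
proof -
  have [measurable]: "(tan :: real \<Rightarrow> real) \<in> borel_measurable borel"
    by (simp add: tan_def[abs_def])
  have "(\<integral>\<^sup>+p. (\<integral>\<^sup>+y. g y p \<partial>lborel) * indicator {0<..} p \<partial>lborel) =
    (\<integral>\<^sup>+p. (\<integral>\<^sup>+x. g (p * tan x) p * ennreal p * ennreal (1 / (cos x)\<^sup>2) * indicator {-(pi/2)<..<pi/2} x
        * indicator {0<..} p \<partial>lborel) \<partial>lborel)"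
  proof (rule nn_integral_cong)
    fix p :: real
    show "(\<integral>\<^sup>+y. g y p \<partial>lborel) * indicator {0<..} p =
      (\<integral>\<^sup>+x. g (p * tan x) p * ennreal p * ennreal (1 / (cos x)\<^sup>2) * indicator {-(pi/2)<..<pi/2} x
        * indicator {0<..} p \<partial>lborel)"
    proof (cases "p > 0")
      case True
      have "(\<integral>\<^sup>+y. g y p \<partial>lborel) = ennreal p * (\<integral>\<^sup>+c. g (p * c) p \<partial>lborel)"
        using nn_integral_real_affine[of "\<lambda>y. g y p" p 0] True by simp
      also have "\<dots> = (\<integral>\<^sup>+c. g (p * c) p * ennreal p \<partial>lborel)"
        by (subst nn_integral_cmult[symmetric]) (auto simp: mult.commute)
      also have "\<dots> = (\<integral>\<^sup>+x. g (p * tan x) p * ennreal p * ennreal (1 / (cos x)\<^sup>2) * indicator {-(pi/2)<..<pi/2} x \<partial>lborel)"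
        by (subst nn_integral_tan_substitution) auto
      finally show ?thesis using True by simp
    qed simp
  qed
  also have "\<dots> = (\<integral>\<^sup>+x. (\<integral>\<^sup>+p. g (p * tan x) p * ennreal p * ennreal (1 / (cos x)\<^sup>2) * indicator {-(pi/2)<..<pi/2} x
        * indicator {0<..} p \<partial>lborel) \<partial>lborel)"
    by (rule lborel_pair.Fubini') measurable
  also have "\<dots> = (\<integral>\<^sup>+x. (\<integral>\<^sup>+s. g (s * sin x) (s * cos x) * ennreal s * indicator {0<..} s \<partial>lborel)
        * indicator {-(pi/2)<..<pi/2} x \<partial>lborel)"
  proof (rule nn_integral_cong)
    fix x :: real
    show "(\<integral>\<^sup>+p. g (p * tan x) p * ennreal p * ennreal (1 / (cos x)\<^sup>2) * indicator {-(pi/2)<..<pi/2} x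
        * indicator {0<..} p \<partial>lborel) = (\<integral>\<^sup>+s. g (s * sin x) (s * cos x) * ennreal s * indicator {0<..} s \<partial>lborel)
        * indicator {-(pi/2)<..<pi/2} x"
    proof (cases "x \<in> {-(pi/2)<..<pi/2}")
      case True
      then have c: "cos x > 0" by (intro cos_gt_zero_pi) auto
      have "(\<integral>\<^sup>+p. g (p * tan x) p * ennreal p * ennreal (1 / (cos x)\<^sup>2) * indicator {0<..} p \<partial>lborel)
        = ennreal (cos x) * (\<integral>\<^sup>+s. g (cos x * s * tan x) (cos x * s) * ennreal (cos x * s) * ennreal (1 / (cos x)\<^sup>2)
            * indicator {0<..} (cos x * s) \<partial>lborel)"
        using nn_integral_real_affine[of "\<lambda>p. g (p * tan x) p * ennreal p * ennreal (1 / (cos x)\<^sup>2) * indicator {0<..} p" "cos x" 0] c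
        by simp
      also have "\<dots> = (\<integral>\<^sup>+s. ennreal (cos x) * (g (cos x * s * tan x) (cos x * s) * ennreal (cos x * s) * ennreal (1 / (cos x)\<^sup>2)
            * indicator {0<..} (cos x * s)) \<partial>lborel)"
        by (rule nn_integral_cmult[symmetric]) measurable
      also have "\<dots> = (\<integral>\<^sup>+s. g (s * sin x) (s * cos x) * ennreal s * indicator {0<..} s \<partial>lborel)"
      proof (rule nn_integral_cong)
        fix s :: real
        show "ennreal (cos x) * (g (cos x * s * tan x) (cos x * s) * ennreal (cos x * s) * ennreal (1 / (cos x)\<^sup>2)
            * indicator {0<..} (cos x * s)) = g (s * sin x) (s * cos x) * ennreal s * indicator {0<..} s"
        proof (cases "s > 0")
          case s: True
          have e: "cos x * s * tan x = s * sin x" using c by (simp add: tan_def)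
          have "ennreal (cos x) * (ennreal (cos x * s) * ennreal (1 / (cos x)\<^sup>2)) = ennreal s"
            using c s by (subst ennreal_mult[symmetric], simp, simp, subst ennreal_mult[symmetric], simp, simp)
              (simp add: power2_eq_square)
          then have "ennreal (cos x) * (g (s * sin x) (s * cos x) * ennreal (cos x * s) * ennreal (1 / (cos x)\<^sup>2))
             = g (s * sin x) (s * cos x) * ennreal s"
            by (metis mult.assoc mult.left_commute)
          then show ?thesis using s c unfolding e by (simp add: mult.commute)
        next
          case False
          then have "\<not> cos x * s > 0" using c by (simp add: zero_less_mult_iff)
          then show ?thesis using False by simp
        qed
      qed
      finally show ?thesis using True by simp
    qed simp
  qed
  finally show ?thesis .
qed

lemma nn_integral_sin_cos_Beta:
  fixes a b :: real
  assumes "a > 0" "b > 0"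
  shows "(\<integral>\<^sup>+r. ennreal ((1 - r\<^sup>2) powr (a - 1) * r powr (2 * b - 1)) * indicator {0..1} r \<partial>lborel) = ennreal (Beta a b / 2)"
proof -
  have "((\<lambda>t. t powr (b - 1) * (1 - t) powr (a - 1)) has_integral Beta b a) {0..1}"
    using has_integral_Beta_real[of b a] assms by simp
  from nn_integral_has_integral_lebesgue[OF _ this] have
     "ennreal (Beta b a) =
        nn_integral lborel (\<lambda>t. ennreal (t powr (b-1) * (1 - t) powr (a-1) *
                                indicator {0^2..1^2} t))"
    by (simp add: mult_ac ennreal_mult' ennreal_indicator)
  also have "\<dots> = (\<integral>\<^sup>+ x. ennreal (x\<^sup>2 powr (b-1) * (1 - x\<^sup>2) powr (a-1) * (2 * x) *
                          indicator {0..1} x) \<partial>lborel)"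
    by (subst nn_integral_substitution[where g = "\<lambda>x. x ^ 2" and g' = "\<lambda>x. 2 * x"])
       (auto intro!: derivative_eq_intros continuous_intros simp: set_borel_measurable_def)
  also have "\<dots> = (\<integral>\<^sup>+ x. 2 * (ennreal ((1 - x\<^sup>2) powr (a - 1) * x powr (2 * b - 1)) * indicator {0..1} x) \<partial>lborel)"
  proof (intro nn_integral_cong_AE AE_I[of _ _ "{0}"])
    have "ennreal (x\<^sup>2 powr (b-1) * (1 - x\<^sup>2) powr (a-1) * (2 * x) * indicator {0..1} x)
       = 2 * (ennreal ((1 - x\<^sup>2) powr (a - 1) * x powr (2 * b - 1)) * indicator {0..1} x)" if "x \<noteq> 0" for x :: real
    proof (cases "x \<in> {0..1}")
      case True
      then have "x > 0" using that by auto
      have e: "x\<^sup>2 powr (b-1) * x = x powr (2 * b - 1)"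
        using \<open>x > 0\<close> powr_mult_base[of x "2 * b - 2"]
        by (simp add: powr_numeral[symmetric] powr_powr mult.commute del: powr_numeral)
      then have "x\<^sup>2 powr (b-1) * (1 - x\<^sup>2) powr (a-1) * (2 * x) = 2 * ((1 - x\<^sup>2) powr (a - 1) * x powr (2 * b - 1))"
        unfolding e[symmetric] by (simp only: mult_ac)
      then show ?thesis using True
        by (simp only: indicator_simps mult_1_right ennreal_mult'[of 2, simplified])
    qed simp
    then show "{x \<in> space lborel. ennreal (x\<^sup>2 powr (b-1) * (1 - x\<^sup>2) powr (a-1) * (2 * x) * indicator {0..1} x)
       \<noteq> 2 * (ennreal ((1 - x\<^sup>2) powr (a - 1) * x powr (2 * b - 1)) * indicator {0..1} x)} \<subseteq> {0}" by auto
  qed auto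
  also have "\<dots> = 2 * (\<integral>\<^sup>+ x. (ennreal ((1 - x\<^sup>2) powr (a - 1) * x powr (2 * b - 1)) * indicator {0..1} x) \<partial>lborel)"
    by (rule nn_integral_cmult) measurable
  finally have "2 * (\<integral>\<^sup>+ x. (ennreal ((1 - x\<^sup>2) powr (a - 1) * x powr (2 * b - 1)) * indicator {0..1} x) \<partial>lborel)
     = 2 * ennreal (Beta a b / 2)"
    using ennreal_mult'[of 2 "Beta a b / 2"] by (simp add: Beta_commute)
  then show ?thesis by (simp add: ennreal_mult_cancel_left)
qed

lemma nn_integral_sin_powr_Beta:
  assumes "b > 0"
  shows "(\<integral>\<^sup>+x. ennreal (sin x powr (2 * b - 1)) * indicator {0..pi} x \<partial>lborel) = ennreal (Beta (1/2) b)"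
proof -
  let ?f = "\<lambda>x. ennreal (sin x powr (2 * b - 1))"
  have half: "(\<integral>\<^sup>+x. ?f x * indicator {0..pi/2} x \<partial>lborel) = ennreal (Beta (1/2) b / 2)"
  proof -
    have "ennreal (Beta (1/2) b / 2) = (\<integral>\<^sup>+r. ennreal ((1 - r\<^sup>2) powr (1/2 - 1) * r powr (2 * b - 1)) * indicator {0..1} r \<partial>lborel)"
      using nn_integral_sin_cos_Beta[of "1/2" b] assms by simp
    also have "\<dots> = (\<integral>\<^sup>+r. ennreal ((1 - r\<^sup>2) powr (1/2 - 1) * r powr (2 * b - 1)) * indicator {sin 0..sin (pi/2)} r \<partial>lborel)"
      by simp
    also have "\<dots> = (\<integral>\<^sup>+x. ennreal ((1 - (sin x)\<^sup>2) powr (1/2 - 1) * sin x powr (2 * b - 1)) * ennreal (cos x) * indicator {0..pi/2} x \<partial>lborel)"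
      by (rule nn_integral_substitution_aux)
        (auto intro!: derivative_eq_intros continuous_intros cos_ge_zero)
    also have "\<dots> = (\<integral>\<^sup>+x. ?f x * indicator {0..pi/2} x \<partial>lborel)"
    proof (intro nn_integral_cong_AE AE_I[of _ _ "{pi/2}"])
      have *: "ennreal ((1 - (sin x)\<^sup>2) powr (1/2 - 1) * sin x powr (2 * b - 1)) * ennreal (cos x) = ?f x"
        if "x \<in> {0..<pi/2}" for x
      proof -
        from that have c: "cos x > 0" by (intro cos_gt_zero_pi) auto
        have "(1 - (sin x)\<^sup>2) powr (1/2 - 1) = 1 / cos x"
          using c by (simp add: cos_squared_eq[symmetric] powr_minus powr_half_sqrt divide_simps)
        then have "((1 - (sin x)\<^sup>2) powr (1/2 - 1) * sin x powr (2 * b - 1)) * cos x = sin x powr (2 * b - 1)"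
          using c by simp
        then show ?thesis using c by (simp add: ennreal_mult''[symmetric])
      qed
      show "{x \<in> space lborel. ennreal ((1 - (sin x)\<^sup>2) powr (1/2 - 1) * sin x powr (2 * b - 1)) * ennreal (cos x) * indicator {0..pi/2} x
         \<noteq> ?f x * indicator {0..pi/2} x} \<subseteq> {pi/2}" (is "?S \<subseteq> _")
      proof
        fix x assume x: "x \<in> ?S"
        show "x \<in> {pi/2}"
        proof (rule ccontr)
          assume "x \<notin> {pi/2}"
          moreover have "x \<in> {0..pi/2}" using x by (cases "x \<in> {0..pi/2}") auto
          ultimately have "x \<in> {0..<pi/2}" by auto
          from *[OF this] x show False by simp
        qed
      qed
    qed auto
    finally show ?thesis ..
  qed
  have "(\<integral>\<^sup>+x. ?f x * indicator {pi/2..pi} x \<partial>lborel) = (\<integral>\<^sup>+x. ?f x * indicator {0..pi/2} x \<partial>lborel)"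
    using nn_integral_real_affine[of "\<lambda>x. ?f x * indicator {pi/2..pi} x" "-1" pi]
    by (auto intro!: nn_integral_cong split: split_indicator)
  moreover have "(\<integral>\<^sup>+x. ?f x * indicator {0..pi} x \<partial>lborel) =
      (\<integral>\<^sup>+x. ?f x * indicator {0..pi/2} x + ?f x * indicator {pi/2..pi} x \<partial>lborel)"
    by (intro nn_integral_cong_AE AE_I[of _ _ "{pi/2}"]) (auto split: split_indicator)
  moreover have "\<dots> = (\<integral>\<^sup>+x. ?f x * indicator {0..pi/2} x \<partial>lborel) + (\<integral>\<^sup>+x. ?f x * indicator {pi/2..pi} x \<partial>lborel)"
    by (rule nn_integral_add) auto
  moreover have "Beta (1/2) b / 2 \<ge> 0"
    using assms by (simp add: Beta_def Gamma_real_pos less_imp_le)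
  ultimately show ?thesis using half by (simp add: ennreal_plus[symmetric] del: ennreal_plus)
qed

section \<open>The measure on the unit half-disc\<close>

definition m_const :: "real \<Rightarrow> real \<Rightarrow> real" where
  "m_const \<alpha> \<beta> = 2 * Gamma (\<alpha> + 1) / (Gamma (1/2) * Gamma (\<alpha> - \<beta>) * Gamma (\<beta> + 1/2))"

lemma sets_m_meas [simp, measurable_cong]: "sets (m_meas \<alpha> \<beta>) = sets (borel \<Otimes>\<^sub>M borel)"
  unfolding m_meas_def by (auto intro!: sets_pair_measure_cong)

lemma space_m_meas [simp]: "space (m_meas \<alpha> \<beta>) = UNIV"
  using sets_eq_imp_space_eq[OF sets_m_meas, of \<alpha> \<beta>] by (simp add: space_pair_measure)

text \<open>
  The product form of the density separates the radial weight from the angular one.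
\<close>

lemma nn_integral_m_meas:
  fixes f :: "real \<Rightarrow> real \<Rightarrow> ennreal"
  assumes [measurable]: "(\<lambda>(r, \<phi>). f r \<phi>) \<in> borel_measurable (borel \<Otimes>\<^sub>M borel)"
    and \<beta>: "\<beta> \<noteq> - 1/2" "\<beta> > -1/2" "\<alpha> > \<beta>"
  shows "(\<integral>\<^sup>+(r, \<phi>). f r \<phi> \<partial>m_meas \<alpha> \<beta>) =
    ennreal (m_const \<alpha> \<beta>) * (\<integral>\<^sup>+r. ennreal ((1 - r\<^sup>2) powr (\<alpha> - \<beta> - 1) * r powr (2 * \<beta> + 1)) * indicator {0..1} r *
      (\<integral>\<^sup>+\<phi>. ennreal (sin \<phi> powr (2 * \<beta>)) * f r \<phi> * indicator {0..pi} \<phi> \<partial>lborel) \<partial>lborel)"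
proof -
  have c: "m_const \<alpha> \<beta> \<ge> 0"
    unfolding m_const_def using \<beta> by (auto intro!: divide_nonneg_nonneg mult_nonneg_nonneg simp: Gamma_real_pos less_imp_le)
  have "(\<integral>\<^sup>+(r, \<phi>). f r \<phi> \<partial>m_meas \<alpha> \<beta>) =
     (\<integral>\<^sup>+(r, \<phi>). ennreal (indicator ({0..1} \<times> {0..pi}) (r, \<phi>) *
         (m_const \<alpha> \<beta> * (1 - r\<^sup>2) powr (\<alpha> - \<beta> - 1) * (r * sin \<phi>) powr (2 * \<beta>) * r)) * f r \<phi> \<partial>(lborel \<Otimes>\<^sub>M lborel))"
    unfolding m_meas_def m_const_def using \<beta>
    by (simp add: nn_integral_density case_prod_beta')
  also have "\<dots> = (\<integral>\<^sup>+r. (\<integral>\<^sup>+\<phi>. ennreal (indicator ({0..1} \<times> {0..pi}) (r, \<phi>) *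
         (m_const \<alpha> \<beta> * (1 - r\<^sup>2) powr (\<alpha> - \<beta> - 1) * (r * sin \<phi>) powr (2 * \<beta>) * r)) * f r \<phi> \<partial>lborel) \<partial>lborel)"
    by (subst lborel.nn_integral_fst[symmetric]) auto
  also have "\<dots> = (\<integral>\<^sup>+r. ennreal (m_const \<alpha> \<beta>) * (ennreal ((1 - r\<^sup>2) powr (\<alpha> - \<beta> - 1) * r powr (2 * \<beta> + 1)) * indicator {0..1} r *
      (\<integral>\<^sup>+\<phi>. ennreal (sin \<phi> powr (2 * \<beta>)) * f r \<phi> * indicator {0..pi} \<phi> \<partial>lborel)) \<partial>lborel)"
  proof (rule nn_integral_cong)
    fix r :: real
    let ?C = "ennreal (m_const \<alpha> \<beta> * ((1 - r\<^sup>2) powr (\<alpha> - \<beta> - 1) * r powr (2 * \<beta> + 1)))"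
    show "(\<integral>\<^sup>+\<phi>. ennreal (indicator ({0..1} \<times> {0..pi}) (r, \<phi>) *
         (m_const \<alpha> \<beta> * (1 - r\<^sup>2) powr (\<alpha> - \<beta> - 1) * (r * sin \<phi>) powr (2 * \<beta>) * r)) * f r \<phi> \<partial>lborel) =
      ennreal (m_const \<alpha> \<beta>) * (ennreal ((1 - r\<^sup>2) powr (\<alpha> - \<beta> - 1) * r powr (2 * \<beta> + 1)) * indicator {0..1} r *
      (\<integral>\<^sup>+\<phi>. ennreal (sin \<phi> powr (2 * \<beta>)) * f r \<phi> * indicator {0..pi} \<phi> \<partial>lborel))"
    proof (cases "r \<in> {0..1}")
      case True
      have "(\<integral>\<^sup>+\<phi>. ennreal (indicator ({0..1} \<times> {0..pi}) (r, \<phi>) *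
         (m_const \<alpha> \<beta> * (1 - r\<^sup>2) powr (\<alpha> - \<beta> - 1) * (r * sin \<phi>) powr (2 * \<beta>) * r)) * f r \<phi> \<partial>lborel)
        = (\<integral>\<^sup>+\<phi>. ?C * (ennreal (sin \<phi> powr (2 * \<beta>)) * f r \<phi> * indicator {0..pi} \<phi>) \<partial>lborel)"
      proof (rule nn_integral_cong)
        fix \<phi> :: real
        show "ennreal (indicator ({0..1} \<times> {0..pi}) (r, \<phi>) *
         (m_const \<alpha> \<beta> * (1 - r\<^sup>2) powr (\<alpha> - \<beta> - 1) * (r * sin \<phi>) powr (2 * \<beta>) * r)) * f r \<phi>
         = ?C * (ennreal (sin \<phi> powr (2 * \<beta>)) * f r \<phi> * indicator {0..pi} \<phi>)"
        proof (cases "\<phi> \<in> {0..pi}")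
          case p: True
          then have s: "sin \<phi> \<ge> 0" by (auto intro: sin_ge_zero)
          have "(r * sin \<phi>) powr (2 * \<beta>) * r = r powr (2 * \<beta> + 1) * sin \<phi> powr (2 * \<beta>)"
            using True s powr_mult_base[of r "2 * \<beta>"] by (simp add: powr_mult mult_ac add.commute)
          then have "m_const \<alpha> \<beta> * (1 - r\<^sup>2) powr (\<alpha> - \<beta> - 1) * (r * sin \<phi>) powr (2 * \<beta>) * r
            = m_const \<alpha> \<beta> * ((1 - r\<^sup>2) powr (\<alpha> - \<beta> - 1) * r powr (2 * \<beta> + 1)) * sin \<phi> powr (2 * \<beta>)"
            by (metis (no_types, opaque_lifting) mult.assoc)
          then have i: "indicator ({0..1} \<times> {0..pi}) (r, \<phi>) *
              (m_const \<alpha> \<beta> * (1 - r\<^sup>2) powr (\<alpha> - \<beta> - 1) * (r * sin \<phi>) powr (2 * \<beta>) * r)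
            = m_const \<alpha> \<beta> * ((1 - r\<^sup>2) powr (\<alpha> - \<beta> - 1) * r powr (2 * \<beta> + 1)) * sin \<phi> powr (2 * \<beta>)"
            using p True by simp
          show ?thesis unfolding i ennreal_mult''[OF powr_ge_zero]
            using p by (simp only: indicator_simps mult_1_right mult.assoc)
        qed (use True in auto)
      qed
      also have "\<dots> = ?C * (\<integral>\<^sup>+\<phi>. ennreal (sin \<phi> powr (2 * \<beta>)) * f r \<phi> * indicator {0..pi} \<phi> \<partial>lborel)"
        by (rule nn_integral_cmult) measurable
      finally show ?thesis using True c by (simp add: ennreal_mult' mult.assoc)
    qed (auto simp: indicator_times)
  qed
  also have "\<dots> = ennreal (m_const \<alpha> \<beta>) * (\<integral>\<^sup>+r. ennreal ((1 - r\<^sup>2) powr (\<alpha> - \<beta> - 1) * r powr (2 * \<beta> + 1)) * indicator {0..1} r *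
      (\<integral>\<^sup>+\<phi>. ennreal (sin \<phi> powr (2 * \<beta>)) * f r \<phi> * indicator {0..pi} \<phi> \<partial>lborel) \<partial>lborel)"
    by (rule nn_integral_cmult) measurable
  finally show ?thesis .
qed

lemma nn_integral_m_meas_real:
  fixes f :: "real \<Rightarrow> real \<Rightarrow> ennreal"
  assumes [measurable]: "(\<lambda>(r, \<phi>). f r \<phi>) \<in> borel_measurable (borel \<Otimes>\<^sub>M borel)"
    and \<alpha>: "\<alpha> > -1/2"
  shows "(\<integral>\<^sup>+(r, \<phi>). f r \<phi> \<partial>m_meas \<alpha> (-1/2)) =
    ennreal (2 / Beta (1/2) (\<alpha> + 1/2)) * (\<integral>\<^sup>+r. ennreal ((1 - r\<^sup>2) powr (\<alpha> - 1/2)) * indicator {0..1} r *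
      ((f r 0 + f r pi) / 2) \<partial>lborel)"
proof -
  let ?c = "2 / Beta (1/2) (\<alpha> + 1/2)"
  have c: "?c \<ge> 0"
    using \<alpha> by (auto intro!: divide_nonneg_nonneg mult_nonneg_nonneg simp: Beta_def Gamma_real_pos less_imp_le)
  have ce: "2 * Gamma (\<alpha> + 1) / (Gamma (1/2) * Gamma (\<alpha> + 1/2)) = ?c"
    by (simp add: Beta_def add.commute)
  let ?D = "distr (measure_pmf (pmf_of_set {0, pi})) borel (\<lambda>\<phi>. \<phi>)"
  interpret D: prob_space ?D by (rule prob_space.prob_space_distr) (auto intro: measure_pmf.prob_space_axioms)
  have "(\<integral>\<^sup>+(r, \<phi>). f r \<phi> \<partial>m_meas \<alpha> (-1/2)) =
    (\<integral>\<^sup>+r. (\<integral>\<^sup>+\<phi>. f r \<phi> \<partial>?D) \<partial>density lborel (\<lambda>r. ennreal (indicator {0..1} r * (?c * (1 - r\<^sup>2) powr (\<alpha> - 1/2)))))"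
    unfolding m_meas_def ce if_P[OF refl] by (subst D.nn_integral_fst[symmetric]) auto
  also have "\<dots> = (\<integral>\<^sup>+r. ennreal (indicator {0..1} r * (?c * (1 - r\<^sup>2) powr (\<alpha> - 1/2))) * ((f r 0 + f r pi) / 2) \<partial>lborel)"
  proof (subst nn_integral_density, measurable, rule nn_integral_cong)
    fix r :: real
    have "(\<integral>\<^sup>+\<phi>. f r \<phi> \<partial>?D) = (\<integral>\<^sup>+\<phi>. f r \<phi> \<partial>measure_pmf (pmf_of_set {0, pi}))"
      by (subst nn_integral_distr) auto
    also have "\<dots> = (f r 0 + f r pi) / 2"
      by (subst nn_integral_pmf_of_set) (auto simp: numeral_2_eq_2)
    finally show "ennreal (indicator {0..1} r * (?c * (1 - r\<^sup>2) powr (\<alpha> - 1/2))) * (\<integral>\<^sup>+\<phi>. f r \<phi> \<partial>?D) =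
      ennreal (indicator {0..1} r * (?c * (1 - r\<^sup>2) powr (\<alpha> - 1/2))) * ((f r 0 + f r pi) / 2)" by simp
  qed
  also have "\<dots> = (\<integral>\<^sup>+r. ennreal ?c * (ennreal ((1 - r\<^sup>2) powr (\<alpha> - 1/2)) * indicator {0..1} r *
      ((f r 0 + f r pi) / 2)) \<partial>lborel)"
  proof (rule nn_integral_cong)
    fix r :: real
    show "ennreal (indicator {0..1} r * (?c * (1 - r\<^sup>2) powr (\<alpha> - 1/2))) * ((f r 0 + f r pi) / 2) =
      ennreal ?c * (ennreal ((1 - r\<^sup>2) powr (\<alpha> - 1/2)) * indicator {0..1} r * ((f r 0 + f r pi) / 2))"
    proof (cases "r \<in> {0..1}")
      case True
      then have i: "indicator {0..1} r * (?c * (1 - r\<^sup>2) powr (\<alpha> - 1/2)) = ?c * (1 - r\<^sup>2) powr (\<alpha> - 1/2)" by simp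
      show ?thesis unfolding i ennreal_mult'[OF c]
        using True by (simp only: indicator_simps mult_1_right mult.assoc)
    qed simp
  qed
  also have "\<dots> = ennreal ?c * (\<integral>\<^sup>+r. (ennreal ((1 - r\<^sup>2) powr (\<alpha> - 1/2)) * indicator {0..1} r *
      ((f r 0 + f r pi) / 2)) \<partial>lborel)"
    by (rule nn_integral_cmult) measurable
  finally show ?thesis .
qed

text \<open>
  The normalising constant is a product of two Beta integrals, one for \<open>r\<close> and one for \<open>\<phi>\<close>; for
  \<open>\<beta> = -1/2\<close> the angular part is a coin toss and only the radial one remains.
\<close>

lemma prob_space_m_meas:
  assumes "\<beta> \<ge> -1/2" "\<alpha> > \<beta>"
  shows "prob_space (m_meas \<alpha> \<beta>)"
proof
  have "emeasure (m_meas \<alpha> \<beta>) (space (m_meas \<alpha> \<beta>)) = (\<integral>\<^sup>+(r, \<phi>). 1 \<partial>m_meas \<alpha> \<beta>)"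
    by (simp add: case_prod_beta')
  also have "\<dots> = 1"
  proof (cases "\<beta> = -1/2")
    case True
    have two: "(1 + 1) / 2 = (1::ennreal)" by (simp add: ennreal_divide_self)
    have pos: "Beta (1/2) (\<alpha> + 1/2) > 0"
      using assms True by (simp add: Beta_def Gamma_real_pos)
    have "(\<integral>\<^sup>+r. ennreal ((1 - r\<^sup>2) powr (\<alpha> - 1/2)) * indicator {0..1} r \<partial>lborel)
      = (\<integral>\<^sup>+r. ennreal ((1 - r\<^sup>2) powr (\<alpha> + 1/2 - 1) * r powr (2 * (1/2) - 1)) * indicator {0..1} r \<partial>lborel)"
      by (intro nn_integral_cong_AE AE_I[of _ _ "{0}"]) auto
    also have "\<dots> = ennreal (Beta (1/2) (\<alpha> + 1/2) / 2)"
      using nn_integral_sin_cos_Beta[of "\<alpha> + 1/2" "1/2"] assms True by (simp add: Beta_commute)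
    finally show ?thesis
      using assms True nn_integral_m_meas_real[of "\<lambda>_ _. 1" \<alpha>] pos
      by (simp add: two ennreal_mult'[symmetric] ennreal_mult''[symmetric])
  next
    case False
    then have b: "\<beta> > -1/2" using assms by auto
    have I: "(\<integral>\<^sup>+\<phi>. ennreal (sin \<phi> powr (2 * \<beta>)) * indicator {0..pi} \<phi> \<partial>lborel) = ennreal (Beta (1/2) (\<beta> + 1/2))"
      using nn_integral_sin_powr_Beta[of "\<beta> + 1/2"] b by simp
    have J: "(\<integral>\<^sup>+r. ennreal ((1 - r\<^sup>2) powr (\<alpha> - \<beta> - 1) * r powr (2 * \<beta> + 1)) * indicator {0..1} r \<partial>lborel)
        = ennreal (Beta (\<alpha> - \<beta>) (\<beta> + 1) / 2)"
      using nn_integral_sin_cos_Beta[of "\<alpha> - \<beta>" "\<beta> + 1"] b assms by (simp add: algebra_simps)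
    have pos: "Gamma (\<alpha> - \<beta>) > 0" "Gamma (\<beta> + 1) > 0" "Gamma (\<alpha> + 1) > 0" "Gamma (1/2::real) > 0" "Gamma (\<beta> + 1/2) > 0"
      using b assms by (auto intro!: Gamma_real_pos)
    have "(\<integral>\<^sup>+(r, \<phi>). 1 \<partial>m_meas \<alpha> \<beta>) = ennreal (m_const \<alpha> \<beta>) * (ennreal (Beta (\<alpha> - \<beta>) (\<beta> + 1) / 2) * ennreal (Beta (1/2) (\<beta> + 1/2)))"
      by (subst nn_integral_m_meas) (use assms b in \<open>simp_all add: I J[symmetric] nn_integral_multc\<close>)
    also have "\<dots> = ennreal (m_const \<alpha> \<beta> * (Beta (\<alpha> - \<beta>) (\<beta> + 1) / 2 * Beta (1/2) (\<beta> + 1/2)))"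
      using pos by (subst ennreal_mult[symmetric], simp_all add: Beta_def less_imp_le add.commute m_const_def,
          subst ennreal_mult[symmetric], simp_all add: less_imp_le)
    also have "m_const \<alpha> \<beta> * (Beta (\<alpha> - \<beta>) (\<beta> + 1) / 2 * Beta (1/2) (\<beta> + 1/2)) = 1"
      using pos[THEN less_imp_neq, symmetric] unfolding m_const_def Beta_def by (simp add: add.commute)
    finally show ?thesis by (simp only: ennreal_1)
  qed
  finally show "emeasure (m_meas \<alpha> \<beta>) (space (m_meas \<alpha> \<beta>)) = 1" .
qed

section \<open>Rotation invariance of Lebesgue measure and radial integrals\<close>

text \<open>
  The image measure is translation invariant because \<open>T\<close> is a linear bijection, and it gives the
  unit ball \<open>C\<close> its Lebesgue measure because \<open>T\<close> preserves the norm. Computing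
  \<open>\<integral>\<integral> 1\<^sub>B(x) 1\<^sub>C(y - x)\<close> in both orders of integration shows that two translation invariant
  measures that agree on \<open>C\<close> are equal.
\<close>

lemma lborel_distr_linear_isometry:
  fixes T :: "'a::euclidean_space \<Rightarrow> 'a"
  assumes T: "linear T" "\<And>x. norm (T x) = norm x"
  shows "distr lborel borel T = lborel"
proof (rule measure_eqI)
  show "sets (distr lborel borel T) = sets lborel" by simp
  fix B assume "B \<in> sets (distr lborel borel T)"
  then have B[measurable]: "B \<in> sets borel" by simp
  have inj: "inj T"
  proof (subst linear_injective_0[OF T(1)], intro allI impI)
    fix x assume "T x = 0" then show "x = 0" using T(2)[of x] by simp
  qed
  then have surj: "surj T" using linear_injective_imp_surjective[OF T(1)] by blast
  have [measurable]: "T \<in> borel_measurable borel"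
    using T(1) by (intro borel_measurable_continuous_onI linear_continuous_on) (simp add: linear_conv_bounded_linear)
  let ?m = "distr lborel borel T"
  define C where "C = ball (0::'a) 1"
  have C[measurable]: "C \<in> sets borel" by (simp add: C_def)
  have fin: "emeasure lborel C \<noteq> \<infinity>" using emeasure_lborel_ball_finite[of "0::'a" 1] by (simp add: less_top C_def)
  have pos: "emeasure lborel C \<noteq> 0"
    using open_not_negligible[of "ball (0::'a) 1"] by (auto simp: C_def negligible_iff_null_sets null_sets_completion_iff)
  have shift: "(\<integral>\<^sup>+y. g (y - x) \<partial>?m) = (\<integral>\<^sup>+y. g y \<partial>?m)" if [measurable]: "g \<in> borel_measurable borel" for x and g :: "'a \<Rightarrow> ennreal"
  proof -
    obtain z where z: "x = T z" using surj by (metis surjD)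
    have "(\<integral>\<^sup>+y. g (y - x) \<partial>?m) = (\<integral>\<^sup>+y. g (T (y - z)) \<partial>lborel)"
      by (subst nn_integral_distr) (simp_all add: z linear_diff[OF T(1)])
    also have "\<dots> = (\<integral>\<^sup>+y. g (T y) \<partial>distr lborel borel ((+) (- z)))"
      by (subst nn_integral_distr) (simp_all add: algebra_simps)
    also have "\<dots> = (\<integral>\<^sup>+y. g y \<partial>?m)"
      by (subst lborel_distr_plus) (simp add: nn_integral_distr)
    finally show ?thesis .
  qed
  have shift': "(\<integral>\<^sup>+x. g (x + y) \<partial>lborel) = (\<integral>\<^sup>+x. g x \<partial>lborel)" if [measurable]: "g \<in> borel_measurable borel" for y and g :: "'a \<Rightarrow> ennreal"
    by (subst lborel_distr_plus[of y, symmetric], subst nn_integral_distr) (simp_all add: add.commute)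
  interpret m: sigma_finite_measure ?m
  proof
    have "T -` ball 0 r = ball 0 r" for r using T(2) by auto
    then have fin: "emeasure ?m (ball 0 r) \<noteq> \<infinity>" for r
      using emeasure_lborel_ball_finite[of "0::'a" r] by (simp add: emeasure_distr less_top)
    have "(\<Union>n. ball (0::'a) (real n)) = UNIV" using reals_Archimedean2 by auto
    then show "\<exists>A. countable A \<and> A \<subseteq> sets ?m \<and> \<Union>A = space ?m \<and> (\<forall>a\<in>A. emeasure ?m a \<noteq> \<infinity>)"
      using fin by (intro exI[of _ "range (\<lambda>n. ball 0 (real n))"]) auto
  qed
  interpret P: pair_sigma_finite ?m "lborel :: 'a measure" ..
  have mC: "emeasure ?m C = emeasure lborel C"
  proof -
    have "T -` C = C" using T(2) by (auto simp: C_def)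
    then show ?thesis by (simp add: emeasure_distr)
  qed
  have i: "(\<integral>\<^sup>+x. indicator C x * indicator B y \<partial>lborel) = emeasure lborel C * indicator B y" for y :: 'a
    by (subst nn_integral_multc) simp_all
  have "emeasure lborel C * emeasure ?m B = (\<integral>\<^sup>+y. (\<integral>\<^sup>+x. indicator C x * indicator B y \<partial>lborel) \<partial>?m)"
    unfolding i by (subst nn_integral_cmult) simp_all
  also have "\<dots> = (\<integral>\<^sup>+x. (\<integral>\<^sup>+y. indicator C x * indicator B y \<partial>?m) \<partial>lborel)"
    by (rule P.Fubini'[symmetric]) simp
  also have "\<dots> = (\<integral>\<^sup>+x. (\<integral>\<^sup>+y. indicator C x * indicator B (y - x) \<partial>?m) \<partial>lborel)"
    by (intro nn_integral_cong shift[symmetric]) simp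
  also have "\<dots> = (\<integral>\<^sup>+y. (\<integral>\<^sup>+x. indicator C x * indicator B (y - x) \<partial>lborel) \<partial>?m)"
    by (rule P.Fubini') simp
  also have "\<dots> = (\<integral>\<^sup>+y. (\<integral>\<^sup>+x. indicator C (x + y) * indicator B (- x) \<partial>lborel) \<partial>?m)"
  proof (rule nn_integral_cong)
    fix y :: 'a
    show "(\<integral>\<^sup>+x. indicator C x * indicator B (y - x) \<partial>lborel) = (\<integral>\<^sup>+x. indicator C (x + y) * indicator B (- x) \<partial>lborel)"
      using shift'[of "\<lambda>x. indicator C x * indicator B (y - x)" y] by simp
  qed
  also have "\<dots> = (\<integral>\<^sup>+x. (\<integral>\<^sup>+y. indicator C (y - (- x)) * indicator B (- x) \<partial>?m) \<partial>lborel)"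
    by (subst P.Fubini'[symmetric]) (simp_all add: add.commute)
  also have "\<dots> = (\<integral>\<^sup>+x. (\<integral>\<^sup>+y. indicator C y * indicator B (- x) \<partial>?m) \<partial>lborel)"
    by (intro nn_integral_cong shift) simp
  also have "\<dots> = (\<integral>\<^sup>+x. emeasure ?m C * indicator B (- x) \<partial>lborel)"
    by (intro nn_integral_cong, subst nn_integral_multc) simp_all
  also have "\<dots> = emeasure ?m C * (\<integral>\<^sup>+x. indicator B (- x) \<partial>lborel)"
    by (rule nn_integral_cmult) measurable
  also have "(\<integral>\<^sup>+x. indicator B (- x) \<partial>lborel) = emeasure lborel B"
  proof -
    have "(\<integral>\<^sup>+x. indicator B (- x) \<partial>lborel) = (\<integral>\<^sup>+x. indicator B x \<partial>distr lborel borel (\<lambda>x::'a. 0 + (-1) *\<^sub>R x))"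
      by (subst nn_integral_distr) simp_all
    also have "distr lborel borel (\<lambda>x::'a. 0 + (-1) *\<^sub>R x) = lborel"
      using lborel_affine[of "-1::real" "0::'a"] by (simp add: density_1)
    finally show ?thesis by simp
  qed
  finally have "emeasure lborel C * emeasure ?m B = emeasure lborel C * emeasure lborel B" by (simp add: mC)
  then show "emeasure ?m B = emeasure lborel B"
    using pos fin by (simp add: ennreal_mult_cancel_left)
qed

text \<open>
  The law of the Euclidean norm under Lebesgue measure is determined by the volumes of balls, and
  \<open>v \<rho>^n\<close> is the primitive of the density on the right.
\<close>

lemma nn_integral_radial:
  fixes g :: "real \<Rightarrow> ennreal"
  assumes J: "finite J" "J \<noteq> {}" and [measurable]: "g \<in> borel_measurable borel"
  shows "(\<integral>\<^sup>+f. g (sqrt (\<Sum>i\<in>J. (f i)\<^sup>2)) \<partial>Pi\<^sub>M J (\<lambda>_. lborel)) =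
    ennreal (unit_ball_vol (card J) * card J) * (\<integral>\<^sup>+\<rho>. g \<rho> * ennreal (\<rho> ^ (card J - 1)) * indicator {0<..} \<rho> \<partial>lborel)"
proof -
  let ?n = "card J" and ?P = "Pi\<^sub>M J (\<lambda>_. lborel :: real measure)"
  let ?N = "\<lambda>f. sqrt (\<Sum>i\<in>J. (f i)\<^sup>2) :: real"
  let ?v = "unit_ball_vol (card J)"
  have n: "?n > 0" using J by (simp add: card_gt_0_iff)
  have v: "?v > 0" by simp
  let ?D = "density lborel (\<lambda>\<rho>. ennreal (?v * ?n) * (ennreal (\<rho> ^ (?n - 1)) * indicator {0<..} \<rho>))"
  have [measurable]: "?N \<in> borel_measurable ?P" by measurable
  have ball: "emeasure (distr ?P borel ?N) {..r} = ennreal (?v * r ^ ?n)" if "r > 0" for r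
    using emeasure_cball_aux[OF J(1) that]
    by (simp add: emeasure_distr vimage_def Int_def conj_commute)
  have ball0: "emeasure (distr ?P borel ?N) {..r} = 0" if "r \<le> 0" for r
  proof -
    have z: "ennreal (?v * 0 ^ ?n) = 0" using n by simp
    have "(\<lambda>k. ennreal (?v * (1 / real (Suc k)) ^ ?n)) \<longlonglongrightarrow> ennreal (?v * 0 ^ ?n)"
      by (intro tendsto_ennrealI tendsto_intros LIMSEQ_Suc[OF lim_1_over_n])
    then have "(\<lambda>k. ennreal (?v * (1 / real (Suc k)) ^ ?n)) \<longlonglongrightarrow> 0" unfolding z .
    moreover have "emeasure (distr ?P borel ?N) {..r} \<le> ennreal (?v * (1 / real (Suc k)) ^ ?n)" for k
    proof -
      have "r \<le> 1 / real (Suc k)" using that by (smt (verit) divide_nonneg_nonneg of_nat_0_le_iff)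
      then have "emeasure (distr ?P borel ?N) {..r} \<le> emeasure (distr ?P borel ?N) {..1 / real (Suc k)}"
        by (intro emeasure_mono) auto
      then show ?thesis by (subst (asm) ball) auto
    qed
    ultimately show ?thesis using LIMSEQ_le_const[of _ 0 "emeasure (distr ?P borel ?N) {..r}"] by auto
  qed
  have dens: "emeasure ?D {..r} = ennreal (?v * (max r 0) ^ ?n)" for r
  proof -
    have "emeasure ?D {..r} = (\<integral>\<^sup>+\<rho>. ennreal (?v * ?n) * (ennreal (\<rho> ^ (?n - 1)) * indicator {0<..} \<rho>) * indicator {..r} \<rho> \<partial>lborel)"
      by (subst emeasure_density) auto
    also have "\<dots> = (\<integral>\<^sup>+\<rho>. ennreal (?v * ?n * \<rho> ^ (?n - 1)) * indicator {0..max r 0} \<rho> \<partial>lborel)"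
    proof (intro nn_integral_cong_AE AE_I[of _ _ "{0}"])
      have "ennreal (?v * ?n) * (ennreal (\<rho> ^ (?n - 1)) * indicator {0<..} \<rho>) * indicator {..r} \<rho>
         = ennreal (?v * ?n * \<rho> ^ (?n - 1)) * indicator {0..max r 0} \<rho>" if "\<rho> \<noteq> 0" for \<rho> :: real
        using that by (auto simp: ennreal_mult' split: split_indicator)
      then show "{\<rho> \<in> space lborel. ennreal (?v * ?n) * (ennreal (\<rho> ^ (?n - 1)) * indicator {0<..} \<rho>) * indicator {..r} \<rho>
         \<noteq> ennreal (?v * ?n * \<rho> ^ (?n - 1)) * indicator {0..max r 0} \<rho>} \<subseteq> {0}" by blast
    qed auto
    also have "\<dots> = ennreal (?v * (max r 0) ^ ?n - ?v * 0 ^ ?n)"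
      by (rule nn_integral_FTC_Icc) (auto intro!: derivative_eq_intros)
    finally show ?thesis using n by simp
  qed
  have "distr ?P borel ?N = ?D"
  proof (rule measure_eqI_generator_eq[where \<Omega> = UNIV and E = "range (\<lambda>r. {..r})" and A = "\<lambda>i. {..real i}"])
    show "Int_stable (range (\<lambda>r::real. {..r}))" by (auto simp: Int_stable_def)
    show "sets (distr ?P borel ?N) = sigma_sets UNIV (range (\<lambda>r::real. {..r}))"
      "sets ?D = sigma_sets UNIV (range (\<lambda>r::real. {..r}))"
      by (simp_all add: borel_eq_atMost)
    show "emeasure (distr ?P borel ?N) X = emeasure ?D X" if "X \<in> range (\<lambda>r::real. {..r})" for X
    proof -
      from that obtain r where X: "X = {..r}" by auto
      show ?thesis unfolding X dens using ball[of r] ball0[of r] n by (cases "r > 0") auto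
    qed
    show "(\<Union>i. {..real i}) = UNIV" using real_arch_simple by auto
    show "emeasure (distr ?P borel ?N) {..real i} \<noteq> \<infinity>" for i
      using ball[of "real i"] ball0[of "real i"] by (cases "real i > 0") auto
  qed auto
  then have "(\<integral>\<^sup>+\<rho>. g \<rho> \<partial>distr ?P borel ?N) = (\<integral>\<^sup>+\<rho>. g \<rho> \<partial>?D)" by simp
  then have "(\<integral>\<^sup>+f. g (?N f) \<partial>?P) = (\<integral>\<^sup>+\<rho>. ennreal (?v * ?n) * (ennreal (\<rho> ^ (?n - 1)) * indicator {0<..} \<rho>) * g \<rho> \<partial>lborel)"
    by (subst (asm) nn_integral_distr, simp, simp) (subst (asm) nn_integral_density, auto)
  also have "\<dots> = (\<integral>\<^sup>+\<rho>. ennreal (?v * ?n) * (g \<rho> * ennreal (\<rho> ^ (?n - 1)) * indicator {0<..} \<rho>) \<partial>lborel)"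
    by (intro nn_integral_cong) (simp add: mult_ac)
  also have "\<dots> = ennreal (?v * ?n) * (\<integral>\<^sup>+\<rho>. g \<rho> * ennreal (\<rho> ^ (?n - 1)) * indicator {0<..} \<rho> \<partial>lborel)"
    by (rule nn_integral_cmult) measurable
  finally show ?thesis .
qed

lemma nn_integral_PiM_Un:
  fixes h :: "('i \<Rightarrow> real) \<Rightarrow> ('i \<Rightarrow> real) \<Rightarrow> ennreal"
  assumes IJ: "finite I" "finite J" "I \<inter> J = {}"
    and [measurable]: "(\<lambda>(x, y). h x y) \<in> borel_measurable (Pi\<^sub>M I (\<lambda>_. lborel) \<Otimes>\<^sub>M Pi\<^sub>M J (\<lambda>_. lborel))"
  shows "(\<integral>\<^sup>+f. h (restrict f I) (restrict f J) \<partial>Pi\<^sub>M (I \<union> J) (\<lambda>_. lborel)) =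
    (\<integral>\<^sup>+x. (\<integral>\<^sup>+y. h x y \<partial>Pi\<^sub>M J (\<lambda>_. lborel)) \<partial>Pi\<^sub>M I (\<lambda>_. lborel))"
proof -
  interpret product_sigma_finite "\<lambda>_::'i. lborel :: real measure" ..
  have [measurable]: "(\<lambda>f. restrict f I) \<in> Pi\<^sub>M (I \<union> J) (\<lambda>_. lborel) \<rightarrow>\<^sub>M Pi\<^sub>M I (\<lambda>_. lborel :: real measure)"
    "(\<lambda>f. restrict f J) \<in> Pi\<^sub>M (I \<union> J) (\<lambda>_. lborel) \<rightarrow>\<^sub>M Pi\<^sub>M J (\<lambda>_. lborel :: real measure)"
    by (auto intro!: measurable_restrict_subset)
  have "(\<integral>\<^sup>+f. h (restrict f I) (restrict f J) \<partial>Pi\<^sub>M (I \<union> J) (\<lambda>_. lborel)) =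
    (\<integral>\<^sup>+x. (\<integral>\<^sup>+y. h (restrict (merge I J (x, y)) I) (restrict (merge I J (x, y)) J) \<partial>Pi\<^sub>M J (\<lambda>_. lborel)) \<partial>Pi\<^sub>M I (\<lambda>_. lborel))"
    by (subst product_nn_integral_fold[OF IJ(3,1,2)]) auto
  also have "\<dots> = (\<integral>\<^sup>+x. (\<integral>\<^sup>+y. h x y \<partial>Pi\<^sub>M J (\<lambda>_. lborel)) \<partial>Pi\<^sub>M I (\<lambda>_. lborel))"
    using IJ(3) by (intro nn_integral_cong) (simp add: restrict_merge space_PiM PiE_restrict)
  finally show ?thesis .
qed

lemma nn_integral_sin_substitution:
  fixes g :: "real \<Rightarrow> ennreal"
  assumes [measurable]: "g \<in> borel_measurable borel" and N: "N > 0"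
  shows "(\<integral>\<^sup>+z. ennreal (cos z ^ (N - 1)) * g (sin z) * indicator {0<..<pi/2} z \<partial>lborel) =
    (\<integral>\<^sup>+r. ennreal ((1 - r\<^sup>2) powr (real N / 2 - 1)) * g r * indicator {0..1} r \<partial>lborel)"
proof -
  have "(\<integral>\<^sup>+r. ennreal ((1 - r\<^sup>2) powr (real N / 2 - 1)) * g r * indicator {0..1} r \<partial>lborel) =
    (\<integral>\<^sup>+r. ennreal ((1 - r\<^sup>2) powr (real N / 2 - 1)) * g r * indicator {sin 0..sin (pi/2)} r \<partial>lborel)" by simp
  also have "\<dots> = (\<integral>\<^sup>+z. ennreal ((1 - (sin z)\<^sup>2) powr (real N / 2 - 1)) * g (sin z) * ennreal (cos z) * indicator {0..pi/2} z \<partial>lborel)"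
    by (rule nn_integral_substitution_aux)
      (auto intro!: derivative_eq_intros continuous_intros cos_ge_zero)
  also have "\<dots> = (\<integral>\<^sup>+z. ennreal (cos z ^ (N - 1)) * g (sin z) * indicator {0<..<pi/2} z \<partial>lborel)"
  proof (intro nn_integral_cong_AE AE_I[of _ _ "{0, pi/2}"])
    show "{z \<in> space lborel. ennreal ((1 - (sin z)\<^sup>2) powr (real N / 2 - 1)) * g (sin z) * ennreal (cos z) * indicator {0..pi/2} z
       \<noteq> ennreal (cos z ^ (N - 1)) * g (sin z) * indicator {0<..<pi/2} z} \<subseteq> {0, pi/2}" (is "?S \<subseteq> _")
    proof
      fix z assume z: "z \<in> ?S"
      show "z \<in> {0, pi/2}"
      proof (rule ccontr)
        assume nz: "z \<notin> {0, pi/2}"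
        have "z \<in> {0..pi/2}" using z by (cases "z \<in> {0..pi/2}") (auto split: split_indicator_asm)
        with nz have zi: "z \<in> {0<..<pi/2}" by auto
        then have c: "cos z > 0" by (intro cos_gt_zero_pi) auto
        have "(1 - (sin z)\<^sup>2) powr (real N / 2 - 1) * cos z = cos z ^ (N - 1)"
        proof -
          have "(1 - (sin z)\<^sup>2) powr (real N / 2 - 1) = cos z powr (real N - 2)"
            using c by (simp add: cos_squared_eq[symmetric] powr_numeral[symmetric] powr_powr del: powr_numeral)
          then have "(1 - (sin z)\<^sup>2) powr (real N / 2 - 1) * cos z = cos z powr (real (N - 1))"
            using c N powr_mult_base[of "cos z" "real N - 2"] by (simp add: mult.commute of_nat_diff)
          then show ?thesis using c by (simp add: powr_realpow)
        qed
        then have "ennreal ((1 - (sin z)\<^sup>2) powr (real N / 2 - 1)) * ennreal (cos z) = ennreal (cos z ^ (N - 1))"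
          by (subst ennreal_mult'[symmetric]) auto
        then have "ennreal ((1 - (sin z)\<^sup>2) powr (real N / 2 - 1)) * g (sin z) * ennreal (cos z) = ennreal (cos z ^ (N - 1)) * g (sin z)"
          by (metis mult.assoc mult.commute)
        then show False using z zi by simp
      qed
    qed
  qed (simp_all add: emeasure_lborel_countable)
  finally show ?thesis ..
qed

section \<open>The uniform distribution on a coordinate sphere\<close>

definition coord_proj :: "'a::euclidean_space set \<Rightarrow> 'a \<Rightarrow> 'a" where
  "coord_proj A x = (\<Sum>b\<in>A. (x \<bullet> b) *\<^sub>R b)"

text \<open>
  For a set \<open>A\<close> of coordinate directions, the product of the unit ball in the span of \<open>A\<close> with the
  unit ball in the complementary span. It is an auxiliary set of finite volume that lets the uniform
  distribution on the unit sphere of the span of \<open>A\<close> be obtained by projecting and normalising a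
  point of the ambient space, so that the dimension of the sphere need not be a type.
\<close>

definition coord_cyl :: "'a::euclidean_space set \<Rightarrow> 'a set" where
  "coord_cyl A = {x. norm (coord_proj A x) \<le> 1 \<and> norm (x - coord_proj A x) \<le> 1}"

definition sphere_meas :: "'a::euclidean_space set \<Rightarrow> 'a measure" where
  "sphere_meas A = distr (uniform_measure lborel (coord_cyl A)) borel (\<lambda>x. sgn (coord_proj A x))"

lemma measurable_coord_proj [measurable]: "coord_proj A \<in> borel_measurable borel"
  unfolding coord_proj_def[abs_def] by measurable

lemma sets_coord_cyl [measurable]: "coord_cyl A \<in> sets borel"
  unfolding coord_cyl_def by measurable

lemma inner_coord_proj:
  assumes "A \<subseteq> Basis" "b \<in> Basis"
  shows "coord_proj A x \<bullet> b = (if b \<in> A then x \<bullet> b else 0)"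
proof -
  have "coord_proj A x \<bullet> b = (\<Sum>c\<in>A. if c = b then x \<bullet> c else 0)"
    unfolding coord_proj_def inner_sum_left using assms by (intro sum.cong) (auto simp: inner_Basis)
  also have "\<dots> = (if b \<in> A then x \<bullet> b else 0)"
    using assms finite_subset[OF assms(1) finite_Basis] by (simp add: sum.delta)
  finally show ?thesis .
qed

lemma norm_coord_proj:
  assumes "A \<subseteq> Basis"
  shows "norm (coord_proj A x) = sqrt (\<Sum>b\<in>A. (x \<bullet> b)\<^sup>2)"
proof -
  have "(\<Sum>b\<in>Basis. (coord_proj A x \<bullet> b)\<^sup>2) = (\<Sum>b\<in>A. (x \<bullet> b)\<^sup>2)"
    using assms by (intro sum.mono_neutral_cong_right) (auto simp: inner_coord_proj[OF assms] subset_iff)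
  moreover have "norm (coord_proj A x) = sqrt (\<Sum>b\<in>Basis. (coord_proj A x \<bullet> b)\<^sup>2)"
    unfolding norm_eq_sqrt_inner by (subst euclidean_inner) (simp only: power2_eq_square)
  ultimately show ?thesis by simp
qed

lemma coord_proj_compl:
  assumes "A \<subseteq> Basis"
  shows "x - coord_proj A x = coord_proj (Basis - A) x"
proof (rule euclidean_eqI)
  fix b :: 'a assume b: "b \<in> Basis"
  show "(x - coord_proj A x) \<bullet> b = coord_proj (Basis - A) x \<bullet> b"
    by (simp add: inner_diff_left inner_coord_proj[OF assms b] inner_coord_proj[OF Diff_subset b] b)
qed

lemma emeasure_coord_cyl:
  assumes "A \<subseteq> Basis"
  shows "emeasure lborel (coord_cyl A) \<noteq> 0" "emeasure lborel (coord_cyl A) \<noteq> \<infinity>"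
proof -
  have n: "norm (coord_proj J x) \<le> norm x" if "J \<subseteq> Basis" for J and x :: 'a
    unfolding norm_coord_proj[OF that] using that
    by (simp add: norm_eq_sqrt_inner[of x] euclidean_inner[of x x] power2_eq_square[symmetric] sum_mono2)
  have "ball 0 1 \<subseteq> coord_cyl A"
  proof
    fix x :: 'a assume "x \<in> ball 0 1"
    then show "x \<in> coord_cyl A"
      unfolding coord_cyl_def coord_proj_compl[OF assms]
      using n[OF assms, of x] n[of "Basis - A" x] by simp
  qed
  then have "emeasure lborel (ball (0::'a) 1) \<le> emeasure lborel (coord_cyl A)"
    by (intro emeasure_mono) auto
  moreover have "emeasure lborel (ball (0::'a) 1) \<noteq> 0"
    using open_not_negligible[of "ball (0::'a) 1"] by (auto simp: negligible_iff_null_sets null_sets_completion_iff)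
  ultimately show "emeasure lborel (coord_cyl A) \<noteq> 0" by auto
  have "coord_cyl A \<subseteq> cball 0 2"
  proof
    fix x assume "x \<in> coord_cyl A"
    then have "norm (coord_proj A x) \<le> 1" "norm (x - coord_proj A x) \<le> 1" by (auto simp: coord_cyl_def)
    then show "x \<in> cball 0 2" using norm_triangle_ineq[of "coord_proj A x" "x - coord_proj A x"] by simp
  qed
  then have "emeasure lborel (coord_cyl A) \<le> emeasure lborel (cball (0::'a) 2)"
    by (intro emeasure_mono) auto
  also have "\<dots> < \<infinity>" by (rule emeasure_lborel_cball_finite)
  finally show "emeasure lborel (coord_cyl A) \<noteq> \<infinity>" by (simp add: less_top)
qed

lemma sets_sphere_meas [simp, measurable_cong]: "sets (sphere_meas A) = sets borel"
  by (simp add: sphere_meas_def)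

lemma space_sphere_meas [simp]: "space (sphere_meas A) = UNIV"
  by (simp add: sphere_meas_def)

lemma prob_space_sphere_meas:
  assumes "A \<subseteq> Basis" shows "prob_space (sphere_meas A)"
  unfolding sphere_meas_def
  by (intro prob_space.prob_space_distr prob_space_uniform_measure emeasure_coord_cyl assms) measurable

lemma nn_integral_sphere_meas:
  fixes g :: "'a::euclidean_space \<Rightarrow> ennreal"
  assumes [measurable]: "g \<in> borel_measurable borel"
  shows "(\<integral>\<^sup>+\<theta>. g \<theta> \<partial>sphere_meas A) =
    (\<integral>\<^sup>+x. g (sgn (coord_proj A x)) * indicator (coord_cyl A) x \<partial>lborel) / emeasure lborel (coord_cyl A)"
  unfolding sphere_meas_def by (subst nn_integral_distr) (simp_all add: nn_integral_uniform_measure)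

lemma AE_sphere_meas:
  assumes A: "A \<subseteq> Basis" "A \<noteq> {}"
  shows "AE \<theta> in sphere_meas A. norm \<theta> = 1 \<and> coord_proj A \<theta> = \<theta>"
proof -
  obtain b where b: "b \<in> A" using A by auto
  then have bB: "b \<in> Basis" using A by blast
  have "AE x in lborel. x \<bullet> b \<noteq> (0::real)"
  proof -
    have "{x. b \<bullet> x = 0} \<in> null_sets lebesgue"
      using negligible_hyperplane[of b 0] nonzero_Basis[OF bB] by (simp add: negligible_iff_null_sets)
    then have "{x. x \<bullet> b = 0} \<in> null_sets lborel"
      by (simp add: null_sets_completion_iff inner_commute)
    then show ?thesis by (rule AE_I') auto
  qed
  then have "AE x in lborel. coord_proj A x \<noteq> 0"
  proof (eventually_elim)
    case (elim x) then show ?case using inner_coord_proj[OF A(1) bB, of x] b by (metis inner_zero_left)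
  qed
  then have "AE x in lborel. norm (sgn (coord_proj A x)) = 1 \<and> coord_proj A (sgn (coord_proj A x)) = sgn (coord_proj A x)"
  proof eventually_elim
    case (elim x)
    have "coord_proj A (sgn (coord_proj A x)) = sgn (coord_proj A x)"
      by (rule euclidean_eqI) (simp add: inner_coord_proj[OF A(1)] sgn_div_norm)
    then show ?case using elim by (simp add: norm_sgn)
  qed
  then have "AE x in uniform_measure lborel (coord_cyl A). norm (sgn (coord_proj A x)) = 1 \<and> coord_proj A (sgn (coord_proj A x)) = sgn (coord_proj A x)"
    by (intro AE_uniform_measureI) (simp, erule eventually_mono, simp)
  moreover have "{x \<in> space borel. norm x = 1 \<and> coord_proj A x = x} \<in> sets (borel :: 'a measure)"
    by measurable
  moreover have "(\<lambda>x. sgn (coord_proj A x)) \<in> uniform_measure lborel (coord_cyl A) \<rightarrow>\<^sub>M borel"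
    by measurable
  ultimately show ?thesis unfolding sphere_meas_def by (simp only: AE_distr_iff)
qed

text \<open>
  The cylinder is invariant under an isometry that commutes with the projection, and so is Lebesgue
  measure; normalising commutes with isometries.
\<close>

lemma distr_sphere_meas_isometry:
  fixes T :: "'a::euclidean_space \<Rightarrow> 'a"
  assumes A: "A \<subseteq> Basis" and T: "linear T" "\<And>x. norm (T x) = norm x" and TA: "\<And>x. T (coord_proj A x) = coord_proj A (T x)"
  shows "distr (sphere_meas A) borel T = sphere_meas A"
proof (rule measure_eqI)
  have [measurable]: "T \<in> borel_measurable borel"
    using T(1) by (intro borel_measurable_continuous_onI linear_continuous_on) (simp add: linear_conv_bounded_linear)
  have sg: "T (sgn (coord_proj A x)) = sgn (coord_proj A (T x))" for x
    by (simp add: sgn_div_norm linear_scale[OF T(1)] TA[symmetric] T(2))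
  have cyl: "T x \<in> coord_cyl A \<longleftrightarrow> x \<in> coord_cyl A" for x
    unfolding coord_cyl_def by (simp add: TA[symmetric] T(2) linear_diff[OF T(1), symmetric])
  fix B assume "B \<in> sets (distr (sphere_meas A) borel T)"
  then have [measurable]: "B \<in> sets borel" by simp
  have "emeasure (distr (sphere_meas A) borel T) B = (\<integral>\<^sup>+\<theta>. indicator B (T \<theta>) \<partial>sphere_meas A)"
    by (subst nn_integral_indicator[symmetric], simp, subst nn_integral_distr) auto
  also have "\<dots> = (\<integral>\<^sup>+x. indicator B (sgn (coord_proj A (T x))) * indicator (coord_cyl A) (T x) \<partial>lborel) / emeasure lborel (coord_cyl A)"
    by (subst nn_integral_sphere_meas) (simp_all add: sg cyl indicator_def)
  also have "(\<integral>\<^sup>+x. indicator B (sgn (coord_proj A (T x))) * indicator (coord_cyl A) (T x) \<partial>lborel) =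
    (\<integral>\<^sup>+x. indicator B (sgn (coord_proj A x)) * indicator (coord_cyl A) x \<partial>distr lborel borel T)"
    by (subst nn_integral_distr) auto
  also have "\<dots> / emeasure lborel (coord_cyl A) = (\<integral>\<^sup>+\<theta>. indicator B \<theta> \<partial>sphere_meas A)"
    unfolding lborel_distr_linear_isometry[OF T] by (rule nn_integral_sphere_meas[symmetric]) simp
  also have "\<dots> = emeasure (sphere_meas A) B" by (rule nn_integral_indicator) simp
  finally show "emeasure (distr (sphere_meas A) borel T) B = emeasure (sphere_meas A) B" .
qed simp

section \<open>Marginals of the uniform distribution on a sphere\<close>

text \<open>
  The integrand \<open>f\<close> evaluated at the normalised point, restricted to the unit ball: \<open>y\<close> is the
  distinguished coordinate, \<open>P\<close> the sum of squares of the other coordinates of the block that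
  contains it, and \<open>Q\<close> the sum of squares of the coordinates outside the block.
\<close>

definition cone_fun :: "(real \<times> real \<Rightarrow> ennreal) \<Rightarrow> real \<Rightarrow> real \<Rightarrow> real \<Rightarrow> ennreal" where
  "cone_fun f y P Q = f (y / sqrt (y\<^sup>2 + P + Q), sqrt (y\<^sup>2 + P) / sqrt (y\<^sup>2 + P + Q)) * indicator {..1} (sqrt (y\<^sup>2 + P + Q))"

lemma measurable_cone_fun [measurable]:
  assumes [measurable]: "f \<in> borel_measurable (borel \<Otimes>\<^sub>M borel)"
   "a \<in> borel_measurable M" "b \<in> borel_measurable M" "c \<in> borel_measurable M"
  shows "(\<lambda>x. cone_fun f (a x) (b x) (c x)) \<in> borel_measurable M"
  unfolding cone_fun_def by measurable

lemma measurable_sum_squares_PiM: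
  assumes "S \<subseteq> A"
  shows "(\<lambda>x. \<Sum>i\<in>S. (x i)\<^sup>2 :: real) \<in> borel_measurable (Pi\<^sub>M A (\<lambda>_. lborel))"
proof (intro borel_measurable_sum borel_measurable_power)
  fix i assume "i \<in> S"
  then have "i \<in> A" using assms by blast
  then show "(\<lambda>x. x i) \<in> borel_measurable (Pi\<^sub>M A (\<lambda>_. lborel))"
    using measurable_component_singleton[of i A "\<lambda>_. lborel :: real measure"] by simp
qed

text \<open>
  Fubini over the coordinate \<open>b\<close>, the rest of the block \<open>A1\<close> and the coordinates outside it, the
  last group in polar coordinates. The constant \<open>c\<close> collects volumes; its value is never computed,
  since both sides of the marginal formulas below are probability measures.
\<close>

lemma nn_integral_sphere_meas_split:
  fixes A1 :: "'a::euclidean_space set"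
  assumes A: "A \<subseteq> Basis" "A1 \<subseteq> A" "b \<in> A1" and ne: "A - A1 \<noteq> {}"
  obtains c :: ennreal where "\<And>f. f \<in> borel_measurable (borel \<Otimes>\<^sub>M borel) \<Longrightarrow>
    (\<integral>\<^sup>+\<theta>. f (\<theta> \<bullet> b, norm (coord_proj A1 \<theta>)) \<partial>sphere_meas A) =
    c * (\<integral>\<^sup>+y. (\<integral>\<^sup>+u. (\<integral>\<^sup>+q. cone_fun f y (\<Sum>i\<in>A1-{b}. (u i)\<^sup>2) (q\<^sup>2) * ennreal (q ^ (card (A - A1) - 1)) * indicator {0<..} q \<partial>lborel)
       \<partial>Pi\<^sub>M (A1 - {b}) (\<lambda>_. lborel)) \<partial>lborel)"
proof -
  interpret product_sigma_finite "\<lambda>_::'a. lborel :: real measure" ..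
  have fin: "finite A" by (rule finite_subset[OF A(1) finite_Basis])
  have fin1: "finite A1" by (rule finite_subset[OF A(2) fin])
  have bA: "b \<in> A" by (rule subsetD[OF A(2,3)])
  have bB: "b \<in> Basis" by (rule subsetD[OF A(1) bA])
  let ?A1 = "A1 - {b}" and ?A2 = "A - A1" and ?Ac = "Basis - A"
  have sub: "?A1 \<subseteq> A" "?A2 \<subseteq> A" "?Ac \<subseteq> Basis" "?A1 \<subseteq> Basis" "?A2 \<subseteq> Basis"
    using A(1,2) by auto
  note [measurable] = sub[THEN measurable_sum_squares_PiM] order_refl[THEN measurable_sum_squares_PiM]
    Un_upper1[THEN measurable_sum_squares_PiM] Un_upper2[THEN measurable_sum_squares_PiM]
  have [measurable]: "(\<lambda>x. x b) \<in> borel_measurable (Pi\<^sub>M A (\<lambda>_. lborel :: real measure))"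
    "(\<lambda>x. x b) \<in> borel_measurable (Pi\<^sub>M Basis (\<lambda>_. lborel :: real measure))"
    "(\<lambda>x. x b) \<in> borel_measurable (Pi\<^sub>M {b} (\<lambda>_. lborel :: real measure))"
    using measurable_component_singleton[of b _ "\<lambda>_. lborel :: real measure"] bA bB by auto
  define K where "K = (\<integral>\<^sup>+w. indicator {..1} (sqrt (\<Sum>i\<in>?Ac. (w i)\<^sup>2)) \<partial>Pi\<^sub>M ?Ac (\<lambda>_. lborel :: real measure))"
  define k2 where "k2 = ennreal (unit_ball_vol (card ?A2) * card ?A2)"
  show thesis
  proof (rule that[of "K * k2 / emeasure lborel (coord_cyl A)"])
    fix f :: "real \<times> real \<Rightarrow> ennreal"
    assume f[measurable]: "f \<in> borel_measurable (borel \<Otimes>\<^sub>M borel)"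
    let ?h = "\<lambda>x y. cone_fun f (x b) (\<Sum>i\<in>?A1. (x i)\<^sup>2) (\<Sum>i\<in>?A2. (x i)\<^sup>2) * indicator {..1} (sqrt (\<Sum>i\<in>?Ac. (y i)\<^sup>2))"
    have eq: "f (sgn (coord_proj A x) \<bullet> b, norm (coord_proj A1 (sgn (coord_proj A x)))) * indicator (coord_cyl A) x
       = ?h (\<lambda>i. x \<bullet> i) (\<lambda>i. x \<bullet> i)" for x :: 'a
    proof -
      have s1: "(\<Sum>i\<in>A1. (x \<bullet> i)\<^sup>2) = (x \<bullet> b)\<^sup>2 + (\<Sum>i\<in>?A1. (x \<bullet> i)\<^sup>2)"
        by (rule sum.remove[OF fin1 A(3)])
      have s2: "(\<Sum>i\<in>A. (x \<bullet> i)\<^sup>2) = (\<Sum>i\<in>A1. (x \<bullet> i)\<^sup>2) + (\<Sum>i\<in>?A2. (x \<bullet> i)\<^sup>2)"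
        using sum.subset_diff[OF A(2) fin] by (simp add: add.commute)
      have nA: "norm (coord_proj A x) = sqrt ((x \<bullet> b)\<^sup>2 + (\<Sum>i\<in>?A1. (x \<bullet> i)\<^sup>2) + (\<Sum>i\<in>?A2. (x \<bullet> i)\<^sup>2))"
        by (simp only: norm_coord_proj[OF A(1)] s1 s2)
      have "A1 \<subseteq> Basis" by (rule order_trans[OF A(2,1)])
      have "coord_proj A1 (sgn (coord_proj A x)) = coord_proj A1 x /\<^sub>R norm (coord_proj A x)"
        by (rule euclidean_eqI) (use A(2) in \<open>auto simp: inner_coord_proj[OF A(1)] inner_coord_proj[OF \<open>A1 \<subseteq> Basis\<close>] sgn_div_norm\<close>)
      then have nA1: "norm (coord_proj A1 (sgn (coord_proj A x))) = sqrt ((x \<bullet> b)\<^sup>2 + (\<Sum>i\<in>?A1. (x \<bullet> i)\<^sup>2)) / norm (coord_proj A x)"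
        by (simp add: norm_coord_proj[OF \<open>A1 \<subseteq> Basis\<close>] s1 divide_inverse mult.commute)
      have ib: "sgn (coord_proj A x) \<bullet> b = (x \<bullet> b) / norm (coord_proj A x)"
        using bA bB by (simp add: sgn_div_norm inner_coord_proj[OF A(1) bB] divide_inverse mult.commute)
      have ic: "indicator (coord_cyl A) x = (indicator {..1} (norm (coord_proj A x)) * indicator {..1} (sqrt (\<Sum>i\<in>?Ac. (x \<bullet> i)\<^sup>2)) :: ennreal)"
        unfolding coord_cyl_def coord_proj_compl[OF A(1)] by (subst (2) norm_coord_proj) (auto split: split_indicator)
      show ?thesis unfolding ic nA1 ib cone_fun_def nA[symmetric] by (simp add: mult.assoc)
    qed
    have m1[measurable]: "(\<lambda>x. ?h x x) \<in> borel_measurable (Pi\<^sub>M Basis (\<lambda>_. lborel))"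
      by measurable
    have "(\<integral>\<^sup>+x. ?h (\<lambda>i. x \<bullet> i) (\<lambda>i. x \<bullet> i) \<partial>(lborel :: 'a measure)) = (\<integral>\<^sup>+x. ?h x x \<partial>Pi\<^sub>M Basis (\<lambda>_. lborel))"
    proof -
      have mm: "(\<lambda>x::'a. ?h (\<lambda>i. x \<bullet> i) (\<lambda>i. x \<bullet> i)) \<in> borel_measurable borel" by measurable
      have mB: "(\<lambda>f. \<Sum>b\<in>Basis. f b *\<^sub>R b) \<in> Pi\<^sub>M Basis (\<lambda>_. lborel :: real measure) \<rightarrow>\<^sub>M (borel :: 'a measure)"
      proof (intro borel_measurable_sum borel_measurable_scaleR borel_measurable_const)
        fix i :: 'a assume "i \<in> Basis"
        then show "(\<lambda>f. f i) \<in> borel_measurable (Pi\<^sub>M Basis (\<lambda>_. lborel :: real measure))"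
          using measurable_component_singleton[of i Basis "\<lambda>_. lborel :: real measure"] by simp
      qed
      have mm': "(\<lambda>x::'a. ?h (\<lambda>i. x \<bullet> i) (\<lambda>i. x \<bullet> i)) \<in> borel_measurable (distr (Pi\<^sub>M Basis (\<lambda>_. lborel)) borel (\<lambda>f. \<Sum>b\<in>Basis. f b *\<^sub>R b))"
        using mm by simp
      show ?thesis
        unfolding lborel_eq[where 'a='a] nn_integral_distr[OF mB mm']
      proof (rule nn_integral_cong)
        fix x :: "'a \<Rightarrow> real"
        have "(\<Sum>b\<in>Basis. x b *\<^sub>R b) \<bullet> i = x i" if "i \<in> Basis" for i :: 'a
          using that by (simp add: inner_sum_left_Basis)
        then have "(\<Sum>b\<in>Basis. x b *\<^sub>R b) \<bullet> b = x b" "(\<Sum>i\<in>?A1. ((\<Sum>b\<in>Basis. x b *\<^sub>R b) \<bullet> i)\<^sup>2) = (\<Sum>i\<in>?A1. (x i)\<^sup>2)"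
          "(\<Sum>i\<in>?A2. ((\<Sum>b\<in>Basis. x b *\<^sub>R b) \<bullet> i)\<^sup>2) = (\<Sum>i\<in>?A2. (x i)\<^sup>2)" "(\<Sum>i\<in>?Ac. ((\<Sum>b\<in>Basis. x b *\<^sub>R b) \<bullet> i)\<^sup>2) = (\<Sum>i\<in>?Ac. (x i)\<^sup>2)"
          using bB sub by (auto intro!: sum.cong simp: subset_iff)
        then show "?h (\<lambda>i. (\<Sum>b\<in>Basis. x b *\<^sub>R b) \<bullet> i) (\<lambda>i. (\<Sum>b\<in>Basis. x b *\<^sub>R b) \<bullet> i) = ?h x x"
          by simp
      qed
    qed
    also have "\<dots> = (\<integral>\<^sup>+x. ?h (restrict x A) (restrict x ?Ac) \<partial>Pi\<^sub>M (A \<union> ?Ac) (\<lambda>_. lborel))"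
    proof -
      have "A \<union> ?Ac = Basis" using A by auto
      moreover have "?h (restrict x A) (restrict x ?Ac) = ?h x x" for x
      proof -
        have "(\<Sum>i\<in>?A1. (restrict x A i)\<^sup>2) = (\<Sum>i\<in>?A1. (x i)\<^sup>2)"
          by (rule sum.cong) (use sub(1) in auto)
        then show ?thesis using bA by simp
      qed
      ultimately show ?thesis by simp
    qed
    also have "\<dots> = (\<integral>\<^sup>+x. (\<integral>\<^sup>+y. ?h x y \<partial>Pi\<^sub>M ?Ac (\<lambda>_. lborel)) \<partial>Pi\<^sub>M A (\<lambda>_. lborel))"
    proof (rule nn_integral_PiM_Un[where h = ?h])
      show "(\<lambda>(x, y). ?h x y) \<in> borel_measurable (Pi\<^sub>M A (\<lambda>_. lborel) \<Otimes>\<^sub>M Pi\<^sub>M ?Ac (\<lambda>_. lborel))"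
        unfolding case_prod_beta' by measurable
    qed (use fin in simp_all)
    also have "\<dots> = (\<integral>\<^sup>+x. cone_fun f (x b) (\<Sum>i\<in>?A1. (x i)\<^sup>2) (\<Sum>i\<in>?A2. (x i)\<^sup>2) * K \<partial>Pi\<^sub>M A (\<lambda>_. lborel))"
      unfolding K_def by (intro nn_integral_cong nn_integral_cmult) measurable
    also have "\<dots> = (\<integral>\<^sup>+x. cone_fun f (x b) (\<Sum>i\<in>?A1. (x i)\<^sup>2) (\<Sum>i\<in>?A2. (x i)\<^sup>2) \<partial>Pi\<^sub>M A (\<lambda>_. lborel)) * K"
      by (intro nn_integral_multc) measurable
    also have "(\<integral>\<^sup>+x. cone_fun f (x b) (\<Sum>i\<in>?A1. (x i)\<^sup>2) (\<Sum>i\<in>?A2. (x i)\<^sup>2) \<partial>Pi\<^sub>M A (\<lambda>_. lborel))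
      = (\<integral>\<^sup>+x. cone_fun f (restrict x {b} b) (\<Sum>i\<in>?A1. (restrict x (?A1 \<union> ?A2) i)\<^sup>2) (\<Sum>i\<in>?A2. (restrict x (?A1 \<union> ?A2) i)\<^sup>2)
          \<partial>Pi\<^sub>M ({b} \<union> (?A1 \<union> ?A2)) (\<lambda>_. lborel))"
    proof -
      have "{b} \<union> (?A1 \<union> ?A2) = A" using A by auto
      then show ?thesis by simp
    qed
    also have "\<dots> = (\<integral>\<^sup>+x. (\<integral>\<^sup>+y. cone_fun f (x b) (\<Sum>i\<in>?A1. (y i)\<^sup>2) (\<Sum>i\<in>?A2. (y i)\<^sup>2)
          \<partial>Pi\<^sub>M (?A1 \<union> ?A2) (\<lambda>_. lborel)) \<partial>Pi\<^sub>M {b} (\<lambda>_. lborel))"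
    proof (rule nn_integral_PiM_Un[where h = "\<lambda>x y. cone_fun f (x b) (\<Sum>i\<in>?A1. (y i)\<^sup>2) (\<Sum>i\<in>?A2. (y i)\<^sup>2)"])
      show "(\<lambda>(x, y). cone_fun f (x b) (\<Sum>i\<in>?A1. (y i)\<^sup>2) (\<Sum>i\<in>?A2. (y i)\<^sup>2))
        \<in> borel_measurable (Pi\<^sub>M {b} (\<lambda>_. lborel) \<Otimes>\<^sub>M Pi\<^sub>M (?A1 \<union> ?A2) (\<lambda>_. lborel))"
        unfolding case_prod_beta' by measurable
    qed (use fin fin1 A(2) bA A(3) in auto)
    also have "\<dots> = (\<integral>\<^sup>+t. (\<integral>\<^sup>+y. cone_fun f t (\<Sum>i\<in>?A1. (y i)\<^sup>2) (\<Sum>i\<in>?A2. (y i)\<^sup>2)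
          \<partial>Pi\<^sub>M (?A1 \<union> ?A2) (\<lambda>_. lborel)) \<partial>lborel)"
    proof (rule product_nn_integral_singleton[where f = "\<lambda>t. (\<integral>\<^sup>+y. cone_fun f t (\<Sum>i\<in>?A1. (y i)\<^sup>2) (\<Sum>i\<in>?A2. (y i)\<^sup>2) \<partial>Pi\<^sub>M (?A1 \<union> ?A2) (\<lambda>_. lborel))"])
      interpret s: finite_product_sigma_finite "\<lambda>_::'a. lborel :: real measure" "?A1 \<union> ?A2" using fin fin1 by unfold_locales simp
      show "(\<lambda>t. \<integral>\<^sup>+y. cone_fun f t (\<Sum>i\<in>?A1. (y i)\<^sup>2) (\<Sum>i\<in>?A2. (y i)\<^sup>2) \<partial>Pi\<^sub>M (?A1 \<union> ?A2) (\<lambda>_. lborel)) \<in> borel_measurable lborel"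
        by (intro s.borel_measurable_nn_integral) (unfold case_prod_beta', measurable)
    qed
    also have "\<dots> = (\<integral>\<^sup>+t. k2 * (\<integral>\<^sup>+u. (\<integral>\<^sup>+q. cone_fun f t (\<Sum>i\<in>?A1. (u i)\<^sup>2) (q\<^sup>2) * ennreal (q ^ (card ?A2 - 1)) * indicator {0<..} q \<partial>lborel)
       \<partial>Pi\<^sub>M ?A1 (\<lambda>_. lborel)) \<partial>lborel)"
    proof (rule nn_integral_cong)
      fix t :: real
      have "(\<integral>\<^sup>+y. cone_fun f t (\<Sum>i\<in>?A1. (y i)\<^sup>2) (\<Sum>i\<in>?A2. (y i)\<^sup>2) \<partial>Pi\<^sub>M (?A1 \<union> ?A2) (\<lambda>_. lborel))
        = (\<integral>\<^sup>+y. cone_fun f t (\<Sum>i\<in>?A1. (restrict y ?A1 i)\<^sup>2) (\<Sum>i\<in>?A2. (restrict y ?A2 i)\<^sup>2) \<partial>Pi\<^sub>M (?A1 \<union> ?A2) (\<lambda>_. lborel))"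
      proof -
        have "(\<Sum>i\<in>?A1. (restrict y ?A1 i)\<^sup>2) = (\<Sum>i\<in>?A1. (y i)\<^sup>2)" "(\<Sum>i\<in>?A2. (restrict y ?A2 i)\<^sup>2) = (\<Sum>i\<in>?A2. (y i)\<^sup>2)" for y :: "'a \<Rightarrow> real"
          by (auto intro!: sum.cong)
        then show ?thesis by (simp only:)
      qed
      also have "\<dots> = (\<integral>\<^sup>+u. (\<integral>\<^sup>+v. cone_fun f t (\<Sum>i\<in>?A1. (u i)\<^sup>2) (\<Sum>i\<in>?A2. (v i)\<^sup>2) \<partial>Pi\<^sub>M ?A2 (\<lambda>_. lborel)) \<partial>Pi\<^sub>M ?A1 (\<lambda>_. lborel))"
      proof (rule nn_integral_PiM_Un[where h = "\<lambda>x y. cone_fun f t (\<Sum>i\<in>?A1. (x i)\<^sup>2) (\<Sum>i\<in>?A2. (y i)\<^sup>2)"])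
        show "(\<lambda>(x, y). cone_fun f t (\<Sum>i\<in>?A1. (x i)\<^sup>2) (\<Sum>i\<in>?A2. (y i)\<^sup>2))
           \<in> borel_measurable (Pi\<^sub>M ?A1 (\<lambda>_. lborel) \<Otimes>\<^sub>M Pi\<^sub>M ?A2 (\<lambda>_. lborel))"
          unfolding case_prod_beta' by measurable
      qed (use fin fin1 A(2) bA A(3) in auto)
      also have "\<dots> = (\<integral>\<^sup>+u. k2 * (\<integral>\<^sup>+q. cone_fun f t (\<Sum>i\<in>?A1. (u i)\<^sup>2) (q\<^sup>2) * ennreal (q ^ (card ?A2 - 1)) * indicator {0<..} q \<partial>lborel)
         \<partial>Pi\<^sub>M ?A1 (\<lambda>_. lborel))"
      proof (rule nn_integral_cong)
        fix u :: "'a \<Rightarrow> real"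
        show "(\<integral>\<^sup>+v. cone_fun f t (\<Sum>i\<in>?A1. (u i)\<^sup>2) (\<Sum>i\<in>?A2. (v i)\<^sup>2) \<partial>Pi\<^sub>M ?A2 (\<lambda>_. lborel)) =
          k2 * (\<integral>\<^sup>+q. cone_fun f t (\<Sum>i\<in>?A1. (u i)\<^sup>2) (q\<^sup>2) * ennreal (q ^ (card ?A2 - 1)) * indicator {0<..} q \<partial>lborel)"
          using nn_integral_radial[of ?A2 "\<lambda>q. cone_fun f t (\<Sum>i\<in>?A1. (u i)\<^sup>2) (q\<^sup>2)"] fin ne
          by (simp add: k2_def sum_nonneg)
      qed
      also have "\<dots> = k2 * (\<integral>\<^sup>+u. (\<integral>\<^sup>+q. cone_fun f t (\<Sum>i\<in>?A1. (u i)\<^sup>2) (q\<^sup>2) * ennreal (q ^ (card ?A2 - 1)) * indicator {0<..} q \<partial>lborel)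
         \<partial>Pi\<^sub>M ?A1 (\<lambda>_. lborel))"
        by (rule nn_integral_cmult) measurable
      finally show "(\<integral>\<^sup>+y. cone_fun f t (\<Sum>i\<in>?A1. (y i)\<^sup>2) (\<Sum>i\<in>?A2. (y i)\<^sup>2) \<partial>Pi\<^sub>M (?A1 \<union> ?A2) (\<lambda>_. lborel)) = \<dots>" .
    qed
    also have "\<dots> = k2 * (\<integral>\<^sup>+t. (\<integral>\<^sup>+u. (\<integral>\<^sup>+q. cone_fun f t (\<Sum>i\<in>?A1. (u i)\<^sup>2) (q\<^sup>2) * ennreal (q ^ (card ?A2 - 1)) * indicator {0<..} q \<partial>lborel)
       \<partial>Pi\<^sub>M ?A1 (\<lambda>_. lborel)) \<partial>lborel)"
    proof (rule nn_integral_cmult)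
      interpret s: finite_product_sigma_finite "\<lambda>_::'a. lborel :: real measure" "?A1" using fin fin1 by unfold_locales simp
      show "(\<lambda>t. (\<integral>\<^sup>+u. (\<integral>\<^sup>+q. cone_fun f t (\<Sum>i\<in>?A1. (u i)\<^sup>2) (q\<^sup>2) * ennreal (q ^ (card ?A2 - 1)) * indicator {0<..} q \<partial>lborel)
       \<partial>Pi\<^sub>M ?A1 (\<lambda>_. lborel))) \<in> borel_measurable lborel"
        by (intro s.borel_measurable_nn_integral) measurable
    qed
    finally have "(\<integral>\<^sup>+x. ?h (\<lambda>i. x \<bullet> i) (\<lambda>i. x \<bullet> i) \<partial>(lborel :: 'a measure)) = k2 * (\<integral>\<^sup>+t. (\<integral>\<^sup>+u. (\<integral>\<^sup>+q. cone_fun f t (\<Sum>i\<in>?A1. (u i)\<^sup>2) (q\<^sup>2) * ennreal (q ^ (card ?A2 - 1)) * indicator {0<..} q \<partial>lborel)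
       \<partial>Pi\<^sub>M ?A1 (\<lambda>_. lborel)) \<partial>lborel) * K" .
    then have fin_eq: "(\<integral>\<^sup>+x. f (sgn (coord_proj A x) \<bullet> b, norm (coord_proj A1 (sgn (coord_proj A x)))) * indicator (coord_cyl A) x \<partial>lborel)
      = k2 * (\<integral>\<^sup>+t. (\<integral>\<^sup>+u. (\<integral>\<^sup>+q. cone_fun f t (\<Sum>i\<in>?A1. (u i)\<^sup>2) (q\<^sup>2) * ennreal (q ^ (card ?A2 - 1)) * indicator {0<..} q \<partial>lborel)
       \<partial>Pi\<^sub>M ?A1 (\<lambda>_. lborel)) \<partial>lborel) * K" by (simp only: eq)
    have "(\<integral>\<^sup>+\<theta>. f (\<theta> \<bullet> b, norm (coord_proj A1 \<theta>)) \<partial>sphere_meas A) =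
      (\<integral>\<^sup>+x. f (sgn (coord_proj A x) \<bullet> b, norm (coord_proj A1 (sgn (coord_proj A x)))) * indicator (coord_cyl A) x \<partial>lborel)
        / emeasure lborel (coord_cyl A)"
      by (rule nn_integral_sphere_meas) measurable
    then show "(\<integral>\<^sup>+\<theta>. f (\<theta> \<bullet> b, norm (coord_proj A1 \<theta>)) \<partial>sphere_meas A) =
      K * k2 / emeasure lborel (coord_cyl A) * (\<integral>\<^sup>+t. (\<integral>\<^sup>+u. (\<integral>\<^sup>+q. cone_fun f t (\<Sum>i\<in>?A1. (u i)\<^sup>2) (q\<^sup>2) * ennreal (q ^ (card ?A2 - 1)) * indicator {0<..} q \<partial>lborel)
       \<partial>Pi\<^sub>M ?A1 (\<lambda>_. lborel)) \<partial>lborel)"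
      unfolding fin_eq by (simp only: divide_ennreal_def mult_ac)
  qed
qed

lemma nn_integral_cone_fun_half_plane:
  fixes F :: "real \<times> real \<Rightarrow> ennreal"
  assumes [measurable]: "F \<in> borel_measurable (borel \<Otimes>\<^sub>M borel)"
  shows "(\<integral>\<^sup>+q. (\<integral>\<^sup>+t. cone_fun F t 0 (q\<^sup>2) * ennreal (sqrt (t\<^sup>2 + q\<^sup>2) ^ m * q ^ n) \<partial>lborel) * indicator {0<..} q \<partial>lborel) =
    (\<integral>\<^sup>+s. ennreal (s ^ (m + n + 1)) * indicator {0<..1} s \<partial>lborel) *
    (\<integral>\<^sup>+x. ennreal (cos x ^ n) * F (sin x, \<bar>sin x\<bar>) * indicator {-(pi/2)<..<pi/2} x \<partial>lborel)"
proof -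
  let ?c = "\<integral>\<^sup>+s. ennreal (s ^ (m + n + 1)) * indicator {0<..1} s \<partial>lborel"
  let ?g = "\<lambda>t q. cone_fun F t 0 (q\<^sup>2) * ennreal (sqrt (t\<^sup>2 + q\<^sup>2) ^ m * q ^ n)"
  have "(\<integral>\<^sup>+q. (\<integral>\<^sup>+t. ?g t q \<partial>lborel) * indicator {0<..} q \<partial>lborel) =
    (\<integral>\<^sup>+x. (\<integral>\<^sup>+s. ?g (s * sin x) (s * cos x) * ennreal s * indicator {0<..} s \<partial>lborel)
        * indicator {-(pi/2)<..<pi/2} x \<partial>lborel)"
    by (rule nn_integral_half_plane_polar[where g = ?g]) measurable
  also have "\<dots> = (\<integral>\<^sup>+x. ?c * (ennreal (cos x ^ n) * F (sin x, \<bar>sin x\<bar>) * indicator {-(pi/2)<..<pi/2} x) \<partial>lborel)"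
  proof (rule nn_integral_cong)
    fix x :: real
    show "(\<integral>\<^sup>+s. ?g (s * sin x) (s * cos x) * ennreal s * indicator {0<..} s \<partial>lborel) * indicator {-(pi/2)<..<pi/2} x
      = ?c * (ennreal (cos x ^ n) * F (sin x, \<bar>sin x\<bar>) * indicator {-(pi/2)<..<pi/2} x)"
    proof (cases "x \<in> {-(pi/2)<..<pi/2}")
      case True
      then have c: "cos x > 0" by (intro cos_gt_zero_pi) auto
      have "?g (s * sin x) (s * cos x) * ennreal s * indicator {0<..} s =
        ennreal (s ^ (m + n + 1)) * indicator {0<..1} s * (ennreal (cos x ^ n) * F (sin x, \<bar>sin x\<bar>))" for s
      proof (cases "s > 0")
        case s: True
        have "(s * sin x)\<^sup>2 + (s * cos x)\<^sup>2 = s\<^sup>2 * ((sin x)\<^sup>2 + (cos x)\<^sup>2)"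
          by (simp only: power_mult_distrib distrib_left)
        then have e: "(s * sin x)\<^sup>2 + (s * cos x)\<^sup>2 = s\<^sup>2" by simp
        have cf: "cone_fun F (s * sin x) 0 ((s * cos x)\<^sup>2) = F (sin x, \<bar>sin x\<bar>) * indicator {..1} s"
          unfolding cone_fun_def add_0_right e using s by (simp add: abs_mult)
        have "ennreal (sqrt (s\<^sup>2) ^ m * (s * cos x) ^ n) * ennreal s = ennreal (s ^ (m + n + 1)) * ennreal (cos x ^ n)"
          using s c by (simp add: ennreal_mult[symmetric] power_mult_distrib power_add mult_ac)
        moreover have "indicator {..1} s = (indicator {0<..1} s :: ennreal)" using s by (auto split: split_indicator)
        ultimately show ?thesis unfolding cf e using s
          by (simp add: mult.assoc mult.left_commute) (metis mult.assoc mult.left_commute mult.commute)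
      qed simp
      then have "(\<integral>\<^sup>+s. ?g (s * sin x) (s * cos x) * ennreal s * indicator {0<..} s \<partial>lborel)
        = (\<integral>\<^sup>+s. ennreal (s ^ (m + n + 1)) * indicator {0<..1} s * (ennreal (cos x ^ n) * F (sin x, \<bar>sin x\<bar>)) \<partial>lborel)"
        by (simp only:)
      also have "\<dots> = ?c * (ennreal (cos x ^ n) * F (sin x, \<bar>sin x\<bar>))"
        by (rule nn_integral_multc) measurable
      finally show ?thesis using True by simp
    qed simp
  qed
  also have "\<dots> = ?c * (\<integral>\<^sup>+x. ennreal (cos x ^ n) * F (sin x, \<bar>sin x\<bar>) * indicator {-(pi/2)<..<pi/2} x \<partial>lborel)"
    by (rule nn_integral_cmult) measurable
  finally show ?thesis .
qed

text \<open>
  The substitution \<open>r = sin x\<close> on each half of the arc.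
\<close>

lemma nn_integral_symmetric_arc:
  fixes F :: "real \<times> real \<Rightarrow> ennreal"
  assumes [measurable]: "F \<in> borel_measurable (borel \<Otimes>\<^sub>M borel)" and N: "N > 0"
  shows "(\<integral>\<^sup>+x. ennreal (cos x ^ (N - 1)) * F (sin x, \<bar>sin x\<bar>) * indicator {-(pi/2)<..<pi/2} x \<partial>lborel) =
    (\<integral>\<^sup>+r. ennreal ((1 - r\<^sup>2) powr (real N / 2 - 1)) * (F (r, r) + F (- r, r)) * indicator {0..1} r \<partial>lborel)"
proof -
  let ?f = "\<lambda>x. ennreal (cos x ^ (N - 1)) * F (sin x, \<bar>sin x\<bar>)"
  have "(\<integral>\<^sup>+x. ?f x * indicator {-(pi/2)<..<pi/2} x \<partial>lborel) =
    (\<integral>\<^sup>+x. ?f x * indicator {0<..<pi/2} x + ?f x * indicator {-(pi/2)<..<0} x \<partial>lborel)"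
    by (intro nn_integral_cong_AE AE_I[of _ _ "{0}"]) (auto split: split_indicator)
  also have "\<dots> = (\<integral>\<^sup>+x. ?f x * indicator {0<..<pi/2} x \<partial>lborel) + (\<integral>\<^sup>+x. ?f x * indicator {-(pi/2)<..<0} x \<partial>lborel)"
    by (rule nn_integral_add) measurable
  also have "(\<integral>\<^sup>+x. ?f x * indicator {-(pi/2)<..<0} x \<partial>lborel) = (\<integral>\<^sup>+x. ?f (-x) * indicator {0<..<pi/2} x \<partial>lborel)"
  proof -
    have "(\<integral>\<^sup>+x. ?f x * indicator {-(pi/2)<..<0} x \<partial>lborel) = ennreal \<bar>-1\<bar> * (\<integral>\<^sup>+x. ?f (0 + (-1) * x) * indicator {-(pi/2)<..<0} (0 + (-1) * x) \<partial>lborel)"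
      by (rule nn_integral_real_affine[where f = "\<lambda>x. ?f x * indicator {-(pi/2)<..<0} x"]) simp_all
    also have "\<dots> = (\<integral>\<^sup>+x. ?f (-x) * indicator {0<..<pi/2} x \<partial>lborel)"
      by (auto intro!: nn_integral_cong split: split_indicator)
    finally show ?thesis .
  qed
  also have "(\<integral>\<^sup>+x. ?f x * indicator {0<..<pi/2} x \<partial>lborel) + (\<integral>\<^sup>+x. ?f (-x) * indicator {0<..<pi/2} x \<partial>lborel)
    = (\<integral>\<^sup>+x. ?f x * indicator {0<..<pi/2} x + ?f (-x) * indicator {0<..<pi/2} x \<partial>lborel)"
    by (rule nn_integral_add[symmetric]) measurable
  also have "\<dots> = (\<integral>\<^sup>+x. ennreal (cos x ^ (N - 1)) * (F (sin x, sin x) + F (- sin x, sin x)) * indicator {0<..<pi/2} x \<partial>lborel)"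
  proof (rule nn_integral_cong)
    fix x :: real
    show "?f x * indicator {0<..<pi/2} x + ?f (-x) * indicator {0<..<pi/2} x =
      ennreal (cos x ^ (N - 1)) * (F (sin x, sin x) + F (- sin x, sin x)) * indicator {0<..<pi/2} x"
    proof (cases "x \<in> {0<..<pi/2}")
      case True
      then have "sin x > 0" by (intro sin_gt_zero) auto
      then show ?thesis using True by (simp add: distrib_left)
    qed simp
  qed
  also have "\<dots> = (\<integral>\<^sup>+r. ennreal ((1 - r\<^sup>2) powr (real N / 2 - 1)) * (F (r, r) + F (- r, r)) * indicator {0..1} r \<partial>lborel)"
    by (rule nn_integral_sin_substitution[where g = "\<lambda>r. F (r, r) + F (- r, r)", OF _ N]) measurable
  finally show ?thesis .
qed

text \<open>
  Two functionals that are multiples of the same functional and agree on one element where they are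
  equal to 1 coincide. This identifies normalising constants without evaluating them.
\<close>

lemma proportional_functionals_eq:
  fixes a b :: ennreal
  assumes "\<And>F. F \<in> S \<Longrightarrow> L F = a * X F" "\<And>F. F \<in> S \<Longrightarrow> R F = b * X F" "E \<in> S" "L E = 1" "R E = 1" "F \<in> S"
  shows "L F = R F"
proof -
  have "a * X E = 1" "b * X E = 1" using assms by metis+
  then have "a = a * (b * X E)" "b = b * (a * X E)" by simp_all
  then have "a = b" by (metis mult.assoc mult.commute)
  then show ?thesis using assms by simp
qed

text \<open>
  A coordinate of a uniform point of the sphere has density proportional to
  \<open>(1 - y\<^sup>2) powr (N/2 - 3/2)\<close> for \<open>N = card A\<close>. Writing \<open>y = r cos \<phi>\<close> with \<open>\<phi>\<close> equal to 0 or
  \<open>\<pi>\<close> gives the degenerate case of the measure.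
\<close>

lemma nn_integral_sphere_meas_marginal_line:
  fixes A :: "'a::euclidean_space set" and F :: "real \<times> real \<Rightarrow> ennreal"
  assumes A: "A \<subseteq> Basis" "b \<in> A" and ne: "A - {b} \<noteq> {}"
   and F: "F \<in> borel_measurable (borel \<Otimes>\<^sub>M borel)"
  shows "(\<integral>\<^sup>+\<theta>. F (\<theta> \<bullet> b, norm (coord_proj {b} \<theta>)) \<partial>sphere_meas A) =
    (\<integral>\<^sup>+(r, \<phi>). F (r * cos \<phi>, r) \<partial>m_meas (real (card A) / 2 - 1) (- 1/2))"
proof -
  interpret product_sigma_finite "\<lambda>_::'a. lborel :: real measure" ..
  have fin: "finite A" by (rule finite_subset[OF A(1) finite_Basis])
  define N where "N = card (A - {b})"
  have N: "N > 0" using ne fin by (simp add: N_def card_gt_0_iff)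
  have cA: "card A = N + 1" using fin A(2) N by (simp add: N_def)
  obtain c where c: "\<And>f. f \<in> borel_measurable (borel \<Otimes>\<^sub>M borel) \<Longrightarrow>
    (\<integral>\<^sup>+\<theta>. f (\<theta> \<bullet> b, norm (coord_proj {b} \<theta>)) \<partial>sphere_meas A) =
    c * (\<integral>\<^sup>+y. (\<integral>\<^sup>+u. (\<integral>\<^sup>+q. cone_fun f y (\<Sum>i\<in>{b}-{b}. (u i)\<^sup>2) (q\<^sup>2) * ennreal (q ^ (card (A - {b}) - 1)) * indicator {0<..} q \<partial>lborel)
       \<partial>Pi\<^sub>M ({b} - {b}) (\<lambda>_. lborel)) \<partial>lborel)"
    using nn_integral_sphere_meas_split[OF A(1), of "{b}" b] A(2) ne by auto
  define X where "X F = (\<integral>\<^sup>+r. ennreal ((1 - r\<^sup>2) powr (real N / 2 - 1)) * (F (r, r) + F (- r, r)) * indicator {0..1} r \<partial>lborel)" for F :: "real \<times> real \<Rightarrow> ennreal"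
  define c3 where "c3 = (\<integral>\<^sup>+s. ennreal (s ^ (0 + (N - 1) + 1)) * indicator {0<..1} s \<partial>lborel)"
  show ?thesis
  proof (rule proportional_functionals_eq[where S = "borel_measurable (borel \<Otimes>\<^sub>M borel)" and E = "\<lambda>_. 1" and a = "c * c3" and X = X
        and b = "ennreal (2 / Beta (1/2) (real (card A) / 2 - 1 + 1/2)) * inverse 2"
        and L = "\<lambda>F. (\<integral>\<^sup>+\<theta>. F (\<theta> \<bullet> b, norm (coord_proj {b} \<theta>)) \<partial>sphere_meas A)"
        and R = "\<lambda>F. (\<integral>\<^sup>+(r, \<phi>). F (r * cos \<phi>, r) \<partial>m_meas (real (card A) / 2 - 1) (- 1/2))"])
    fix F :: "real \<times> real \<Rightarrow> ennreal" assume [measurable]: "F \<in> borel_measurable (borel \<Otimes>\<^sub>M borel)"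
    have "(\<integral>\<^sup>+\<theta>. F (\<theta> \<bullet> b, norm (coord_proj {b} \<theta>)) \<partial>sphere_meas A) =
      c * (\<integral>\<^sup>+y. (\<integral>\<^sup>+q. cone_fun F y 0 (q\<^sup>2) * ennreal (q ^ (N - 1)) * indicator {0<..} q \<partial>lborel) \<partial>lborel)"
      by (subst c) (simp_all add: N_def nn_integral_empty space_PiM_empty)
    also have "(\<integral>\<^sup>+y. (\<integral>\<^sup>+q. cone_fun F y 0 (q\<^sup>2) * ennreal (q ^ (N - 1)) * indicator {0<..} q \<partial>lborel) \<partial>lborel)
      = (\<integral>\<^sup>+q. (\<integral>\<^sup>+y. cone_fun F y 0 (q\<^sup>2) * ennreal (q ^ (N - 1)) * indicator {0<..} q \<partial>lborel) \<partial>lborel)"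
      by (rule lborel_pair.Fubini') measurable
    also have "\<dots> = (\<integral>\<^sup>+q. (\<integral>\<^sup>+y. cone_fun F y 0 (q\<^sup>2) * ennreal (sqrt (y\<^sup>2 + q\<^sup>2) ^ 0 * q ^ (N - 1)) \<partial>lborel) * indicator {0<..} q \<partial>lborel)"
      unfolding power_0 mult_1_left by (intro nn_integral_cong nn_integral_multc) measurable
    also have "\<dots> = c3 * (\<integral>\<^sup>+x. ennreal (cos x ^ (N - 1)) * F (sin x, \<bar>sin x\<bar>) * indicator {-(pi/2)<..<pi/2} x \<partial>lborel)"
      unfolding c3_def by (rule nn_integral_cone_fun_half_plane) measurable
    also have "(\<integral>\<^sup>+x. ennreal (cos x ^ (N - 1)) * F (sin x, \<bar>sin x\<bar>) * indicator {-(pi/2)<..<pi/2} x \<partial>lborel) = X F"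
      unfolding X_def by (rule nn_integral_symmetric_arc[OF _ N]) measurable
    finally show "(\<integral>\<^sup>+\<theta>. F (\<theta> \<bullet> b, norm (coord_proj {b} \<theta>)) \<partial>sphere_meas A) = c * c3 * X F"
      by (simp only: mult.assoc)
    have "(\<integral>\<^sup>+(r, \<phi>). F (r * cos \<phi>, r) \<partial>m_meas (real (card A) / 2 - 1) (- 1/2)) =
      ennreal (2 / Beta (1/2) (real (card A) / 2 - 1 + 1/2)) * (\<integral>\<^sup>+r. ennreal ((1 - r\<^sup>2) powr (real (card A) / 2 - 1 - 1/2)) * indicator {0..1} r *
      ((F (r * cos 0, r) + F (r * cos pi, r)) / 2) \<partial>lborel)"
      by (rule nn_integral_m_meas_real[where f = "\<lambda>r \<phi>. F (r * cos \<phi>, r)"]) (measurable, use N in \<open>simp add: cA\<close>)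
    also have "(\<integral>\<^sup>+r. ennreal ((1 - r\<^sup>2) powr (real (card A) / 2 - 1 - 1/2)) * indicator {0..1} r *
      ((F (r * cos 0, r) + F (r * cos pi, r)) / 2) \<partial>lborel) = 
      (\<integral>\<^sup>+r. ennreal ((1 - r\<^sup>2) powr (real N / 2 - 1)) * (F (r, r) + F (- r, r)) * indicator {0..1} r * inverse 2 \<partial>lborel)"
      unfolding divide_ennreal_def
      by (intro nn_integral_cong) (simp add: cA mult_ac add_divide_distrib)
    also have "\<dots> = X F * inverse 2"
      unfolding X_def by (rule nn_integral_multc) measurable
    finally show "(\<integral>\<^sup>+(r, \<phi>). F (r * cos \<phi>, r) \<partial>m_meas (real (card A) / 2 - 1) (- 1/2)) =
      ennreal (2 / Beta (1/2) (real (card A) / 2 - 1 + 1/2)) * inverse 2 * X F"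
      by (simp only: mult.assoc mult.commute mult.left_commute)
  next
    interpret s: prob_space "sphere_meas A" by (rule prob_space_sphere_meas[OF A(1)])
    show "(\<integral>\<^sup>+\<theta>. 1 \<partial>sphere_meas A) = 1" using s.emeasure_space_1 by simp
    interpret m: prob_space "m_meas (real (card A) / 2 - 1) (- 1/2)" by (rule prob_space_m_meas) (use N cA in auto)
    show "(\<integral>\<^sup>+(r, \<phi>). 1 \<partial>m_meas (real (card A) / 2 - 1) (- 1/2)) = 1" using m.emeasure_space_1 by (simp add: case_prod_beta')
  qed (use F in simp_all)
qed

text \<open>
  For a block \<open>A1\<close> of at least two coordinates, \<open>r\<close> is the length of the projection to the block
  and \<open>\<phi>\<close> the angle between the projection and the direction \<open>b\<close>. Two changes to polar
  coordinates, first inside the block and then between the block and its complement, produce the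
  weights \<open>(sin \<phi>)^(m - 2)\<close> and \<open>r^(m - 1) (1 - r\<^sup>2) powr ((N - m)/2 - 1)\<close> for \<open>m = card A1\<close>.
\<close>

lemma nn_integral_sphere_meas_marginal_higher:
  fixes A :: "'a::euclidean_space set" and F :: "real \<times> real \<Rightarrow> ennreal"
  assumes A: "A \<subseteq> Basis" "A1 \<subseteq> A" "b \<in> A1" and ne: "A - A1 \<noteq> {}" and d: "card A1 \<ge> 2"
   and F: "F \<in> borel_measurable (borel \<Otimes>\<^sub>M borel)"
  shows "(\<integral>\<^sup>+\<theta>. F (\<theta> \<bullet> b, norm (coord_proj A1 \<theta>)) \<partial>sphere_meas A) =
    (\<integral>\<^sup>+(r, \<phi>). F (r * cos \<phi>, r) \<partial>m_meas (real (card A) / 2 - 1) (real (card A1) / 2 - 1))"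
proof -
  interpret product_sigma_finite "\<lambda>_::'a. lborel :: real measure" ..
  have fin: "finite A" by (rule finite_subset[OF A(1) finite_Basis])
  have fin1: "finite A1" by (rule finite_subset[OF A(2) fin])
  define N where "N = card (A - A1)"
  define d where "d = card A1"
  have d2: "d \<ge> 2" using d by (simp add: d_def)
  have N: "N > 0" using ne fin by (simp add: N_def card_gt_0_iff)
  have cA: "card A = d + N" using card_Diff_subset[OF fin1 A(2)] card_mono[OF fin A(2)] by (simp add: N_def d_def)
  have cA1: "card (A1 - {b}) = d - 1" using fin1 A(3) by (simp add: d_def)
  have A1b: "finite (A1 - {b})" "A1 - {b} \<noteq> {}"
  proof -
    show "finite (A1 - {b})" using fin1 by simp
    have "card (A1 - {b}) > 0" unfolding cA1 using d2 by simp
    then show "A1 - {b} \<noteq> {}" by (metis card.empty less_irrefl)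
  qed
  obtain c where c: "\<And>f. f \<in> borel_measurable (borel \<Otimes>\<^sub>M borel) \<Longrightarrow>
    (\<integral>\<^sup>+\<theta>. f (\<theta> \<bullet> b, norm (coord_proj A1 \<theta>)) \<partial>sphere_meas A) =
    c * (\<integral>\<^sup>+y. (\<integral>\<^sup>+u. (\<integral>\<^sup>+q. cone_fun f y (\<Sum>i\<in>A1-{b}. (u i)\<^sup>2) (q\<^sup>2) * ennreal (q ^ (card (A - A1) - 1)) * indicator {0<..} q \<partial>lborel)
       \<partial>Pi\<^sub>M (A1 - {b}) (\<lambda>_. lborel)) \<partial>lborel)"
    using nn_integral_sphere_meas_split[OF A ne] by blast
  define X where "X F = (\<integral>\<^sup>+r. ennreal ((1 - r\<^sup>2) powr (real N / 2 - 1) * r ^ (d - 1)) * indicator {0..1} r *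
      (\<integral>\<^sup>+x. ennreal (cos x ^ (d - 2)) * F (r * sin x, r) * indicator {-(pi/2)<..<pi/2} x \<partial>lborel) \<partial>lborel)" for F :: "real \<times> real \<Rightarrow> ennreal"
  define c3 where "c3 = (\<integral>\<^sup>+s. ennreal (s ^ ((d - 1) + (N - 1) + 1)) * indicator {0<..1} s \<partial>lborel)"
  define k1 where "k1 = ennreal (unit_ball_vol (card (A1 - {b})) * card (A1 - {b}))"
  show ?thesis
  proof (rule proportional_functionals_eq[where S = "borel_measurable (borel \<Otimes>\<^sub>M borel)" and E = "\<lambda>_. 1" and a = "c * (k1 * c3)" and X = X
        and b = "ennreal (m_const (real (card A) / 2 - 1) (real (card A1) / 2 - 1))"
        and L = "\<lambda>F. (\<integral>\<^sup>+\<theta>. F (\<theta> \<bullet> b, norm (coord_proj A1 \<theta>)) \<partial>sphere_meas A)"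
        and R = "\<lambda>F. (\<integral>\<^sup>+(r, \<phi>). F (r * cos \<phi>, r) \<partial>m_meas (real (card A) / 2 - 1) (real (card A1) / 2 - 1))"])
    fix F :: "real \<times> real \<Rightarrow> ennreal" assume [measurable]: "F \<in> borel_measurable (borel \<Otimes>\<^sub>M borel)"
    let ?H = "\<lambda>y p. (\<integral>\<^sup>+q. cone_fun F y (p\<^sup>2) (q\<^sup>2) * ennreal (q ^ (N - 1)) * indicator {0<..} q \<partial>lborel)"
    have "(\<integral>\<^sup>+\<theta>. F (\<theta> \<bullet> b, norm (coord_proj A1 \<theta>)) \<partial>sphere_meas A) =
      c * (\<integral>\<^sup>+y. (\<integral>\<^sup>+u. ?H y (sqrt (\<Sum>i\<in>A1-{b}. (u i)\<^sup>2)) \<partial>Pi\<^sub>M (A1 - {b}) (\<lambda>_. lborel)) \<partial>lborel)"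
      by (subst c) (simp_all add: N_def sum_nonneg)
    also have "(\<integral>\<^sup>+y. (\<integral>\<^sup>+u. ?H y (sqrt (\<Sum>i\<in>A1-{b}. (u i)\<^sup>2)) \<partial>Pi\<^sub>M (A1 - {b}) (\<lambda>_. lborel)) \<partial>lborel) =
      (\<integral>\<^sup>+y. k1 * (\<integral>\<^sup>+p. ?H y p * ennreal (p ^ (d - 2)) * indicator {0<..} p \<partial>lborel) \<partial>lborel)"
    proof (rule nn_integral_cong)
      fix y :: real
      have "(\<integral>\<^sup>+u. ?H y (sqrt (\<Sum>i\<in>A1-{b}. (u i)\<^sup>2)) \<partial>Pi\<^sub>M (A1 - {b}) (\<lambda>_. lborel)) =
        k1 * (\<integral>\<^sup>+p. ?H y p * ennreal (p ^ (card (A1 - {b}) - 1)) * indicator {0<..} p \<partial>lborel)"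
        unfolding k1_def by (rule nn_integral_radial[where g = "?H y", OF A1b]) measurable
      moreover have "card (A1 - {b}) - 1 = d - 2" unfolding cA1 by simp
      ultimately show "(\<integral>\<^sup>+u. ?H y (sqrt (\<Sum>i\<in>A1-{b}. (u i)\<^sup>2)) \<partial>Pi\<^sub>M (A1 - {b}) (\<lambda>_. lborel)) =
        k1 * (\<integral>\<^sup>+p. ?H y p * ennreal (p ^ (d - 2)) * indicator {0<..} p \<partial>lborel)" by (simp only:)
    qed
    also have "\<dots> = k1 * (\<integral>\<^sup>+y. (\<integral>\<^sup>+p. ?H y p * ennreal (p ^ (d - 2)) * indicator {0<..} p \<partial>lborel) \<partial>lborel)"
      by (rule nn_integral_cmult) measurable
    also have "(\<integral>\<^sup>+y. (\<integral>\<^sup>+p. ?H y p * ennreal (p ^ (d - 2)) * indicator {0<..} p \<partial>lborel) \<partial>lborel) =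
      (\<integral>\<^sup>+p. (\<integral>\<^sup>+y. ?H y p * ennreal (p ^ (d - 2)) * indicator {0<..} p \<partial>lborel) \<partial>lborel)"
      by (rule lborel_pair.Fubini') measurable
    also have "\<dots> = (\<integral>\<^sup>+p. (\<integral>\<^sup>+y. ?H y p * ennreal (p ^ (d - 2)) \<partial>lborel) * indicator {0<..} p \<partial>lborel)"
      by (intro nn_integral_cong nn_integral_multc) measurable
    also have "\<dots> = (\<integral>\<^sup>+x. (\<integral>\<^sup>+s. ?H (s * sin x) (s * cos x) * ennreal ((s * cos x) ^ (d - 2)) * ennreal s * indicator {0<..} s \<partial>lborel)
        * indicator {-(pi/2)<..<pi/2} x \<partial>lborel)"
      by (rule nn_integral_half_plane_polar[where g = "\<lambda>y p. ?H y p * ennreal (p ^ (d - 2))"]) measurable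
    also have "\<dots> = (\<integral>\<^sup>+x. c3 * (\<integral>\<^sup>+r. ennreal ((1 - r\<^sup>2) powr (real N / 2 - 1) * r ^ (d - 1)) * indicator {0..1} r *
       (ennreal (cos x ^ (d - 2)) * F (r * sin x, r) * indicator {-(pi/2)<..<pi/2} x) \<partial>lborel) \<partial>lborel)"
    proof (rule nn_integral_cong)
      fix x :: real
      show "(\<integral>\<^sup>+s. ?H (s * sin x) (s * cos x) * ennreal ((s * cos x) ^ (d - 2)) * ennreal s * indicator {0<..} s \<partial>lborel)
        * indicator {-(pi/2)<..<pi/2} x = c3 * (\<integral>\<^sup>+r. ennreal ((1 - r\<^sup>2) powr (real N / 2 - 1) * r ^ (d - 1)) * indicator {0..1} r *
       (ennreal (cos x ^ (d - 2)) * F (r * sin x, r) * indicator {-(pi/2)<..<pi/2} x) \<partial>lborel)"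
      proof (cases "x \<in> {-(pi/2)<..<pi/2}")
        case True
        then have cx: "cos x > 0" by (intro cos_gt_zero_pi) auto
        define G where "G = (\<lambda>(a, b'::real). F (a * sin x, a) * ennreal (a ^ (d - 1)) * indicator {0<..} a)"
        have [measurable]: "G \<in> borel_measurable (borel \<Otimes>\<^sub>M borel)" unfolding G_def by measurable
        have 1: "?H (s * sin x) (s * cos x) * ennreal ((s * cos x) ^ (d - 2)) * ennreal s * indicator {0<..} s
          = ennreal (cos x ^ (d - 2)) * (\<integral>\<^sup>+q. cone_fun G s 0 (q\<^sup>2) * ennreal (sqrt (s\<^sup>2 + q\<^sup>2) ^ (d - 1) * q ^ (N - 1)) * indicator {0<..} q \<partial>lborel)" for s :: real
        proof (cases "s > 0")
          case s: True
          have "(s * sin x)\<^sup>2 + (s * cos x)\<^sup>2 = s\<^sup>2 * ((sin x)\<^sup>2 + (cos x)\<^sup>2)"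
            by (simp only: power_mult_distrib distrib_left)
          then have e: "(s * sin x)\<^sup>2 + (s * cos x)\<^sup>2 = s\<^sup>2" by simp
          have cf: "cone_fun G s 0 (q\<^sup>2) * ennreal (sqrt (s\<^sup>2 + q\<^sup>2) ^ (d - 1) * q ^ (N - 1)) =
             cone_fun F (s * sin x) ((s * cos x)\<^sup>2) (q\<^sup>2) * ennreal (q ^ (N - 1)) * ennreal (s ^ (d - 1))" if "q > 0" for q
          proof -
            have p: "sqrt (s\<^sup>2 + q\<^sup>2) > 0" using s by (simp add: add_pos_nonneg)
            have "ennreal ((s / sqrt (s\<^sup>2 + q\<^sup>2)) ^ (d - 1)) * ennreal (sqrt (s\<^sup>2 + q\<^sup>2) ^ (d - 1) * q ^ (N - 1)) = ennreal (s ^ (d - 1) * q ^ (N - 1))"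
              using s p that by (subst ennreal_mult[symmetric]) (simp_all add: power_divide)
            also have "\<dots> = ennreal (q ^ (N - 1)) * ennreal (s ^ (d - 1))" using s that by (subst mult.commute, intro ennreal_mult) simp_all
            finally have *: "ennreal ((s / sqrt (s\<^sup>2 + q\<^sup>2)) ^ (d - 1)) * ennreal (sqrt (s\<^sup>2 + q\<^sup>2) ^ (d - 1) * q ^ (N - 1)) = ennreal (q ^ (N - 1)) * ennreal (s ^ (d - 1))" .
            have 3: "cone_fun G s 0 (q\<^sup>2) = F (s * sin x / sqrt (s\<^sup>2 + q\<^sup>2), s / sqrt (s\<^sup>2 + q\<^sup>2)) * ennreal ((s / sqrt (s\<^sup>2 + q\<^sup>2)) ^ (d - 1)) * indicator {..1} (sqrt (s\<^sup>2 + q\<^sup>2))"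
              using s p by (simp add: cone_fun_def G_def)
            have 4: "cone_fun F (s * sin x) ((s * cos x)\<^sup>2) (q\<^sup>2) = F (s * sin x / sqrt (s\<^sup>2 + q\<^sup>2), s / sqrt (s\<^sup>2 + q\<^sup>2)) * indicator {..1} (sqrt (s\<^sup>2 + q\<^sup>2))"
              unfolding cone_fun_def e using s by simp
            have "cone_fun G s 0 (q\<^sup>2) * ennreal (sqrt (s\<^sup>2 + q\<^sup>2) ^ (d - 1) * q ^ (N - 1)) = 
              F (s * sin x / sqrt (s\<^sup>2 + q\<^sup>2), s / sqrt (s\<^sup>2 + q\<^sup>2)) * indicator {..1} (sqrt (s\<^sup>2 + q\<^sup>2)) *
              (ennreal ((s / sqrt (s\<^sup>2 + q\<^sup>2)) ^ (d - 1)) * ennreal (sqrt (s\<^sup>2 + q\<^sup>2) ^ (d - 1) * q ^ (N - 1)))"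
              unfolding 3 by (simp only: mult_ac)
            then show ?thesis unfolding * 4 by (simp only: mult_ac)
          qed
          have "(\<integral>\<^sup>+q. cone_fun G s 0 (q\<^sup>2) * ennreal (sqrt (s\<^sup>2 + q\<^sup>2) ^ (d - 1) * q ^ (N - 1)) * indicator {0<..} q \<partial>lborel)
            = (\<integral>\<^sup>+q. cone_fun F (s * sin x) ((s * cos x)\<^sup>2) (q\<^sup>2) * ennreal (q ^ (N - 1)) * indicator {0<..} q * ennreal (s ^ (d - 1)) \<partial>lborel)"
          proof (rule nn_integral_cong)
            fix q :: real
            show "cone_fun G s 0 (q\<^sup>2) * ennreal (sqrt (s\<^sup>2 + q\<^sup>2) ^ (d - 1) * q ^ (N - 1)) * indicator {0<..} q =
              cone_fun F (s * sin x) ((s * cos x)\<^sup>2) (q\<^sup>2) * ennreal (q ^ (N - 1)) * indicator {0<..} q * ennreal (s ^ (d - 1))"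
            proof (cases "q > 0")
              case True show ?thesis unfolding cf[OF True] using True by simp
            qed simp
          qed
          also have "\<dots> = ?H (s * sin x) (s * cos x) * ennreal (s ^ (d - 1))"
            by (rule nn_integral_multc) measurable
          finally have 2: "(\<integral>\<^sup>+q. cone_fun G s 0 (q\<^sup>2) * ennreal (sqrt (s\<^sup>2 + q\<^sup>2) ^ (d - 1) * q ^ (N - 1)) * indicator {0<..} q \<partial>lborel) = \<dots>" .
          have "d - 1 = Suc (d - 2)" using d2 by simp
          then have "(s * cos x) ^ (d - 2) * s = cos x ^ (d - 2) * s ^ (d - 1)" by (simp add: power_mult_distrib)
          then have 5: "ennreal ((s * cos x) ^ (d - 2)) * ennreal s = ennreal (cos x ^ (d - 2)) * ennreal (s ^ (d - 1))"
            using s cx by (subst (1 2) ennreal_mult[symmetric]) simp_all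
          have "indicator {0<..} s = (1::ennreal)" using s by simp
          then show ?thesis unfolding 2 by (simp only: mult_1_right mult.assoc 5) (simp only: mult_ac)
        next
          case False
          then have z: "cone_fun G s 0 (q\<^sup>2) = 0" if "q > 0" for q
          proof -
            have "sqrt (s\<^sup>2 + q\<^sup>2) > 0" using that by (simp add: add_nonneg_pos)
            then have "\<not> s / sqrt (s\<^sup>2 + q\<^sup>2) > 0" using False by (simp add: zero_less_divide_iff)
            then show ?thesis by (simp add: cone_fun_def G_def)
          qed
          have "(\<integral>\<^sup>+q. cone_fun G s 0 (q\<^sup>2) * ennreal (sqrt (s\<^sup>2 + q\<^sup>2) ^ (d - 1) * q ^ (N - 1)) * indicator {0<..} q \<partial>lborel) = integral\<^sup>N lborel (\<lambda>q::real. 0)"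
          proof (rule nn_integral_cong)
            fix q :: real
            show "cone_fun G s 0 (q\<^sup>2) * ennreal (sqrt (s\<^sup>2 + q\<^sup>2) ^ (d - 1) * q ^ (N - 1)) * indicator {0<..} q = 0"
              using z[of q] by (cases "q > 0") simp_all
          qed
          then show ?thesis using False by simp
        qed
        have "(\<integral>\<^sup>+s. ?H (s * sin x) (s * cos x) * ennreal ((s * cos x) ^ (d - 2)) * ennreal s * indicator {0<..} s \<partial>lborel)
          = ennreal (cos x ^ (d - 2)) * (\<integral>\<^sup>+s. (\<integral>\<^sup>+q. cone_fun G s 0 (q\<^sup>2) * ennreal (sqrt (s\<^sup>2 + q\<^sup>2) ^ (d - 1) * q ^ (N - 1)) * indicator {0<..} q \<partial>lborel) \<partial>lborel)"
          unfolding 1 by (rule nn_integral_cmult) measurable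
        also have "(\<integral>\<^sup>+s. (\<integral>\<^sup>+q. cone_fun G s 0 (q\<^sup>2) * ennreal (sqrt (s\<^sup>2 + q\<^sup>2) ^ (d - 1) * q ^ (N - 1)) * indicator {0<..} q \<partial>lborel) \<partial>lborel)
          = (\<integral>\<^sup>+q. (\<integral>\<^sup>+s. cone_fun G s 0 (q\<^sup>2) * ennreal (sqrt (s\<^sup>2 + q\<^sup>2) ^ (d - 1) * q ^ (N - 1)) * indicator {0<..} q \<partial>lborel) \<partial>lborel)"
          by (rule lborel_pair.Fubini') measurable
        also have "\<dots> = (\<integral>\<^sup>+q. (\<integral>\<^sup>+s. cone_fun G s 0 (q\<^sup>2) * ennreal (sqrt (s\<^sup>2 + q\<^sup>2) ^ (d - 1) * q ^ (N - 1)) \<partial>lborel) * indicator {0<..} q \<partial>lborel)"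
          by (intro nn_integral_cong nn_integral_multc) measurable
        also have "\<dots> = c3 * (\<integral>\<^sup>+x. ennreal (cos x ^ (N - 1)) * G (sin x, \<bar>sin x\<bar>) * indicator {-(pi/2)<..<pi/2} x \<partial>lborel)"
          unfolding c3_def by (rule nn_integral_cone_fun_half_plane) measurable
        also have "(\<integral>\<^sup>+x. ennreal (cos x ^ (N - 1)) * G (sin x, \<bar>sin x\<bar>) * indicator {-(pi/2)<..<pi/2} x \<partial>lborel)
          = (\<integral>\<^sup>+z. ennreal (cos z ^ (N - 1)) * (F (sin z * sin x, sin z) * ennreal (sin z ^ (d - 1))) * indicator {0<..<pi/2} z \<partial>lborel)"
        proof (rule nn_integral_cong)
          fix z :: real
          consider "z \<in> {0<..<pi/2}" | "z \<in> {-(pi/2)<..0}" | "z \<notin> {-(pi/2)<..<pi/2}" by force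
          then show "ennreal (cos z ^ (N - 1)) * G (sin z, \<bar>sin z\<bar>) * indicator {-(pi/2)<..<pi/2} z =
            ennreal (cos z ^ (N - 1)) * (F (sin z * sin x, sin z) * ennreal (sin z ^ (d - 1))) * indicator {0<..<pi/2} z"
          proof cases
            case 1 then have "sin z > 0" by (intro sin_gt_zero) auto
            with 1 show ?thesis by (simp add: G_def)
          next
            case 2 then have "sin (-z) \<ge> 0" by (intro sin_ge_zero) auto
            with 2 show ?thesis by (simp add: G_def)
          qed auto
        qed
        also have "\<dots> = (\<integral>\<^sup>+r. ennreal ((1 - r\<^sup>2) powr (real N / 2 - 1)) * (F (r * sin x, r) * ennreal (r ^ (d - 1))) * indicator {0..1} r \<partial>lborel)"
          by (rule nn_integral_sin_substitution[where g = "\<lambda>r. F (r * sin x, r) * ennreal (r ^ (d - 1))", OF _ N]) measurable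
        finally have "(\<integral>\<^sup>+s. ?H (s * sin x) (s * cos x) * ennreal ((s * cos x) ^ (d - 2)) * ennreal s * indicator {0<..} s \<partial>lborel)
          = c3 * (ennreal (cos x ^ (d - 2)) * (\<integral>\<^sup>+r. ennreal ((1 - r\<^sup>2) powr (real N / 2 - 1)) * (F (r * sin x, r) * ennreal (r ^ (d - 1))) * indicator {0..1} r \<partial>lborel))"
          by (simp only: mult.left_commute)
        also have "ennreal (cos x ^ (d - 2)) * (\<integral>\<^sup>+r. ennreal ((1 - r\<^sup>2) powr (real N / 2 - 1)) * (F (r * sin x, r) * ennreal (r ^ (d - 1))) * indicator {0..1} r \<partial>lborel)
          = (\<integral>\<^sup>+r. ennreal (cos x ^ (d - 2)) * (ennreal ((1 - r\<^sup>2) powr (real N / 2 - 1)) * (F (r * sin x, r) * ennreal (r ^ (d - 1))) * indicator {0..1} r) \<partial>lborel)"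
          by (rule nn_integral_cmult[symmetric]) measurable
        also have "\<dots> = (\<integral>\<^sup>+r. ennreal ((1 - r\<^sup>2) powr (real N / 2 - 1) * r ^ (d - 1)) * indicator {0..1} r *
           (ennreal (cos x ^ (d - 2)) * F (r * sin x, r) * indicator {-(pi/2)<..<pi/2} x) \<partial>lborel)"
        proof (rule nn_integral_cong)
          fix r :: real
          have "ennreal ((1 - r\<^sup>2) powr (real N / 2 - 1) * r ^ (d - 1)) = ennreal ((1 - r\<^sup>2) powr (real N / 2 - 1)) * ennreal (r ^ (d - 1))"
            by (rule ennreal_mult') simp
          moreover have "indicator {-(pi/2)<..<pi/2} x = (1::ennreal)" using True by simp
          ultimately show "ennreal (cos x ^ (d - 2)) * (ennreal ((1 - r\<^sup>2) powr (real N / 2 - 1)) * (F (r * sin x, r) * ennreal (r ^ (d - 1))) * indicator {0..1} r)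
            = ennreal ((1 - r\<^sup>2) powr (real N / 2 - 1) * r ^ (d - 1)) * indicator {0..1} r *
           (ennreal (cos x ^ (d - 2)) * F (r * sin x, r) * indicator {-(pi/2)<..<pi/2} x)"
            by (simp only: mult_1_right) (simp only: mult_ac)
        qed
        finally have fe: "(\<integral>\<^sup>+s. ?H (s * sin x) (s * cos x) * ennreal ((s * cos x) ^ (d - 2)) * ennreal s * indicator {0<..} s \<partial>lborel) = c3 * \<dots>" .
        have "indicator {-(pi/2)<..<pi/2} x = (1::ennreal)" using True by simp
        then show ?thesis unfolding fe by (simp only: mult_1_right)
      qed simp
    qed
    also have "\<dots> = c3 * (\<integral>\<^sup>+x. (\<integral>\<^sup>+r. ennreal ((1 - r\<^sup>2) powr (real N / 2 - 1) * r ^ (d - 1)) * indicator {0..1} r *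
       (ennreal (cos x ^ (d - 2)) * F (r * sin x, r) * indicator {-(pi/2)<..<pi/2} x) \<partial>lborel) \<partial>lborel)"
      by (rule nn_integral_cmult) measurable
    also have "(\<integral>\<^sup>+x. (\<integral>\<^sup>+r. ennreal ((1 - r\<^sup>2) powr (real N / 2 - 1) * r ^ (d - 1)) * indicator {0..1} r *
       (ennreal (cos x ^ (d - 2)) * F (r * sin x, r) * indicator {-(pi/2)<..<pi/2} x) \<partial>lborel) \<partial>lborel) =
      (\<integral>\<^sup>+r. (\<integral>\<^sup>+x. ennreal ((1 - r\<^sup>2) powr (real N / 2 - 1) * r ^ (d - 1)) * indicator {0..1} r *
       (ennreal (cos x ^ (d - 2)) * F (r * sin x, r) * indicator {-(pi/2)<..<pi/2} x) \<partial>lborel) \<partial>lborel)"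
      by (rule lborel_pair.Fubini') measurable
    also have "\<dots> = X F"
      unfolding X_def by (intro nn_integral_cong nn_integral_cmult) measurable
    finally show "(\<integral>\<^sup>+\<theta>. F (\<theta> \<bullet> b, norm (coord_proj A1 \<theta>)) \<partial>sphere_meas A) = c * (k1 * c3) * X F"
      by (simp only: mult.assoc)
    let ?a = "real (card A) / 2 - 1" and ?b = "real (card A1) / 2 - 1"
    have "(\<integral>\<^sup>+(r, \<phi>). F (r * cos \<phi>, r) \<partial>m_meas ?a ?b) =
      ennreal (m_const ?a ?b) * (\<integral>\<^sup>+r. ennreal ((1 - r\<^sup>2) powr (?a - ?b - 1) * r powr (2 * ?b + 1)) * indicator {0..1} r *
      (\<integral>\<^sup>+\<phi>. ennreal (sin \<phi> powr (2 * ?b)) * F (r * cos \<phi>, r) * indicator {0..pi} \<phi> \<partial>lborel) \<partial>lborel)"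
      by (rule nn_integral_m_meas[where f = "\<lambda>r \<phi>. F (r * cos \<phi>, r)"]) (measurable, use d2 N in \<open>auto simp: cA d_def[symmetric]\<close>)
    also have "(\<integral>\<^sup>+r. ennreal ((1 - r\<^sup>2) powr (?a - ?b - 1) * r powr (2 * ?b + 1)) * indicator {0..1} r *
      (\<integral>\<^sup>+\<phi>. ennreal (sin \<phi> powr (2 * ?b)) * F (r * cos \<phi>, r) * indicator {0..pi} \<phi> \<partial>lborel) \<partial>lborel) = X F"
      unfolding X_def
    proof (rule nn_integral_cong_AE, rule AE_mp[OF AE_lborel_singleton[of "0::real"]], rule AE_I2, rule impI)
      fix r :: real assume r: "r \<noteq> 0"
      have "(\<integral>\<^sup>+\<phi>. ennreal (sin \<phi> powr (2 * ?b)) * F (r * cos \<phi>, r) * indicator {0..pi} \<phi> \<partial>lborel) =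
        (\<integral>\<^sup>+\<phi>. ennreal (sin \<phi> ^ (d - 2)) * F (r * cos \<phi>, r) * indicator {0<..<pi} \<phi> \<partial>lborel)"
      proof (rule nn_integral_cong_AE, rule AE_mp[OF AE_lborel_singleton[of "0::real"]], rule AE_mp[OF AE_lborel_singleton[of pi]], rule AE_I2, rule impI, rule impI)
        fix \<phi> :: real assume "\<phi> \<noteq> pi" "\<phi> \<noteq> 0"
        show "ennreal (sin \<phi> powr (2 * ?b)) * F (r * cos \<phi>, r) * indicator {0..pi} \<phi> = ennreal (sin \<phi> ^ (d - 2)) * F (r * cos \<phi>, r) * indicator {0<..<pi} \<phi>"
        proof (cases "\<phi> \<in> {0<..<pi}")
          case True
          then have "sin \<phi> > 0" by (intro sin_gt_zero) auto
          moreover have "2 * ?b = real (d - 2)" using d2 by (simp add: d_def[symmetric] of_nat_diff)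
          ultimately have "sin \<phi> powr (2 * ?b) = sin \<phi> ^ (d - 2)" by (simp only: powr_realpow)
          then show ?thesis using True by (simp only:) simp
        next
          case False
          then have "\<phi> \<notin> {0..pi}" using \<open>\<phi> \<noteq> 0\<close> \<open>\<phi> \<noteq> pi\<close> by auto
          then have "indicator {0..pi} \<phi> = (0::ennreal)" "indicator {0<..<pi} \<phi> = (0::ennreal)"
            using False by (simp_all only: indicator_simps not_False_eq_True)
          then show ?thesis by (simp only: mult_zero_right)
        qed
      qed
      also have "\<dots> = ennreal \<bar>-1\<bar> * (\<integral>\<^sup>+x. ennreal (sin (pi/2 + (-1) * x) ^ (d - 2)) * F (r * cos (pi/2 + (-1) * x), r) * indicator {0<..<pi} (pi/2 + (-1) * x) \<partial>lborel)"
        by (rule nn_integral_real_affine[where f = "\<lambda>\<phi>. ennreal (sin \<phi> ^ (d - 2)) * F (r * cos \<phi>, r) * indicator {0<..<pi} \<phi>"]) simp_all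
      also have "\<dots> = (\<integral>\<^sup>+x. ennreal (cos x ^ (d - 2)) * F (r * sin x, r) * indicator {-(pi/2)<..<pi/2} x \<partial>lborel)"
      proof -
        have "sin (pi/2 + (-1) * x) = cos x" "cos (pi/2 + (-1) * x) = sin x" 
          "indicator {0<..<pi} (pi/2 + (-1) * x) = (indicator {-(pi/2)<..<pi/2} x :: ennreal)" for x :: real
          by (auto simp: sin_diff cos_diff split: split_indicator)
        then show ?thesis by simp
      qed
      finally have I: "(\<integral>\<^sup>+\<phi>. ennreal (sin \<phi> powr (2 * ?b)) * F (r * cos \<phi>, r) * indicator {0..pi} \<phi> \<partial>lborel) = \<dots>" .
      show "ennreal ((1 - r\<^sup>2) powr (?a - ?b - 1) * r powr (2 * ?b + 1)) * indicator {0..1} r *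
          (\<integral>\<^sup>+\<phi>. ennreal (sin \<phi> powr (2 * ?b)) * F (r * cos \<phi>, r) * indicator {0..pi} \<phi> \<partial>lborel) =
        ennreal ((1 - r\<^sup>2) powr (real N / 2 - 1) * r ^ (d - 1)) * indicator {0..1} r *
          (\<integral>\<^sup>+x. ennreal (cos x ^ (d - 2)) * F (r * sin x, r) * indicator {-(pi/2)<..<pi/2} x \<partial>lborel)"
      proof (cases "r \<in> {0..1}")
        case True
        then have "r > 0" using r by auto
        moreover have "2 * ?b + 1 = real (d - 1)" using d2 by (simp add: d_def[symmetric] of_nat_diff)
        ultimately have "r powr (2 * ?b + 1) = r ^ (d - 1)" by (simp only: powr_realpow)
        moreover have "?a - ?b - 1 = real N / 2 - 1" by (simp add: cA d_def add_divide_distrib)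
        ultimately show ?thesis unfolding I by (simp only:)
      qed simp
    qed
    finally show "(\<integral>\<^sup>+(r, \<phi>). F (r * cos \<phi>, r) \<partial>m_meas ?a ?b) = ennreal (m_const ?a ?b) * X F" .
  next
    interpret s: prob_space "sphere_meas A" by (rule prob_space_sphere_meas[OF A(1)])
    show "(\<integral>\<^sup>+\<theta>. 1 \<partial>sphere_meas A) = 1" using s.emeasure_space_1 by simp
    interpret m: prob_space "m_meas (real (card A) / 2 - 1) (real (card A1) / 2 - 1)"
      by (rule prob_space_m_meas) (use N d2 cA in \<open>auto simp: d_def[symmetric]\<close>)
    show "(\<integral>\<^sup>+(r, \<phi>). 1 \<partial>m_meas (real (card A) / 2 - 1) (real (card A1) / 2 - 1)) = 1" using m.emeasure_space_1 by (simp add: case_prod_beta')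
  qed (use F in simp_all)
qed

section \<open>Quaternions as a normed division algebra\<close>

lemma inner_quat_mult: "inner (x * y) (x * y) = inner x x * inner y (y::quat)"
  by (simp add: inner_quat_def times_quat_def algebra_simps)

instantiation quat :: real_normed_div_algebra
begin

definition "inverse x = quat_cnj x /\<^sub>R inner x x"
definition "x div y = x * inverse (y :: quat)"

instance
proof
  fix x y :: quat
  show "norm (x * y) = norm x * norm y"
    by (simp add: norm_quat_def inner_quat_mult real_sqrt_mult)
  show "inverse 0 = (0 :: quat)"
    by (simp add: inverse_quat_def)
  show "x div y = x * inverse y" by (rule divide_quat_def)
  assume "x \<noteq> 0"
  then have "inner x x \<noteq> 0" by simp
  then show "inverse x * x = 1" "x * inverse x = 1"
    by (simp_all add: inverse_quat_def quat_eq_iff quat_cnj_def times_quat_def scaleR_quat_def one_quat_def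
        inner_quat_def divide_simps)
qed

end

section \<open>Form-preserving matrices over a field with involution\<close>

text \<open>
  Conjugation on the real numbers, the complex numbers or the quaternions. The matrix arguments that
  only use these laws are carried out once for all three.
\<close>

locale involution =
  fixes c :: "'f::{real_normed_div_algebra, euclidean_space} \<Rightarrow> 'f"
  assumes c_add: "c (x + y) = c x + c y" and c_mult: "c (x * y) = c y * c x"
    and c_c [simp]: "c (c x) = x" and c_norm: "c x * x = of_real ((norm x)\<^sup>2)"
begin

lemma c_0 [simp]: "c 0 = 0"
  using c_add[of 0 0] by simp

lemma c_1 [simp]: "c 1 = 1"
  using c_mult[of "c 1" 1] by simp

lemma c_eq_0_iff [simp]: "c x = 0 \<longleftrightarrow> x = 0"
  using c_c[of x] by (metis c_0)

lemma c_minus: "c (- x) = - c x"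
  using c_add[of x "- x"] by (simp add: eq_neg_iff_add_eq_0 add.commute)

lemma c_diff: "c (x - y) = c x - c y"
  using c_add[of x "- y"] by (simp add: c_minus)

lemma c_sum: "c (sum f A) = (\<Sum>i\<in>A. c (f i))"
  by (induction A rule: infinite_finite_induct) (simp_all add: c_add)

lemma norm_c [simp]: "norm (c x) = norm x"
proof -
  have "norm (c x * x) = (norm x)\<^sup>2" unfolding c_norm norm_of_real by simp
  then show ?thesis by (cases "x = 0") (simp_all add: norm_mult power2_eq_square)
qed

lemma c_norm': "x * c x = of_real ((norm x)\<^sup>2)"
  using c_norm[of "c x"] by simp

lemma c_inverse: "c (inverse x) = inverse (c x)"
proof (cases "x = 0")
  case False
  have "c x * c (inverse x) = 1" using c_mult[of "inverse x" x] False by simp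
  then show ?thesis by (rule inverse_unique[symmetric])
qed simp

lemma adjoint_mult: "adjoint_mat c (A ** B) = adjoint_mat c B ** adjoint_mat c A"
  by (simp add: adjoint_mat_def matrix_matrix_mult_def vec_eq_iff c_sum c_mult)

lemma adjoint_adjoint [simp]: "adjoint_mat c (adjoint_mat c A) = A"
  by (simp add: adjoint_mat_def vec_eq_iff)

lemma adjoint_1 [simp]: "adjoint_mat c (mat 1) = mat 1"
  by (simp add: adjoint_mat_def vec_eq_iff mat_def)

end

lemma lorentz_form_square [simp]: "lorentz_form ** lorentz_form = (mat 1 :: ('f::ring_1, 'n::{finite,linorder}) sqmat)"
  by (simp add: lorentz_form_def matrix_matrix_mult_def vec_eq_iff mat_def if_distrib[where f = "\<lambda>x. x * _"] cong: if_cong)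

lemma lorentz_form_mult_left: "(lorentz_form ** A) $ i $ j = (if i = ix0 then A $ i $ j else - (A $ i $ j :: 'f::ring_1))"
  by (simp add: lorentz_form_def matrix_matrix_mult_def if_distrib[where f = "\<lambda>x. x * _"] cong: if_cong)

lemma lorentz_form_mult_right: "(A ** lorentz_form) $ i $ j = (if j = ix0 then A $ i $ j else - (A $ i $ j :: 'f::ring_1))"
  by (simp add: lorentz_form_def matrix_matrix_mult_def if_distrib[where f = "\<lambda>x. _ * x"] cong: if_cong)

lemma matrix_eq_by_columns:
  fixes A B :: "('f::ring_1, 'n::finite) sqmat"
  assumes "\<And>x. A *v x = B *v x" shows "A = B"
proof -
  have e: "(A *v axis j 1) $ i = A $ i $ j" for A :: "('f, 'n) sqmat" and i j
    by (simp add: matrix_vector_mult_def axis_def if_distrib[where f = "\<lambda>x. _ * x"] cong: if_cong)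
  show ?thesis using assms e by (simp add: vec_eq_iff) metis
qed

text \<open>
  Over the quaternions there is no determinant to argue with; left multiplication by a matrix is a
  real-linear endomorphism of a finite-dimensional space, and an injective one is surjective.
\<close>

lemma matrix_right_inverse_imp_left:
  fixes A B :: "('f::{real_normed_div_algebra, euclidean_space}, 'n::finite) sqmat"
  assumes AB: "A ** B = mat 1"
  shows "B ** A = mat 1"
proof (rule matrix_eq_by_columns)
  fix y
  have lin: "linear (\<lambda>x. B *v x)"
    by (rule linearI) (simp_all add: matrix_vector_mult_def vec_eq_iff distrib_left sum.distrib scaleR_sum_right)
  have "inj (\<lambda>x. B *v x)"
    by (rule inj_on_inverseI[where g = "\<lambda>x. A *v x"]) (simp add: matrix_vector_mul_assoc AB)
  then have "surj (\<lambda>x. B *v x)" using linear_injective_imp_surjective[OF lin] by blast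
  then obtain x where "y = B *v x" by (metis surjD)
  then have "(B ** A) *v y = B *v ((A ** B) *v x)" by (simp only: matrix_vector_mul_assoc matrix_mul_assoc)
  then show "(B ** A) *v y = mat 1 *v y" using \<open>y = B *v x\<close> by (simp add: AB)
qed

lemma matrix_inv_eqI:
  fixes A B :: "('f::semiring_1, 'n::finite) sqmat"
  assumes "A ** B = mat 1" "B ** A = mat 1"
  shows "matrix_inv A = B"
proof -
  let ?C = "matrix_inv A"
  have "A ** ?C = mat 1 \<and> ?C ** A = mat 1"
    unfolding matrix_inv_def by (rule someI[of _ B]) (use assms in simp)
  then have "?C = ?C ** (A ** B)" "(?C ** A) ** B = B" by (simp_all add: assms)
  then show ?thesis by (simp add: matrix_mul_assoc)
qed

context involution
begin

lemma preserves_form_inverse: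
  fixes A :: "('f, 'n::{finite,linorder}) sqmat"
  assumes "preserves_form c A"
  shows "(lorentz_form ** adjoint_mat c A ** lorentz_form) ** A = mat 1" "A ** (lorentz_form ** adjoint_mat c A ** lorentz_form) = mat 1"
proof -
  have "(lorentz_form ** adjoint_mat c A ** lorentz_form) ** A = lorentz_form ** (adjoint_mat c A ** lorentz_form ** A)"
    by (simp only: matrix_mul_assoc)
  then show 1: "(lorentz_form ** adjoint_mat c A ** lorentz_form) ** A = mat 1"
    using assms by (simp add: preserves_form_def)
  show "A ** (lorentz_form ** adjoint_mat c A ** lorentz_form) = mat 1"
    by (rule matrix_right_inverse_imp_left[OF 1])
qed

lemma preserves_form_mult:
  assumes "preserves_form c A" "preserves_form c B"
  shows "preserves_form c (A ** B)"
proof -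
  have "adjoint_mat c (A ** B) ** lorentz_form ** (A ** B) = adjoint_mat c B ** (adjoint_mat c A ** lorentz_form ** A) ** B"
    by (simp only: adjoint_mult matrix_mul_assoc)
  then show ?thesis using assms by (simp add: preserves_form_def)
qed

lemma preserves_form_left_inverse:
  assumes A: "preserves_form c A" and AB: "A ** B = mat 1"
  shows "preserves_form c B"
proof -
  have "adjoint_mat c B ** lorentz_form ** B = adjoint_mat c B ** (adjoint_mat c A ** lorentz_form ** A) ** B"
    using A by (simp add: preserves_form_def)
  also have "\<dots> = adjoint_mat c (A ** B) ** lorentz_form ** (A ** B)"
    by (simp only: adjoint_mult matrix_mul_assoc)
  finally show ?thesis by (simp add: AB preserves_form_def)
qed

lemma preserves_form_1 [simp]: "preserves_form c (mat 1)"
  by (simp add: preserves_form_def)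

text \<open>
  A left inverse of a square matrix is a right inverse, so the defining relation may be
  transposed.
\<close>

lemma preserves_form_adjoint:
  assumes A: "preserves_form c A"
  shows "A ** lorentz_form ** adjoint_mat c A = lorentz_form"
proof -
  have "A ** lorentz_form ** adjoint_mat c A = (A ** (lorentz_form ** adjoint_mat c A ** lorentz_form)) ** lorentz_form"
    by (simp only: matrix_mul_assoc[symmetric] lorentz_form_square matrix_mul_rid)
  then show ?thesis by (simp add: preserves_form_inverse[OF A])
qed

lemma block_diag_commutes:
  fixes A :: "('f, 'n::{finite,linorder}) sqmat"
  assumes "block_diag A" shows "lorentz_form ** A = A ** lorentz_form"
  using assms by (auto simp: vec_eq_iff lorentz_form_mult_left lorentz_form_mult_right block_diag_def)

lemma block_diag_unitary_preserves_form:
  assumes "block_diag A" "unitary_mat c A"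
  shows "preserves_form c A"
proof -
  have "adjoint_mat c A ** lorentz_form ** A = adjoint_mat c A ** A ** lorentz_form"
    by (simp only: block_diag_commutes[OF assms(1)] matrix_mul_assoc[symmetric])
  then show ?thesis using assms(2) by (simp add: preserves_form_def unitary_mat_def)
qed

lemma preserves_form_entry:
  fixes A :: "('f, 'n::{finite,linorder}) sqmat"
  assumes "preserves_form c A"
  shows "c (A $ ix0 $ i) * A $ ix0 $ j - (\<Sum>l\<in>-{ix0}. c (A $ l $ i) * A $ l $ j) = lorentz_form $ i $ j"
proof -
  have "(adjoint_mat c A ** (lorentz_form ** A)) $ i $ j = (\<Sum>l\<in>UNIV. c (A $ l $ i) * (if l = ix0 then A $ l $ j else - (A $ l $ j)))"
    by (subst matrix_matrix_mult_def) (simp add: lorentz_form_mult_left adjoint_mat_def)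
  also have "\<dots> = c (A $ ix0 $ i) * A $ ix0 $ j + (\<Sum>l\<in>-{ix0}. - (c (A $ l $ i) * A $ l $ j))"
    by (subst sum.remove[of _ ix0]) (auto simp: Compl_eq_Diff_UNIV intro!: sum.cong)
  finally show ?thesis using assms by (simp add: preserves_form_def matrix_mul_assoc sum_negf)
qed

text \<open>
  If column 0 vanishes off the diagonal, so does row 0, and the remaining block is unitary: this is
  why the stabiliser of the base point is described by its first column alone.
\<close>

lemma preserves_form_block_diag:
  fixes A :: "('f, 'n::{finite,linorder}) sqmat"
  assumes A: "preserves_form c A" and z: "\<And>i. i \<noteq> ix0 \<Longrightarrow> A $ i $ ix0 = 0"
  shows "block_diag A" "unitary_mat c A" "norm (A $ ix0 $ ix0) = 1"
proof -
  have e: "c (A $ ix0 $ ix0) * A $ ix0 $ j = lorentz_form $ ix0 $ j" for j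
    using preserves_form_entry[OF A, of ix0 j] z by simp
  have 0: "c (A $ ix0 $ ix0) * A $ ix0 $ ix0 = 1" using e[of ix0] by (simp add: lorentz_form_def)
  then have "of_real ((norm (A $ ix0 $ ix0))\<^sup>2) = (1::'f)" by (simp only: c_norm)
  then show "norm (A $ ix0 $ ix0) = 1" by (simp only: of_real_eq_1_iff) (smt (verit) norm_ge_zero power2_eq_1_iff)
  then have "A $ ix0 $ ix0 \<noteq> 0" by auto
  then have "A $ ix0 $ i = 0" if "i \<noteq> ix0" for i
    using e[of i] that by (auto simp: lorentz_form_def)
  then show bd: "block_diag A" using z by (simp add: block_diag_def)
  have "adjoint_mat c A ** A = (adjoint_mat c A ** lorentz_form ** A) ** lorentz_form"
    by (simp only: block_diag_commutes[OF bd] matrix_mul_assoc[symmetric] lorentz_form_square matrix_mul_rid)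
  then have "adjoint_mat c A ** A = mat 1" using A by (simp add: preserves_form_def)
  then show "unitary_mat c A" by (simp add: unitary_mat_def matrix_right_inverse_imp_left)
qed

lemma sum_c_norm: "(\<Sum>l\<in>UNIV. c (x $ l) * x $ l) = of_real ((norm (x::'f^'n::finite))\<^sup>2)"
  by (simp add: c_norm norm_vec_def L2_set_def sum_nonneg)

text \<open>
  A generalised Householder matrix \<open>1 - w \<tau> w'\<close> with \<open>w = e\<^sub>1 - \<theta>\<close> and \<open>w'\<close> the conjugate transpose. The scalar
  \<open>\<tau> = 1 / (1 - cnj (\<theta>\<^sub>1))\<close> is chosen such that \<open>e\<^sub>1\<close> is mapped to \<open>e\<^sub>1 - w = \<theta>\<close>; the matrix is unitary
  because \<open>w' w = 2 - 2 Re \<theta>\<^sub>1\<close>. Unlike an ordinary reflection it needs no unit scalar to make an inner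
  product real.
\<close>

lemma unitary_transport:
  fixes \<theta> :: "'f^'n::{finite,linorder}"
  assumes n: "norm \<theta> = 1" and z: "\<theta> $ ix0 = 0" and ix: "ix0 \<noteq> (ix1 :: 'n)"
  obtains U :: "('f, 'n) sqmat" where "unitary_mat c U" "block_diag U" "U $ ix0 $ ix0 = 1" "\<And>i. U $ i $ ix1 = \<theta> $ i"
proof (cases "\<theta> $ ix1 = 1")
  case True
  have "(\<Sum>i\<in>UNIV. (norm (\<theta> $ i))\<^sup>2) = 1"
    using n by (simp add: norm_vec_def L2_set_def)
  then have "(\<Sum>i\<in>UNIV-{ix1}. (norm (\<theta> $ i))\<^sup>2) = 0" using True by (subst (asm) sum.remove[of _ ix1]) auto
  then have "\<theta> $ i = (if i = ix1 then 1 else 0)" for i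
    using True by (subst (asm) sum_nonneg_eq_0_iff) auto
  then show ?thesis using ix
    by (intro that[of "mat 1"]) (simp add: unitary_mat_def, auto simp: block_diag_def mat_def)
next
  case False
  define w where "w = axis ix1 1 - \<theta>"
  define a where "a = 1 - c (\<theta> $ ix1)"
  define \<tau> where "\<tau> = inverse a"
  have "c (\<theta> $ ix1) \<noteq> 1" using False c_c[of "\<theta> $ ix1"] by (metis c_1)
  then have a: "a \<noteq> 0" by (simp add: a_def)
  have W: "(\<Sum>l\<in>UNIV. c (w $ l) * w $ l) = c a + a"
  proof -
    have "(\<Sum>l\<in>UNIV. c (w $ l) * w $ l) = (\<Sum>l\<in>UNIV. (if l = ix1 then 1 - c (\<theta> $ l) - \<theta> $ l else 0) + c (\<theta> $ l) * \<theta> $ l)"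
      by (intro sum.cong) (auto simp: w_def axis_def c_diff algebra_simps)
    also have "\<dots> = (1 - c (\<theta> $ ix1) - \<theta> $ ix1) + 1"
      unfolding sum.distrib sum_c_norm n by simp
    finally show ?thesis by (simp add: a_def c_diff)
  qed
  have tau: "\<tau> + c \<tau> = c \<tau> * (c a + a) * \<tau>"
    using a by (simp add: \<tau>_def c_inverse distrib_left distrib_right mult.assoc)
  define U where "U = (\<chi> i j. (if i = j then 1 else 0) - w $ i * \<tau> * c (w $ j))"
  have adj: "c (U $ l $ i) = (if i = l then 1 else 0) - w $ i * c \<tau> * c (w $ l)" for i l
    by (simp add: U_def c_diff c_mult mult.assoc)
  have "(adjoint_mat c U ** U) $ i $ j = (if i = j then 1 else 0)" for i j
  proof -
    have "(adjoint_mat c U ** U) $ i $ j = (\<Sum>l\<in>UNIV. ((if i = l then 1 else 0) - w $ i * c \<tau> * c (w $ l)) * ((if l = j then 1 else 0) - w $ l * \<tau> * c (w $ j)))"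
      by (simp add: matrix_matrix_mult_def adjoint_mat_def adj) (simp add: U_def)
    also have "\<dots> = (\<Sum>l\<in>UNIV. (if l = i then (if i = j then 1 else 0) - w $ i * \<tau> * c (w $ j) else 0)
       - (if l = j then w $ i * c \<tau> * c (w $ j) else 0) + w $ i * c \<tau> * (c (w $ l) * w $ l) * \<tau> * c (w $ j))"
      by (intro sum.cong) (auto simp: algebra_simps)
    also have "\<dots> = (if i = j then 1 else 0) - w $ i * \<tau> * c (w $ j) - w $ i * c \<tau> * c (w $ j) + w $ i * (c \<tau> * (c a + a) * \<tau>) * c (w $ j)"
      unfolding sum.distrib sum_subtractf sum_distrib_left[symmetric] sum_distrib_right[symmetric] W
      by (simp add: mult.assoc)
    also have "\<dots> = (if i = j then 1 else 0)"
      unfolding tau[symmetric] by (simp add: algebra_simps)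
    finally show ?thesis .
  qed
  then have "adjoint_mat c U ** U = mat 1" by (simp add: vec_eq_iff mat_def)
  then have un: "unitary_mat c U" by (simp add: unitary_mat_def matrix_right_inverse_imp_left)
  have w0: "w $ ix0 = 0" using z ix by (simp add: w_def axis_def)
  have cw1: "\<tau> * c (w $ ix1) = 1" using a by (simp add: \<tau>_def w_def axis_def c_diff a_def)
  show ?thesis
  proof (rule that[of U])
    show "unitary_mat c U" by (rule un)
    show "U $ i $ ix1 = \<theta> $ i" for i
    proof -
      have "U $ i $ ix1 = (if i = ix1 then 1 else 0) - w $ i" by (simp add: U_def mult.assoc cw1)
      then show ?thesis by (simp add: w_def axis_def)
    qed
  qed (auto simp: block_diag_def U_def w0)
qed

lemma c_of_real [simp]: "c (of_real r) = of_real r"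
proof (cases "r = 0")
  case False
  have "c (of_real r) * of_real r = of_real r * (of_real r :: 'f)"
    unfolding c_norm by (simp add: power2_eq_square flip: of_real_mult)
  then show ?thesis using False by simp
qed simp

end

interpretation real_inv: involution "id :: real \<Rightarrow> real"
  by unfold_locales (simp_all add: power2_eq_square)

interpretation complex_inv: involution cnj
  by unfold_locales (simp_all add: complex_norm_square[symmetric] mult.commute)

lemma quat_of_real_eq: "of_real r = Quat r 0 0 0"
  by (simp add: of_real_def scaleR_quat_def one_quat_def)

interpretation quat_inv: involution quat_cnj
proof
  fix x y :: quat
  show "quat_cnj (x + y) = quat_cnj x + quat_cnj y"
    by (simp add: quat_cnj_def plus_quat_def)
  show "quat_cnj (x * y) = quat_cnj y * quat_cnj x"
    by (simp add: quat_cnj_def times_quat_def algebra_simps)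
  show "quat_cnj (quat_cnj x) = x" by (simp add: quat_cnj_def)
  have "(norm x)\<^sup>2 = inner x x" by (simp add: norm_quat_def)
  then show "quat_cnj x * x = of_real ((norm x)\<^sup>2)"
    by (simp add: quat_of_real_eq quat_cnj_def times_quat_def inner_quat_def algebra_simps)
qed

section \<open>Hyperbolic rotations\<close>

text \<open>
  The matrix \<open>a_t\<close> over an arbitrary scalar algebra.
\<close>

definition boost_entry :: "real \<Rightarrow> 'n::{finite,linorder} \<Rightarrow> 'n \<Rightarrow> real" where
  "boost_entry t i j = (if i = j then (if i = ix0 \<or> i = ix1 then cosh t else 1)
     else if {i, j} = {ix0, ix1} then sinh t else 0)"

definition boost :: "real \<Rightarrow> ('f::real_normed_div_algebra, 'n::{finite,linorder}) sqmat" where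
  "boost t = (\<chi> i j. of_real (boost_entry t i j))"

lemma boost_0: "boost 0 = mat 1"
  by (simp add: boost_def boost_entry_def mat_def vec_eq_iff)

lemma boost_entry_add:
  assumes ix: "ix0 \<noteq> (ix1 :: 'n::{finite,linorder})"
  shows "(\<Sum>l\<in>UNIV. boost_entry s i l * boost_entry t l j) = boost_entry (s + t) i (j :: 'n)"
proof (cases "i = ix0 \<or> i = ix1")
  case True
  have "(\<Sum>l\<in>UNIV. boost_entry s i l * boost_entry t l j) = (\<Sum>l\<in>{ix0, ix1}. boost_entry s i l * boost_entry t l j)"
    using True by (intro sum.mono_neutral_right) (auto simp: boost_entry_def doubleton_eq_iff)
  also have "\<dots> = boost_entry s i ix0 * boost_entry t ix0 j + boost_entry s i ix1 * boost_entry t ix1 j"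
    using ix by simp
  also have "\<dots> = boost_entry (s + t) i j"
    using True ix by (cases "j = ix0 \<or> j = ix1")
      (auto simp: boost_entry_def doubleton_eq_iff cosh_add sinh_add)
  finally show ?thesis .
next
  case False
  have "(\<Sum>l\<in>UNIV. boost_entry s i l * boost_entry t l j) = (\<Sum>l\<in>UNIV. if l = i then boost_entry t i j else 0)"
    using False by (intro sum.cong) (auto simp: boost_entry_def doubleton_eq_iff)
  then show ?thesis using False by (auto simp: boost_entry_def doubleton_eq_iff)
qed

lemma boost_add:
  assumes "ix0 \<noteq> (ix1 :: 'n::{finite,linorder})"
  shows "boost s ** boost t = (boost (s + t) :: ('f::real_normed_div_algebra, 'n) sqmat)"
  by (simp add: boost_def matrix_matrix_mult_def vec_eq_iff boost_entry_add[OF assms] flip: of_real_mult of_real_sum)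

lemma lorentz_boost:
  assumes ix: "ix0 \<noteq> (ix1 :: 'n::{finite,linorder})"
  shows "lorentz_form ** boost t ** lorentz_form = (boost (- t) :: ('f::real_normed_div_algebra, 'n) sqmat)"
  using ix by (auto simp: vec_eq_iff lorentz_form_mult_right lorentz_form_mult_left boost_def boost_entry_def doubleton_eq_iff)

lemma (in involution) adjoint_boost: "adjoint_mat c (boost t) = (boost t :: ('f, 'n::{finite,linorder}) sqmat)"
  by (simp add: adjoint_mat_def boost_def vec_eq_iff boost_entry_def insert_commute)

lemma (in involution) boost_preserves_form:
  assumes ix: "ix0 \<noteq> (ix1 :: 'n::{finite,linorder})"
  shows "preserves_form c (boost t :: ('f, 'n) sqmat)"
proof -
  let ?B = "boost t :: ('f, 'n) sqmat"
  let ?J = "lorentz_form :: ('f, 'n) sqmat"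
  have 1: "?J ** ?B ** ?J ** ?B = mat 1"
    by (simp add: lorentz_boost[OF ix] boost_add[OF ix] boost_0)
  have "?B ** ?J ** ?B = ?J ** ?J ** ?B ** ?J ** ?B" by simp
  also have "\<dots> = ?J ** (?J ** ?B ** ?J ** ?B)" by (simp only: matrix_mul_assoc)
  also have "\<dots> = ?J" unfolding 1 by simp
  finally show ?thesis by (simp only: preserves_form_def adjoint_boost)
qed

lemma det_boost:
  assumes ix: "ix0 \<noteq> (ix1 :: 'n::{finite,linorder})"
  shows "det (boost t :: ('f::real_normed_field, 'n) sqmat) = 1"
proof -
  let ?B = "boost (t / 2) :: ('f, 'n) sqmat"
  let ?J = "lorentz_form :: ('f, 'n) sqmat"
  have "?J ** ?B ** ?J ** ?B = mat 1"
    by (simp add: lorentz_boost[OF ix] boost_add[OF ix] boost_0)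
  then have "det (?J ** ?B ** ?J ** ?B) = 1" by simp
  then have "(det ?J * det ?J) * (det ?B * det ?B) = 1" by (simp add: det_mul mult_ac)
  moreover have "det ?J * det ?J = 1" using det_mul[of ?J ?J] by simp
  ultimately have "det ?B * det ?B = 1" by simp
  moreover have "boost t = ?B ** ?B" by (simp add: boost_add[OF ix])
  ultimately show ?thesis by (simp add: det_mul)
qed

section \<open>Determinants of unitary matrices\<close>

lemma det_adjoint_mat:
  fixes A :: "('f::real_normed_field, 'n::finite) sqmat"
  assumes add: "\<And>x y. c (x + y) = c x + c y" and mult: "\<And>x y. c (x * y) = c x * c y" and one: "c 1 = 1"
  shows "det (adjoint_mat c A) = c (det A)"
proof -
  have zero: "c 0 = 0" using add[of 0 0] by simp
  have minus: "c (- x) = - c x" for x using add[of x "- x"] zero by (simp add: eq_neg_iff_add_eq_0 add.commute)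
  have s: "c (sum f S) = (\<Sum>i\<in>S. c (f i))" for f and S :: "('n \<Rightarrow> 'n) set"
    by (induction S rule: infinite_finite_induct) (simp_all add: add zero)
  have p: "c (prod f S) = (\<Prod>i\<in>S. c (f i))" for f and S :: "'n set"
    by (induction S rule: infinite_finite_induct) (simp_all add: mult one)
  have sg: "c (of_int (sign p)) = of_int (sign p)" for p :: "'n \<Rightarrow> 'n"
    by (simp add: sign_def one minus)
  have "c (det A) = det (\<chi> i j. c (A $ i $ j))"
    by (simp add: det_def s mult p sg)
  also have "\<dots> = det (transpose (\<chi> i j. c (A $ i $ j)))" by (simp add: det_transpose)
  also have "transpose (\<chi> i j. c (A $ i $ j)) = adjoint_mat c A"
    by (simp add: transpose_def adjoint_mat_def vec_eq_iff)
  finally show ?thesis ..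
qed

text \<open>
  The determinant of the matrix found above is a unit \<open>\<delta>\<close>. Multiplying a column other than columns
  0 and 1 by its conjugate makes the determinant 1 and does not disturb \<open>\<theta>\<close>; such a column exists
  because there are at least three indices.
\<close>

lemma special_unitary_transport:
  fixes c :: "'f::{real_normed_field, euclidean_space} \<Rightarrow> 'f" and \<theta> :: "'f^'n::{finite,linorder}"
  assumes inv: "involution c" and n: "norm \<theta> = 1" and z: "\<theta> $ ix0 = 0" and ix: "ix0 \<noteq> (ix1 :: 'n)" and card: "CARD('n) \<ge> 3"
  obtains U :: "('f, 'n) sqmat" where "unitary_mat c U" "block_diag U" "U $ ix0 $ ix0 = 1" "det U = 1" "\<And>i. U $ i $ ix1 = \<theta> $ i"
proof -
  interpret involution c by (rule inv)
  obtain V :: "('f, 'n) sqmat" where V: "unitary_mat c V" "block_diag V" "V $ ix0 $ ix0 = 1" "\<And>i. V $ i $ ix1 = \<theta> $ i"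
    using unitary_transport[OF n z ix] by blast
  have "{ix0, ix1 :: 'n} \<noteq> UNIV"
  proof
    assume e: "{ix0, ix1 :: 'n} = UNIV"
    have "card {ix0, ix1 :: 'n} = 2" using ix by simp
    then show False using card unfolding e by simp
  qed
  then obtain j0 :: 'n where j0: "j0 \<noteq> ix0" "j0 \<noteq> ix1" by blast
  have "c (det V) * det V = 1"
  proof -
    have "det (adjoint_mat c V ** V) = 1" using V(1) by (simp add: unitary_mat_def)
    moreover have "det (adjoint_mat c V) = c (det V)"
      by (rule det_adjoint_mat) (simp_all add: c_add c_mult mult.commute)
    ultimately show ?thesis by (simp add: det_mul)
  qed
  define \<delta> where "\<delta> = c (det V)"
  have d: "det V * \<delta> = 1" "c \<delta> * \<delta> = 1" "\<delta> * c \<delta> = 1"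
    using \<open>c (det V) * det V = 1\<close> by (simp_all add: \<delta>_def mult.commute)
  define D :: "('f, 'n) sqmat" where "D = (\<chi> i j. if i = j then (if i = j0 then \<delta> else 1) else 0)"
  have VD: "(V ** D) $ i $ j = V $ i $ j * (if j = j0 then \<delta> else 1)" for i j
  proof -
    have "(V ** D) $ i $ j = (\<Sum>l\<in>UNIV. V $ i $ l * (if l = j then (if l = j0 then \<delta> else 1) else 0))"
      by (simp add: matrix_matrix_mult_def D_def)
    also have "\<dots> = (\<Sum>l\<in>UNIV. if l = j then V $ i $ j * (if j = j0 then \<delta> else 1) else 0)"
      by (intro sum.cong) simp_all
    finally show ?thesis by simp
  qed
  have "adjoint_mat c D ** D = mat 1"
  proof -
    have "(adjoint_mat c D ** D) $ i $ j = (if i = j then 1 else 0)" for i j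
    proof -
      have "(adjoint_mat c D ** D) $ i $ j = (\<Sum>l\<in>UNIV. adjoint_mat c D $ i $ l * D $ l $ j)"
        by (simp add: matrix_matrix_mult_def)
      also have "\<dots> = (\<Sum>l\<in>UNIV. if l = i then (if i = j then 1 else 0) else 0)"
        by (intro sum.cong) (auto simp: adjoint_mat_def D_def d)
      finally show ?thesis by simp
    qed
    then show ?thesis by (simp add: vec_eq_iff mat_def)
  qed
  moreover have "adjoint_mat c V ** V = mat 1" using V(1) by (simp add: unitary_mat_def)
  moreover have "adjoint_mat c (V ** D) ** (V ** D) = adjoint_mat c D ** (adjoint_mat c V ** V) ** D"
    by (simp only: adjoint_mult matrix_mul_assoc)
  ultimately have "adjoint_mat c (V ** D) ** (V ** D) = mat 1" by simp
  then have un: "unitary_mat c (V ** D)" by (simp add: unitary_mat_def matrix_right_inverse_imp_left)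
  have "det D = (\<Prod>i\<in>UNIV. D $ i $ i)" by (rule det_diagonal) (simp add: D_def)
  also have "\<dots> = \<delta>" by (simp add: D_def)
  finally have det: "det (V ** D) = 1" by (simp add: det_mul d)
  show ?thesis
  proof (rule that[of "V ** D"])
    show "block_diag (V ** D)" using V(2) by (simp add: VD block_diag_def)
    show "(V ** D) $ ix0 $ ix0 = 1" using V(3) j0(1)[symmetric] by (simp add: VD)
    show "(V ** D) $ i $ ix1 = \<theta> $ i" for i using V(4) j0(2)[symmetric] by (simp add: VD)
  qed (rule un det)+
qed

section \<open>Connectedness of SO(k)\<close>

definition refl_mat :: "real^'n \<Rightarrow> (real, 'n::finite) sqmat" where
  "refl_mat a = (\<chi> i j. (if i = j then 1 else 0) - 2 * a $ i * a $ j / (a \<bullet> a))"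

lemma refl_mat_minus: "refl_mat (- a) = refl_mat a"
  by (simp add: refl_mat_def)

lemma refl_mat_mult: "(refl_mat a ** A) $ i $ j = A $ i $ j - 2 * a $ i * (\<Sum>l\<in>UNIV. a $ l * A $ l $ j) / (a \<bullet> a)"
proof -
  have "(refl_mat a ** A) $ i $ j = (\<Sum>l\<in>UNIV. (if l = i then A $ i $ j else 0) - 2 * a $ i / (a \<bullet> a) * (a $ l * A $ l $ j))"
    unfolding matrix_matrix_mult_def refl_mat_def by (simp, intro sum.cong) (auto simp: algebra_simps)
  also have "\<dots> = A $ i $ j - 2 * a $ i / (a \<bullet> a) * (\<Sum>l\<in>UNIV. a $ l * A $ l $ j)"
    by (simp add: sum_subtractf sum_distrib_left)
  finally show ?thesis by simp
qed

lemma inner_vec_sum: "(a::real^'n::finite) \<bullet> b = (\<Sum>l\<in>UNIV. a $ l * b $ l)"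
  by (simp add: inner_vec_def)

lemma refl_mat_square:
  assumes "a \<noteq> 0" shows "refl_mat a ** refl_mat a = mat 1"
proof -
  have q: "a \<bullet> a \<noteq> 0" using assms by simp
  have s: "(\<Sum>l\<in>UNIV. a $ l * refl_mat a $ l $ j) = - a $ j" for j
  proof -
    define k where "k = 2 * a $ j / (a \<bullet> a)"
    have "a $ l * refl_mat a $ l $ j = (if l = j then a $ j else 0) - k * (a $ l * a $ l)" for l
      unfolding refl_mat_def k_def by (simp add: algebra_simps)
    then have "(\<Sum>l\<in>UNIV. a $ l * refl_mat a $ l $ j) = a $ j - (\<Sum>l\<in>UNIV. k * (a $ l * a $ l))"
      by (simp add: sum_subtractf)
    also have "(\<Sum>l\<in>UNIV. k * (a $ l * a $ l)) = k * (a \<bullet> a)"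
      unfolding inner_vec_sum by (rule sum_distrib_left[symmetric])
    finally show ?thesis using q by (simp add: k_def)
  qed
  have "(refl_mat a ** refl_mat a) $ i $ j = mat 1 $ i $ j" for i j
    unfolding refl_mat_mult s by (simp add: refl_mat_def mat_def)
  then show ?thesis by (simp add: vec_eq_iff)
qed

lemma adjoint_refl_mat: "adjoint_mat id (refl_mat a) = refl_mat a"
  by (simp add: adjoint_mat_def refl_mat_def vec_eq_iff mult_ac eq_commute)

lemma refl_mat_unitary:
  assumes "a \<noteq> 0" shows "unitary_mat id (refl_mat a)"
  using refl_mat_square[OF assms] by (simp add: unitary_mat_def adjoint_refl_mat)

lemma refl_mat_block_diag:
  assumes "a $ ix0 = 0" shows "block_diag (refl_mat a)" "refl_mat a $ ix0 $ ix0 = 1"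
  by (auto simp: block_diag_def refl_mat_def assms)

text \<open>
  A reflection is conjugate to a diagonal matrix with exactly one entry \<open>-1\<close>.
\<close>

lemma det_refl_mat:
  fixes a :: "real^'n::finite"
  assumes "a \<noteq> 0" shows "det (refl_mat a) = -1"
proof -
  obtain k :: 'n where True by blast
  let ?u = "a /\<^sub>R norm a"
  have "norm ?u = 1" using assms by simp
  then obtain A where A: "orthogonal_matrix A" "A *v axis k 1 = ?u"
    using orthogonal_matrix_exists_basis by metis
  have col: "A $ i $ k = a $ i / norm a" for i
    using A(2) by (simp add: matrix_vector_mult_basis column_def vec_eq_iff divide_inverse_commute)
  have q: "a \<bullet> a = (norm a)\<^sup>2" by (simp add: power2_norm_eq_inner)
  define D :: "(real, 'n) sqmat" where "D = (\<chi> i j. if i = j then (if i = k then -1 else 1) else 0)"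
  have s: "(\<Sum>l\<in>UNIV. a $ l * A $ l $ j) = (if j = k then norm a else 0)" for j
  proof -
    have "transpose A ** A = mat 1" using A(1) by (simp add: orthogonal_matrix_def)
    then have "(transpose A ** A) $ k $ j = (if k = j then 1 else 0)" by (simp add: mat_def)
    then have "(\<Sum>l\<in>UNIV. (a $ l / norm a) * A $ l $ j) = (if k = j then 1 else 0)"
      by (simp add: matrix_matrix_mult_def transpose_def col)
    then have "(\<Sum>l\<in>UNIV. a $ l * A $ l $ j) / norm a = (if k = j then 1 else 0)"
      by (simp add: sum_divide_distrib)
    then show ?thesis using assms by (auto simp: field_simps split: if_splits)
  qed
  have "(A ** D) $ i $ j = A $ i $ j * (if j = k then -1 else 1)" for i j
  proof -
    have "(A ** D) $ i $ j = (\<Sum>l\<in>UNIV. A $ i $ l * (if l = j then (if l = k then -1 else 1) else 0))"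
      by (simp add: matrix_matrix_mult_def D_def)
    also have "\<dots> = (\<Sum>l\<in>UNIV. if l = j then A $ i $ j * (if j = k then -1 else 1) else 0)"
      by (intro sum.cong) simp_all
    finally show ?thesis by simp
  qed
  moreover have "(refl_mat a ** A) $ i $ j = A $ i $ j * (if j = k then -1 else 1)" for i j
    using assms by (simp add: refl_mat_mult s q col power2_eq_square)
  ultimately have "refl_mat a ** A = A ** D" by (simp add: vec_eq_iff)
  then have "det (refl_mat a) * det A = det A * det D" by (metis det_mul)
  moreover have "det A \<noteq> 0" using det_orthogonal_matrix[OF A(1)] by auto
  ultimately have "det (refl_mat a) = det D" by simp
  also have "det D = (\<Prod>i\<in>UNIV. D $ i $ i)" by (rule det_diagonal) (simp add: D_def)
  also have "\<dots> = -1" by (simp add: D_def)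
  finally show ?thesis .
qed

lemma continuous_on_matrix_mult_left:
  "continuous_on S (\<lambda>X. A ** (X :: (real, 'n::finite) sqmat))"
  unfolding matrix_matrix_mult_def by (intro continuous_intros)

lemma one_in_SO1: "mat 1 \<in> SO1"
  by (simp add: SO1_def real_inv.preserves_form_1)

lemma SO1_mult: "A \<in> SO1 \<Longrightarrow> B \<in> SO1 \<Longrightarrow> A ** B \<in> SO1"
  by (auto simp: SO1_def det_mul intro: real_inv.preserves_form_mult)

lemma one_in_SO1o: "mat 1 \<in> SO1o"
  by (simp add: SO1o_def one_in_SO1)

lemma SO1o_subset: "SO1o \<subseteq> SO1"
  unfolding SO1o_def by (rule connected_component_subset)

lemma SO1oI:
  assumes "connected S" "S \<subseteq> SO1" "mat 1 \<in> S" "A \<in> S" shows "A \<in> SO1o"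
  using connected_component_maximal[OF assms(3,1,2)] assms(4) by (auto simp: SO1o_def)

lemma SO1o_mult:
  assumes A: "A \<in> SO1o" and B: "B \<in> SO1o" shows "A ** B \<in> SO1o"
proof -
  let ?S = "(\<lambda>X. A ** X) ` SO1o"
  have "connected ?S"
    by (intro connected_continuous_image continuous_on_matrix_mult_left) (simp add: SO1o_def)
  moreover have "?S \<subseteq> SO1" using A SO1o_subset SO1_mult by blast
  moreover have "A \<in> ?S" using one_in_SO1o by (metis image_eqI matrix_mul_rid)
  ultimately have "?S \<subseteq> connected_component_set SO1 A" by (intro connected_component_maximal)
  also have "\<dots> = SO1o" using A unfolding SO1o_def using connected_component_eq by metis
  finally show ?thesis using B by blast
qed

lemma SO1o_inverse:
  assumes A: "A \<in> SO1o" and AB: "A ** B = mat 1" "B ** A = mat 1" shows "B \<in> SO1o"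
proof (rule SO1oI)
  let ?S = "(\<lambda>X. B ** X) ` SO1o"
  show "connected ?S"
    by (intro connected_continuous_image continuous_on_matrix_mult_left) (simp add: SO1o_def)
  have "det A * det B = 1" using AB(1) by (metis det_I det_mul)
  then have "B \<in> SO1" using A SO1o_subset AB real_inv.preserves_form_left_inverse[of A B] by (auto simp: SO1_def)
  then show "?S \<subseteq> SO1" using SO1o_subset SO1_mult by blast
  show "mat 1 \<in> ?S" using A AB by (metis image_eqI)
  show "B \<in> ?S" using one_in_SO1o by (metis image_eqI matrix_mul_rid)
qed

text \<open>
  Replacing \<open>b\<close> by \<open>-b\<close> if necessary, the segment from \<open>a\<close> to \<open>b\<close> avoids 0. Moving the second
  vector along it joins the product to the identity inside the group.
\<close>

lemma refl_pair_in_SO1o: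
  assumes a: "a \<noteq> 0" "a $ ix0 = 0" and b: "b \<noteq> 0" "b $ ix0 = 0"
  shows "refl_mat a ** refl_mat b \<in> SO1o"
proof -
  have main: "refl_mat a ** refl_mat b \<in> SO1o" if b: "b \<noteq> 0" "b $ ix0 = 0" and ab: "a \<bullet> b \<ge> 0" for b
  proof (rule SO1oI)
    let ?S = "(\<lambda>x. refl_mat a ** refl_mat x) ` closed_segment a b"
    have nz: "x \<noteq> 0 \<and> x $ ix0 = 0" if x: "x \<in> closed_segment a b" for x
    proof -
      obtain u where u: "0 \<le> u" "u \<le> 1" "x = (1 - u) *\<^sub>R a + u *\<^sub>R b" using x by (auto simp: in_segment)
      have "x \<noteq> 0"
      proof
        assume "x = 0"
        have 1: "x \<bullet> a = (1 - u) * (a \<bullet> a) + u * (a \<bullet> b)" "x \<bullet> b = (1 - u) * (a \<bullet> b) + u * (b \<bullet> b)"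
          by (simp_all add: u(3) inner_add_left inner_add_right inner_commute)
        have nn: "(1 - u) * (a \<bullet> a) \<ge> 0" "u * (a \<bullet> b) \<ge> 0" "(1 - u) * (a \<bullet> b) \<ge> 0" "u * (b \<bullet> b) \<ge> 0"
          using u ab by simp_all
        have "(1 - u) * (a \<bullet> a) = 0" "u * (b \<bullet> b) = 0" using 1 nn \<open>x = 0\<close> by (auto simp: add_nonneg_eq_0_iff)
        then show False using a(1) b(1) by auto
      qed
      then show ?thesis using a(2) b(2) by (simp add: u(3))
    qed
    have "continuous_on (closed_segment a b) (\<lambda>x. refl_mat x)"
      unfolding refl_mat_def using nz by (intro continuous_intros) auto
    then have "continuous_on (closed_segment a b) (\<lambda>x. refl_mat a ** refl_mat x)"
      by (rule continuous_on_compose2[OF continuous_on_matrix_mult_left[of UNIV]]) auto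
    then show "connected ?S" by (intro connected_continuous_image connected_segment)
    show "?S \<subseteq> SO1"
    proof clarify
      fix x assume x: "x \<in> closed_segment a b"
      have "preserves_form id (refl_mat y)" if "y \<noteq> 0" "y $ ix0 = 0" for y
        using that by (intro real_inv.block_diag_unitary_preserves_form refl_mat_block_diag refl_mat_unitary)
      then have "preserves_form id (refl_mat a ** refl_mat x)"
        using nz[OF x] a by (blast intro: real_inv.preserves_form_mult)
      then show "refl_mat a ** refl_mat x \<in> SO1"
        using nz[OF x] a by (simp add: SO1_def det_mul det_refl_mat)
    qed
    show "mat 1 \<in> ?S" using refl_mat_square[OF a(1)] by (metis ends_in_segment(1) image_eqI)
    show "refl_mat a ** refl_mat b \<in> ?S" by blast
  qed
  show ?thesis
  proof (cases "a \<bullet> b \<ge> 0")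
    case True then show ?thesis using main b by blast
  next
    case False
    then have "refl_mat a ** refl_mat (- b) \<in> SO1o" using b by (intro main) auto
    then show ?thesis by (simp add: refl_mat_minus)
  qed
qed

text \<open>
  The Cartan-Dieudonne argument: induct on the number of basis vectors that the matrix moves. A
  reflection fixes one more of them, reflections are paired so that the determinant is kept, and each
  pair lies in the identity component.
\<close>

lemma orthogonal_in_SO1o:
  fixes A :: "(real, 'n::{finite,linorder}) sqmat"
  assumes "unitary_mat id A" "\<And>i. A $ i $ ix0 = (if i = ix0 then 1 else 0)"
  shows "(det A = 1 \<longrightarrow> A \<in> SO1o) \<and> (det A = -1 \<longrightarrow> (\<forall>a. a \<noteq> 0 \<longrightarrow> a $ ix0 = 0 \<longrightarrow> refl_mat a ** A \<in> SO1o))"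
  using assms
proof (induction "card {j. \<exists>i. A $ i $ j \<noteq> (if i = j then 1 else 0)}" arbitrary: A rule: less_induct)
  case less
  define mv where "mv B = {j. \<exists>i. B $ i $ j \<noteq> (if i = j then 1 else 0)}" for B :: "(real, 'n) sqmat"
  show ?case
  proof (cases "mv A = {}")
    case True
    then have "A = mat 1" by (auto simp: mv_def vec_eq_iff mat_def)
    then show ?thesis by (simp add: one_in_SO1o)
  next
    case False
    then obtain j where j: "j \<in> mv A" by blast
    have j0: "j \<noteq> ix0" using j less.prems(2) by (auto simp: mv_def)
    have orth: "(\<Sum>l\<in>UNIV. A $ l $ p * A $ l $ q) = (if p = q then 1 else 0)" for p q
    proof -
      have "(adjoint_mat id A ** A) $ p $ q = (if p = q then 1 else 0)"
        using less.prems(1) by (simp add: unitary_mat_def mat_def)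
      then show ?thesis by (simp add: matrix_matrix_mult_def adjoint_mat_def)
    qed
    define u where "u = (\<chi> i. A $ i $ j)"
    define a where "a = u - axis j 1"
    have az: "a $ i = A $ i $ j - (if i = j then 1 else 0)" for i by (simp add: a_def u_def axis_def)
    have a: "a \<noteq> 0" using j by (auto simp: mv_def vec_eq_iff az)
    have fixl: "A $ l $ j = 0" if "l \<notin> mv A" for l
    proof -
      have "l \<noteq> j" using that j by auto
      have "(\<Sum>m\<in>UNIV. A $ m $ l * A $ m $ j) = (\<Sum>m\<in>UNIV. if m = l then A $ l $ j else 0)"
        using that by (intro sum.cong) (auto simp: mv_def)
      then show ?thesis using orth[of l j] \<open>l \<noteq> j\<close> by simp
    qed
    have "ix0 \<notin> mv A" using less.prems(2) by (auto simp: mv_def)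
    then have a0: "a $ ix0 = 0" using fixl j0 by (simp add: az)
    have uu: "(\<Sum>l\<in>UNIV. A $ l $ j * A $ l $ j) = 1" using orth[of j j] by simp
    have aa: "a \<bullet> a = 2 - 2 * A $ j $ j"
    proof -
      have "a \<bullet> a = (\<Sum>l\<in>UNIV. A $ l $ j * A $ l $ j + (if l = j then 1 - 2 * A $ j $ j else 0))"
        unfolding inner_vec_sum by (intro sum.cong) (auto simp: az algebra_simps)
      then show ?thesis by (simp add: sum.distrib uu)
    qed
    have aA: "(\<Sum>l\<in>UNIV. a $ l * A $ l $ q) = (if q = j then 1 else 0) - A $ j $ q" for q
    proof -
      have "(\<Sum>l\<in>UNIV. a $ l * A $ l $ q) = (\<Sum>l\<in>UNIV. A $ l $ j * A $ l $ q - (if l = j then A $ j $ q else 0))"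
        by (intro sum.cong) (auto simp: az algebra_simps)
      then show ?thesis using orth[of j q] by (simp add: sum_subtractf eq_commute)
    qed
    define B where "B = refl_mat a ** A"
    have AB: "A = refl_mat a ** B" by (simp add: B_def matrix_mul_assoc refl_mat_square[OF a])
    have Bj: "B $ i $ j = (if i = j then 1 else 0)" for i
    proof -
      have "B $ i $ j = A $ i $ j - 2 * a $ i * (1 - A $ j $ j) / (2 - 2 * A $ j $ j)"
        by (simp add: B_def refl_mat_mult aA aa)
      moreover have "2 - 2 * A $ j $ j \<noteq> 0" unfolding aa[symmetric] using a by simp
      moreover have "2 * a $ i * (1 - A $ j $ j) = a $ i * (2 - 2 * A $ j $ j)" by (simp add: algebra_simps)
      ultimately have "B $ i $ j = A $ i $ j - a $ i" by simp
      then show ?thesis by (simp add: az)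
    qed
    have Bq: "B $ i $ q = (if i = q then 1 else 0)" if "q \<notin> mv A" for i q
    proof -
      have "q \<noteq> j" using that j by auto
      then have "A $ j $ q = 0" using that by (auto simp: mv_def)
      moreover have "A $ i $ q = (if i = q then 1 else 0)" using that by (auto simp: mv_def)
      ultimately show ?thesis unfolding B_def refl_mat_mult aA using \<open>q \<noteq> j\<close> by simp
    qed
    have "mv B \<subset> mv A"
    proof (rule psubsetI)
      show "mv B \<subseteq> mv A"
      proof
        fix q assume q: "q \<in> mv B"
        show "q \<in> mv A"
        proof (rule ccontr)
          assume "q \<notin> mv A"
          then show False using Bq[of q] q by (simp add: mv_def[of B])
        qed
      qed
      have "j \<notin> mv B" using Bj by (simp add: mv_def[of B])
      then show "mv B \<noteq> mv A" using j by blast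
    qed
    then have lt: "card (mv B) < card (mv A)" by (intro psubset_card_mono) auto
    have uB: "unitary_mat id B"
    proof -
      have "adjoint_mat id B ** B = adjoint_mat id A ** (refl_mat a ** refl_mat a) ** A"
        unfolding B_def real_inv.adjoint_mult adjoint_refl_mat by (simp only: matrix_mul_assoc)
      then have "adjoint_mat id B ** B = mat 1" using less.prems(1) by (simp add: refl_mat_square[OF a] unitary_mat_def)
      then show ?thesis by (simp add: unitary_mat_def matrix_right_inverse_imp_left)
    qed
    have IH: "(det B = 1 \<longrightarrow> B \<in> SO1o) \<and> (det B = -1 \<longrightarrow> (\<forall>a. a \<noteq> 0 \<longrightarrow> a $ ix0 = 0 \<longrightarrow> refl_mat a ** B \<in> SO1o))"
      by (rule less.hyps) (use lt uB Bq \<open>ix0 \<notin> mv A\<close> in \<open>auto simp: mv_def\<close>)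
    have dB: "det B = - det A" by (simp add: B_def det_mul det_refl_mat[OF a])
    show ?thesis
    proof (intro conjI impI allI)
      assume "det A = 1" then show "A \<in> SO1o" using IH dB a a0 AB by auto
    next
      fix b :: "(real, 'n) vec" assume "det A = -1" "b \<noteq> 0" "b $ ix0 = 0"
      then have "B \<in> SO1o" "refl_mat b ** refl_mat a \<in> SO1o" using IH dB refl_pair_in_SO1o a a0 by auto
      then have "(refl_mat b ** refl_mat a) ** B \<in> SO1o" using SO1o_mult by blast
      then show "refl_mat b ** A \<in> SO1o" by (simp add: AB[symmetric] matrix_mul_assoc[symmetric])
    qed
  qed
qed

text \<open>
  The entry has absolute value at least 1 on the whole group, so it cannot change its sign on a
  connected set that contains the identity.
\<close>

lemma SO1o_entry_pos:
  fixes A :: "(real, 'n::{finite,linorder}) sqmat"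
  assumes A: "A \<in> SO1o" shows "A $ ix0 $ ix0 > 0"
proof (rule ccontr)
  assume neg: "\<not> A $ ix0 $ ix0 > 0"
  let ?f = "\<lambda>A :: (real, 'n) sqmat. A $ ix0 $ ix0"
  have "connected (?f ` SO1o)"
    by (intro connected_continuous_image continuous_intros) (simp add: SO1o_def)
  moreover have "?f A \<in> ?f ` SO1o" using A by blast
  moreover have "1 \<in> ?f ` SO1o" by (rule image_eqI[OF _ one_in_SO1o]) (simp add: mat_def)
  ultimately have "{?f A..1} \<subseteq> ?f ` SO1o" by (rule connected_contains_Icc)
  moreover have "0 \<in> {?f A..1}" using neg by simp
  ultimately have "0 \<in> ?f ` SO1o" by (rule subsetD)
  then obtain B where "0 = ?f B" and B1: "B \<in> SO1o" by (rule imageE)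
  then have B: "B \<in> SO1o" "B $ ix0 $ ix0 = 0" by simp_all
  then have "preserves_form id B" using SO1o_subset by (auto simp: SO1_def)
  from real_inv.preserves_form_entry[OF this, of ix0 ix0]
  have "- (\<Sum>l\<in>-{ix0}. B $ l $ ix0 * B $ l $ ix0) = 1" using B(2) by (simp add: lorentz_form_def)
  moreover have "(\<Sum>l\<in>-{ix0}. B $ l $ ix0 * B $ l $ ix0) \<ge> 0" by (intro sum_nonneg) simp
  ultimately show False by simp
qed

section \<open>The three classical pairs (G, K)\<close>

locale star_embedding = involution c
  for c :: "'f::{real_normed_div_algebra, euclidean_space} \<Rightarrow> 'f" +
  fixes e :: "'f \<Rightarrow> quat"
  assumes e_add: "e (x + y) = e x + e y" and e_mult: "e (x * y) = e x * e y"
    and e_of_real: "e (of_real r) = quat_of_real r"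
    and e_c: "e (c x) = quat_cnj (e x)" and e_norm [simp]: "norm (e x) = norm x"
begin

lemma e_0 [simp]: "e 0 = 0"
  using e_of_real[of 0] by (simp add: quat_of_real_def zero_quat_def)

lemma e_1 [simp]: "e 1 = 1"
  using e_of_real[of 1] by (simp add: quat_of_real_def one_quat_def)

lemma e_minus: "e (- x) = - e x"
  using e_add[of x "- x"] by (simp add: eq_neg_iff_add_eq_0 add.commute)

lemma e_sum: "e (sum f A) = (\<Sum>i\<in>A. e (f i))"
  by (induction A rule: infinite_finite_induct) (simp_all add: e_add)

lemma e_eq_iff [simp]: "e x = e y \<longleftrightarrow> x = y"
proof
  assume "e x = e y"
  then have "norm (e (x - y)) = 0" using e_add[of x "- y"] by (simp add: e_minus)
  then show "x = y" by simp
qed simp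

lemma e_eq_0_iff [simp]: "e x = 0 \<longleftrightarrow> x = 0"
  using e_eq_iff[of x 0] by (simp del: e_eq_iff)

lemma e_inverse: "e (inverse x) = inverse (e x)"
proof (cases "x = 0")
  case False
  have "e x * e (inverse x) = 1" using e_mult[of x "inverse x"] False by simp
  then show ?thesis by (rule inverse_unique[symmetric])
qed simp

lemma mat_map_mult: "mat_map e (A ** B) = mat_map e A ** mat_map e B"
  by (simp add: mat_map_def matrix_matrix_mult_def vec_eq_iff e_sum e_mult)

lemma mat_map_1 [simp]: "mat_map e (mat 1) = mat 1"
  by (simp add: mat_map_def vec_eq_iff mat_def)

lemma mat_map_adjoint: "mat_map e (adjoint_mat c A) = adjoint_mat quat_cnj (mat_map e A)"
  by (simp add: mat_map_def adjoint_mat_def vec_eq_iff e_c)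

lemma mat_map_lorentz: "mat_map e lorentz_form = lorentz_form"
  by (simp add: mat_map_def lorentz_form_def vec_eq_iff e_minus)

lemma mat_map_preserves_form: "preserves_form c A \<Longrightarrow> preserves_form quat_cnj (mat_map e A)"
  unfolding preserves_form_def by (metis mat_map_adjoint mat_map_lorentz mat_map_mult)

lemma mat_map_boost: "mat_map e (boost t) = a_mat t"
  by (simp add: mat_map_def boost_def a_mat_def boost_entry_def vec_eq_iff e_of_real)

lemma range_e_closed:
  assumes "x \<in> range e" "y \<in> range e"
  shows "x * y \<in> range e" "x + y \<in> range e" "quat_cnj x \<in> range e" "inverse x \<in> range e" "of_real r \<in> range e"
proof -
  obtain a b where ab: "x = e a" "y = e b" using assms by blast
  show "x * y \<in> range e" "x + y \<in> range e" "quat_cnj x \<in> range e" "inverse x \<in> range e"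
    unfolding ab e_mult[symmetric] e_add[symmetric] e_c[symmetric] e_inverse[symmetric] by (rule rangeI)+
  have "of_real r = e (of_real r)" by (simp add: e_of_real quat_of_real_def quat_of_real_eq)
  then show "of_real r \<in> range e" by blast
qed

end

interpretation emb_real: star_embedding "id :: real \<Rightarrow> real" quat_of_real
  by unfold_locales (simp_all add: quat_of_real_def quat_cnj_def plus_quat_def times_quat_def norm_quat_def inner_quat_def power2_eq_square[symmetric])

interpretation emb_complex: star_embedding cnj quat_of_complex
  by unfold_locales (simp_all add: quat_of_real_def quat_of_complex_def quat_cnj_def plus_quat_def times_quat_def norm_quat_def inner_quat_def
      norm_complex_def power2_eq_square)

lemma emb_quat: "star_embedding quat_cnj (\<lambda>x. x)"
  by unfold_locales (simp_all add: quat_of_real_eq quat_of_real_def)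

text \<open>
  The facts about each classical pair from which everything else follows: a group of
  form-preserving matrices containing the boosts, whose maximal compact subgroup is the stabiliser of
  the base point and acts transitively on the unit sphere of directions.
\<close>

locale hyp_base = star_embedding c e
  for c :: "'f::{real_normed_div_algebra, euclidean_space} \<Rightarrow> 'f" and e +
  fixes G0 K0 :: "('f, 'n::{finite,linorder}) sqmat set"
  assumes G0_1: "mat 1 \<in> G0" and G0_mult: "A \<in> G0 \<Longrightarrow> B \<in> G0 \<Longrightarrow> A ** B \<in> G0"
    and G0_inverse: "A \<in> G0 \<Longrightarrow> A ** B = mat 1 \<Longrightarrow> B ** A = mat 1 \<Longrightarrow> B \<in> G0"
    and G0_form: "A \<in> G0 \<Longrightarrow> preserves_form c A"
    and G0_boost: "boost t \<in> G0"
    and K0_eq: "K0 = {A \<in> G0. \<forall>i. i \<noteq> ix0 \<longrightarrow> A $ i $ ix0 = 0}"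
    and K0_transport: "norm \<theta> = 1 \<Longrightarrow> \<theta> $ ix0 = 0 \<Longrightarrow> \<exists>U\<in>K0. U $ ix0 $ ix0 = 1 \<and> (\<forall>i. U $ i $ ix1 = \<theta> $ i)"
begin

lemma group_facts:
  fixes G K
  defines "G \<equiv> mat_map e ` G0" and "K \<equiv> mat_map e ` K0"
  shows "mat 1 \<in> G" "\<And>A B. A \<in> G \<Longrightarrow> B \<in> G \<Longrightarrow> A ** B \<in> G"
    "\<And>A. A \<in> G \<Longrightarrow> \<exists>B\<in>G. A ** B = mat 1 \<and> B ** A = mat 1"
    "\<And>A. A \<in> G \<Longrightarrow> preserves_form quat_cnj A"
    "\<And>t. a_mat t \<in> G"
    "K = {A \<in> G. \<forall>i. i \<noteq> ix0 \<longrightarrow> A $ i $ ix0 = 0}"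
    "\<And>A i j. A \<in> G \<Longrightarrow> A $ i $ j \<in> range e"
    "\<And>\<theta>. norm \<theta> = 1 \<Longrightarrow> \<theta> $ ix0 = 0 \<Longrightarrow> (\<And>i. \<theta> $ i \<in> range e) \<Longrightarrow>
      \<exists>U\<in>K. U $ ix0 $ ix0 = 1 \<and> (\<forall>i. U $ i $ ix1 = \<theta> $ i)"
proof -
  show "mat 1 \<in> G" unfolding G_def using G0_1 by (metis image_eqI mat_map_1)
  show "A ** B \<in> G" if GG: "A \<in> G" "B \<in> G" for A B
  proof -
    obtain A0 B0 where AB: "A = mat_map e A0" "B = mat_map e B0" "A0 \<in> G0" "B0 \<in> G0"
      using GG unfolding G_def by blast
    have "A ** B = mat_map e (A0 ** B0)" by (simp only: AB mat_map_mult)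
    then show ?thesis using G0_mult[OF AB(3,4)] unfolding G_def by blast
  qed
  show "\<exists>B\<in>G. A ** B = mat 1 \<and> B ** A = mat 1" if A: "A \<in> G" for A
  proof -
    obtain A0 where A0: "A = mat_map e A0" "A0 \<in> G0" using A by (auto simp: G_def)
    define B0 where "B0 = lorentz_form ** adjoint_mat c A0 ** lorentz_form"
    have B0: "B0 ** A0 = mat 1" "A0 ** B0 = mat 1"
      unfolding B0_def using preserves_form_inverse[OF G0_form[OF A0(2)]] by blast+
    then have "B0 \<in> G0" using A0(2) by (intro G0_inverse[of A0 B0])
    then have "mat_map e B0 \<in> G" unfolding G_def by blast
    moreover have "A ** mat_map e B0 = mat 1" "mat_map e B0 ** A = mat 1"
      unfolding A0(1) mat_map_mult[symmetric] B0 by simp_all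
    ultimately show ?thesis by blast
  qed
  show "preserves_form quat_cnj A" if "A \<in> G" for A
    using that unfolding G_def by (blast intro: mat_map_preserves_form G0_form)
  show "a_mat t \<in> G" for t unfolding G_def mat_map_boost[symmetric] using G0_boost[of t] by blast
  have "mat_map e A $ i $ j = 0 \<longleftrightarrow> A $ i $ j = 0" for A :: "('f, 'n) sqmat" and i j
    by (simp add: mat_map_def)
  then show "K = {A \<in> G. \<forall>i. i \<noteq> ix0 \<longrightarrow> A $ i $ ix0 = 0}"
    unfolding K_def G_def K0_eq by auto
  show "A $ i $ j \<in> range e" if "A \<in> G" for A i j
    using that by (auto simp: G_def mat_map_def)
  show "\<exists>U\<in>K. U $ ix0 $ ix0 = 1 \<and> (\<forall>i. U $ i $ ix1 = \<theta> $ i)"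
    if \<theta>: "norm \<theta> = 1" "\<theta> $ ix0 = 0" "\<And>i. \<theta> $ i \<in> range e" for \<theta>
  proof -
    define \<theta>0 where "\<theta>0 = (\<chi> i. inv_into UNIV e (\<theta> $ i))"
    have e0: "e (\<theta>0 $ i) = \<theta> $ i" for i unfolding \<theta>0_def using \<theta>(3)[of i] by (simp add: f_inv_into_f)
    have "norm \<theta>0 = norm \<theta>" by (simp add: norm_vec_def flip: e0)
    moreover have "\<theta>0 $ ix0 = 0" using e0[of ix0] \<theta>(2) by simp
    ultimately have "\<exists>U\<in>K0. U $ ix0 $ ix0 = 1 \<and> (\<forall>i. U $ i $ ix1 = \<theta>0 $ i)"
      using \<theta>(1) by (intro K0_transport) simp_all
    then obtain U where U: "U \<in> K0" "U $ ix0 $ ix0 = 1" "\<And>i. U $ i $ ix1 = \<theta>0 $ i"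
      by blast
    show ?thesis
      by (rule bexI[of _ "mat_map e U"]) (use U in \<open>simp_all add: mat_map_def e0 K_def\<close>)
  qed
qed

end

lemma hyp_base_real:
  assumes ix: "ix0 \<noteq> (ix1 :: 'n::{finite,linorder})" and card: "CARD('n) \<ge> 3"
  shows "hyp_base id quat_of_real SO1o (K_SO :: (real, 'n) sqmat set)"
proof
  show form: "preserves_form id A" if "A \<in> SO1o" for A :: "(real, 'n) sqmat"
    using that SO1o_subset by (auto simp: SO1_def)
  show "boost t \<in> (SO1o :: (real, 'n) sqmat set)" for t
  proof (rule SO1oI)
    let ?S = "(boost :: real \<Rightarrow> (real, 'n) sqmat) ` UNIV"
    have "continuous_on UNIV (\<lambda>t. boost_entry t i (j::'n))" for i j
      unfolding boost_entry_def by (cases "i = j"; cases "i = ix0 \<or> i = ix1"; cases "{i, j} = {ix0, ix1}") (auto intro!: continuous_intros)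
    then have "continuous_on UNIV (boost :: real \<Rightarrow> (real, 'n) sqmat)"
      unfolding boost_def by (intro continuous_intros) simp
    then show "connected ?S" by (intro connected_continuous_image connected_UNIV)
    show "?S \<subseteq> SO1" using real_inv.boost_preserves_form[OF ix] det_boost[OF ix] by (auto simp: SO1_def)
    show "mat 1 \<in> ?S" unfolding boost_0[symmetric] by blast
    show "boost t \<in> ?S" by blast
  qed
  show "(K_SO :: (real, 'n) sqmat set) = {A \<in> SO1o. \<forall>i. i \<noteq> ix0 \<longrightarrow> A $ i $ ix0 = 0}" (is "?L = ?R")
  proof (intro set_eqI iffI)
    fix A :: "(real, 'n) sqmat" assume "A \<in> ?L"
    then have A: "block_diag A" "A $ ix0 $ ix0 = 1" "unitary_mat id A" "det A = 1" by (auto simp: K_SO_def)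
    then have z: "A $ i $ ix0 = (if i = ix0 then 1 else 0)" for i by (simp add: block_diag_def)
    then have "A \<in> SO1o" using orthogonal_in_SO1o[of A] A by blast
    then show "A \<in> ?R" using z by simp
  next
    fix A :: "(real, 'n) sqmat" assume A: "A \<in> ?R"
    then have z: "A $ i $ ix0 = 0" if "i \<noteq> ix0" for i using that by blast
    have "A \<in> SO1o" using A by blast
    note bd = real_inv.preserves_form_block_diag[OF form[OF this] z]
    have "A $ ix0 $ ix0 = 1" using bd(3) SO1o_entry_pos[OF \<open>A \<in> SO1o\<close>] by simp
    moreover have "det A = 1" using \<open>A \<in> SO1o\<close> SO1o_subset by (auto simp: SO1_def)
    ultimately show "A \<in> ?L" using bd by (simp add: K_SO_def)
  qed
  show "\<exists>U\<in>K_SO. U $ ix0 $ ix0 = 1 \<and> (\<forall>i. U $ i $ ix1 = \<theta> $ i)" if th: "norm \<theta> = 1" "\<theta> $ ix0 = 0" for \<theta> :: "(real, 'n) vec"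
  proof -
    obtain U :: "(real, 'n) sqmat" where U: "unitary_mat id U" "block_diag U" "U $ ix0 $ ix0 = 1" "det U = 1" "\<And>i. U $ i $ ix1 = \<theta> $ i"
      using special_unitary_transport[OF real_inv.involution_axioms th ix card] by blast
    then show ?thesis by (intro bexI[of _ U]) (simp_all add: K_SO_def)
  qed
qed (blast intro: one_in_SO1o SO1o_mult SO1o_inverse)+

lemma hyp_base_complex:
  assumes ix: "ix0 \<noteq> (ix1 :: 'n::{finite,linorder})" and card: "CARD('n) \<ge> 3"
  shows "hyp_base cnj quat_of_complex SU1 (K_SU :: (complex, 'n) sqmat set)"
proof
  show "mat 1 \<in> (SU1 :: (complex, 'n) sqmat set)" by (simp add: SU1_def complex_inv.preserves_form_1)
  show "A ** B \<in> SU1" if "A \<in> SU1" "B \<in> SU1" for A B :: "(complex, 'n) sqmat"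
    using that by (simp add: SU1_def det_mul complex_inv.preserves_form_mult)
  show "B \<in> SU1" if "A \<in> SU1" "A ** B = mat 1" "B ** A = mat 1" for A B :: "(complex, 'n) sqmat"
  proof -
    have "det A * det B = 1" using that(2) by (metis det_I det_mul)
    then show ?thesis using that complex_inv.preserves_form_left_inverse[of A B] by (simp add: SU1_def)
  qed
  show form: "preserves_form cnj A" if "A \<in> SU1" for A :: "(complex, 'n) sqmat"
    using that by (simp add: SU1_def)
  show "boost t \<in> (SU1 :: (complex, 'n) sqmat set)" for t
    by (simp add: SU1_def complex_inv.boost_preserves_form[OF ix] det_boost[OF ix])
  show "(K_SU :: (complex, 'n) sqmat set) = {A \<in> SU1. \<forall>i. i \<noteq> ix0 \<longrightarrow> A $ i $ ix0 = 0}" (is "?L = ?R")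
  proof (intro set_eqI iffI)
    fix A :: "(complex, 'n) sqmat" assume "A \<in> ?L"
    then have A: "block_diag A" "unitary_mat cnj A" "det A = 1" by (auto simp: K_SU_def)
    then show "A \<in> ?R" using complex_inv.block_diag_unitary_preserves_form[OF A(1,2)] by (simp add: SU1_def block_diag_def)
  next
    fix A :: "(complex, 'n) sqmat" assume A: "A \<in> ?R"
    then have z: "A $ i $ ix0 = 0" if "i \<noteq> ix0" for i using that by blast
    have A': "A \<in> SU1" using A by blast
    note bd = complex_inv.preserves_form_block_diag[OF form[OF A'] z]
    then show "A \<in> ?L" using A' by (simp add: K_SU_def SU1_def)
  qed
  show "\<exists>U\<in>K_SU. U $ ix0 $ ix0 = 1 \<and> (\<forall>i. U $ i $ ix1 = \<theta> $ i)" if th: "norm \<theta> = 1" "\<theta> $ ix0 = 0" for \<theta> :: "(complex, 'n) vec"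
  proof -
    obtain U :: "(complex, 'n) sqmat" where U: "unitary_mat cnj U" "block_diag U" "U $ ix0 $ ix0 = 1" "det U = 1" "\<And>i. U $ i $ ix1 = \<theta> $ i"
      using special_unitary_transport[OF complex_inv.involution_axioms th ix card] by blast
    then show ?thesis by (intro bexI[of _ U]) (simp_all add: K_SU_def)
  qed
qed

lemma hyp_base_quat:
  assumes ix: "ix0 \<noteq> (ix1 :: 'n::{finite,linorder})"
  shows "hyp_base quat_cnj (\<lambda>x. x) Sp1 (K_Sp :: (quat, 'n) sqmat set)"
proof (intro hyp_base.intro hyp_base_axioms.intro emb_quat)
  show "mat 1 \<in> (Sp1 :: (quat, 'n) sqmat set)" by (simp add: Sp1_def quat_inv.preserves_form_1)
  show "A ** B \<in> Sp1" if "A \<in> Sp1" "B \<in> Sp1" for A B :: "(quat, 'n) sqmat"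
    using that by (simp add: Sp1_def quat_inv.preserves_form_mult)
  show "B \<in> Sp1" if "A \<in> Sp1" "A ** B = mat 1" "B ** A = mat 1" for A B :: "(quat, 'n) sqmat"
    using that quat_inv.preserves_form_left_inverse[of A B] by (simp add: Sp1_def)
  show form: "preserves_form quat_cnj A" if "A \<in> Sp1" for A :: "(quat, 'n) sqmat"
    using that by (simp add: Sp1_def)
  show "boost t \<in> (Sp1 :: (quat, 'n) sqmat set)" for t
    by (simp add: Sp1_def quat_inv.boost_preserves_form[OF ix])
  show "(K_Sp :: (quat, 'n) sqmat set) = {A \<in> Sp1. \<forall>i. i \<noteq> ix0 \<longrightarrow> A $ i $ ix0 = 0}" (is "?L = ?R")
  proof (intro set_eqI iffI)
    fix A :: "(quat, 'n) sqmat" assume "A \<in> ?L"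
    then have A: "block_diag A" "unitary_mat quat_cnj A" by (auto simp: K_Sp_def)
    then show "A \<in> ?R" using quat_inv.block_diag_unitary_preserves_form[OF A] by (simp add: Sp1_def block_diag_def)
  next
    fix A :: "(quat, 'n) sqmat" assume A: "A \<in> ?R"
    then have z: "A $ i $ ix0 = 0" if "i \<noteq> ix0" for i using that by blast
    have A': "A \<in> Sp1" using A by blast
    note bd = quat_inv.preserves_form_block_diag[OF form[OF A'] z]
    then show "A \<in> ?L" by (simp add: K_Sp_def)
  qed
  show "\<exists>U\<in>K_Sp. U $ ix0 $ ix0 = 1 \<and> (\<forall>i. U $ i $ ix1 = \<theta> $ i)" if th: "norm \<theta> = 1" "\<theta> $ ix0 = 0" for \<theta> :: "(quat, 'n) vec"
  proof -
    obtain U :: "(quat, 'n) sqmat" where U: "unitary_mat quat_cnj U" "block_diag U" "U $ ix0 $ ix0 = 1" "\<And>i. U $ i $ ix1 = \<theta> $ i"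
      using quat_inv.unitary_transport[OF th ix] by blast
    then show ?thesis by (intro bexI[of _ U]) (simp_all add: K_Sp_def)
  qed
qed

text \<open>
  The copy of the base field inside the quaternions.
\<close>

fun base_elems :: "base_field \<Rightarrow> quat set" where
  "base_elems F_real = range quat_of_real"
| "base_elems F_complex = range quat_of_complex"
| "base_elems F_quat = UNIV"

lemma base_elems_closed:
  assumes "x \<in> base_elems F" "y \<in> base_elems F"
  shows "x * y \<in> base_elems F" "x + y \<in> base_elems F" "quat_cnj x \<in> base_elems F" "inverse x \<in> base_elems F" "of_real r \<in> base_elems F"
  using assms by (cases F; simp add: emb_real.range_e_closed emb_complex.range_e_closed)+

lemma ix0_neq_ix1:
  assumes "CARD('n) \<ge> 2" shows "ix0 \<noteq> (ix1 :: 'n::{finite,linorder})"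
proof
  assume e: "ix0 = (ix1 :: 'n)"
  have "x = ix0" for x :: 'n
  proof (rule antisym)
    show "x \<le> ix0" unfolding e by (simp add: ix1_def)
    show "ix0 \<le> x" by (simp add: ix0_def)
  qed
  then have "(UNIV :: 'n set) = {ix0}" by blast
  then have "CARD('n) = card {ix0 :: 'n}" by simp
  then show False using assms by simp
qed

section \<open>Common properties of the three pairs\<close>

text \<open>
  From here on the three cases are treated together, as groups of quaternionic matrices.
\<close>

locale hyp_groups =
  fixes F :: base_field and G K :: "(quat, 'n::{finite,linorder}) sqmat set"
  assumes card_n: "CARD('n) \<ge> 3" and G_def: "G = Ggrp F" and K_def: "K = Kgrp F"
begin

lemma ix01: "ix0 \<noteq> (ix1 :: 'n)"
  by (rule ix0_neq_ix1) (use card_n in simp)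

lemma group_facts:
  shows G_1: "mat 1 \<in> G" and G_mult: "\<And>A B. A \<in> G \<Longrightarrow> B \<in> G \<Longrightarrow> A ** B \<in> G"
    and G_inverse: "\<And>A. A \<in> G \<Longrightarrow> \<exists>B\<in>G. A ** B = mat 1 \<and> B ** A = mat 1"
    and G_form: "\<And>A. A \<in> G \<Longrightarrow> preserves_form quat_cnj A"
    and G_boost: "\<And>t. a_mat t \<in> G"
    and K_eq: "K = {A \<in> G. \<forall>i. i \<noteq> ix0 \<longrightarrow> A $ i $ ix0 = 0}"
    and G_entry: "\<And>A i j. A \<in> G \<Longrightarrow> A $ i $ j \<in> base_elems F"
    and K_transport: "\<And>\<theta>. norm \<theta> = 1 \<Longrightarrow> \<theta> $ ix0 = 0 \<Longrightarrow> (\<And>i. \<theta> $ i \<in> base_elems F) \<Longrightarrow>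
      \<exists>U\<in>K. U $ ix0 $ ix0 = 1 \<and> (\<forall>i. U $ i $ ix1 = \<theta> $ i)"
proof -
  consider "F = F_real" | "F = F_complex" | "F = F_quat" by (cases F) auto
  then have "mat 1 \<in> G \<and> (\<forall>A\<in>G. \<forall>B\<in>G. A ** B \<in> G) \<and> (\<forall>A\<in>G. \<exists>B\<in>G. A ** B = mat 1 \<and> B ** A = mat 1) \<and>
    (\<forall>A\<in>G. preserves_form quat_cnj A) \<and> (\<forall>t. a_mat t \<in> G) \<and> K = {A \<in> G. \<forall>i. i \<noteq> ix0 \<longrightarrow> A $ i $ ix0 = 0} \<and>
    (\<forall>A\<in>G. \<forall>i j. A $ i $ j \<in> base_elems F) \<and>
    (\<forall>\<theta>. norm \<theta> = 1 \<longrightarrow> \<theta> $ ix0 = 0 \<longrightarrow> (\<forall>i. \<theta> $ i \<in> base_elems F) \<longrightarrow> (\<exists>U\<in>K. U $ ix0 $ ix0 = 1 \<and> (\<forall>i. U $ i $ ix1 = \<theta> $ i)))"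
  proof cases
    case 1
    have GK: "G = mat_map quat_of_real ` SO1o" "K = mat_map quat_of_real ` K_SO" "base_elems F = range quat_of_real"
      by (simp_all add: G_def K_def 1)
    show ?thesis unfolding GK
      by (intro conjI allI ballI impI; rule hyp_base.group_facts[OF hyp_base_real[OF ix01 card_n]]; (assumption | blast))
  next
    case 2
    have GK: "G = mat_map quat_of_complex ` SU1" "K = mat_map quat_of_complex ` K_SU" "base_elems F = range quat_of_complex"
      by (simp_all add: G_def K_def 2)
    show ?thesis unfolding GK
      by (intro conjI allI ballI impI; rule hyp_base.group_facts[OF hyp_base_complex[OF ix01 card_n]]; (assumption | blast))
  next
    case 3
    have GK: "G = mat_map (\<lambda>x. x) ` Sp1" "K = mat_map (\<lambda>x. x) ` K_Sp" "base_elems F = range (\<lambda>x. x)"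
      by (simp_all add: G_def K_def 3 mat_map_def)
    show ?thesis unfolding GK
      by (intro conjI allI ballI impI; rule hyp_base.group_facts[OF hyp_base_quat[OF ix01]]; (assumption | blast))
  qed
  then show "mat 1 \<in> G" "\<And>A B. A \<in> G \<Longrightarrow> B \<in> G \<Longrightarrow> A ** B \<in> G"
    "\<And>A. A \<in> G \<Longrightarrow> \<exists>B\<in>G. A ** B = mat 1 \<and> B ** A = mat 1"
    "\<And>A. A \<in> G \<Longrightarrow> preserves_form quat_cnj A" "\<And>t. a_mat t \<in> G"
    "K = {A \<in> G. \<forall>i. i \<noteq> ix0 \<longrightarrow> A $ i $ ix0 = 0}"
    "\<And>A i j. A \<in> G \<Longrightarrow> A $ i $ j \<in> base_elems F"
    "\<And>\<theta>. norm \<theta> = 1 \<Longrightarrow> \<theta> $ ix0 = 0 \<Longrightarrow> (\<And>i. \<theta> $ i \<in> base_elems F) \<Longrightarrow>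
      \<exists>U\<in>K. U $ ix0 $ ix0 = 1 \<and> (\<forall>i. U $ i $ ix1 = \<theta> $ i)"
    by blast+
qed

end

context hyp_groups
begin

lemma KG: "h \<in> K \<Longrightarrow> h \<in> G"
  unfolding K_eq by blast

lemma K_col: "h \<in> K \<Longrightarrow> i \<noteq> ix0 \<Longrightarrow> h $ i $ ix0 = 0"
  unfolding K_eq by blast

lemma K_block:
  assumes "h \<in> K"
  shows "block_diag h" "unitary_mat quat_cnj h" "norm (h $ ix0 $ ix0) = 1"
  using quat_inv.preserves_form_block_diag[OF G_form[OF KG[OF assms]] K_col[OF assms]] by blast+

lemma K_row: "h \<in> K \<Longrightarrow> i \<noteq> ix0 \<Longrightarrow> h $ ix0 $ i = 0"
  using K_block(1) unfolding block_diag_def by blast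

lemma K_I: "h \<in> G \<Longrightarrow> (\<And>i. i \<noteq> ix0 \<Longrightarrow> h $ i $ ix0 = 0) \<Longrightarrow> h \<in> K"
  unfolding K_eq by blast

lemma mult_col0:
  fixes g h :: "(quat, 'n) sqmat"
  assumes "\<And>i. i \<noteq> ix0 \<Longrightarrow> h $ i $ ix0 = 0"
  shows "(g ** h) $ i $ ix0 = g $ i $ ix0 * h $ ix0 $ ix0"
proof -
  have "(g ** h) $ i $ ix0 = (\<Sum>l\<in>UNIV. g $ i $ l * h $ l $ ix0)" by (simp add: matrix_matrix_mult_def)
  also have "\<dots> = (\<Sum>l\<in>(UNIV::'n set). if l = ix0 then g $ i $ ix0 * h $ ix0 $ ix0 else 0)"
    by (rule sum.cong) (simp_all add: assms)
  finally show ?thesis by simp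
qed

lemma mult_K_col0: "h \<in> K \<Longrightarrow> ((g :: (quat, 'n) sqmat) ** h) $ i $ ix0 = g $ i $ ix0 * h $ ix0 $ ix0"
  using mult_col0[of h g i] K_col[of h] by simp

lemma K_mult_row0:
  assumes "h \<in> K" shows "(h ** (g :: (quat, 'n) sqmat)) $ ix0 $ j = h $ ix0 $ ix0 * g $ ix0 $ j"
proof -
  have "(h ** g) $ ix0 $ j = (\<Sum>l\<in>UNIV. h $ ix0 $ l * g $ l $ j)" by (simp add: matrix_matrix_mult_def)
  also have "\<dots> = (\<Sum>l\<in>(UNIV::'n set). if l = ix0 then h $ ix0 $ ix0 * g $ ix0 $ j else 0)"
    by (rule sum.cong) (simp_all add: K_row[OF assms])
  finally show ?thesis by simp
qed

lemma K_1: "mat 1 \<in> K"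
  by (rule K_I[OF G_1]) (simp add: mat_def)

lemma K_mult:
  assumes "g \<in> K" "h \<in> K" shows "g ** h \<in> K"
  by (rule K_I) (use assms K_col in \<open>simp_all add: G_mult KG mult_K_col0\<close>)

lemma K_inverse:
  assumes h: "h \<in> K" shows "\<exists>B\<in>K. h ** B = mat 1 \<and> B ** h = mat 1"
proof -
  obtain B where B: "B \<in> G" "h ** B = mat 1" "B ** h = mat 1" using G_inverse[OF KG[OF h]] by blast
  have "B \<in> K"
  proof (rule K_I[OF B(1)])
    fix i :: 'n assume i: "i \<noteq> ix0"
    have "B $ i $ ix0 * h $ ix0 $ ix0 = 0" using mult_K_col0[OF h, of B i] i by (simp add: B(3) mat_def)
    moreover have "h $ ix0 $ ix0 \<noteq> 0" using K_block(3)[OF h] by auto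
    ultimately show "B $ i $ ix0 = 0" by simp
  qed
  then show ?thesis using B by blast
qed

lemma lcoset_eq: "lcoset F g = (\<lambda>h. g ** h) ` K"
  by (simp add: lcoset_def K_def)

lemma lcoset_self: "g \<in> lcoset F (g :: (quat, 'n) sqmat)"
  unfolding lcoset_eq using K_1 by (metis image_eqI matrix_mul_rid)

lemma lcoset_mult_K:
  assumes h: "h \<in> K" shows "lcoset F (g ** h) = lcoset F g"
proof -
  obtain B where B: "B \<in> K" "h ** B = mat 1" using K_inverse[OF h] by blast
  show ?thesis
  proof (intro set_eqI iffI)
    fix x assume "x \<in> lcoset F (g ** h)"
    then obtain k where "k \<in> K" "x = g ** (h ** k)" by (auto simp: lcoset_eq matrix_mul_assoc)
    then show "x \<in> lcoset F g" using K_mult[OF h] by (auto simp: lcoset_eq)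
  next
    fix x assume "x \<in> lcoset F g"
    then obtain k where k: "k \<in> K" "x = g ** k" by (auto simp: lcoset_eq)
    then have "x = (g ** h) ** (B ** k)" by (simp add: matrix_mul_assoc[symmetric]) (simp add: matrix_mul_assoc B(2))
    then show "x \<in> lcoset F (g ** h)" using K_mult[OF B(1) k(1)] by (auto simp: lcoset_eq)
  qed
qed

lemma lcoset_subset_G: "g \<in> G \<Longrightarrow> lcoset F g \<subseteq> G"
  unfolding lcoset_eq using G_mult KG by blast

lemma in_lcosetD: "x \<in> lcoset F (g :: (quat, 'n) sqmat) \<Longrightarrow> \<exists>h\<in>K. x = g ** h"
  unfolding lcoset_eq by blast

lemma hyp_space_cases:
  fixes x :: "(quat, 'n) sqmat set"
  assumes "x \<in> hyp_space F" obtains g where "g \<in> G" "x = lcoset F g"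
  using assms by (auto simp: hyp_space_def G_def)

lemma lcoset_in_hyp_space: "g \<in> G \<Longrightarrow> lcoset F g \<in> hyp_space F"
  by (auto simp: hyp_space_def G_def)

lemma hyp_act_lcoset: "hyp_act g (lcoset F h) = lcoset F (g ** (h :: (quat, 'n) sqmat))"
  by (simp add: hyp_act_def lcoset_eq image_image matrix_mul_assoc)

lemma hyp_origin_eq: "hyp_origin F = lcoset F (mat 1 :: (quat, 'n) sqmat)"
  by (simp add: hyp_origin_def)

lemma norm_col0:
  assumes g: "g \<in> G"
  shows "(norm (g $ ix0 $ ix0))\<^sup>2 = 1 + (\<Sum>l\<in>-{ix0}. (norm (g $ l $ ix0))\<^sup>2)"
proof -
  have "of_real ((norm (g $ ix0 $ ix0))\<^sup>2) - (\<Sum>l\<in>-{ix0}. of_real ((norm (g $ l $ ix0))\<^sup>2)) = (1::quat)"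
    using quat_inv.preserves_form_entry[OF G_form[OF g], of ix0 ix0]
    unfolding quat_inv.c_norm by (simp add: lorentz_form_def)
  then have "of_real ((norm (g $ ix0 $ ix0))\<^sup>2 - (\<Sum>l\<in>-{ix0}. (norm (g $ l $ ix0))\<^sup>2)) = (of_real 1::quat)"
    by simp
  then have "(norm (g $ ix0 $ ix0))\<^sup>2 - (\<Sum>l\<in>-{ix0}. (norm (g $ l $ ix0))\<^sup>2) = 1"
    by (simp only: of_real_eq_iff)
  then show ?thesis by simp
qed

lemma norm_00_ge_1:
  assumes "g \<in> G" shows "norm (g $ ix0 $ ix0) \<ge> 1"
proof -
  have "(norm (g $ ix0 $ ix0))\<^sup>2 \<ge> 1\<^sup>2" unfolding norm_col0[OF assms] by (simp add: sum_nonneg)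
  then show ?thesis by (rule power2_le_imp_le) simp
qed

section \<open>Cartan decomposition and distance\<close>

definition rad :: "(quat, 'n) sqmat \<Rightarrow> real" where
  "rad g = arcosh (norm (g $ ix0 $ ix0))"

lemma rad:
  assumes g: "g \<in> G"
  shows "rad g \<ge> 0" "cosh (rad g) = norm (g $ ix0 $ ix0)" "sinh (rad g) = sqrt (\<Sum>l\<in>-{ix0}. (norm (g $ l $ ix0))\<^sup>2)"
proof -
  show 1: "rad g \<ge> 0" "cosh (rad g) = norm (g $ ix0 $ ix0)"
    using norm_00_ge_1[OF g] by (simp_all add: rad_def arcosh_nonneg_real)
  have "(sinh (rad g))\<^sup>2 = (\<Sum>l\<in>-{ix0}. (norm (g $ l $ ix0))\<^sup>2)"
    unfolding sinh_square_eq 1(2) norm_col0[OF g] by simp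
  moreover have "sinh (rad g) \<ge> 0" using 1(1) by simp
  ultimately show "sinh (rad g) = sqrt (\<Sum>l\<in>-{ix0}. (norm (g $ l $ ix0))\<^sup>2)"
    by (metis real_sqrt_unique)
qed

text \<open>
  The first column of \<open>g\<close>, which represents the point \<open>g K\<close>, has the polar form \<open>(cosh t, sinh t \<theta>)\<close>
  after multiplication by a unit scalar on the right, and by transitivity \<open>\<theta>\<close> is a column of an
  element of \<open>K\<close>.
\<close>

lemma direction:
  assumes g: "g \<in> G"
  obtains k l where "k \<in> K" "k $ ix0 $ ix0 = 1" "norm l = 1" "g $ ix0 $ ix0 * l = of_real (cosh (rad g))"
    "\<And>i. i \<noteq> ix0 \<Longrightarrow> g $ i $ ix0 * l = of_real (sinh (rad g)) * k $ i $ ix1"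
proof -
  let ?p = "g $ ix0 $ ix0" and ?s = "sinh (rad g)"
  define l where "l = inverse ?p * of_real (norm ?p)"
  have p: "?p \<noteq> 0" using norm_00_ge_1[OF g] by auto
  have l: "norm l = 1" using p by (simp add: l_def norm_mult norm_inverse)
  have pl: "?p * l = of_real (cosh (rad g))" using p by (simp add: l_def rad(2)[OF g] mult.assoc[symmetric])
  have lF: "l \<in> base_elems F" unfolding l_def using G_entry[OF g] by (intro base_elems_closed(1,4,5)) auto
  have s2: "?s\<^sup>2 = (\<Sum>l\<in>-{ix0}. (norm (g $ l $ ix0))\<^sup>2)" unfolding rad(3)[OF g] by (simp add: sum_nonneg)
  show ?thesis
  proof (cases "?s = 0")
    case True
    then have "g $ i $ ix0 = 0" if "i \<noteq> ix0" for i
      using s2 that by (simp add: sum_nonneg_eq_0_iff)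
    then show ?thesis
      by (intro that[OF K_1 _ l pl]) (simp_all add: True mat_def)
  next
    case False
    define \<theta> where "\<theta> = (\<chi> i. if i = ix0 then 0 else of_real (1 / ?s) * (g $ i $ ix0 * l))"
    have "(\<Sum>i\<in>UNIV. (norm (\<theta> $ i))\<^sup>2) = (\<Sum>i\<in>-{ix0}. (norm (g $ i $ ix0))\<^sup>2 / ?s\<^sup>2)"
    proof -
      have "(\<Sum>i\<in>UNIV. (norm (\<theta> $ i))\<^sup>2) = (\<Sum>i\<in>-{ix0}. (norm (\<theta> $ i))\<^sup>2)"
        by (rule sum.mono_neutral_right) (auto simp: \<theta>_def)
      also have "\<dots> = (\<Sum>i\<in>-{ix0}. (norm (g $ i $ ix0))\<^sup>2 / ?s\<^sup>2)"
        by (intro sum.cong refl) (simp add: \<theta>_def norm_mult l power_divide power_mult_distrib del: of_real_divide)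
      finally show ?thesis .
    qed
    also have "\<dots> = 1" using False unfolding sum_divide_distrib[symmetric] s2[symmetric] by simp
    finally have n: "norm \<theta> = 1" by (simp add: norm_vec_def L2_set_def)
    have "\<theta> $ i \<in> base_elems F" for i
    proof (cases "i = ix0")
      case True
      have "of_real 0 \<in> base_elems F" by (rule base_elems_closed(5)[OF lF lF])
      then show ?thesis using True by (simp add: \<theta>_def)
    next
      case False
      have "of_real (1 / ?s) * (g $ i $ ix0 * l) \<in> base_elems F"
        by (intro base_elems_closed(1) base_elems_closed(5)[OF lF lF] G_entry g lF)
      then show ?thesis using False by (simp add: \<theta>_def)
    qed
    then obtain k where k: "k \<in> K" "k $ ix0 $ ix0 = 1" "\<And>i. k $ i $ ix1 = \<theta> $ i"
      using K_transport[OF n] by (auto simp: \<theta>_def)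
    show ?thesis
    proof (rule that[OF k(1,2) l pl])
      fix i :: 'n assume "i \<noteq> ix0"
      then have "of_real ?s * k $ i $ ix1 = of_real ?s * (of_real (1 / ?s) * (g $ i $ ix0 * l))"
        by (simp add: k(3) \<theta>_def)
      also have "\<dots> = of_real (?s * (1 / ?s)) * (g $ i $ ix0 * l)"
        by (simp only: of_real_mult mult.assoc)
      also have "?s * (1 / ?s) = 1" using False by simp
      finally show "g $ i $ ix0 * l = of_real ?s * k $ i $ ix1" by simp
    qed
  qed
qed

lemma a_mat_entries:
  "a_mat t $ ix0 $ ix0 = of_real (cosh t)" "a_mat t $ (ix1::'n) $ ix0 = of_real (sinh t)"
  "i \<noteq> ix0 \<Longrightarrow> i \<noteq> ix1 \<Longrightarrow> a_mat t $ i $ (ix0::'n) = 0"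
  using ix01 by (auto simp: a_mat_def quat_of_real_def quat_of_real_eq zero_quat_def doubleton_eq_iff)

text \<open>
  If \<open>k1\<close> moves the standard direction to the direction of \<open>g K\<close>, then \<open>a_t^-1 k1^-1 g\<close> fixes
  the base point and thus lies in \<open>K\<close>.
\<close>

lemma KAK:
  assumes g: "g \<in> G"
  obtains k1 k2 where "k1 \<in> K" "k2 \<in> K" "g = k1 ** a_mat (rad g) ** k2"
proof -
  obtain k l where k: "k \<in> K" "k $ ix0 $ ix0 = 1" and l: "norm l = 1" and
    gl: "g $ ix0 $ ix0 * l = of_real (cosh (rad g))"
    "\<And>i. i \<noteq> ix0 \<Longrightarrow> g $ i $ ix0 * l = of_real (sinh (rad g)) * k $ i $ ix1"
    using direction[OF g] by blast
  define w where "w = k ** a_mat (rad g)"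
  have wG: "w \<in> G" unfolding w_def by (intro G_mult KG k(1) G_boost)
  have wcol: "w $ i $ ix0 = g $ i $ ix0 * l" for i
  proof -
    have "w $ i $ ix0 = (\<Sum>j\<in>UNIV. k $ i $ j * a_mat (rad g) $ j $ ix0)" by (simp add: w_def matrix_matrix_mult_def)
    also have "\<dots> = (\<Sum>j\<in>{ix0, ix1}. k $ i $ j * a_mat (rad g) $ j $ ix0)"
      by (rule sum.mono_neutral_right) (auto simp: a_mat_entries(3))
    also have "\<dots> = k $ i $ ix0 * of_real (cosh (rad g)) + k $ i $ ix1 * of_real (sinh (rad g))"
      using ix01 by (simp add: a_mat_entries)
    also have "\<dots> = g $ i $ ix0 * l"
    proof (cases "i = ix0")
      case True then show ?thesis using k(2) gl(1) K_row[OF k(1), of ix1] ix01 by simp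
    next
      case False
      have "k $ i $ ix1 * of_real (sinh (rad g)) = of_real (sinh (rad g)) * k $ i $ ix1"
        by (simp add: scaleR_conv_of_real[symmetric]) (metis mult_scaleR_right mult.right_neutral of_real_def)
      then show ?thesis using False gl(2)[OF False] K_col[OF k(1) False] by simp
    qed
    finally show ?thesis .
  qed
  obtain w' where w': "w' \<in> G" "w ** w' = mat 1" "w' ** w = mat 1" using G_inverse[OF wG] by blast
  have "w' ** g \<in> K"
  proof (rule K_I)
    show "w' ** g \<in> G" using G_mult w'(1) g by blast
    fix i :: 'n assume i: "i \<noteq> ix0"
    have l0: "l \<noteq> 0" using l by auto
    have "(w' ** g) $ i $ ix0 * l = (\<Sum>j\<in>UNIV. w' $ i $ j * (g $ j $ ix0 * l))"
      by (simp add: matrix_matrix_mult_def sum_distrib_right mult.assoc)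
    also have "\<dots> = (w' ** w) $ i $ ix0" by (simp only: wcol[symmetric]) (simp add: matrix_matrix_mult_def)
    also have "\<dots> = 0" using i by (simp add: w'(3) mat_def)
    finally show "(w' ** g) $ i $ ix0 = 0" using l0 by simp
  qed
  moreover have "g = k ** a_mat (rad g) ** (w' ** g)"
    unfolding w_def[symmetric] by (simp add: matrix_mul_assoc w'(2))
  ultimately show ?thesis using that k(1) by blast
qed

lemma dcoset_eq: "dcoset F g = {h1 ** g ** h2 | h1 h2. h1 \<in> K \<and> h2 \<in> K}"
  by (simp add: dcoset_def K_def)

lemma dcoset_self: "g \<in> dcoset F (g :: (quat, 'n) sqmat)"
proof -
  have "g = mat 1 ** g ** mat 1" by simp
  then show ?thesis unfolding dcoset_eq using K_1 by blast
qed

lemma dcoset_mult_subset: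
  assumes "h1 \<in> K" "h2 \<in> K" shows "dcoset F (h1 ** g ** h2) \<subseteq> dcoset F g"
proof
  fix x assume "x \<in> dcoset F (h1 ** g ** h2)"
  then obtain a b where ab: "a \<in> K" "b \<in> K" "x = a ** (h1 ** g ** h2) ** b" by (auto simp: dcoset_eq)
  then have "x = (a ** h1) ** g ** (h2 ** b)" by (simp add: matrix_mul_assoc)
  then show "x \<in> dcoset F g" using K_mult[OF ab(1) assms(1)] K_mult[OF assms(2) ab(2)] unfolding dcoset_eq by blast
qed

lemma dcoset_mult:
  assumes "h1 \<in> K" "h2 \<in> K" shows "dcoset F (h1 ** g ** h2) = dcoset F g"
proof
  obtain b1 b2 where b: "b1 \<in> K" "b1 ** h1 = mat 1" "b2 \<in> K" "h2 ** b2 = mat 1"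
    using K_inverse[OF assms(1)] K_inverse[OF assms(2)] by blast
  have "b1 ** (h1 ** g ** h2) ** b2 = (b1 ** h1) ** g ** (h2 ** b2)" by (simp only: matrix_mul_assoc)
  then have "b1 ** (h1 ** g ** h2) ** b2 = g" by (simp add: b)
  then show "dcoset F g \<subseteq> dcoset F (h1 ** g ** h2)" using dcoset_mult_subset[OF b(1,3), of "h1 ** g ** h2"] by simp
qed (rule dcoset_mult_subset[OF assms])

lemma dcoset_norm_00:
  assumes "x \<in> dcoset F (g :: (quat, 'n) sqmat)" shows "norm (x $ ix0 $ ix0) = norm (g $ ix0 $ ix0)"
proof -
  obtain a b where ab: "a \<in> K" "b \<in> K" "x = a ** g ** b" using assms by (auto simp: dcoset_eq)
  show ?thesis unfolding ab(3) mult_K_col0[OF ab(2)] K_mult_row0[OF ab(1)]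
    by (simp add: norm_mult K_block(3)[OF ab(1)] K_block(3)[OF ab(2)])
qed

text \<open>
  The double coset of \<open>g\<close> is determined by \<open>|g_00|\<close>, which is invariant under \<open>K\<close> on both sides
  and equals \<open>cosh t\<close> for \<open>a_t\<close>; so the distance is defined and given by the area hyperbolic cosine.
\<close>

lemma hyp_dist_lcoset:
  assumes g: "g \<in> G" and h: "h \<in> G" and h': "h ** h' = mat 1" "h' ** h = mat 1"
  shows "hyp_dist F (lcoset F g) (lcoset F h) = rad (h' ** g)"
proof -
  have h'G: "h' \<in> G"
  proof -
    obtain B where B: "B \<in> G" "h ** B = mat 1" using G_inverse[OF h] by blast
    have "h' = h' ** (h ** B)" using B(2) by simp
    also have "\<dots> = B" by (simp add: matrix_mul_assoc h')
    finally show ?thesis using B(1) by simp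
  qed
  have m: "h' ** g \<in> G" using G_mult h'G g by blast
  show ?thesis
    unfolding hyp_dist_def
  proof (rule the_equality)
    have "dcoset F (matrix_inv h ** g) = dcoset F (a_mat (rad (h' ** g)))"
    proof -
      obtain k1 k2 where k: "k1 \<in> K" "k2 \<in> K" "h' ** g = k1 ** a_mat (rad (h' ** g)) ** k2" using KAK[OF m] by blast
      have "dcoset F (h' ** g) = dcoset F (a_mat (rad (h' ** g)))" by (subst k(3)) (rule dcoset_mult[OF k(1,2)])
      then show ?thesis by (simp add: matrix_inv_eqI[OF h'])
    qed
    then show "0 \<le> rad (h' ** g) \<and> (\<exists>x\<in>Ggrp F. \<exists>y\<in>Ggrp F. lcoset F g = lcoset F x \<and> lcoset F h = lcoset F y \<and>
       dcoset F (matrix_inv y ** x) = dcoset F (a_mat (rad (h' ** g))))"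
      using rad(1)[OF m] g h unfolding G_def by blast
  next
    fix t assume "0 \<le> t \<and> (\<exists>x\<in>Ggrp F. \<exists>y\<in>Ggrp F. lcoset F g = lcoset F x \<and> lcoset F h = lcoset F y \<and>
       dcoset F (matrix_inv y ** x) = dcoset F (a_mat t))"
    then obtain x y where t: "0 \<le> t" and xy: "x \<in> G" "y \<in> G" "lcoset F g = lcoset F x" "lcoset F h = lcoset F y"
       and d: "dcoset F (matrix_inv y ** x) = dcoset F (a_mat t)" unfolding G_def by blast
    have "x \<in> lcoset F g" "y \<in> lcoset F h" using lcoset_self[of x] lcoset_self[of y] xy(3,4) by simp_all
    then obtain a b where ab: "a \<in> K" "x = g ** a" "b \<in> K" "y = h ** b" using in_lcosetD by blast
    obtain b' where b': "b' \<in> K" "b ** b' = mat 1" "b' ** b = mat 1" using K_inverse[OF ab(3)] by blast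
    have "y ** (b' ** h') = h ** (b ** b') ** h'" "(b' ** h') ** y = b' ** (h' ** h) ** b" unfolding ab(4) by (simp_all only: matrix_mul_assoc)
    then have "y ** (b' ** h') = mat 1" "(b' ** h') ** y = mat 1" using b' h' by simp_all
    then have "matrix_inv y = b' ** h'" by (rule matrix_inv_eqI)
    then have "matrix_inv y ** x = b' ** (h' ** g) ** a" unfolding ab(2) by (simp only: matrix_mul_assoc)
    then have "dcoset F (h' ** g) = dcoset F (a_mat t)" using d dcoset_mult[OF b'(1) ab(1)] by simp
    then have "h' ** g \<in> dcoset F (a_mat t)" using dcoset_self by blast
    then have "norm ((h' ** g) $ ix0 $ ix0) = cosh t" using dcoset_norm_00 by (simp add: a_mat_entries)
    then show "t = rad (h' ** g)" using t by (simp add: rad_def arcosh_cosh_real)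
  qed
qed

lemma hyp_dist_to_origin: "g \<in> G \<Longrightarrow> hyp_dist F (lcoset F g) (hyp_origin F) = rad g"
  unfolding hyp_origin_eq using hyp_dist_lcoset[OF _ G_1, of g "mat 1"] by simp

lemma hyp_dist_from_origin:
  assumes g: "g \<in> G" shows "hyp_dist F (hyp_origin F) (lcoset F g) = rad g"
proof -
  note inv = quat_inv.preserves_form_inverse[OF G_form[OF g]]
  let ?g' = "lorentz_form ** adjoint_mat quat_cnj g ** lorentz_form"
  have "hyp_dist F (hyp_origin F) (lcoset F g) = rad (?g' ** mat 1)"
    unfolding hyp_origin_eq by (rule hyp_dist_lcoset[OF G_1 g inv(2,1)])
  also have "\<dots> = rad g"
    by (simp add: rad_def lorentz_form_mult_left lorentz_form_mult_right adjoint_mat_def)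
  finally show ?thesis .
qed

section \<open>The Busemann function\<close>

text \<open>
  The exponential of the Busemann function of the boundary point with coordinates
  \<open>(1, 0, \<dots>, 0, -1)\<close>: the modulus of the form between that point and the first column of \<open>g\<close>.
\<close>

definition busn :: "(quat, 'n) sqmat \<Rightarrow> real" where
  "busn g = norm (g $ ix0 $ ix0 + g $ ix1 $ ix0)"

lemma norm_10_le:
  assumes g: "g \<in> G" and i: "i \<noteq> ix0" shows "norm (g $ i $ ix0) \<le> sinh (rad g)"
proof -
  have "(norm (g $ i $ ix0))\<^sup>2 \<le> (\<Sum>l\<in>-{ix0}. (norm (g $ l $ ix0))\<^sup>2)"
    using i by (intro member_le_sum) auto
  then show ?thesis unfolding rad(3)[OF g] by (rule real_le_rsqrt)
qed

lemma busn_bounds: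
  assumes g: "g \<in> G" shows "exp (- rad g) \<le> busn g" "busn g \<le> exp (rad g)"
proof -
  have 1: "norm (g $ ix1 $ ix0) \<le> sinh (rad g)" using norm_10_le[OF g] ix01 by metis
  have "busn g \<le> norm (g $ ix0 $ ix0) + norm (g $ ix1 $ ix0)" unfolding busn_def by (rule norm_triangle_ineq)
  also have "\<dots> \<le> cosh (rad g) + sinh (rad g)" using 1 rad(2)[OF g] by simp
  finally show "busn g \<le> exp (rad g)" by (simp add: cosh_plus_sinh)
  have "cosh (rad g) - sinh (rad g) \<le> norm (g $ ix0 $ ix0) - norm (g $ ix1 $ ix0)" using 1 rad(2)[OF g] by simp
  also have "\<dots> \<le> busn g" unfolding busn_def by (rule norm_diff_ineq)
  finally show "exp (- rad g) \<le> busn g" by (simp add: cosh_minus_sinh)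
qed

lemma busn_pos: "g \<in> G \<Longrightarrow> busn g > 0"
  using busn_bounds(1) exp_gt_zero by (rule order.strict_trans2[rotated])

lemma busn_mult_K: "h \<in> K \<Longrightarrow> busn (g ** h) = busn g"
  by (simp add: busn_def mult_K_col0 distrib_right[symmetric] norm_mult K_block(3))

text \<open>
  The row vector \<open>g_0j + g_1j\<close> of an element of the group is isotropic. By transitivity it can be
  rotated by \<open>u \<in> K\<close> into a multiple of \<open>(1, 0, \<dots>, 0, 1)\<close>, and then the functional
  \<open>y \<mapsto> y_00 + y_10\<close> is reproduced up to the factor \<open>busn h\<close>. Since \<open>h u\<close> and \<open>h\<close> represent the same
  point, every point of the space has a representative for which the Busemann function is additive.
\<close>

lemma busemann_cocycle:
  assumes h: "h \<in> G"
  obtains u where "u \<in> K" "\<And>y. busn ((h ** u) ** y) = busn h * busn y"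
proof -
  define r where "r i = h $ ix0 $ i + h $ ix1 $ i" for i
  have hform: "(h ** lorentz_form ** adjoint_mat quat_cnj h) $ a $ b = lorentz_form $ a $ b" for a b
    using quat_inv.preserves_form_adjoint[OF G_form[OF h]] by simp
  have ent: "(\<Sum>i\<in>UNIV. (if i = ix0 then h $ a $ i else - (h $ a $ i)) * quat_cnj (h $ b $ i)) = lorentz_form $ a $ b" for a b
  proof -
    have "(h ** lorentz_form ** adjoint_mat quat_cnj h) $ a $ b = (\<Sum>i\<in>UNIV. (h ** lorentz_form) $ a $ i * adjoint_mat quat_cnj h $ i $ b)"
      by (subst matrix_matrix_mult_def) simp
    then show ?thesis using hform[of a b] by (simp add: lorentz_form_mult_right adjoint_mat_def)
  qed
  have "(\<Sum>i\<in>UNIV. (if i = ix0 then r i else - r i) * quat_cnj (r i)) =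
     (\<Sum>i\<in>UNIV. (if i = ix0 then h $ ix0 $ i else - (h $ ix0 $ i)) * quat_cnj (h $ ix0 $ i)
      + (if i = ix0 then h $ ix0 $ i else - (h $ ix0 $ i)) * quat_cnj (h $ ix1 $ i)
      + (if i = ix0 then h $ ix1 $ i else - (h $ ix1 $ i)) * quat_cnj (h $ ix0 $ i)
      + (if i = ix0 then h $ ix1 $ i else - (h $ ix1 $ i)) * quat_cnj (h $ ix1 $ i))"
    by (intro sum.cong refl) (simp add: r_def quat_inv.c_add algebra_simps)
  also have "\<dots> = 0" unfolding sum.distrib ent using ix01 by (simp add: lorentz_form_def)
  finally have null0: "(\<Sum>i\<in>UNIV. (if i = ix0 then r i else - r i) * quat_cnj (r i)) = 0" .
  have "(\<Sum>i\<in>UNIV. (if i = ix0 then r i else - r i) * quat_cnj (r i)) = of_real ((norm (r ix0))\<^sup>2 - (\<Sum>i\<in>-{ix0}. (norm (r i))\<^sup>2))"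
  proof -
    have "(\<Sum>i\<in>UNIV. (if i = ix0 then r i else - r i) * quat_cnj (r i)) = (\<Sum>i\<in>insert ix0 (-{ix0}). if i = ix0 then of_real ((norm (r i))\<^sup>2) else - of_real ((norm (r i))\<^sup>2))"
      by (intro sum.cong) (auto simp: quat_inv.c_norm')
    also have "\<dots> = of_real ((norm (r ix0))\<^sup>2) + (\<Sum>i\<in>-{ix0}. - of_real ((norm (r i))\<^sup>2))"
      by (subst sum.insert) (auto intro!: sum.cong)
    finally show ?thesis by (simp add: sum_negf)
  qed
  then have "of_real ((norm (r ix0))\<^sup>2 - (\<Sum>i\<in>-{ix0}. (norm (r i))\<^sup>2)) = (of_real 0 :: quat)"
    unfolding null0 by (simp only: of_real_0)
  then have "(norm (r ix0))\<^sup>2 - (\<Sum>i\<in>-{ix0}. (norm (r i))\<^sup>2) = 0" by (simp only: of_real_eq_iff)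
  then have null: "(norm (r ix0))\<^sup>2 = (\<Sum>i\<in>-{ix0}. (norm (r i))\<^sup>2)" by simp
  have r0: "r ix0 \<noteq> 0"
  proof
    assume z: "r ix0 = 0"
    then have "r i = 0" for i
      using null by (cases "i = ix0") (simp_all add: sum_nonneg_eq_0_iff)
    then have e: "h $ ix1 $ i = - (h $ ix0 $ i)" for i by (simp add: r_def add_eq_0_iff)
    have "(\<Sum>i\<in>UNIV. (if i = ix0 then h $ ix0 $ i else - (h $ ix0 $ i)) * quat_cnj (h $ ix1 $ i)) =
      - (\<Sum>i\<in>UNIV. (if i = ix0 then h $ ix0 $ i else - (h $ ix0 $ i)) * quat_cnj (h $ ix0 $ i))"
      unfolding sum_negf[symmetric] by (intro sum.cong refl) (simp add: e quat_inv.c_minus)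
    then show False unfolding ent using ix01 by (simp add: lorentz_form_def)
  qed
  define w where "w = (\<chi> i. if i = ix0 then 0 else quat_cnj (inverse (r ix0) * r i))"
  have rF: "r i \<in> base_elems F" for i unfolding r_def by (intro base_elems_closed(2) G_entry h)
  have "(\<Sum>i\<in>UNIV. (norm (w $ i))\<^sup>2) = (\<Sum>i\<in>-{ix0}. (norm (w $ i))\<^sup>2)"
    by (rule sum.mono_neutral_right) (auto simp: w_def)
  also have "\<dots> = (\<Sum>i\<in>-{ix0}. (norm (r i))\<^sup>2 / (norm (r ix0))\<^sup>2)"
    by (intro sum.cong refl) (simp add: w_def norm_mult norm_inverse divide_inverse power_mult_distrib power_inverse mult.commute)
  also have "\<dots> = 1" unfolding sum_divide_distrib[symmetric] null[symmetric] using r0 by simp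
  finally have n: "norm w = 1" by (simp add: norm_vec_def L2_set_def)
  have wF: "w $ i \<in> base_elems F" for i
  proof (cases "i = ix0")
    case True
    have "of_real 0 \<in> base_elems F" by (rule base_elems_closed(5)[OF rF rF])
    then show ?thesis using True by (simp add: w_def)
  next
    case False
    have "quat_cnj (inverse (r ix0) * r i) \<in> base_elems F" 
      using base_elems_closed(3)[OF base_elems_closed(1)[OF base_elems_closed(4)[OF rF rF] rF] rF] .
    then show ?thesis using False by (simp add: w_def)
  qed
  obtain u where u: "u \<in> K" "u $ ix0 $ ix0 = 1" "\<And>i. u $ i $ ix1 = w $ i"
    using K_transport[OF n _ wF] by (auto simp: w_def)
  have ri: "r i = r ix0 * quat_cnj (u $ i $ ix1)" if "i \<noteq> ix0" for i
    using that r0 by (simp add: u(3) w_def mult.assoc[symmetric])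
  have row: "(h ** u) $ ix0 $ j + (h ** u) $ ix1 $ j = r ix0 * (if j = ix0 \<or> j = ix1 then 1 else 0)" for j
  proof -
    have "(h ** u) $ ix0 $ j + (h ** u) $ ix1 $ j = (\<Sum>i\<in>UNIV. r i * u $ i $ j)"
      by (simp add: matrix_matrix_mult_def r_def distrib_right sum.distrib)
    also have "\<dots> = (\<Sum>i\<in>UNIV. (if i = ix0 then r ix0 * u $ ix0 $ j else 0) + r ix0 * (quat_cnj (u $ i $ ix1) * u $ i $ j))"
    proof (intro sum.cong refl)
      fix i :: 'n
      show "r i * u $ i $ j = (if i = ix0 then r ix0 * u $ ix0 $ j else 0) + r ix0 * (quat_cnj (u $ i $ ix1) * u $ i $ j)"
        using ri[of i] K_row[OF u(1), of ix1] ix01 by (cases "i = ix0") (simp_all add: mult.assoc)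
    qed
    also have "\<dots> = r ix0 * u $ ix0 $ j + r ix0 * (adjoint_mat quat_cnj u ** u) $ ix1 $ j"
      by (simp add: sum.distrib matrix_matrix_mult_def adjoint_mat_def sum_distrib_left)
    also have "adjoint_mat quat_cnj u ** u = mat 1" using K_block(2)[OF u(1)] by (simp add: unitary_mat_def)
    finally show ?thesis using K_row[OF u(1), of j] u(2) ix01 by (auto simp: mat_def)
  qed
  have prod: "busn ((h ** u) ** y) = norm (r ix0) * busn y" for y
  proof -
    have "((h ** u) ** y) $ ix0 $ ix0 + ((h ** u) ** y) $ ix1 $ ix0 = (\<Sum>j\<in>UNIV. ((h ** u) $ ix0 $ j + (h ** u) $ ix1 $ j) * y $ j $ ix0)"
      by (subst (1 3) matrix_matrix_mult_def) (simp add: distrib_right sum.distrib)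
    also have "\<dots> = (\<Sum>j\<in>{ix0, ix1}. r ix0 * y $ j $ ix0)"
      unfolding row by (rule sum.mono_neutral_cong_right) auto
    also have "\<dots> = r ix0 * (y $ ix0 $ ix0 + y $ ix1 $ ix0)"
      using ix01 by (simp add: distrib_left)
    finally show ?thesis by (simp add: busn_def norm_mult)
  qed
  have "busn (mat 1) = 1" using ix01 by (simp add: busn_def mat_def eq_commute)
  then have "norm (r ix0) = busn h" using prod[of "mat 1"] by (simp add: busn_mult_K[OF u(1)])
  then show ?thesis using that u(1) prod by simp
qed

text \<open>
  Rotating a point by an element of \<open>K\<close> amounts to replacing the boundary point by another one, and
  every unit direction \<open>\<theta>\<close> occurs.
\<close>

lemma rotate_boundary:
  assumes "norm \<theta> = 1" "\<theta> $ ix0 = 0" "\<And>i. \<theta> $ i \<in> base_elems F"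
  obtains k where "k \<in> K" "\<And>g. busn (k ** g) = norm (g $ ix0 $ ix0 + (\<Sum>i\<in>UNIV. quat_cnj (\<theta> $ i) * g $ i $ ix0))"
proof -
  obtain U where U: "U \<in> K" "U $ ix0 $ ix0 = 1" "\<And>i. U $ i $ ix1 = \<theta> $ i" using K_transport[OF assms] by blast
  obtain k where k: "k \<in> K" "U ** k = mat 1" "k ** U = mat 1" using K_inverse[OF U(1)] by blast
  have "adjoint_mat quat_cnj U = k"
  proof -
    have "adjoint_mat quat_cnj U = adjoint_mat quat_cnj U ** (U ** k)" by (simp add: k(2))
    also have "\<dots> = k" using K_block(2)[OF U(1)] by (simp add: matrix_mul_assoc unitary_mat_def)
    finally show ?thesis .
  qed
  then have ke: "k $ i $ j = quat_cnj (U $ j $ i)" for i j by (auto simp: adjoint_mat_def)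
  show ?thesis
  proof (rule that[OF k(1)])
    fix g :: "(quat, 'n) sqmat"
    have "(k ** g) $ ix0 $ ix0 = g $ ix0 $ ix0" unfolding K_mult_row0[OF k(1)] by (simp add: ke U(2))
    moreover have "(k ** g) $ ix1 $ ix0 = (\<Sum>i\<in>UNIV. quat_cnj (\<theta> $ i) * g $ i $ ix0)"
      by (simp add: matrix_matrix_mult_def ke U(3))
    ultimately show "busn (k ** g) = norm (g $ ix0 $ ix0 + (\<Sum>i\<in>UNIV. quat_cnj (\<theta> $ i) * g $ i $ ix0))"
      by (simp add: busn_def)
  qed
qed

end

section \<open>Coordinates of F^k\<close>

fun fbasis :: "base_field \<Rightarrow> quat set" where
  "fbasis F_real = {Quat 1 0 0 0}"
| "fbasis F_complex = {Quat 1 0 0 0, Quat 0 1 0 0}"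
| "fbasis F_quat = {Quat 1 0 0 0, Quat 0 1 0 0, Quat 0 0 1 0, Quat 0 0 0 1}"

fun fproj :: "base_field \<Rightarrow> quat \<Rightarrow> quat" where
  "fproj F_real x = Quat (qre x) 0 0 0"
| "fproj F_complex x = Quat (qre x) (qi x) 0 0"
| "fproj F_quat x = x"

lemma fbasis_subset: "fbasis F \<subseteq> Basis"
  by (cases F) (auto simp: Basis_quat_def)

lemma card_fbasis: "card (fbasis F) = real_dim F"
proof -
  have "card (Basis :: quat set) = 4" by (simp add: Basis_quat_def)
  then show ?thesis by (cases F) simp_all
qed

lemma one_in_fbasis: "1 \<in> fbasis F"
  by (cases F) (simp_all add: one_quat_def)

lemma fproj_inner: "u \<in> Basis \<Longrightarrow> fproj F x \<bullet> u = (if u \<in> fbasis F then x \<bullet> u else 0)"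
  by (cases F) (auto simp: Basis_quat_def inner_quat_def)

lemma fproj_mult: "a \<in> base_elems F \<Longrightarrow> fproj F (a * x) = a * fproj F x"
  by (cases F) (auto simp: quat_of_real_def quat_of_complex_def times_quat_def)

lemma fproj_add: "fproj F (x + y) = fproj F x + fproj F y"
  by (cases F) (simp_all add: plus_quat_def)

lemma fproj_0: "fproj F 0 = 0"
  by (cases F) (simp_all add: zero_quat_def)

lemma fproj_sum: "fproj F (sum f A) = (\<Sum>i\<in>A. fproj F (f i))"
  by (induction A rule: infinite_finite_induct) (simp_all add: fproj_add fproj_0)

lemma fproj_in_base: "fproj F x \<in> base_elems F"
proof (cases F)
  case F_real
  have "fproj F x = quat_of_real (qre x)" by (simp add: F_real quat_of_real_def)
  then show ?thesis by (simp add: F_real)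
next
  case F_complex
  have "fproj F x = quat_of_complex (Complex (qre x) (qi x))" by (simp add: F_complex quat_of_complex_def)
  then show ?thesis unfolding F_complex by simp
qed simp

text \<open>
  The real coordinate directions of the vectors over the base field supported on \<open>I\<close>, inside the
  quaternionic vectors.
\<close>

definition fcoords :: "base_field \<Rightarrow> 'n::finite set \<Rightarrow> (quat, 'n) vec set" where
  "fcoords F I = (\<lambda>(i, u). axis i u) ` (I \<times> fbasis F)"

lemma fcoords_subset: "fcoords F I \<subseteq> Basis"
  using fbasis_subset by (auto simp: fcoords_def Basis_vec_def)

lemma axis_in_fcoords: "u \<in> Basis \<Longrightarrow> axis i u \<in> fcoords F I \<longleftrightarrow> i \<in> I \<and> u \<in> fbasis F"
  using fbasis_subset[of F] nonzero_Basis by (auto simp: fcoords_def axis_eq_axis image_iff) 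

lemma card_fcoords: "card (fcoords F I) = card I * real_dim F"
proof -
  have "inj_on (\<lambda>(i, u). axis i u :: (quat, 'a) vec) (I \<times> fbasis F)"
    using fbasis_subset[of F] nonzero_Basis by (auto simp: inj_on_def axis_eq_axis subset_iff)
  then show ?thesis by (simp add: fcoords_def card_image card_cartesian_product card_fbasis)
qed

lemma coord_proj_fcoords: "coord_proj (fcoords F I) x = (\<chi> i. if i \<in> I then fproj F (x $ i) else 0)"
proof (rule euclidean_eqI)
  fix b :: "(quat, 'a) vec" assume b: "b \<in> Basis"
  then obtain i u where iu: "b = axis i u" "u \<in> Basis" by (auto simp: Basis_vec_def)
  show "coord_proj (fcoords F I) x \<bullet> b = (\<chi> i. if i \<in> I then fproj F (x $ i) else 0) \<bullet> b"
    unfolding inner_coord_proj[OF fcoords_subset b] unfolding iu(1) axis_in_fcoords[OF iu(2)] inner_axis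
    by (simp add: fproj_inner[OF iu(2)])
qed

text \<open>
  The real part and the modulus of one coordinate of a uniform unit vector over the base field are
  distributed as \<open>(r cos \<phi>, r)\<close> under the measure that defines the modified moments.
\<close>

lemma nn_integral_fsphere_marginal:
  fixes \<Phi> :: "real \<times> real \<Rightarrow> ennreal" and I :: "'n::finite set"
  assumes j: "j \<in> I" and I: "card I \<ge> 2" and \<Phi>[measurable]: "\<Phi> \<in> borel_measurable (borel \<Otimes>\<^sub>M borel)"
  shows "(\<integral>\<^sup>+\<theta>. \<Phi> (qre (\<theta> $ j), norm (\<theta> $ j)) \<partial>sphere_meas (fcoords F I)) =
    (\<integral>\<^sup>+(r, \<phi>). \<Phi> (r * cos \<phi>, r) \<partial>m_meas (real (real_dim F) * real (card I) / 2 - 1) (real (real_dim F) / 2 - 1))"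
proof -
  let ?A = "fcoords F I" and ?A1 = "fcoords F {j}" and ?b = "axis j 1 :: (quat, 'n) vec"
  have d: "real_dim F \<ge> 1" by (cases F) simp_all
  have b: "?b \<in> ?A1" using one_in_fbasis fbasis_subset by (subst axis_in_fcoords) auto
  have sub: "?A1 \<subseteq> ?A" using j by (auto simp: fcoords_def)
  have ne: "?A - ?A1 \<noteq> {}"
  proof
    assume "?A - ?A1 = {}"
    then have "?A = ?A1" using sub by blast
    then have "card ?A = card ?A1" by (rule arg_cong)
    then have "card I * real_dim F = card {j} * real_dim F" by (simp only: card_fcoords)
    then show False using I d by simp
  qed
  have qb: "\<theta> \<bullet> ?b = qre (\<theta> $ j)" for \<theta>
    by (simp add: inner_axis inner_quat_def one_quat_def)
  have A0: "?A \<noteq> {}" using b sub by blast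
  have "(\<integral>\<^sup>+\<theta>. \<Phi> (qre (\<theta> $ j), norm (\<theta> $ j)) \<partial>sphere_meas ?A) = (\<integral>\<^sup>+\<theta>. \<Phi> (\<theta> \<bullet> ?b, norm (coord_proj ?A1 \<theta>)) \<partial>sphere_meas ?A)"
  proof (rule nn_integral_cong_AE)
    show "AE \<theta> in sphere_meas ?A. \<Phi> (qre (\<theta> $ j), norm (\<theta> $ j)) = \<Phi> (\<theta> \<bullet> ?b, norm (coord_proj ?A1 \<theta>))"
      using AE_sphere_meas[OF fcoords_subset A0]
    proof eventually_elim
      case (elim \<theta>)
      then have e: "coord_proj ?A \<theta> = \<theta>" by blast
      have f: "fproj F (\<theta> $ j) = \<theta> $ j" using arg_cong[OF e, of "\<lambda>x. x $ j"] j by (simp add: coord_proj_fcoords)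
      have "coord_proj ?A1 \<theta> = axis j (\<theta> $ j)"
        by (auto simp: coord_proj_fcoords vec_eq_iff axis_def f)
      moreover have "(\<Sum>i\<in>UNIV. (norm (axis j (\<theta> $ j) $ i))\<^sup>2) = (\<Sum>i\<in>UNIV. if i = j then (norm (\<theta> $ j))\<^sup>2 else 0)"
        by (intro sum.cong) (auto simp: axis_def)
      then have "norm (axis j (\<theta> $ j)) = norm (\<theta> $ j)" by (simp add: norm_vec_def L2_set_def)
      ultimately show ?case by (simp add: qb)
    qed
  qed
  also have "\<dots> = (\<integral>\<^sup>+(r, \<phi>). \<Phi> (r * cos \<phi>, r) \<partial>m_meas (real (card ?A) / 2 - 1) (real (card ?A1) / 2 - 1))"
  proof (cases "card ?A1 \<ge> 2")
    case True
    show ?thesis by (rule nn_integral_sphere_meas_marginal_higher[OF fcoords_subset sub b ne True \<Phi>])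
  next
    case False
    then have c1: "card ?A1 = 1" using d card_fcoords[of F "{j}"] by simp
    then obtain a where a: "?A1 = {a}" by (metis card_1_singletonE)
    then have A1: "?A1 = {?b}" using b by simp
    have "(\<integral>\<^sup>+\<theta>. \<Phi> (\<theta> \<bullet> ?b, norm (coord_proj {?b} \<theta>)) \<partial>sphere_meas ?A) = (\<integral>\<^sup>+(r, \<phi>). \<Phi> (r * cos \<phi>, r) \<partial>m_meas (real (card ?A) / 2 - 1) (- 1/2))"
      by (rule nn_integral_sphere_meas_marginal_line[OF fcoords_subset _ _ \<Phi>]) (use b sub ne A1 in auto)
    then show ?thesis unfolding c1 A1 by simp
  qed
  finally show ?thesis by (simp add: card_fcoords mult.commute)
qed

section \<open>Measurability on G/K\<close>

lemma space_hyp_borel [simp]: "space (hyp_borel F) = hyp_space F"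
  unfolding hyp_borel_def by (rule space_measure_of) auto

lemma continuous_on_matrix_mult:
  "continuous_on S (\<lambda>X. A ** (X :: (quat, 'n::finite) sqmat))"
  unfolding matrix_matrix_mult_def by (intro continuous_intros)

lemma norm_real_combination_quat: "norm (of_real c + of_real s * (q::quat)) = sqrt (c\<^sup>2 + 2 * c * s * qre q + s\<^sup>2 * (norm q)\<^sup>2)"
proof -
  have "(norm q)\<^sup>2 = inner q q" by (simp add: norm_quat_def)
  then show ?thesis
    by (simp add: norm_quat_def[of "Quat _ _ _ _"] quat_of_real_eq inner_quat_def plus_quat_def times_quat_def power2_eq_square algebra_simps)
qed

lemma cmod_polar_combination: "cmod (of_real c + of_real r * exp (\<i> * of_real \<phi>) * of_real s) = sqrt (c\<^sup>2 + 2 * c * s * (r * cos \<phi>) + s\<^sup>2 * r\<^sup>2)"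
proof -
  have "(c + r * cos \<phi> * s)\<^sup>2 + (r * sin \<phi> * s)\<^sup>2 = c\<^sup>2 + 2 * c * s * (r * cos \<phi>) + s\<^sup>2 * r\<^sup>2 * ((cos \<phi>)\<^sup>2 + (sin \<phi>)\<^sup>2)"
    unfolding power2_eq_square by (simp only: algebra_simps)
  then have "c\<^sup>2 + 2 * c * s * (r * cos \<phi>) + s\<^sup>2 * r\<^sup>2 = (c + r * cos \<phi> * s)\<^sup>2 + (r * sin \<phi> * s)\<^sup>2" by simp
  then show ?thesis by (simp add: cmod_def Re_exp Im_exp)
qed

text \<open>
  The modulus of a linear functional of the vector \<open>w\<close> depends only on the products
  \<open>w_i cnj (w_j)\<close>, which do not change when \<open>w\<close> is multiplied by a unit scalar on the right.
\<close>

lemma norm_sum_cnj_mult: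
  fixes v w :: "'n::finite \<Rightarrow> quat"
  shows "(norm (\<Sum>i\<in>UNIV. quat_cnj (v i) * w i))\<^sup>2 = (\<Sum>i\<in>UNIV. \<Sum>j\<in>UNIV. (v i * quat_cnj (v j)) \<bullet> (w i * quat_cnj (w j)))"
proof -
  have e: "(quat_cnj a * x) \<bullet> (quat_cnj b * y) = (a * quat_cnj b) \<bullet> (x * quat_cnj y)" for a b x y
    by (simp add: inner_quat_def quat_cnj_def times_quat_def algebra_simps)
  show ?thesis
    by (simp add: power2_norm_eq_inner inner_sum_left inner_sum_right e) (rule sum.swap)
qed

lemma measurable_quat_cnj [measurable]: "quat_cnj \<in> borel_measurable borel"
proof -
  have "linear quat_cnj"
    by (rule linearI) (simp_all add: quat_cnj_def plus_quat_def scaleR_quat_def)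
  then show ?thesis
    by (intro borel_measurable_continuous_onI linear_continuous_on) (simp add: linear_conv_bounded_linear)
qed

lemma continuous_on_quat_cnj [continuous_intros]: "continuous_on S f \<Longrightarrow> continuous_on S (\<lambda>x. quat_cnj (f x))"
proof -
  have "linear quat_cnj"
    by (rule linearI) (simp_all add: quat_cnj_def plus_quat_def scaleR_quat_def)
  then have "continuous_on UNIV quat_cnj"
    by (intro linear_continuous_on) (simp add: linear_conv_bounded_linear)
  then show "continuous_on S f \<Longrightarrow> continuous_on S (\<lambda>x. quat_cnj (f x))"
    by (rule continuous_on_compose2) auto
qed

lemma measurable_vec_component [measurable]:
  "(\<lambda>x. x $ i) \<in> borel_measurable (borel :: (quat, 'n::finite) vec measure)"
  by (intro borel_measurable_continuous_onI continuous_intros)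

text \<open>
  The value of the Busemann kernel at distance \<open>t\<close> from the origin in the direction that has the
  coordinate \<open>r e^{i \<phi>}\<close> along the boundary point.
\<close>

definition horo :: "real \<Rightarrow> real \<Rightarrow> real \<Rightarrow> real" where
  "horo t r \<phi> = cmod (of_real (cosh t) + of_real r * exp (\<i> * of_real \<phi>) * of_real (sinh t))"

lemma measurable_horo [measurable]:
  assumes [measurable]: "a \<in> borel_measurable M" "b \<in> borel_measurable M" "c \<in> borel_measurable M"
  shows "(\<lambda>x. horo (a x) (b x) (c x)) \<in> borel_measurable M"
  unfolding horo_def cmod_polar_combination cosh_field_def sinh_field_def by measurable

text \<open>
  The sets and measures are parameters fixed by equations, so that the size of the matrices does not
  become ambiguous in statements that mention only the space.
\<close>

locale hyp_geometry = hyp_groups F G K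
  for F and G K :: "(quat, 'n::{finite,linorder}) sqmat set" +
  fixes HS :: "(quat, 'n) sqmat set set" and HB :: "(quat, 'n) sqmat set measure" and org :: "(quat, 'n) sqmat set"
    and J :: "'n set" and \<tau> :: "(quat, 'n) vec measure" and kk :: nat
  assumes HS_def: "HS = hyp_space F" and HB_def: "HB = hyp_borel F" and org_def: "org = hyp_origin F"
    and J_def [simp]: "J = -{ix0}" and \<tau>_def: "\<tau> = sphere_meas (fcoords F J)" and kk_def: "kk = CARD('n) - 1"
begin

lemma lcoset_of_member:
  assumes "y \<in> lcoset F (g :: (quat, 'n) sqmat)" shows "lcoset F y = lcoset F g"
  using in_lcosetD[OF assms] lcoset_mult_K by blast

lemma HS_cases:
  assumes "x \<in> HS" obtains g where "g \<in> G" "x = lcoset F g"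
  using assms hyp_space_cases unfolding HS_def by blast

lemma lcoset_in_HS: "g \<in> G \<Longrightarrow> lcoset F g \<in> HS"
  unfolding HS_def by (rule lcoset_in_hyp_space)

lemma org_eq: "org = lcoset F (mat 1)"
  unfolding org_def by (rule hyp_origin_eq)

lemma space_HB [simp]: "space HB = HS"
  unfolding HB_def HS_def by (rule space_hyp_borel)

lemma HB_eq: "HB = sigma HS {U. U \<subseteq> HS \<and> openin (top_of_set (Ggrp F)) (\<Union>U)}"
  unfolding HB_def HS_def hyp_borel_def ..

lemma hyp_gen_subset: "{U. U \<subseteq> HS \<and> openin (top_of_set (Ggrp F)) (\<Union>U)} \<subseteq> Pow HS"
  by blast

lemma open_in_hyp_borel:
  assumes "U \<subseteq> HS" "openin (top_of_set G) (\<Union>U)" shows "U \<in> sets HB"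
proof -
  have "U \<in> sigma_sets HS {U. U \<subseteq> HS \<and> openin (top_of_set (Ggrp F)) (\<Union>U)}"
    using assms by (intro sigma_sets.Basic) (simp add: G_def)
  then show ?thesis unfolding HB_eq sets_measure_of[OF hyp_gen_subset] .
qed

text \<open>
  The Borel sets of the quotient are generated by the sets whose union is open in the group.
\<close>

lemma measurable_hyp_borelI:
  fixes f :: "(quat, 'n) sqmat set \<Rightarrow> 'b::topological_space"
  assumes f: "continuous_on G (\<lambda>g. f (lcoset F g))"
  shows "f \<in> borel_measurable HB"
proof (rule borel_measurableI)
  fix S :: "'b set" assume S: "open S"
  let ?U = "f -` S \<inter> HS"
  have "\<Union>?U = G \<inter> (\<lambda>g. f (lcoset F g)) -` S"
  proof (intro set_eqI iffI)
    fix y assume "y \<in> \<Union>?U"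
    then obtain x where x: "y \<in> x" "x \<in> HS" "f x \<in> S" by blast
    obtain g where g: "g \<in> G" "x = lcoset F g" using HS_cases[OF x(2)] by blast
    have "y \<in> G" using lcoset_subset_G[OF g(1)] x(1) g(2) by blast
    moreover have "lcoset F y = x" using lcoset_of_member[of y g] x(1) g(2) by simp
    ultimately show "y \<in> G \<inter> (\<lambda>g. f (lcoset F g)) -` S" using x(3) by simp
  next
    fix y assume y: "y \<in> G \<inter> (\<lambda>g. f (lcoset F g)) -` S"
    then have "lcoset F y \<in> ?U" using lcoset_in_HS[of y] by simp
    then show "y \<in> \<Union>?U" using lcoset_self[of y] by blast
  qed
  then have "openin (top_of_set G) (\<Union>?U)"
    using continuous_openin_preimage_gen[OF f S] by simp
  then have "?U \<in> sets HB" by (intro open_in_hyp_borel) auto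
  then show "f -` S \<inter> space HB \<in> sets HB" by simp
qed

lemma hyp_act_in: "g \<in> G \<Longrightarrow> x \<in> HS \<Longrightarrow> hyp_act g x \<in> HS"
proof -
  assume g: "g \<in> G" and "x \<in> HS"
  then obtain h where h: "h \<in> G" "x = lcoset F h" using HS_cases by blast
  show ?thesis unfolding h(2) hyp_act_lcoset by (rule lcoset_in_HS[OF G_mult[OF g h(1)]])
qed

lemma hyp_act_measurable:
  assumes g: "g \<in> G" shows "hyp_act g \<in> HB \<rightarrow>\<^sub>M HB"
proof -
  have "hyp_act g \<in> HB \<rightarrow>\<^sub>M sigma HS {U. U \<subseteq> HS \<and> openin (top_of_set (Ggrp F)) (\<Union>U)}"
  proof (rule measurable_measure_of[OF hyp_gen_subset])
    show "hyp_act g \<in> space HB \<rightarrow> HS" using hyp_act_in[OF g] by simp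
    fix U assume "U \<in> {U. U \<subseteq> HS \<and> openin (top_of_set (Ggrp F)) (\<Union>U)}"
    then have U: "U \<subseteq> HS" "openin (top_of_set G) (\<Union>U)" by (simp_all add: G_def)
    let ?V = "hyp_act g -` U \<inter> HS"
    have "\<Union>?V = G \<inter> (\<lambda>y. g ** y) -` \<Union>U"
    proof (intro set_eqI iffI)
      fix y assume "y \<in> \<Union>?V"
      then obtain x where x: "y \<in> x" "x \<in> HS" "hyp_act g x \<in> U" by blast
      obtain h where h: "h \<in> G" "x = lcoset F h" using HS_cases[OF x(2)] by blast
      have "y \<in> G" using lcoset_subset_G[OF h(1)] x(1) h(2) by blast
      moreover have "lcoset F y = x" using lcoset_of_member[of y h] x(1) h(2) by simp
      then have "lcoset F (g ** y) \<in> U" using x(3) hyp_act_lcoset[of g y] by simp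
      then have "g ** y \<in> \<Union>U" using lcoset_self[of "g ** y"] by blast
      ultimately show "y \<in> G \<inter> (\<lambda>y. g ** y) -` \<Union>U" by simp
    next
      fix y assume y: "y \<in> G \<inter> (\<lambda>y. g ** y) -` \<Union>U"
      then obtain u where u: "u \<in> U" "g ** y \<in> u" by blast
      obtain w where w: "w \<in> G" "u = lcoset F w" using HS_cases[of u] u(1) U(1) by blast
      have "lcoset F (g ** y) = u" using lcoset_of_member[of "g ** y" w] u(2) w(2) by simp
      then have "lcoset F y \<in> ?V" using lcoset_in_HS[of y] y u(1) hyp_act_lcoset[of g y] by simp
      then show "y \<in> \<Union>?V" using lcoset_self[of y] by blast
    qed
    moreover have "openin (top_of_set G) (G \<inter> (\<lambda>y. g ** y) -` \<Union>U)"
      by (rule continuous_openin_preimage[OF continuous_on_matrix_mult _ U(2)]) (use G_mult[OF g] in auto)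
    ultimately have "openin (top_of_set G) (\<Union>?V)" by simp
    then have "?V \<in> sets HB" by (intro open_in_hyp_borel) auto
    then show "hyp_act g -` U \<inter> space HB \<in> sets HB" by simp
  qed
  then show ?thesis unfolding HB_eq[symmetric] .
qed

text \<open>
  A choice of representative; everything built from it below is independent of the choice.
\<close>

definition rep :: "(quat, 'n) sqmat set \<Rightarrow> (quat, 'n) sqmat" where
  "rep x = (SOME g. g \<in> x)"

lemma rep_lcoset:
  obtains h where "h \<in> K" "rep (lcoset F g) = g ** h"
proof -
  have "rep (lcoset F g) \<in> lcoset F g" unfolding rep_def using lcoset_self by (rule someI)
  then show ?thesis using in_lcosetD that by blast
qed

text \<open>
  Quantities that are well defined on points and separate them: the products of the entries of the
  first column with their conjugates.
\<close>

definition col_proj :: "(quat, 'n) sqmat set \<Rightarrow> (quat, 'n) sqmat" where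
  "col_proj x = (\<chi> i j. rep x $ i $ ix0 * quat_cnj (rep x $ j $ ix0))"

lemma col_proj_lcoset:
  shows "col_proj (lcoset F g) = (\<chi> i j. g $ i $ ix0 * quat_cnj (g $ j $ ix0))"
proof -
  obtain h where h: "h \<in> K" "rep (lcoset F g) = g ** h" using rep_lcoset by blast
  have "h $ ix0 $ ix0 * quat_cnj (h $ ix0 $ ix0) = 1"
    unfolding quat_inv.c_norm' by (simp add: K_block(3)[OF h(1)])
  then have "(g $ i $ ix0 * h $ ix0 $ ix0) * quat_cnj (g $ j $ ix0 * h $ ix0 $ ix0) = g $ i $ ix0 * quat_cnj (g $ j $ ix0)" for i j
    by (simp add: quat_inv.c_mult mult.assoc) (simp add: mult.assoc[symmetric])
  then show ?thesis by (simp add: col_proj_def h(2) mult_K_col0[OF h(1)])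
qed

lemma col_proj_measurable [measurable]: "(\<lambda>x. col_proj x $ i $ j) \<in> borel_measurable HB"
  by (rule measurable_hyp_borelI) (simp add: col_proj_lcoset, intro continuous_intros)

definition dist0 :: "(quat, 'n) sqmat set \<Rightarrow> real" where
  "dist0 x = hyp_dist F x org"

lemma dist0_lcoset: "g \<in> G \<Longrightarrow> dist0 (lcoset F g) = rad g"
  using hyp_dist_to_origin[of g] by (simp add: dist0_def flip: org_def)

lemma dist0_measurable [measurable]: "dist0 \<in> borel_measurable HB"
proof (rule measurable_hyp_borelI)
  have "continuous_on G (\<lambda>g. ln (norm (g $ ix0 $ ix0) + sqrt ((norm (g $ ix0 $ ix0))\<^sup>2 - 1)))"
  proof (intro continuous_intros ballI)
    fix g assume g: "g \<in> G"
    have "(norm (g $ ix0 $ ix0))\<^sup>2 \<ge> 1" using norm_00_ge_1[OF g] by simp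
    then have "sqrt ((norm (g $ ix0 $ ix0))\<^sup>2 - 1) \<ge> 0" by simp
    then show "norm (g $ ix0 $ ix0) + sqrt ((norm (g $ ix0 $ ix0))\<^sup>2 - 1) \<noteq> 0" using norm_00_ge_1[OF g] by linarith
  qed
  moreover have "dist0 (lcoset F g) = ln (norm (g $ ix0 $ ix0) + sqrt ((norm (g $ ix0 $ ix0))\<^sup>2 - 1))" if "g \<in> G" for g
    unfolding dist0_lcoset[OF that] rad_def by (rule arcosh_real_def[OF norm_00_ge_1[OF that]])
  ultimately show "continuous_on G (\<lambda>g. dist0 (lcoset F g))" by (simp cong: continuous_on_cong)
qed

definition bus :: "(quat, 'n) sqmat set \<Rightarrow> real" where
  "bus x = busn (rep x)"

lemma bus_lcoset: "bus (lcoset F g) = busn g"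
proof -
  obtain h where h: "h \<in> K" "rep (lcoset F g) = g ** h" using rep_lcoset by blast
  then show ?thesis by (simp add: bus_def busn_mult_K)
qed

lemma bus_measurable [measurable]: "bus \<in> borel_measurable HB"
  by (rule measurable_hyp_borelI) (simp add: bus_lcoset busn_def, intro continuous_intros)

lemma bus_pos: "x \<in> HS \<Longrightarrow> bus x > 0"
  by (erule HS_cases) (simp add: bus_lcoset busn_pos)

lemma bus_le: "x \<in> HS \<Longrightarrow> ln (bus x) \<le> dist0 x"
proof -
  assume "x \<in> HS"
  then obtain g where g: "g \<in> G" "x = lcoset F g" using HS_cases by blast
  have "ln (busn g) \<le> ln (exp (rad g))" using busn_pos[OF g(1)] busn_bounds(2)[OF g(1)] by (subst ln_le_cancel_iff) auto
  then show ?thesis by (simp add: g(2) bus_lcoset dist0_lcoset[OF g(1)])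
qed

lemma dist0_nonneg: "x \<in> HS \<Longrightarrow> dist0 x \<ge> 0"
  by (erule HS_cases) (simp add: dist0_lcoset rad(1))

text \<open>
  This turns one step of the walk, seen from the current point \<open>x\<close>, into an independent increment of
  the logarithm.
\<close>

lemma bus_cocycle:
  assumes x: "x \<in> HS"
  obtains g where "g \<in> G" "x = hyp_act g org" "\<And>y. y \<in> HS \<Longrightarrow> bus (hyp_act g y) = bus x * bus y"
proof -
  obtain h where h: "h \<in> G" "x = lcoset F h" using HS_cases[OF x] by blast
  \<comment> \<open>the representative of the point is changed from \<open>h\<close> to \<open>h u\<close>\<close>
  obtain u where u: "u \<in> K" "\<And>y. busn ((h ** u) ** y) = busn h * busn y" using busemann_cocycle[OF h(1)] by blast
  show ?thesis
  proof (rule that[of "h ** u"])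
    show "h ** u \<in> G" using G_mult h(1) KG[OF u(1)] by blast
    show "x = hyp_act (h ** u) org" unfolding org_eq hyp_act_lcoset by (simp add: lcoset_mult_K[OF u(1)] h(2))
    fix y assume "y \<in> HS"
    then obtain z where "y = lcoset F z" using HS_cases by blast
    then show "bus (hyp_act (h ** u) y) = bus x * bus y" by (simp add: hyp_act_lcoset bus_lcoset u(2) h(2))
  qed
qed

abbreviation "mm \<equiv> m_meas (real (real_dim F) * real kk / 2 - 1) (real (real_dim F) / 2 - 1)"

lemma card_J: "card J = kk" "kk \<ge> 2"
  using card_n by (simp_all add: kk_def Compl_eq_Diff_UNIV card_Diff_singleton)

section \<open>Averaging over K\<close>

text \<open>
  The Busemann kernel for a varying boundary point \<open>v\<close>, jointly measurable in \<open>v\<close> and the point.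
\<close>

definition boundary_norm :: "(quat, 'n) vec \<Rightarrow> (quat, 'n) sqmat set \<Rightarrow> real" where
  "boundary_norm v x = sqrt (\<Sum>i\<in>UNIV. \<Sum>j\<in>UNIV. (v $ i * quat_cnj (v $ j)) \<bullet> col_proj x $ i $ j)"

lemma boundary_norm_lcoset: "boundary_norm v (lcoset F g) = norm (\<Sum>i\<in>UNIV. quat_cnj (v $ i) * g $ i $ ix0)"
  unfolding boundary_norm_def col_proj_lcoset using norm_sum_cnj_mult[of "\<lambda>i. v $ i" "\<lambda>i. g $ i $ ix0"]
  by (simp flip: norm_sum_cnj_mult)

lemma measurable_boundary_norm [measurable]:
  assumes [measurable]: "f \<in> borel_measurable M" "h \<in> M \<rightarrow>\<^sub>M HB"
  shows "(\<lambda>x. boundary_norm (f x) (h x)) \<in> borel_measurable M"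
proof -
  have [measurable]: "(\<lambda>x. col_proj (h x) $ i $ j) \<in> borel_measurable M" for i j
    by (rule measurable_compose[OF _ col_proj_measurable]) fact
  have [measurable]: "(\<lambda>x. f x $ i) \<in> borel_measurable M" for i
    by (rule measurable_compose[OF _ measurable_vec_component]) fact
  have [measurable]: "(\<lambda>x. quat_cnj (f x $ i)) \<in> borel_measurable M" for i
    by (rule measurable_compose[OF _ measurable_quat_cnj]) measurable
  show ?thesis unfolding boundary_norm_def by measurable
qed

definition shift0 :: "(quat, 'n) vec \<Rightarrow> (quat, 'n) vec" where "shift0 \<theta> = \<theta> + axis ix0 1"

lemma measurable_shift0 [measurable]: "shift0 \<in> borel_measurable borel"
  unfolding shift0_def[abs_def] by measurable

lemma boundary_norm_shift0:
  shows "boundary_norm (shift0 \<theta>) (lcoset F g) = norm (g $ ix0 $ ix0 + (\<Sum>i\<in>UNIV. quat_cnj (\<theta> $ i) * g $ i $ ix0))"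
proof -
  have "(\<Sum>i\<in>UNIV. quat_cnj (shift0 \<theta> $ i) * g $ i $ ix0) = (\<Sum>i\<in>UNIV. (if i = ix0 then g $ ix0 $ ix0 else 0) + quat_cnj (\<theta> $ i) * g $ i $ ix0)"
    by (intro sum.cong refl) (auto simp: shift0_def axis_def quat_inv.c_add distrib_right)
  then show ?thesis by (simp add: boundary_norm_lcoset sum.distrib)
qed

lemma AE_tau: "AE \<theta> in \<tau>. norm \<theta> = 1 \<and> \<theta> $ ix0 = 0 \<and> (\<forall>i. \<theta> $ i \<in> base_elems F)"
proof -
  have "axis ix1 1 \<in> fcoords F J"
    unfolding fcoords_def by (rule image_eqI[where x = "(ix1, 1)"]) (use ix01 one_in_fbasis[of F] in auto)
  then have "fcoords F J \<noteq> {}" by blast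
  from AE_sphere_meas[OF fcoords_subset this] show ?thesis unfolding \<tau>_def
  proof eventually_elim
    case (elim \<theta>)
    then have cp: "norm \<theta> = 1 \<and> coord_proj (fcoords F J) \<theta> = \<theta>" by blast
    have e: "\<theta> $ i = (if i \<in> J then fproj F (\<theta> $ i) else 0)" for i
      using coord_proj_fcoords[of F J \<theta>] arg_cong[OF conjunct2[OF cp], of "\<lambda>x. x $ i"] by simp
    have "0 \<in> base_elems F" using fproj_in_base[of F 0] by (simp add: fproj_0)
    then have "\<theta> $ i \<in> base_elems F" for i using e[of i] fproj_in_base[of F "\<theta> $ i"] by (cases "i \<in> J") auto
    moreover have "\<theta> $ ix0 = 0" using e[of ix0] by simp
    ultimately show ?case using elim by blast
  qed
qed

lemma sets_tau [simp, measurable_cong]: "sets \<tau> = sets borel"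
  unfolding \<tau>_def by simp

lemma prob_space_tau: "prob_space \<tau>"
  unfolding \<tau>_def by (rule prob_space_sphere_meas[OF fcoords_subset])

text \<open>
  An element of \<open>K\<close> acts on the sphere of directions by isometries, hence preserves its uniform
  distribution.
\<close>

lemma K_isometry:
  assumes k: "k \<in> K"
  shows "linear (\<lambda>x. k *v x)" "norm (k *v x) = norm x" "k *v coord_proj (fcoords F J) x = coord_proj (fcoords F J) (k *v x)"
proof -
  show "linear (\<lambda>x. k *v x)"
    by (rule linearI) (simp_all add: matrix_vector_mult_def vec_eq_iff distrib_left sum.distrib scaleR_sum_right)
  have un: "adjoint_mat quat_cnj k ** k = mat 1" using K_block(2)[OF k] by (simp add: unitary_mat_def)
  have "of_real ((norm (k *v x))\<^sup>2) = (\<Sum>l\<in>UNIV. quat_cnj ((k *v x) $ l) * (k *v x) $ l)"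
    by (rule quat_inv.sum_c_norm[symmetric])
  also have "\<dots> = (\<Sum>l\<in>UNIV. \<Sum>i\<in>UNIV. \<Sum>j\<in>UNIV. quat_cnj (x $ i) * (quat_cnj (k $ l $ i) * k $ l $ j) * x $ j)"
    by (simp add: matrix_vector_mult_def quat_inv.c_sum quat_inv.c_mult sum_product mult.assoc)
  also have "\<dots> = (\<Sum>i\<in>UNIV. \<Sum>l\<in>UNIV. \<Sum>j\<in>UNIV. quat_cnj (x $ i) * (quat_cnj (k $ l $ i) * k $ l $ j) * x $ j)"
    by (rule sum.swap)
  also have "\<dots> = (\<Sum>i\<in>UNIV. \<Sum>j\<in>UNIV. \<Sum>l\<in>UNIV. quat_cnj (x $ i) * (quat_cnj (k $ l $ i) * k $ l $ j) * x $ j)"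
    by (intro sum.cong refl sum.swap)
  also have "\<dots> = (\<Sum>i\<in>UNIV. \<Sum>j\<in>UNIV. quat_cnj (x $ i) * (adjoint_mat quat_cnj k ** k) $ i $ j * x $ j)"
    by (simp add: matrix_matrix_mult_def adjoint_mat_def sum_distrib_left sum_distrib_right)
  also have "\<dots> = (\<Sum>i\<in>UNIV. \<Sum>j\<in>UNIV. if j = i then quat_cnj (x $ i) * x $ i else 0)"
    unfolding un by (intro sum.cong refl) (simp add: mat_def)
  also have "\<dots> = of_real ((norm x)\<^sup>2)" by (simp add: quat_inv.sum_c_norm)
  finally have "(norm (k *v x))\<^sup>2 = (norm x)\<^sup>2" by (simp only: of_real_eq_iff)
  then show "norm (k *v x) = norm x" by (simp add: power2_eq_iff_nonneg)
  show "k *v coord_proj (fcoords F J) x = coord_proj (fcoords F J) (k *v x)"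
  proof (subst vec_eq_iff, rule allI)
    fix i
    have L: "(k *v coord_proj (fcoords F J) x) $ i = (\<Sum>j\<in>UNIV. k $ i $ j * (if j \<in> J then fproj F (x $ j) else 0))"
      by (simp add: matrix_vector_mult_def coord_proj_fcoords)
    have R: "coord_proj (fcoords F J) (k *v x) $ i = (if i \<in> J then (\<Sum>j\<in>UNIV. k $ i $ j * fproj F (x $ j)) else 0)"
      using fproj_mult[OF G_entry[OF KG[OF k]]] by (simp add: coord_proj_fcoords matrix_vector_mult_def fproj_sum)
    show "(k *v coord_proj (fcoords F J) x) $ i = coord_proj (fcoords F J) (k *v x) $ i"
    proof (cases "i = ix0")
      case True
      then show ?thesis unfolding L R using K_row[OF k] by (auto intro!: sum.neutral)
    next
      case False
      have "(\<Sum>j\<in>UNIV. k $ i $ j * (if j \<in> J then fproj F (x $ j) else 0)) = (\<Sum>j\<in>UNIV. k $ i $ j * fproj F (x $ j))"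
        using K_col[OF k False] by (intro sum.cong refl) auto
      then show ?thesis unfolding L R using False by simp
    qed
  qed
qed

text \<open>
  Averaged over the boundary, the kernel depends on the point only through its distance from the
  origin: an element of \<open>K\<close> turns the direction of the point into a coordinate direction, and the
  marginal of the uniform distribution along that coordinate is known.
\<close>

lemma sphere_average:
  assumes g: "g \<in> G" and f[measurable]: "f \<in> borel_measurable borel"
  shows "(\<integral>\<^sup>+\<theta>. f (boundary_norm (shift0 \<theta>) (lcoset F g)) \<partial>\<tau>) = (\<integral>\<^sup>+(r, \<phi>). f (horo (rad g) r \<phi>) \<partial>mm)"
proof -
  let ?c = "cosh (rad g)" and ?s = "sinh (rad g)"
  obtain k l where k: "k \<in> K" "k $ ix0 $ ix0 = 1" and l: "norm l = 1" and
    gl: "g $ ix0 $ ix0 * l = of_real ?c" "\<And>i. i \<noteq> ix0 \<Longrightarrow> g $ i $ ix0 * l = of_real ?s * k $ i $ ix1"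
    using direction[OF g] by blast
  obtain k' where k': "k' \<in> K" "k ** k' = mat 1" "k' ** k = mat 1" using K_inverse[OF k(1)] by blast
  have adj: "adjoint_mat quat_cnj k = k'"
  proof -
    have "adjoint_mat quat_cnj k = adjoint_mat quat_cnj k ** (k ** k')" by (simp add: k'(2))
    also have "\<dots> = k'" using K_block(2)[OF k(1)] by (simp add: matrix_mul_assoc unitary_mat_def)
    finally show ?thesis .
  qed
  have ke: "k' $ i $ j = quat_cnj (k $ j $ i)" for i j by (simp add: adj[symmetric] adjoint_mat_def)
  note iso = K_isometry[OF k'(1)]
  have [measurable]: "(\<lambda>x. k' *v x) \<in> borel_measurable borel"
    using iso(1) by (intro borel_measurable_continuous_onI linear_continuous_on) (simp add: linear_conv_bounded_linear)
  have com: "q * of_real s = of_real s * q" for q :: quat and s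
    by (simp add: times_quat_def quat_of_real_eq quat_eq_iff)
  have "(\<integral>\<^sup>+\<theta>. f (boundary_norm (shift0 \<theta>) (lcoset F g)) \<partial>\<tau>) = (\<integral>\<^sup>+\<theta>. f (norm (of_real ?c + of_real ?s * (k' *v \<theta>) $ ix1)) \<partial>\<tau>)"
  proof (rule nn_integral_cong_AE)
    show "AE \<theta> in \<tau>. f (boundary_norm (shift0 \<theta>) (lcoset F g)) = f (norm (of_real ?c + of_real ?s * (k' *v \<theta>) $ ix1))"
      using AE_tau
    proof eventually_elim
      case (elim \<theta>)
      have "norm (g $ ix0 $ ix0 + (\<Sum>i\<in>UNIV. quat_cnj (\<theta> $ i) * g $ i $ ix0)) = norm ((g $ ix0 $ ix0 + (\<Sum>i\<in>UNIV. quat_cnj (\<theta> $ i) * g $ i $ ix0)) * l)"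
        by (simp add: norm_mult l)
      also have "(g $ ix0 $ ix0 + (\<Sum>i\<in>UNIV. quat_cnj (\<theta> $ i) * g $ i $ ix0)) * l = of_real ?c + (\<Sum>i\<in>UNIV. quat_cnj (\<theta> $ i) * (g $ i $ ix0 * l))"
        by (simp add: distrib_right gl(1) sum_distrib_right mult.assoc)
      also have "(\<Sum>i\<in>UNIV. quat_cnj (\<theta> $ i) * (g $ i $ ix0 * l)) = (\<Sum>i\<in>UNIV. of_real ?s * quat_cnj (quat_cnj (k $ i $ ix1) * \<theta> $ i))"
      proof (intro sum.cong refl)
        fix i :: 'n
        show "quat_cnj (\<theta> $ i) * (g $ i $ ix0 * l) = of_real ?s * quat_cnj (quat_cnj (k $ i $ ix1) * \<theta> $ i)"
        proof (cases "i = ix0")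
          case True then show ?thesis using elim by simp
        next
          case False
          show ?thesis unfolding gl(2)[OF False] quat_inv.c_mult quat_inv.c_c
            by (simp only: mult.assoc[symmetric] com[symmetric, of ?s "quat_cnj (\<theta> $ i)"])
        qed
      qed
      also have "\<dots> = of_real ?s * quat_cnj ((k' *v \<theta>) $ ix1)"
        by (simp add: matrix_vector_mult_def ke quat_inv.c_sum sum_distrib_left)
      also have "of_real ?c + of_real ?s * quat_cnj ((k' *v \<theta>) $ ix1) = quat_cnj (of_real ?c + of_real ?s * (k' *v \<theta>) $ ix1)"
        by (simp add: quat_inv.c_add quat_inv.c_mult com)
      finally show ?case by (simp add: boundary_norm_shift0)
    qed
  qed
  also have "\<dots> = (\<integral>\<^sup>+\<theta>. f (norm (of_real ?c + of_real ?s * \<theta> $ ix1)) \<partial>distr \<tau> borel (\<lambda>x. k' *v x))"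
    by (subst nn_integral_distr) simp_all
  also have "distr \<tau> borel (\<lambda>x. k' *v x) = \<tau>"
    unfolding \<tau>_def by (rule distr_sphere_meas_isometry[OF fcoords_subset iso])
  also have "(\<integral>\<^sup>+\<theta>. f (norm (of_real ?c + of_real ?s * \<theta> $ ix1)) \<partial>\<tau>) =
     (\<integral>\<^sup>+\<theta>. (\<lambda>(a, b). f (sqrt (?c\<^sup>2 + 2 * ?c * ?s * a + ?s\<^sup>2 * b\<^sup>2))) (qre (\<theta> $ ix1), norm (\<theta> $ ix1)) \<partial>\<tau>)"
    by (simp add: norm_real_combination_quat)
  also have "\<dots> = (\<integral>\<^sup>+(r, \<phi>). (\<lambda>(a, b). f (sqrt (?c\<^sup>2 + 2 * ?c * ?s * a + ?s\<^sup>2 * b\<^sup>2))) (r * cos \<phi>, r) \<partial>m_meas (real (real_dim F) * real (card J) / 2 - 1) (real (real_dim F) / 2 - 1))"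
    unfolding \<tau>_def by (rule nn_integral_fsphere_marginal) (use ix01 card_J in \<open>simp, simp, measurable\<close>)
  also have "\<dots> = (\<integral>\<^sup>+(r, \<phi>). f (horo (rad g) r \<phi>) \<partial>mm)"
    by (simp only: card_J(1) horo_def cmod_polar_combination prod.case)
  finally show ?thesis .
qed

lemma dist0_K: "k \<in> K \<Longrightarrow> x \<in> HS \<Longrightarrow> dist0 (hyp_act k x) = dist0 x"
proof -
  assume k: "k \<in> K" and "x \<in> HS"
  then obtain g where g: "g \<in> G" "x = lcoset F g" using HS_cases by blast
  have "k ** g \<in> G" using G_mult KG[OF k] g(1) by blast
  then show ?thesis by (simp add: g hyp_act_lcoset dist0_lcoset rad_def K_mult_row0[OF k] norm_mult K_block(3)[OF k])
qed

text \<open>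
  For a measure invariant under \<open>K\<close> the boundary point may be replaced by a uniformly distributed
  one, by Fubini. This gives the joint law of distance and Busemann function: conditionally on the
  distance \<open>t\<close>, the latter is distributed as \<open>ln (horo t r \<phi>)\<close>.
\<close>

lemma K_average:
  fixes f :: "real \<times> real \<Rightarrow> ennreal"
  assumes \<mu>: "prob_space \<mu>" "sets \<mu> = sets HB" and inv: "\<And>k. k \<in> K \<Longrightarrow> distr \<mu> HB (hyp_act k) = \<mu>"
    and f[measurable]: "f \<in> borel_measurable (borel \<Otimes>\<^sub>M borel)"
  shows "(\<integral>\<^sup>+x. f (dist0 x, bus x) \<partial>\<mu>) = (\<integral>\<^sup>+x. (\<integral>\<^sup>+(r, \<phi>). f (dist0 x, horo (dist0 x) r \<phi>) \<partial>mm) \<partial>\<mu>)"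
proof -
  interpret \<mu>: prob_space \<mu> by fact
  interpret \<tau>: prob_space \<tau> by (rule prob_space_tau)
  interpret P: pair_sigma_finite \<mu> \<tau> ..
  note [measurable_cong] = \<mu>(2)
  have sp: "space \<mu> = HS" using sets_eq_imp_space_eq[OF \<mu>(2)] by simp
  have 1: "(\<integral>\<^sup>+x. f (dist0 x, bus x) \<partial>\<mu>) = (\<integral>\<^sup>+x. f (dist0 x, boundary_norm (shift0 \<theta>) x) \<partial>\<mu>)"
    if th: "norm \<theta> = 1" "\<theta> $ ix0 = 0" "\<And>i. \<theta> $ i \<in> base_elems F" for \<theta>
  proof -
    obtain k where k: "k \<in> K" "\<And>g. busn (k ** g) = norm (g $ ix0 $ ix0 + (\<Sum>i\<in>UNIV. quat_cnj (\<theta> $ i) * g $ i $ ix0))"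
      using rotate_boundary[OF th] by blast
    have [measurable]: "hyp_act k \<in> \<mu> \<rightarrow>\<^sub>M HB" using hyp_act_measurable[OF KG[OF k(1)]] by simp
    have "(\<integral>\<^sup>+x. f (dist0 x, bus x) \<partial>\<mu>) = (\<integral>\<^sup>+x. f (dist0 x, bus x) \<partial>distr \<mu> HB (hyp_act k))"
      unfolding inv[OF k(1)] ..
    also have "\<dots> = (\<integral>\<^sup>+x. f (dist0 (hyp_act k x), bus (hyp_act k x)) \<partial>\<mu>)"
      by (subst nn_integral_distr) simp_all
    also have "\<dots> = (\<integral>\<^sup>+x. f (dist0 x, boundary_norm (shift0 \<theta>) x) \<partial>\<mu>)"
    proof (rule nn_integral_cong)
      fix x assume "x \<in> space \<mu>"
      then have x: "x \<in> HS" by (simp add: sp)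
      then obtain g where g: "g \<in> G" "x = lcoset F g" using HS_cases by blast
      have "bus (hyp_act k x) = boundary_norm (shift0 \<theta>) x" by (simp add: g(2) hyp_act_lcoset bus_lcoset k(2) boundary_norm_shift0)
      then show "f (dist0 (hyp_act k x), bus (hyp_act k x)) = f (dist0 x, boundary_norm (shift0 \<theta>) x)" by (simp add: dist0_K[OF k(1) x])
    qed
    finally show ?thesis .
  qed
  have "(\<integral>\<^sup>+x. f (dist0 x, bus x) \<partial>\<mu>) = (\<integral>\<^sup>+\<theta>. (\<integral>\<^sup>+x. f (dist0 x, bus x) \<partial>\<mu>) \<partial>\<tau>)"
    using \<tau>.emeasure_space_1 by simp
  also have "\<dots> = (\<integral>\<^sup>+\<theta>. (\<integral>\<^sup>+x. f (dist0 x, boundary_norm (shift0 \<theta>) x) \<partial>\<mu>) \<partial>\<tau>)"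
    by (rule nn_integral_cong_AE) (use AE_tau in \<open>eventually_elim, simp add: 1\<close>)
  also have "\<dots> = (\<integral>\<^sup>+x. (\<integral>\<^sup>+\<theta>. f (dist0 x, boundary_norm (shift0 \<theta>) x) \<partial>\<tau>) \<partial>\<mu>)"
    by (rule P.Fubini') measurable
  also have "\<dots> = (\<integral>\<^sup>+x. (\<integral>\<^sup>+(r, \<phi>). f (dist0 x, horo (dist0 x) r \<phi>) \<partial>mm) \<partial>\<mu>)"
  proof (rule nn_integral_cong)
    fix x assume "x \<in> space \<mu>"
    then have x: "x \<in> HS" by (simp add: sp)
    then obtain g where g: "g \<in> G" "x = lcoset F g" using HS_cases by blast
    have "(\<integral>\<^sup>+\<theta>. f (rad g, boundary_norm (shift0 \<theta>) (lcoset F g)) \<partial>\<tau>) = (\<integral>\<^sup>+(r, \<phi>). f (rad g, horo (rad g) r \<phi>) \<partial>mm)"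
      by (rule sphere_average[OF g(1), where f = "\<lambda>s. f (rad g, s)"]) measurable
    then show "(\<integral>\<^sup>+\<theta>. f (dist0 x, boundary_norm (shift0 \<theta>) x) \<partial>\<tau>) = (\<integral>\<^sup>+(r, \<phi>). f (dist0 x, horo (dist0 x) r \<phi>) \<partial>mm)"
      by (simp add: g(2) dist0_lcoset[OF g(1)])
  qed
  finally show ?thesis .
qed

end

section \<open>Distribution functions and characteristic functions\<close>

text \<open>
  Levy's inversion formula for both measures on an interval \<open>(a, b]\<close>; the kernel is bounded by
  \<open>2/|t|\<close>, and \<open>a\<close> tends to \<open>-\<infinity>\<close>.
\<close>

lemma cdf_diff_le_of_char:
  fixes h :: "real \<Rightarrow> real"
  assumes \<mu>1: "real_distribution \<mu>1" and \<mu>2: "real_distribution \<mu>2"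
    and atom1: "\<And>x. measure \<mu>1 {x} = 0" and atom2: "\<And>x. measure \<mu>2 {x} = 0"
    and h: "integrable lborel h" and hn: "\<And>t. h t \<ge> 0"
    and bound: "\<And>t. cmod (char \<mu>1 t - char \<mu>2 t) \<le> \<bar>t\<bar> * h t"
  shows "\<bar>cdf \<mu>1 b - cdf \<mu>2 b\<bar> \<le> (1 / pi) * (LINT t|lborel. h t)"
proof -
  interpret \<mu>1: real_distribution \<mu>1 by fact
  interpret \<mu>2: real_distribution \<mu>2 by fact
  let ?E = "(1 / pi) * (LINT t|lborel. h t)"
  define k where "k a t = (iexp (-(t * a)) - iexp (-(t * b))) / (\<i> * complex_of_real t)" for a t
  have km[measurable]: "k a \<in> borel_measurable borel" for a unfolding k_def by measurable
  have k1: "cmod (k a t) \<le> b - a" if "a \<le> b" for a t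
  proof -
    have "cmod ((iexp (t * (- a)) - iexp (t * (- b))) / (\<i> * complex_of_real t)) \<le> - a - (- b)" if "t \<noteq> 0"
      by (rule Levy_Inversion_aux2) (use \<open>a \<le> b\<close> that in auto)
    then show ?thesis using that by (cases "t = 0") (simp_all add: k_def)
  qed
  have k2: "cmod (k a t) * \<bar>t\<bar> \<le> 2" for a t
  proof -
    have "cmod (iexp (-(t * a)) - iexp (-(t * b))) \<le> cmod (iexp (-(t * a))) + cmod (iexp (-(t * b)))"
      by (rule norm_triangle_ineq4)
    also have "\<dots> = 2" by simp
    finally show ?thesis by (cases "t = 0") (simp_all add: k_def norm_divide norm_mult)
  qed
  have diff: "\<bar>measure \<mu>1 {a<..b} - measure \<mu>2 {a<..b}\<bar> \<le> ?E" if ab: "a \<le> b" for a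
  proof -
    have set_int: "complex_set_integrable lborel {- T..T} (\<lambda>t. k a t * char \<mu> t)" if "real_distribution \<mu>" for \<mu> T
    proof -
      interpret real_distribution \<mu> by fact
      show ?thesis unfolding set_integrable_def
      proof (rule Bochner_Integration.integrable_bound)
        show "integrable lborel (\<lambda>t. indicator {-T..T} t *\<^sub>R (b - a))"
          using ab by (intro integrable_real_indicator[THEN integrable_scaleR_left]) (auto simp: emeasure_lborel_Icc_eq)
        show "AE t in lborel. norm (indicat_real {- T..T} t *\<^sub>R (k a t * char \<mu> t)) \<le> norm (indicat_real {- T..T} t *\<^sub>R (b - a))"
        proof (rule AE_I2)
          fix t
          have "cmod (k a t) * cmod (char \<mu> t) \<le> (b - a) * 1"
            by (intro mult_mono k1 cmod_char_le_1) (use ab in auto)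
          then show "norm (indicat_real {- T..T} t *\<^sub>R (k a t * char \<mu> t)) \<le> norm (indicat_real {- T..T} t *\<^sub>R (b - a))"
            using ab by (simp add: norm_mult split: split_indicator)
        qed
      qed measurable
    qed
    let ?I = "\<lambda>\<mu> T::nat. 1 / (2 * pi) * (CLBINT t=-T..T. k a t * char \<mu> t)"
    have lim: "?I \<mu> \<longlonglongrightarrow> complex_of_real (measure \<mu> {a<..b})" if \<mu>: "real_distribution \<mu>" "\<And>x. measure \<mu> {x} = 0" for \<mu>
      unfolding k_def by (rule real_distribution.Levy_Inversion[OF \<mu>(1) ab]) (simp_all add: \<mu>(2))
    have lims: "(\<lambda>T. cmod (?I \<mu>1 T - ?I \<mu>2 T)) \<longlonglongrightarrow> cmod (complex_of_real (measure \<mu>1 {a<..b}) - complex_of_real (measure \<mu>2 {a<..b}))"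
      by (intro tendsto_intros lim \<mu>1 \<mu>2 atom1 atom2)
    have "cmod (?I \<mu>1 T - ?I \<mu>2 T) \<le> ?E" for T :: nat
    proof -
      have i: "?I \<mu> T = 1 / (2 * pi) * (CLBINT t:{-real T..real T}. k a t * char \<mu> t)" for \<mu>
        by (subst interval_integral_Icc) simp_all
      have "?I \<mu>1 T - ?I \<mu>2 T = 1 / (2 * pi) * ((CLBINT t:{-real T..real T}. k a t * char \<mu>1 t) - (CLBINT t:{-real T..real T}. k a t * char \<mu>2 t))"
        unfolding i by (simp add: right_diff_distrib)
      also have "(CLBINT t:{-real T..real T}. k a t * char \<mu>1 t) - (CLBINT t:{-real T..real T}. k a t * char \<mu>2 t)
        = (CLBINT t:{-real T..real T}. k a t * char \<mu>1 t - k a t * char \<mu>2 t)"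
        by (rule set_integral_diff(2)[symmetric]) (intro set_int \<mu>1 \<mu>2)+
      finally have e: "cmod (?I \<mu>1 T - ?I \<mu>2 T) = 1 / (2 * pi) * cmod (CLBINT t:{-real T..real T}. k a t * char \<mu>1 t - k a t * char \<mu>2 t)"
        by (simp add: norm_mult norm_divide)
      have "cmod (CLBINT t:{-real T..real T}. k a t * char \<mu>1 t - k a t * char \<mu>2 t) \<le> (LINT t|lborel. 2 * h t)"
        unfolding set_lebesgue_integral_def
      proof (rule Bochner_Integration.integral_norm_bound_integral)
        show "integrable lborel (\<lambda>t. indicat_real {- real T..real T} t *\<^sub>R (k a t * char \<mu>1 t - k a t * char \<mu>2 t))"
          using set_integral_diff(1)[OF set_int[OF \<mu>1] set_int[OF \<mu>2]] unfolding set_integrable_def .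
        show "integrable lborel (\<lambda>t. 2 * h t)" using h by simp
        fix t :: real
        have "cmod (k a t * char \<mu>1 t - k a t * char \<mu>2 t) = cmod (k a t) * cmod (char \<mu>1 t - char \<mu>2 t)"
          by (simp only: right_diff_distrib[symmetric] norm_mult)
        also have "\<dots> \<le> cmod (k a t) * (\<bar>t\<bar> * h t)" by (intro mult_left_mono bound) simp
        also have "\<dots> \<le> 2 * h t" using mult_right_mono[OF k2[of a t] hn[of t]] by (simp add: mult.assoc)
        finally show "norm (indicat_real {- real T..real T} t *\<^sub>R (k a t * char \<mu>1 t - k a t * char \<mu>2 t)) \<le> 2 * h t"
          using hn[of t] by (auto split: split_indicator)
      qed
      then show ?thesis unfolding e by (simp add: field_simps)
    qed
    then have "cmod (complex_of_real (measure \<mu>1 {a<..b}) - complex_of_real (measure \<mu>2 {a<..b})) \<le> ?E"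
      by (intro LIMSEQ_le_const2[OF lims]) auto
    then show ?thesis by (simp flip: of_real_diff)
  qed
  have "((\<lambda>a. \<bar>(cdf \<mu>1 b - cdf \<mu>1 a) - (cdf \<mu>2 b - cdf \<mu>2 a)\<bar>) \<longlongrightarrow> \<bar>(cdf \<mu>1 b - 0) - (cdf \<mu>2 b - 0)\<bar>) at_bot"
    by (intro tendsto_intros \<mu>1.cdf_lim_at_bot \<mu>2.cdf_lim_at_bot)
  moreover have "eventually (\<lambda>a. \<bar>(cdf \<mu>1 b - cdf \<mu>1 a) - (cdf \<mu>2 b - cdf \<mu>2 a)\<bar> \<le> ?E) at_bot"
  proof (rule eventually_mono[OF eventually_le_at_bot[of "b - 1"]])
    fix a assume "a \<le> b - 1"
    then have ab: "a < b" by simp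
    show "\<bar>(cdf \<mu>1 b - cdf \<mu>1 a) - (cdf \<mu>2 b - cdf \<mu>2 a)\<bar> \<le> ?E"
      using diff[of a] ab unfolding \<mu>1.cdf_diff_eq[OF ab] \<mu>2.cdf_diff_eq[OF ab] by simp
  qed
  ultimately have "\<bar>(cdf \<mu>1 b - 0) - (cdf \<mu>2 b - 0)\<bar> \<le> ?E"
    by (rule tendsto_upperbound) simp
  then show ?thesis by simp
qed

section \<open>Gaussian smoothing\<close>

text \<open>
  The law of \<open>Y + \<delta> Z\<close> for independent \<open>Y\<close> with law \<open>\<mu>\<close> and standard normal \<open>Z\<close>. It has no atoms
  and its characteristic function is integrable, as the inversion formula requires.
\<close>

definition smooth :: "real measure \<Rightarrow> real \<Rightarrow> real measure" where
  "smooth \<mu> \<delta> = distr (\<mu> \<Otimes>\<^sub>M std_normal_distribution) borel (\<lambda>(x, g). x + \<delta> * g)"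

lemma prob_space_std_normal: "prob_space std_normal_distribution"
  by (rule prob_space_normal_density) simp

context
  fixes \<mu> :: "real measure" and \<delta> :: real
  assumes \<mu>: "real_distribution \<mu>" and \<delta>: "\<delta> > 0"
begin

interpretation \<mu>: real_distribution \<mu> by (rule \<mu>)
interpretation N: prob_space std_normal_distribution by (rule prob_space_std_normal)
interpretation P: pair_prob_space \<mu> std_normal_distribution ..

lemma smooth_real_distribution: "real_distribution (smooth \<mu> \<delta>)"
  unfolding smooth_def by (rule P.real_distribution_distr) simp

lemma char_smooth: "char (smooth \<mu> \<delta>) t = char \<mu> t * exp (- (\<delta> * t)\<^sup>2 / 2)"
proof -
  have "char (smooth \<mu> \<delta>) t = (CLINT z|\<mu> \<Otimes>\<^sub>M std_normal_distribution. iexp (t * (fst z + \<delta> * snd z)))"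
    unfolding smooth_def char_def by (subst integral_distr) (simp_all add: case_prod_beta')
  also have "\<dots> = (CLINT z|\<mu> \<Otimes>\<^sub>M std_normal_distribution. (case z of (x, g) \<Rightarrow> iexp (t * x) * iexp (t * \<delta> * g)))"
    by (intro Bochner_Integration.integral_cong) (auto simp: distrib_left exp_add mult.assoc algebra_simps)
  also have "\<dots> = (CLINT x|\<mu>. (CLINT g|std_normal_distribution. iexp (t * x) * iexp (t * \<delta> * g)))"
  proof -
    have "integrable (\<mu> \<Otimes>\<^sub>M std_normal_distribution) (\<lambda>z. case z of (x, g) \<Rightarrow> iexp (t * x) * iexp (t * \<delta> * g))"
      by (rule P.integrable_const_bound[where B = 1]) (auto simp: norm_mult)
    from P.integral_fst'[OF this, symmetric] show ?thesis by (simp only: prod.case)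
  qed
  also have "\<dots> = (CLINT x|\<mu>. iexp (t * x) * char std_normal_distribution (t * \<delta>))"
    by (simp add: char_def)
  also have "\<dots> = char \<mu> t * char std_normal_distribution (t * \<delta>)"
    by (simp add: char_def[of \<mu>])
  finally show ?thesis by (simp add: char_std_normal_distribution mult.commute)
qed

lemma atom_smooth: "measure (smooth \<mu> \<delta>) {a} = 0"
proof -
  have m: "{z. fst z + \<delta> * snd z = a} \<in> sets (\<mu> \<Otimes>\<^sub>M std_normal_distribution)"
  proof -
    have "{z \<in> space (\<mu> \<Otimes>\<^sub>M std_normal_distribution). fst z + \<delta> * snd z = a} \<in> sets (\<mu> \<Otimes>\<^sub>M std_normal_distribution)"
      by measurable
    then show ?thesis by (simp add: space_pair_measure)
  qed
  have "emeasure (smooth \<mu> \<delta>) {a} = emeasure (\<mu> \<Otimes>\<^sub>M std_normal_distribution) {z. fst z + \<delta> * snd z = a}"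
    unfolding smooth_def by (subst emeasure_distr) (auto simp: space_pair_measure intro!: arg_cong2[where f = emeasure])
  also have "\<dots> = (\<integral>\<^sup>+x. emeasure std_normal_distribution {g. x + \<delta> * g = a} \<partial>\<mu>)"
    using m by (subst N.emeasure_pair_measure_alt) (auto simp: vimage_def)
  also have "\<dots> = (\<integral>\<^sup>+x. 0 \<partial>\<mu>)"
  proof (rule nn_integral_cong)
    fix x
    have "{g. x + \<delta> * g = a} = {(a - x) / \<delta>}" using \<delta> by (auto simp: field_simps)
    then show "emeasure std_normal_distribution {g. x + \<delta> * g = a} = 0"
      by (simp add: emeasure_density nn_integral_null_set[of "{(a - x) / \<delta>}"] null_sets_def)
  qed
  finally show ?thesis by (simp add: measure_def)
qed

text \<open>
  On the event \<open>|Z| \<le> s\<close> the variables \<open>Y\<close> and \<open>Y + \<delta> Z\<close> differ by at most \<open>\<delta> s\<close>.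
\<close>

lemma cdf_smooth_bounds:
  "cdf \<mu> x \<le> cdf (smooth \<mu> \<delta>) (x + \<delta> * s) + measure std_normal_distribution {g. \<bar>g\<bar> > s}"
  "cdf (smooth \<mu> \<delta>) (x - \<delta> * s) \<le> cdf \<mu> x + measure std_normal_distribution {g. \<bar>g\<bar> > s}"
proof -
  let ?P = "\<mu> \<Otimes>\<^sub>M std_normal_distribution"
  have s1: "measure ?P ({..x} \<times> UNIV) = cdf \<mu> x"
    using N.emeasure_pair_measure_Times[of "{..x}" \<mu> UNIV] N.emeasure_space_1 by (simp add: cdf_def measure_def)
  have s2: "measure ?P (UNIV \<times> {g. \<bar>g\<bar> > s}) = measure std_normal_distribution {g. \<bar>g\<bar> > s}"
    using N.emeasure_pair_measure_Times[of UNIV \<mu> "{g. \<bar>g\<bar> > s}"] \<mu>.emeasure_space_1 by (simp add: measure_def)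
  have s3: "cdf (smooth \<mu> \<delta>) y = measure ?P {z. fst z + \<delta> * snd z \<le> y}" for y
    unfolding cdf_def smooth_def by (subst measure_distr) (auto simp: space_pair_measure case_prod_beta' intro!: arg_cong2[where f = measure])
  have m[measurable]: "{z. fst z + \<delta> * snd z \<le> y} \<in> sets ?P" for y
  proof -
    have "{z \<in> space ?P. fst z + \<delta> * snd z \<le> y} \<in> sets ?P" by measurable
    then show ?thesis by (simp add: space_pair_measure)
  qed
  have m1: "{..x} \<times> UNIV \<in> sets ?P" "UNIV \<times> {g. \<bar>g\<bar> > s} \<in> sets ?P"
    by (intro pair_measureI; simp)+
  have "cdf \<mu> x \<le> measure ?P ({z. fst z + \<delta> * snd z \<le> x + \<delta> * s} \<union> UNIV \<times> {g. \<bar>g\<bar> > s})"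
    unfolding s1[symmetric]
  proof (rule P.finite_measure_mono)
    show "{..x} \<times> UNIV \<subseteq> {z. fst z + \<delta> * snd z \<le> x + \<delta> * s} \<union> UNIV \<times> {g. \<bar>g\<bar> > s}"
      using \<delta> by (auto intro!: add_mono)
  qed (intro sets.Un m m1)
  also have "\<dots> \<le> measure ?P {z. fst z + \<delta> * snd z \<le> x + \<delta> * s} + measure ?P (UNIV \<times> {g. \<bar>g\<bar> > s})"
    by (rule measure_Un_le[OF m m1(2)])
  finally show "cdf \<mu> x \<le> cdf (smooth \<mu> \<delta>) (x + \<delta> * s) + measure std_normal_distribution {g. \<bar>g\<bar> > s}"
    unfolding s3 s2 .
  have "cdf (smooth \<mu> \<delta>) (x - \<delta> * s) \<le> measure ?P ({..x} \<times> UNIV \<union> UNIV \<times> {g. \<bar>g\<bar> > s})"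
    unfolding s3
  proof (rule P.finite_measure_mono)
    show "{z. fst z + \<delta> * snd z \<le> x - \<delta> * s} \<subseteq> {..x} \<times> UNIV \<union> UNIV \<times> {g. \<bar>g\<bar> > s}"
    proof
      fix z assume z: "z \<in> {z. fst z + \<delta> * snd z \<le> x - \<delta> * s}"
      show "z \<in> {..x} \<times> UNIV \<union> UNIV \<times> {g. \<bar>g\<bar> > s}"
      proof (cases "\<bar>snd z\<bar> > s")
        case False
        then have "\<delta> * (- s) \<le> \<delta> * snd z" using \<delta> by (intro mult_left_mono) auto
        then show ?thesis using z by (cases z) auto
      qed (cases z, auto)
    qed
  qed (intro sets.Un m1)
  also have "\<dots> \<le> measure ?P ({..x} \<times> UNIV) + measure ?P (UNIV \<times> {g. \<bar>g\<bar> > s})"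
    by (rule measure_Un_le[OF m1])
  finally show "cdf (smooth \<mu> \<delta>) (x - \<delta> * s) \<le> cdf \<mu> x + measure std_normal_distribution {g. \<bar>g\<bar> > s}"
    unfolding s1 s2 .
qed

end

text \<open>
  Markov's inequality for the fourth moment, which is 3.
\<close>

lemma std_normal_tail:
  assumes "s > 0"
  shows "measure std_normal_distribution {g. \<bar>g\<bar> > s} \<le> 3 / s ^ 4"
proof -
  interpret N: prob_space std_normal_distribution by (rule prob_space_std_normal)
  have "measure std_normal_distribution {g. \<bar>g\<bar> > s} \<le> measure std_normal_distribution {g \<in> space std_normal_distribution. g ^ 4 \<ge> s ^ 4}"
  proof (rule N.finite_measure_mono)
    show "{g. \<bar>g\<bar> > s} \<subseteq> {g \<in> space std_normal_distribution. g ^ 4 \<ge> s ^ 4}"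
    proof
      fix g :: real assume "g \<in> {g. \<bar>g\<bar> > s}"
      then have "s ^ 4 \<le> \<bar>g\<bar> ^ 4" using assms by (intro power_mono) auto
      then show "g \<in> {g \<in> space std_normal_distribution. g ^ 4 \<ge> s ^ 4}" by simp
    qed
  qed simp
  also have "\<dots> \<le> (LINT g|std_normal_distribution. g ^ 4) / s ^ 4"
    by (rule integral_Markov_inequality_measure[where A = "{}"])
      (use integrable_std_normal_distribution_moment[of 4] assms in auto)
  also have "(LINT g|std_normal_distribution. g ^ 4) = 3"
    using std_normal_distribution_even_moments[of 2] by (simp add: fact_numeral)
  finally show ?thesis .
qed

section \<open>Centred normal laws\<close>

abbreviation "normal0 \<sigma> \<equiv> density lborel (\<lambda>x. ennreal (normal_density 0 \<sigma> x))"

lemma normal0_real_distribution: "\<sigma> > 0 \<Longrightarrow> real_distribution (normal0 \<sigma>)"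
  using prob_space_normal_density[of \<sigma> 0] by (auto simp: real_distribution_def real_distribution_axioms_def)

lemma char_normal0:
  assumes "\<sigma> > 0" shows "char (normal0 \<sigma>) t = exp (- (\<sigma> * t)\<^sup>2 / 2)"
proof -
  interpret N: prob_space std_normal_distribution by (rule prob_space_std_normal)
  have "distributed std_normal_distribution lborel (\<lambda>x. x) (normal_density 0 1)"
    unfolding distributed_def by (simp add: distr_id2)
  from N.normal_density_affine[OF this, of \<sigma> 0] assms
  have "distributed std_normal_distribution lborel (\<lambda>x. \<sigma> * x) (normal_density 0 \<sigma>)" by simp
  then have "distr std_normal_distribution lborel (\<lambda>x. \<sigma> * x) = normal0 \<sigma>"
    by (rule distributed_distr_eq_density)
  moreover have "distr std_normal_distribution lborel (\<lambda>x. \<sigma> * x) = distr std_normal_distribution borel (\<lambda>x. \<sigma> * x)"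
    by (rule distr_cong) simp_all
  ultimately have "char (normal0 \<sigma>) t = char (distr std_normal_distribution borel (\<lambda>x. \<sigma> * x)) t" by simp
  also have "\<dots> = char std_normal_distribution (\<sigma> * t)"
    unfolding char_def by (subst integral_distr) (simp_all add: mult.assoc mult.left_commute mult.commute)
  finally show ?thesis by (simp add: char_std_normal_distribution)
qed

lemma cdf_normal0_lipschitz:
  assumes s: "\<sigma> > 0" and xy: "x \<le> y"
  shows "cdf (normal0 \<sigma>) y - cdf (normal0 \<sigma>) x \<le> (y - x) / \<sigma>"
proof (cases "x = y")
  case False
  then have lt: "x < y" using xy by simp
  interpret real_distribution "normal0 \<sigma>" by (rule normal0_real_distribution[OF s])
  have nd: "normal_density 0 \<sigma> z \<le> 1 / \<sigma>" for z
  proof -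
    have "sqrt (2 * pi * \<sigma>\<^sup>2) = sqrt (2 * pi) * \<sigma>" using s by (simp add: real_sqrt_mult)
    moreover have "sqrt (2 * pi) \<ge> 1" using pi_gt3 by simp
    ultimately have "sqrt (2 * pi * \<sigma>\<^sup>2) \<ge> \<sigma>" using s by simp
    then have "1 / sqrt (2 * pi * \<sigma>\<^sup>2) \<le> 1 / \<sigma>" using s by (intro divide_left_mono) auto
    moreover have "exp (- (z - 0)\<^sup>2 / (2 * \<sigma>\<^sup>2)) \<le> 1" by simp
    ultimately have "1 / sqrt (2 * pi * \<sigma>\<^sup>2) * exp (- (z - 0)\<^sup>2 / (2 * \<sigma>\<^sup>2)) \<le> 1 / \<sigma> * 1"
      using s by (intro mult_mono) auto
    then show ?thesis by (simp add: normal_density_def)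
  qed
  have "emeasure (normal0 \<sigma>) {x<..y} = (\<integral>\<^sup>+z. ennreal (normal_density 0 \<sigma> z) * indicator {x<..y} z \<partial>lborel)"
    by (rule emeasure_density) simp_all
  also have "\<dots> \<le> (\<integral>\<^sup>+z. ennreal (1 / \<sigma>) * indicator {x<..y} z \<partial>lborel)"
    by (intro nn_integral_mono mult_right_mono ennreal_leI nd) simp
  also have "\<dots> = ennreal (1 / \<sigma>) * ennreal (y - x)" using lt by (simp add: nn_integral_cmult)
  also have "\<dots> = ennreal ((y - x) / \<sigma>)" using s lt by (subst ennreal_mult[symmetric]) simp_all
  finally have "measure (normal0 \<sigma>) {x<..y} \<le> (y - x) / \<sigma>"
    unfolding emeasure_eq_measure using s lt by (simp add: ennreal_le_iff)
  then show ?thesis unfolding cdf_diff_eq[OF lt] .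
qed simp

section \<open>Central limit theorem from powers of a characteristic function\<close>

text \<open>
  The proof of the central limit theorem uses nothing about the sums except that their
  characteristic functions are powers. The hypothesis is stated in this form because
  only the one-dimensional laws of the Busemann function along the walk are known.
\<close>

lemma clt_of_char_powers:
  fixes \<rho> :: "real measure" and \<beta> :: "nat \<Rightarrow> real measure"
  assumes \<rho>: "real_distribution \<rho>" and \<beta>: "\<And>n. real_distribution (\<beta> n)"
    and ch: "\<And>n t. n > 0 \<Longrightarrow> char (\<beta> n) t = char \<rho> (t / sqrt n) ^ n"
    and int1: "integrable \<rho> (\<lambda>x. x)" and int2: "integrable \<rho> (\<lambda>x. x\<^sup>2)"
    and mean: "(LINT x|\<rho>. x) = 0" and var: "(LINT x|\<rho>. x\<^sup>2) = \<sigma>\<^sup>2" and \<sigma>: "\<sigma> > 0"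
  shows "weak_conv_m \<beta> (normal0 \<sigma>)"
proof (rule levy_continuity)
  show "real_distribution (normal0 \<sigma>)" by (rule normal0_real_distribution[OF \<sigma>])
  fix t
  interpret \<rho>: real_distribution \<rho> by fact
  let ?t = "\<lambda>n. t / sqrt (real n)"
  let ?q = "\<lambda>n. 1 + (- (\<sigma> * t)\<^sup>2 / 2) / real n"
  have main: "\<forall>\<^sub>F n in sequentially. cmod (char (\<beta> n) t - (?q n) ^ n) \<le> t\<^sup>2 / 6 * (LINT x|\<rho>. min (6 * x\<^sup>2) (\<bar>?t n\<bar> * \<bar>x\<bar> ^ 3))"
  proof (rule eventually_sequentiallyI)
    fix n :: nat
    assume "n \<ge> nat (ceiling ((\<sigma> * t)\<^sup>2 / 4)) + 1"
    then have n: "real n \<ge> (\<sigma> * t)\<^sup>2 / 4" "n > 0" by linarith+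
    have "norm (char \<rho> (?t n) - (1 - (?t n)\<^sup>2 * \<sigma>\<^sup>2 / 2)) \<le> (?t n)\<^sup>2 / 6 * (LINT x|\<rho>. min (6 * x\<^sup>2) (\<bar>?t n\<bar> * \<bar>x\<bar> ^ 3))"
      by (rule \<rho>.char_approx3) (use int1 int2 mean var in auto)
    moreover have "1 - (?t n)\<^sup>2 * \<sigma>\<^sup>2 / 2 = ?q n"
      using n(2) by (simp add: power_divide power_mult_distrib mult.commute)
    ultimately have *: "norm (char \<rho> (?t n) - complex_of_real (?q n)) \<le> (?t n)\<^sup>2 / 6 * (LINT x|\<rho>. min (6 * x\<^sup>2) (\<bar>?t n\<bar> * \<bar>x\<bar> ^ 3))"
      by (metis of_real_diff of_real_1 of_real_mult of_real_power of_real_divide of_real_numeral)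
    have "\<bar>?q n\<bar> \<le> 1" using n by (simp add: abs_le_iff field_simps)
    then have q1: "cmod (complex_of_real (?q n)) \<le> 1" by (simp only: norm_of_real)
    have "cmod (char (\<beta> n) t - complex_of_real (?q n) ^ n) \<le> n * cmod (char \<rho> (?t n) - complex_of_real (?q n))"
      unfolding ch[OF n(2)] by (rule norm_power_diff[OF \<rho>.cmod_char_le_1 q1])
    also have "\<dots> \<le> n * ((?t n)\<^sup>2 / 6 * (LINT x|\<rho>. min (6 * x\<^sup>2) (\<bar>?t n\<bar> * \<bar>x\<bar> ^ 3)))"
      by (rule mult_left_mono[OF *]) simp
    also have "\<dots> = t\<^sup>2 / 6 * (LINT x|\<rho>. min (6 * x\<^sup>2) (\<bar>?t n\<bar> * \<bar>x\<bar> ^ 3))"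
      using n(2) by (simp add: power_divide)
    finally show "cmod (char (\<beta> n) t - (?q n) ^ n) \<le> t\<^sup>2 / 6 * (LINT x|\<rho>. min (6 * x\<^sup>2) (\<bar>?t n\<bar> * \<bar>x\<bar> ^ 3))"
      by (simp only: of_real_power)
  qed
  have "(\<lambda>n. min (6 * x\<^sup>2) (\<bar>?t n\<bar> * \<bar>x\<bar> ^ 3)) \<longlonglongrightarrow> 0" for x
  proof -
    have "(\<lambda>n. ?t n) \<longlonglongrightarrow> 0"
      by (intro tendsto_divide_0[OF tendsto_const] filterlim_at_top_imp_at_infinity
          filterlim_compose[OF sqrt_at_top filterlim_real_sequentially])
    then have "(\<lambda>n. min (6 * x\<^sup>2) (\<bar>?t n\<bar> * \<bar>x\<bar> ^ 3)) \<longlonglongrightarrow> min (6 * x\<^sup>2) (\<bar>0\<bar> * \<bar>x\<bar> ^ 3)"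
      by (intro tendsto_intros)
    then show ?thesis by simp
  qed
  then have "(\<lambda>n. LINT x|\<rho>. min (6 * x\<^sup>2) (\<bar>?t n\<bar> * \<bar>x\<bar> ^ 3)) \<longlonglongrightarrow> (LINT x|\<rho>. 0)"
    using int2 by (intro integral_dominated_convergence[where w = "\<lambda>x. 6 * x\<^sup>2"]) auto
  then have *: "(\<lambda>n. t\<^sup>2 / 6 * (LINT x|\<rho>. min (6 * x\<^sup>2) (\<bar>?t n\<bar> * \<bar>x\<bar> ^ 3))) \<longlonglongrightarrow> 0"
    by (simp only: integral_zero tendsto_mult_right_zero)
  have "(\<lambda>n. complex_of_real ((?q n) ^ n)) \<longlonglongrightarrow> complex_of_real (exp (- (\<sigma> * t)\<^sup>2 / 2))"
    by (rule isCont_tendsto_compose[OF _ tendsto_exp_limit_sequentially]) auto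
  then have "(\<lambda>n. char (\<beta> n) t) \<longlonglongrightarrow> complex_of_real (exp (- (\<sigma> * t)\<^sup>2 / 2))"
    by (rule Lim_transform) (rule Lim_null_comparison[OF main *])
  then show "(\<lambda>n. char (\<beta> n) t) \<longlonglongrightarrow> char (normal0 \<sigma>) t"
    by (simp add: char_normal0[OF \<sigma>])
qed (rule \<beta>)

section \<open>Rate of convergence\<close>

text \<open>
  Compare both distribution functions with their smoothed versions at points shifted by \<open>\<delta> s\<close>; the
  normal distribution function is Lipschitz, so the shifts cost \<open>2 \<delta> s / \<sigma>\<close>.
\<close>

lemma smoothing_inequality:
  assumes \<mu>: "real_distribution \<mu>" and \<sigma>: "\<sigma> > 0" and \<delta>: "\<delta> > 0" and s: "s > 0"
    and E: "\<And>x. \<bar>cdf (smooth \<mu> \<delta>) x - cdf (smooth (normal0 \<sigma>) \<delta>) x\<bar> \<le> E"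
  shows "\<bar>cdf \<mu> x - cdf (normal0 \<sigma>) x\<bar> \<le> E + 2 * \<delta> * s / \<sigma> + 6 / s ^ 4"
proof -
  let ?N = "normal0 \<sigma>" and ?p = "measure std_normal_distribution {g. \<bar>g\<bar> > s}"
  note N = normal0_real_distribution[OF \<sigma>]
  have ds: "\<delta> * s > 0" using \<delta> s by simp
  have p: "?p \<le> 3 / s ^ 4" by (rule std_normal_tail[OF s])
  have l1: "cdf ?N (x + 2 * (\<delta> * s)) - cdf ?N x \<le> 2 * (\<delta> * s) / \<sigma>"
    using cdf_normal0_lipschitz[OF \<sigma>, of x "x + 2 * (\<delta> * s)"] ds by simp
  have l2: "cdf ?N x - cdf ?N (x - 2 * (\<delta> * s)) \<le> 2 * (\<delta> * s) / \<sigma>"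
    using cdf_normal0_lipschitz[OF \<sigma>, of "x - 2 * (\<delta> * s)" x] ds by simp
  have y1: "x + 2 * (\<delta> * s) - \<delta> * s = x + \<delta> * s" and y2: "x - 2 * (\<delta> * s) + \<delta> * s = x - \<delta> * s" by simp_all
  have u1: "cdf \<mu> x \<le> cdf (smooth \<mu> \<delta>) (x + \<delta> * s) + ?p" by (rule cdf_smooth_bounds(1)[OF \<mu> \<delta>])
  have u2: "cdf (smooth ?N \<delta>) (x + \<delta> * s) \<le> cdf ?N (x + 2 * (\<delta> * s)) + ?p"
    using cdf_smooth_bounds(2)[OF N \<delta>, of "x + 2 * (\<delta> * s)" s] by (simp only: y1)
  have v1: "cdf (smooth \<mu> \<delta>) (x - \<delta> * s) \<le> cdf \<mu> x + ?p" by (rule cdf_smooth_bounds(2)[OF \<mu> \<delta>])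
  have v2: "cdf ?N (x - 2 * (\<delta> * s)) \<le> cdf (smooth ?N \<delta>) (x - \<delta> * s) + ?p"
    using cdf_smooth_bounds(1)[OF N \<delta>, of "x - 2 * (\<delta> * s)" s] by (simp only: y2)
  have e1: "cdf (smooth \<mu> \<delta>) (x + \<delta> * s) - cdf (smooth ?N \<delta>) (x + \<delta> * s) \<le> E" using E[of "x + \<delta> * s"] by linarith
  have e2: "cdf (smooth ?N \<delta>) (x - \<delta> * s) - cdf (smooth \<mu> \<delta>) (x - \<delta> * s) \<le> E" using E[of "x - \<delta> * s"] by linarith
  have q: "6 / s ^ 4 = 2 * (3 / s ^ 4)" by simp
  have r: "2 * \<delta> * s / \<sigma> = 2 * (\<delta> * s) / \<sigma>" by simp
  show ?thesis unfolding q r abs_le_iff using l1 l2 u1 u2 v1 v2 e1 e2 p by linarith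
qed

lemma norm_power_diff_le:
  fixes a b :: complex
  assumes "cmod a \<le> m" "cmod b \<le> m" "m > 0" "n > 0"
  shows "cmod (a ^ n - b ^ n) \<le> n * m ^ (n - 1) * cmod (a - b)"
proof -
  have "cmod (a / of_real m) \<le> 1" "cmod (b / of_real m) \<le> 1" using assms by (simp_all add: norm_divide)
  then have "cmod ((a / of_real m) ^ n - (b / of_real m) ^ n) \<le> n * cmod (a / of_real m - b / of_real m)"
    by (rule norm_power_diff)
  also have "(a / of_real m) ^ n - (b / of_real m) ^ n = (a ^ n - b ^ n) / of_real (m ^ n)"
    by (simp add: power_divide diff_divide_distrib)
  also have "a / of_real m - b / of_real m = (a - b) / of_real m" by (simp add: diff_divide_distrib)
  finally have "cmod (a ^ n - b ^ n) / m ^ n \<le> n * (cmod (a - b) / m)"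
    using assms by (simp add: norm_divide norm_power)
  then have "cmod (a ^ n - b ^ n) \<le> n * (cmod (a - b) / m) * m ^ n" using assms by (simp add: divide_le_eq)
  also have "\<dots> = n * m ^ (n - 1) * cmod (a - b)" using assms by (cases n) simp_all
  finally show ?thesis .
qed

lemma exp_minus_bounds:
  assumes "u \<ge> (0::real)" shows "\<bar>exp (- u) - (1 - u)\<bar> \<le> u\<^sup>2"
proof -
  have 1: "1 - u \<le> exp (- u)" using exp_ge_add_one_self[of "- u"] by simp
  have "exp (- u) * (1 + u) \<le> exp (- u) * exp u" using exp_ge_add_one_self[of u] by (intro mult_left_mono) auto
  also have "\<dots> = 1" by (simp flip: exp_add)
  also have "1 \<le> (1 - u + u\<^sup>2) * (1 + u)"
  proof -
    have "(1 - u + u\<^sup>2) * (1 + u) = 1 + u ^ 3" by (simp add: power2_eq_square power3_eq_cube algebra_simps)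
    then show ?thesis using assms by simp
  qed
  finally have "exp (- u) \<le> 1 - u + u\<^sup>2" using assms by (simp add: mult_le_cancel_right)
  then show ?thesis using 1 by (simp add: abs_le_iff)
qed

text \<open>
  The third-order Taylor expansion of the characteristic function near 0, and the resulting Gaussian
  bound on its modulus.
\<close>

lemma char_cubic_bounds:
  assumes \<rho>: "real_distribution \<rho>" and int1: "integrable \<rho> (\<lambda>x. x)" and int2: "integrable \<rho> (\<lambda>x. x\<^sup>2)" and int3: "integrable \<rho> (\<lambda>x. \<bar>x\<bar> ^ 3)"
    and mean: "(LINT x|\<rho>. x) = 0" and var: "(LINT x|\<rho>. x\<^sup>2) = \<sigma>\<^sup>2" and \<sigma>: "\<sigma> > 0"
  obtains c C where "c > 0" "C \<ge> 0" "\<And>s. \<bar>s\<bar> \<le> c \<Longrightarrow> (\<sigma> * s)\<^sup>2 \<le> 1"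
    "\<And>s. \<bar>s\<bar> \<le> c \<Longrightarrow> cmod (char \<rho> s - exp (- (\<sigma> * s)\<^sup>2 / 2)) \<le> C * \<bar>s\<bar> ^ 3"
    "\<And>s. \<bar>s\<bar> \<le> c \<Longrightarrow> cmod (char \<rho> s) \<le> exp (- (\<sigma> * s)\<^sup>2 / 4)"
proof -
  interpret \<rho>: real_distribution \<rho> by fact
  define b where "b = (LINT x|\<rho>. \<bar>x\<bar> ^ 3)"
  have b: "b \<ge> 0" unfolding b_def by (rule integral_nonneg_AE) simp
  define c where "c = min 1 (min (1 / \<sigma>) (3 * \<sigma>\<^sup>2 / (2 * (b + 1))))"
  have c: "c > 0" using \<sigma> b by (simp add: c_def)
  have ap: "cmod (char \<rho> s - (1 - s\<^sup>2 * \<sigma>\<^sup>2 / 2)) \<le> \<bar>s\<bar> ^ 3 * b / 6" for s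
  proof -
    have "cmod (char \<rho> s - (1 - s\<^sup>2 * \<sigma>\<^sup>2 / 2)) \<le> s\<^sup>2 / 6 * (LINT x|\<rho>. min (6 * x\<^sup>2) (\<bar>s\<bar> * \<bar>x\<bar> ^ 3))"
      by (rule \<rho>.char_approx3) (use int1 int2 mean var in auto)
    also have "\<dots> \<le> s\<^sup>2 / 6 * (LINT x|\<rho>. \<bar>s\<bar> * \<bar>x\<bar> ^ 3)"
    proof (intro mult_left_mono integral_mono)
      show "integrable \<rho> (\<lambda>x. \<bar>s\<bar> * \<bar>x\<bar> ^ 3)" using int3 by simp
      then show "integrable \<rho> (\<lambda>x. min (6 * x\<^sup>2) (\<bar>s\<bar> * \<bar>x\<bar> ^ 3))"
        by (rule Bochner_Integration.integrable_bound) auto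
    qed auto
    also have "\<dots> = \<bar>s\<bar> ^ 3 * b / 6" by (simp add: b_def power3_eq_cube power2_eq_square)
    finally show ?thesis .
  qed
  have ss: "(\<sigma> * s)\<^sup>2 \<le> 1" if "\<bar>s\<bar> \<le> c" for s
  proof -
    have "\<bar>s\<bar> \<le> 1 / \<sigma>" using that by (simp add: c_def)
    then have "\<bar>\<sigma> * s\<bar> \<le> 1" using \<sigma> by (simp add: abs_mult field_simps)
    then show ?thesis by (simp add: abs_square_le_1)
  qed
  define C where "C = b / 6 + \<sigma> ^ 4 / 4"
  show ?thesis
  proof (rule that[of c C])
    show "c > 0" by (rule c)
    show "C \<ge> 0" using b by (simp add: C_def)
    fix s assume s: "\<bar>s\<bar> \<le> c"
    show "(\<sigma> * s)\<^sup>2 \<le> 1" by (rule ss[OF s])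
    have s1: "\<bar>s\<bar> \<le> 1" using s by (simp add: c_def)
    let ?u = "(\<sigma> * s)\<^sup>2 / 2"
    have us: "1 - s\<^sup>2 * \<sigma>\<^sup>2 / 2 = 1 - ?u" by (simp add: power_mult_distrib mult.commute)
    have ap': "cmod (char \<rho> s - complex_of_real (1 - ?u)) \<le> \<bar>s\<bar> ^ 3 * b / 6"
      using ap[of s] unfolding us[symmetric] by simp
    have "cmod (complex_of_real (exp (- ?u)) - complex_of_real (1 - ?u)) \<le> ?u\<^sup>2"
      using exp_minus_bounds[of ?u] by (simp flip: of_real_diff)
    also have "?u\<^sup>2 = \<sigma> ^ 4 / 4 * (\<bar>s\<bar> ^ 3 * \<bar>s\<bar>)"
      by (simp add: power_mult_distrib power_divide power2_eq_square power3_eq_cube power4_eq_xxxx)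
    also have "\<dots> \<le> \<sigma> ^ 4 / 4 * (\<bar>s\<bar> ^ 3 * 1)" using s1 by (intro mult_left_mono) auto
    finally have ex: "cmod (complex_of_real (exp (- ?u)) - complex_of_real (1 - ?u)) \<le> \<sigma> ^ 4 / 4 * \<bar>s\<bar> ^ 3" by simp
    have "cmod (char \<rho> s - complex_of_real (exp (- ?u))) \<le> cmod (char \<rho> s - complex_of_real (1 - ?u)) + cmod (complex_of_real (exp (- ?u)) - complex_of_real (1 - ?u))"
      by (metis norm_triangle_ineq4 diff_diff_eq2 diff_add_cancel)
    also have "\<dots> \<le> C * \<bar>s\<bar> ^ 3" using ap' ex by (simp add: C_def algebra_simps)
    finally show "cmod (char \<rho> s - exp (- (\<sigma> * s)\<^sup>2 / 2)) \<le> C * \<bar>s\<bar> ^ 3" by simp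
    have "cmod (char \<rho> s) \<le> cmod (complex_of_real (1 - ?u)) + cmod (char \<rho> s - complex_of_real (1 - ?u))"
      by (metis norm_triangle_sub)
    also have "cmod (complex_of_real (1 - ?u)) = 1 - ?u"
      unfolding norm_of_real using ss[OF s] by simp
    also have "cmod (char \<rho> s - complex_of_real (1 - ?u)) \<le> ?u / 2"
    proof -
      have "\<bar>s\<bar> * b \<le> 3 * \<sigma>\<^sup>2 / (2 * (b + 1)) * b" using s b by (intro mult_right_mono) (simp_all add: c_def)
      also have "\<dots> = 3 * \<sigma>\<^sup>2 / 2 * (b / (b + 1))" by simp
      also have "\<dots> \<le> 3 * \<sigma>\<^sup>2 / 2 * 1" using b by (intro mult_left_mono) simp_all
      finally have sb: "\<bar>s\<bar> * b \<le> 3 * \<sigma>\<^sup>2 / 2" by simp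
      have "\<bar>s\<bar> ^ 3 * b / 6 = s\<^sup>2 / 6 * (\<bar>s\<bar> * b)" by (simp add: power3_eq_cube power2_eq_square)
      also have "\<dots> \<le> s\<^sup>2 / 6 * (3 * \<sigma>\<^sup>2 / 2)" by (intro mult_left_mono sb) simp
      also have "\<dots> = ?u / 2" by (simp add: power_mult_distrib)
      finally show ?thesis by (rule order_trans[OF ap'])
    qed
    finally have "cmod (char \<rho> s) \<le> 1 + (- (\<sigma> * s)\<^sup>2 / 4)" by simp
    also have "\<dots> \<le> exp (- (\<sigma> * s)\<^sup>2 / 4)" by (rule exp_ge_add_one_self)
    finally show "cmod (char \<rho> s) \<le> exp (- (\<sigma> * s)\<^sup>2 / 4)" .
  qed
qed

lemma exp_minus_le_inverse_square:
  assumes "y > (0::real)" shows "exp (- y) \<le> 2 / y\<^sup>2"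
proof -
  have "y\<^sup>2 / 2 \<le> exp y" using exp_lower_Taylor_quadratic[of y] assms by simp
  then have "exp (- y) * (y\<^sup>2 / 2) \<le> exp (- y) * exp y" by (intro mult_left_mono) auto
  also have "\<dots> = 1" by (simp flip: exp_add)
  finally show ?thesis using assms by (simp add: field_simps)
qed

lemma gaussian_integrals:
  assumes a: "a > 0"
  shows "integrable lborel (\<lambda>t. exp (- (a * t)\<^sup>2))" "integrable lborel (\<lambda>t. t\<^sup>2 * exp (- (a * t)\<^sup>2))"
    "(LINT t|lborel. exp (- (a * t)\<^sup>2)) = sqrt pi / a"
proof -
  define s where "s = 1 / (a * sqrt 2)"
  have s: "s > 0" using a by (simp add: s_def)
  have s2: "2 * s\<^sup>2 = 1 / a\<^sup>2" using a by (simp add: s_def power_mult_distrib power_divide)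
  have e: "exp (- (a * t)\<^sup>2) = sqrt (2 * pi * s\<^sup>2) * normal_density 0 s t" for t
  proof -
    have "- (a * t)\<^sup>2 = - (t - 0)\<^sup>2 / (2 * s\<^sup>2)" unfolding s2 by (simp add: power_mult_distrib mult.commute)
    then show ?thesis using s by (simp add: normal_density_def)
  qed
  show "integrable lborel (\<lambda>t. exp (- (a * t)\<^sup>2))" unfolding e using s by simp
  show "integrable lborel (\<lambda>t. t\<^sup>2 * exp (- (a * t)\<^sup>2))"
  proof -
    have "integrable lborel (\<lambda>t. sqrt (2 * pi * s\<^sup>2) * (normal_density 0 s t * (t - 0) ^ 2))"
      by (intro integrable_mult_right integrable_normal_moment[OF s])
    then show ?thesis unfolding e by (simp only: mult.commute mult.left_commute mult.assoc diff_zero)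
  qed
  have "sqrt (2 * pi * s\<^sup>2) = sqrt (pi * (2 * s\<^sup>2))" by (simp add: mult_ac)
  also have "\<dots> = sqrt pi / a" unfolding s2 using a by (simp add: real_sqrt_divide)
  finally show "(LINT t|lborel. exp (- (a * t)\<^sup>2)) = sqrt pi / a" unfolding e using s by simp
qed

text \<open>
  Smoothing on the scale \<open>\<delta> = n^(-5/12)\<close>, with \<open>s = n^(1/12)\<close>. For \<open>|t| \<le> c \<surd>n\<close> the third-order
  expansion controls the difference of the characteristic functions and contributes \<open>n^(-1/2)\<close>. For
  larger \<open>t\<close> it is bounded by 2 and the Gaussian factor of the smoothing contributes
  \<open>(\<surd>n \<delta>)^(-5) = n^(-5/12)\<close>. The two smoothing errors \<open>\<delta> s\<close> and \<open>s^(-4)\<close> are both \<open>n^(-1/3)\<close>. This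
  is weaker than the theorem of Berry and Esseen but needs no sharper smoothing kernel.
\<close>

lemma rate_of_char_powers:
  fixes \<rho> :: "real measure" and \<beta> :: "nat \<Rightarrow> real measure"
  assumes \<rho>: "real_distribution \<rho>" and \<beta>: "\<And>n. real_distribution (\<beta> n)"
    and ch: "\<And>n t. n > 0 \<Longrightarrow> char (\<beta> n) t = char \<rho> (t / sqrt n) ^ n"
    and int1: "integrable \<rho> (\<lambda>x. x)" and int2: "integrable \<rho> (\<lambda>x. x\<^sup>2)" and int3: "integrable \<rho> (\<lambda>x. \<bar>x\<bar> ^ 3)"
    and mean: "(LINT x|\<rho>. x) = 0" and var: "(LINT x|\<rho>. x\<^sup>2) = \<sigma>\<^sup>2" and \<sigma>: "\<sigma> > 0"
  obtains D where "\<And>n x. n > 0 \<Longrightarrow> \<bar>cdf (\<beta> n) x - cdf (normal0 \<sigma>) x\<bar> \<le> D * real n powr (- 1/3)"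
proof -
  interpret \<rho>: real_distribution \<rho> by fact
  obtain c C where c: "c > 0" and C: "C \<ge> 0" and ss: "\<And>s. \<bar>s\<bar> \<le> c \<Longrightarrow> (\<sigma> * s)\<^sup>2 \<le> 1"
    and ch1: "\<And>s. \<bar>s\<bar> \<le> c \<Longrightarrow> cmod (char \<rho> s - exp (- (\<sigma> * s)\<^sup>2 / 2)) \<le> C * \<bar>s\<bar> ^ 3"
    and ch2: "\<And>s. \<bar>s\<bar> \<le> c \<Longrightarrow> cmod (char \<rho> s) \<le> exp (- (\<sigma> * s)\<^sup>2 / 4)"
    using char_cubic_bounds[OF \<rho> int1 int2 int3 mean var \<sigma>] by blast
  \<comment> \<open>\<open>(a t)\<^sup>2\<close> is half of the Gaussian exponent \<open>(\<sigma> t)\<^sup>2 / 4\<close>, which is enough\<close>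
  define a where "a = \<sigma> / sqrt 8"
  have a: "a > 0" using \<sigma> by (simp add: a_def)
  have a2: "(a * t)\<^sup>2 = (\<sigma> * t)\<^sup>2 / 8" for t by (simp add: a_def power_mult_distrib power_divide)
  define A where "A = (LINT t|lborel. t\<^sup>2 * exp (- (a * t)\<^sup>2))"
  define K1 where "K1 = 4 * C"
  define K2 where "K2 = 64 / c ^ 5"
  have A: "A \<ge> 0" unfolding A_def by (rule integral_nonneg_AE) simp
  have K: "K1 \<ge> 0" "K2 \<ge> 0" using C c by (simp_all add: K1_def K2_def)
  define D where "D = (1 / pi) * (K1 * A + K2 * (2 * sqrt pi)) + 2 / \<sigma> + 6"
  have main: "\<bar>cdf (\<beta> n) x - cdf (normal0 \<sigma>) x\<bar> \<le> D * real n powr (- 1/3)" if n: "n > 0" for n x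
  proof -
    have n1: "real n \<ge> 1" using n by simp
    define r where "r = sqrt (real n)"
    have r: "r > 0" "r\<^sup>2 = real n" using n by (simp_all add: r_def)
    define \<delta> where "\<delta> = real n powr (- 5/12)"
    define s where "s = real n powr (1/12)"
    have \<delta>: "\<delta> > 0" "s > 0" using n by (simp_all add: \<delta>_def s_def)
    have near: "cmod (char (\<beta> n) t - exp (- (\<sigma> * t)\<^sup>2 / 2)) \<le> \<bar>t\<bar> * (K1 / r * (t\<^sup>2 * exp (- (a * t)\<^sup>2)))" if t: "\<bar>t\<bar> \<le> c * r" for t
    proof -
      let ?s = "t / r" and ?m = "exp (- (\<sigma> * (t / r))\<^sup>2 / 4)"
      have sc: "\<bar>?s\<bar> \<le> c" using t r by (simp add: abs_divide divide_le_eq)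
      have ev: "complex_of_real (exp (- (\<sigma> * t)\<^sup>2 / 2)) = complex_of_real (exp (- (\<sigma> * ?s)\<^sup>2 / 2)) ^ n"
      proof -
        have "real n * (- (\<sigma> * ?s)\<^sup>2 / 2) = - (\<sigma> * t)\<^sup>2 / 2"
          using r by (simp add: power_mult_distrib power_divide flip: r(2))
        then have "exp (- (\<sigma> * ?s)\<^sup>2 / 2) ^ n = exp (- (\<sigma> * t)\<^sup>2 / 2)" by (simp only: exp_of_nat_mult[symmetric])
        then show ?thesis by (simp flip: of_real_power)
      qed
      have b: "cmod (complex_of_real (exp (- (\<sigma> * ?s)\<^sup>2 / 2))) \<le> ?m"
        unfolding norm_of_real by simp
      have "cmod (char (\<beta> n) t - exp (- (\<sigma> * t)\<^sup>2 / 2)) \<le> n * ?m ^ (n - 1) * cmod (char \<rho> ?s - complex_of_real (exp (- (\<sigma> * ?s)\<^sup>2 / 2)))"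
        unfolding ch[OF n] ev r_def[symmetric] by (rule norm_power_diff_le[OF ch2[OF sc] b _ n]) simp
      also have "\<dots> \<le> n * (2 * exp (- (a * t)\<^sup>2)) * (C * \<bar>?s\<bar> ^ 3)"
      proof (intro mult_mono ch1[OF sc] order_refl)
        have "?m ^ (n - 1) = exp (real (n - 1) * (- (\<sigma> * ?s)\<^sup>2 / 4))" by (simp only: exp_of_nat_mult)
        also have "real (n - 1) * (- (\<sigma> * ?s)\<^sup>2 / 4) = - ((real n - 1) * (\<sigma> * ?s)\<^sup>2) / 4" using n by (simp add: of_nat_diff)
        also have "\<dots> \<le> - ((real n - 1) * (\<sigma> * ?s)\<^sup>2) / 8" using n1 by simp
        also have "\<dots> = - (real n * (\<sigma> * ?s)\<^sup>2) / 8 + (\<sigma> * ?s)\<^sup>2 / 8" by (simp add: algebra_simps diff_divide_distrib)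
        also have "real n * (\<sigma> * ?s)\<^sup>2 = (\<sigma> * t)\<^sup>2" using r by (simp add: power_mult_distrib power_divide flip: r(2))
        also have "- (\<sigma> * t)\<^sup>2 / 8 + (\<sigma> * ?s)\<^sup>2 / 8 \<le> - (a * t)\<^sup>2 + 1 / 8" unfolding a2 using ss[OF sc] by simp
        finally have "?m ^ (n - 1) \<le> exp (- (a * t)\<^sup>2 + 1 / 8)" by simp
        also have "\<dots> = exp (- (a * t)\<^sup>2) * exp (1 / 8)" by (rule exp_add)
        also have "\<dots> \<le> exp (- (a * t)\<^sup>2) * 2"
          using exp_bound[of "1/8 :: real"] by (intro mult_left_mono) (simp_all add: power2_eq_square)
        finally show "?m ^ (n - 1) \<le> 2 * exp (- (a * t)\<^sup>2)" by (simp only: mult.commute)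
      qed simp_all
      also have "\<dots> \<le> \<bar>t\<bar> * (K1 / r * (t\<^sup>2 * exp (- (a * t)\<^sup>2)))"
      proof -
        have "real n * \<bar>?s\<bar> ^ 3 = \<bar>t\<bar> * t\<^sup>2 / r"
        proof -
          have "real n * \<bar>?s\<bar> ^ 3 = r\<^sup>2 * (\<bar>t\<bar> ^ 3 / r ^ 3)" using r by (simp add: power_divide flip: r(2))
          also have "\<dots> = \<bar>t\<bar> ^ 3 / r" using r(1) by (simp add: power2_eq_square power3_eq_cube)
          finally show ?thesis by (simp add: power2_eq_square power3_eq_cube)
        qed
        moreover have e8: "n * (2 * exp (- (a * t)\<^sup>2)) * (C * \<bar>?s\<bar> ^ 3) = 2 * C * exp (- (a * t)\<^sup>2) * (real n * \<bar>?s\<bar> ^ 3)"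
          by (simp only: mult.commute mult.left_commute mult.assoc)
        ultimately have "n * (2 * exp (- (a * t)\<^sup>2)) * (C * \<bar>?s\<bar> ^ 3) = 2 * C * exp (- (a * t)\<^sup>2) * (\<bar>t\<bar> * t\<^sup>2 / r)"
          by (simp only: e8)
        also have "\<dots> \<le> 4 * C * exp (- (a * t)\<^sup>2) * (\<bar>t\<bar> * t\<^sup>2 / r)" using C r by (intro mult_right_mono) auto
        also have "\<dots> = \<bar>t\<bar> * (K1 / r * (t\<^sup>2 * exp (- (a * t)\<^sup>2)))" by (simp add: K1_def)
        finally show ?thesis .
      qed
      finally show ?thesis .
    qed
    have far: "cmod (char (\<beta> n) t - exp (- (\<sigma> * t)\<^sup>2 / 2)) * exp (- (\<delta> * t)\<^sup>2 / 2) \<le> \<bar>t\<bar> * (K2 / (r ^ 5 * \<delta> ^ 4) * exp (- (\<delta> / 2 * t)\<^sup>2))"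
      if t: "\<bar>t\<bar> > c * r" for t
    proof -
      have t0: "\<bar>t\<bar> > 0" using t c r by (meson less_trans mult_pos_pos)
      interpret bn: real_distribution "\<beta> n" by (rule \<beta>)
      have "cmod (char (\<beta> n) t - exp (- (\<sigma> * t)\<^sup>2 / 2)) \<le> cmod (char (\<beta> n) t) + cmod (complex_of_real (exp (- (\<sigma> * t)\<^sup>2 / 2)))"
        by (rule norm_triangle_ineq4)
      also have "\<dots> \<le> 1 + 1" by (intro add_mono bn.cmod_char_le_1) (unfold norm_of_real, simp)
      finally have two: "cmod (char (\<beta> n) t - exp (- (\<sigma> * t)\<^sup>2 / 2)) \<le> 2" by simp
      have y: "(\<delta> / 2 * t)\<^sup>2 > 0" using \<delta> t0 by simp
      have "exp (- (\<delta> * t)\<^sup>2 / 2) = exp (- (\<delta> / 2 * t)\<^sup>2) * exp (- (\<delta> / 2 * t)\<^sup>2)"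
        by (simp add: power_mult_distrib power_divide flip: exp_add)
      also have "\<dots> \<le> 2 / ((\<delta> / 2 * t)\<^sup>2)\<^sup>2 * exp (- (\<delta> / 2 * t)\<^sup>2)"
        by (intro mult_right_mono exp_minus_le_inverse_square[OF y]) simp
      also have "2 / ((\<delta> / 2 * t)\<^sup>2)\<^sup>2 = 32 / (\<delta> ^ 4 * t ^ 4)"
        by (simp add: power_mult_distrib power_divide)
      finally have "cmod (char (\<beta> n) t - exp (- (\<sigma> * t)\<^sup>2 / 2)) * exp (- (\<delta> * t)\<^sup>2 / 2) \<le> 2 * (32 / (\<delta> ^ 4 * t ^ 4) * exp (- (\<delta> / 2 * t)\<^sup>2))"
        using two by (intro mult_mono) auto
      also have "\<dots> = 64 / \<delta> ^ 4 * exp (- (\<delta> / 2 * t)\<^sup>2) * (1 / t ^ 4)" by simp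
      also have "\<dots> \<le> 64 / \<delta> ^ 4 * exp (- (\<delta> / 2 * t)\<^sup>2) * (\<bar>t\<bar> * (1 / (c ^ 5 * r ^ 5)))"
      proof (rule mult_left_mono)
        have "(c * r) ^ 5 \<le> \<bar>t\<bar> ^ 5" using t c r by (intro power_mono) auto
        also have "\<bar>t\<bar> ^ 5 = \<bar>t\<bar> * t ^ 4" by (simp add: power_numeral_reduce) 
        finally have "c ^ 5 * r ^ 5 \<le> \<bar>t\<bar> * t ^ 4" by (simp add: power_mult_distrib)
        then show "1 / t ^ 4 \<le> \<bar>t\<bar> * (1 / (c ^ 5 * r ^ 5))" using t0 c r by (simp add: field_simps)
      qed simp
      also have "\<dots> = \<bar>t\<bar> * (K2 / (r ^ 5 * \<delta> ^ 4) * exp (- (\<delta> / 2 * t)\<^sup>2))"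
        by (simp add: K2_def mult_ac)
      finally show ?thesis .
    qed
    define h where "h t = K1 / r * (t\<^sup>2 * exp (- (a * t)\<^sup>2)) + K2 / (r ^ 5 * \<delta> ^ 4) * exp (- (\<delta> / 2 * t)\<^sup>2)" for t
    have hn: "h t \<ge> 0" for t unfolding h_def using K r \<delta> by simp
    have hb: "cmod (char (smooth (\<beta> n) \<delta>) t - char (smooth (normal0 \<sigma>) \<delta>) t) \<le> \<bar>t\<bar> * h t" for t
    proof -
      have "cmod (char (smooth (\<beta> n) \<delta>) t - char (smooth (normal0 \<sigma>) \<delta>) t) = cmod (char (\<beta> n) t - exp (- (\<sigma> * t)\<^sup>2 / 2)) * exp (- (\<delta> * t)\<^sup>2 / 2)"
        unfolding char_smooth[OF \<beta> \<delta>(1)] char_smooth[OF normal0_real_distribution[OF \<sigma>] \<delta>(1)] char_normal0[OF \<sigma>] left_diff_distrib[symmetric] norm_mult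
        by simp
      also have "\<dots> \<le> \<bar>t\<bar> * h t"
      proof (cases "\<bar>t\<bar> \<le> c * r")
        case True
        have "cmod (char (\<beta> n) t - exp (- (\<sigma> * t)\<^sup>2 / 2)) * exp (- (\<delta> * t)\<^sup>2 / 2) \<le> \<bar>t\<bar> * (K1 / r * (t\<^sup>2 * exp (- (a * t)\<^sup>2))) * 1"
          using near[OF True] K r by (intro mult_mono) auto
        also have "\<dots> \<le> \<bar>t\<bar> * h t" unfolding h_def mult_1_right using K r \<delta> by (intro mult_left_mono) auto
        finally show ?thesis .
      next
        case False
        then have "cmod (char (\<beta> n) t - exp (- (\<sigma> * t)\<^sup>2 / 2)) * exp (- (\<delta> * t)\<^sup>2 / 2) \<le> \<bar>t\<bar> * (K2 / (r ^ 5 * \<delta> ^ 4) * exp (- (\<delta> / 2 * t)\<^sup>2))"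
          by (intro far) simp
        also have "\<dots> \<le> \<bar>t\<bar> * h t" unfolding h_def using K r by (intro mult_left_mono) auto
        finally show ?thesis .
      qed
      finally show ?thesis .
    qed
    have d2: "\<delta> / 2 > 0" using \<delta> by simp
    note g1 = gaussian_integrals[OF a] and g2 = gaussian_integrals[OF d2]
    have hi: "integrable lborel h" unfolding h_def using g1(2) g2(1) by (intro Bochner_Integration.integrable_add integrable_mult_right) auto
    have hint: "(LINT t|lborel. h t) = K1 * A / r + K2 * (2 * sqrt pi) / (r ^ 5 * \<delta> ^ 5)"
    proof -
      have "(LINT t|lborel. h t) = K1 / r * A + K2 / (r ^ 5 * \<delta> ^ 4) * (sqrt pi / (\<delta> / 2))"
        unfolding h_def A_def g2(3)[symmetric] using g1(2) g2(1) by (subst Bochner_Integration.integral_add) auto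
      also have "K2 / (r ^ 5 * \<delta> ^ 4) * (sqrt pi / (\<delta> / 2)) = K2 * (2 * sqrt pi) / (r ^ 5 * \<delta> ^ 5)"
        using \<delta> r by (simp add: field_simps power_numeral_reduce)
      finally show ?thesis by simp
    qed
    have pw: "1 / r \<le> real n powr (- 1/3)" "1 / (r ^ 5 * \<delta> ^ 5) \<le> real n powr (- 1/3)" "\<delta> * s = real n powr (- 1/3)" "1 / s ^ 4 = real n powr (- 1/3)"
    proof -
      have rp: "r = real n powr (1/2)" using n by (simp add: r_def powr_half_sqrt)
      have "1 / r = real n powr (- 1/2)" unfolding rp using n by (simp add: powr_minus_divide)
      also have "\<dots> \<le> real n powr (- 1/3)" using n1 by (intro powr_mono) auto
      finally show "1 / r \<le> real n powr (- 1/3)" .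
      have "r ^ 5 * \<delta> ^ 5 = real n powr (5/2) * real n powr (- 25/12)"
        unfolding rp \<delta>_def using n by (simp add: powr_power)
      also have "\<dots> = real n powr (5/12)" by (simp flip: powr_add)
      finally have "1 / (r ^ 5 * \<delta> ^ 5) = real n powr (- 5/12)" using n by (simp add: powr_minus_divide)
      also have "\<dots> \<le> real n powr (- 1/3)" using n1 by (intro powr_mono) auto
      finally show "1 / (r ^ 5 * \<delta> ^ 5) \<le> real n powr (- 1/3)" .
      show "\<delta> * s = real n powr (- 1/3)" unfolding \<delta>_def s_def by (simp flip: powr_add)
      have "s ^ 4 = real n powr (1/3)" unfolding s_def using n by (simp add: powr_power)
      then show "1 / s ^ 4 = real n powr (- 1/3)" by (simp add: powr_minus_divide)
    qed
    have "\<bar>cdf (smooth (\<beta> n) \<delta>) x - cdf (smooth (normal0 \<sigma>) \<delta>) x\<bar> \<le> (1 / pi) * (LINT t|lborel. h t)" for x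
      by (rule cdf_diff_le_of_char[OF smooth_real_distribution[OF \<beta> \<delta>(1)] smooth_real_distribution[OF normal0_real_distribution[OF \<sigma>] \<delta>(1)]
            atom_smooth[OF \<beta> \<delta>(1)] atom_smooth[OF normal0_real_distribution[OF \<sigma>] \<delta>(1)] hi hn hb])
    then have "\<bar>cdf (\<beta> n) x - cdf (normal0 \<sigma>) x\<bar> \<le> (1 / pi) * (LINT t|lborel. h t) + 2 * \<delta> * s / \<sigma> + 6 / s ^ 4"
      by (rule smoothing_inequality[OF \<beta> \<sigma> \<delta>])
    also have "2 * \<delta> * s / \<sigma> = 2 / \<sigma> * (\<delta> * s)" by simp
    also have "6 / s ^ 4 = 6 * (1 / s ^ 4)" by simp
    also have "(LINT t|lborel. h t) = K1 * A * (1 / r) + K2 * (2 * sqrt pi) * (1 / (r ^ 5 * \<delta> ^ 5))" unfolding hint by simp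
    also have "(1 / pi) * (K1 * A * (1 / r) + K2 * (2 * sqrt pi) * (1 / (r ^ 5 * \<delta> ^ 5))) + 2 / \<sigma> * (\<delta> * s) + 6 * (1 / s ^ 4)
      \<le> (1 / pi) * (K1 * A * real n powr (- 1/3) + K2 * (2 * sqrt pi) * real n powr (- 1/3)) + 2 / \<sigma> * real n powr (- 1/3) + 6 * real n powr (- 1/3)"
      unfolding pw(3,4) using K A pw(1,2) by (intro add_mono mult_left_mono order_refl) auto
    also have "\<dots> = D * real n powr (- 1/3)" by (simp add: D_def distrib_left distrib_right add.assoc mult.assoc)
    finally show ?thesis .
  qed
  then show ?thesis by (rule that)
qed

section \<open>The horospherical function\<close>

lemma horo_bounds:
  assumes t: "0 \<le> t" and r: "0 \<le> r" "r \<le> 1"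
  shows "horo t r \<phi> \<le> exp t" "exp (- t) \<le> horo t r \<phi>" "exp t * (1 - r\<^sup>2) / 4 \<le> horo t r \<phi>"
proof -
  have s: "sinh t \<ge> 0" using t by simp
  have nz: "cmod (of_real r * exp (\<i> * of_real \<phi>) * of_real (sinh t)) = r * sinh t"
    using r s by (simp add: norm_mult)
  have nc: "cmod (of_real (cosh t)) = cosh t" by simp
  have "horo t r \<phi> \<le> cosh t + r * sinh t"
    unfolding horo_def by (rule order_trans[OF norm_triangle_ineq]) (simp only: nz nc order_refl)
  also have "\<dots> \<le> cosh t + 1 * sinh t" using r s by (intro add_left_mono mult_right_mono)
  finally show "horo t r \<phi> \<le> exp t" by (simp add: cosh_plus_sinh)
  have low: "cosh t - r * sinh t \<le> horo t r \<phi>"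
    unfolding horo_def using norm_diff_ineq[of "of_real (cosh t)" "of_real r * exp (\<i> * of_real \<phi>) * of_real (sinh t) :: complex"]
    by (simp only: nz nc)
  have "cosh t - 1 * sinh t \<le> cosh t - r * sinh t" using r s by (intro diff_left_mono mult_right_mono)
  then show "exp (- t) \<le> horo t r \<phi>" using low by (simp add: cosh_minus_sinh)
  have e: "cosh t - r * sinh t = exp t * (1 - r) / 2 + exp (- t) * (1 + r) / 2"
    by (simp add: cosh_field_def sinh_field_def field_simps)
  have "1 - r\<^sup>2 = (1 - r) * (1 + r)" by (simp add: power2_eq_square algebra_simps)
  also have "\<dots> \<le> (1 - r) * 2" using r by (intro mult_left_mono) auto
  finally have "exp t * (1 - r\<^sup>2) \<le> exp t * ((1 - r) * 2)" by (intro mult_left_mono) auto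
  then have "exp t * (1 - r\<^sup>2) / 4 \<le> exp t * (1 - r) / 2" by simp
  also have "\<dots> \<le> cosh t - r * sinh t" unfolding e using r by simp
  finally show "exp t * (1 - r\<^sup>2) / 4 \<le> horo t r \<phi>" using low by linarith
qed

lemma abs_ln_horo_le:
  assumes "0 \<le> t" "0 \<le> r" "r \<le> 1"
  shows "\<bar>ln (horo t r \<phi>)\<bar> \<le> t"
proof -
  have p: "horo t r \<phi> > 0" using horo_bounds(2)[OF assms, of \<phi>] exp_gt_zero[of "- t"] by linarith
  have "ln (horo t r \<phi>) \<le> ln (exp t)" using horo_bounds(1)[OF assms, of \<phi>] p by (subst ln_le_cancel_iff) auto
  then have "ln (horo t r \<phi>) \<le> t" by simp
  moreover have "- t \<le> ln (horo t r \<phi>)" using horo_bounds(2)[OF assms, of \<phi>] p by (simp add: ln_ge_iff)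
  ultimately show ?thesis by (simp add: abs_le_iff)
qed

text \<open>
  The square of the function is a quadratic polynomial in \<open>r\<close> with leading coefficient
  \<open>(sinh t)\<^sup>2\<close>.
\<close>

lemma finite_horo_level:
  assumes t: "t > 0"
  shows "finite {r. horo t r \<phi> = c}"
proof -
  let ?p = "[:(cosh t)\<^sup>2 - c\<^sup>2, 2 * cosh t * sinh t * cos \<phi>, (sinh t)\<^sup>2:]"
  have "(sinh t)\<^sup>2 \<noteq> 0" using t by simp
  then have "?p \<noteq> 0" by simp
  then have "finite {r. poly ?p r = 0}" by (rule poly_roots_finite)
  moreover have "{r. horo t r \<phi> = c} \<subseteq> {r. poly ?p r = 0}"
  proof
    fix r assume "r \<in> {r. horo t r \<phi> = c}"
    then have c: "c = sqrt ((cosh t)\<^sup>2 + 2 * cosh t * sinh t * (r * cos \<phi>) + (sinh t)\<^sup>2 * r\<^sup>2)"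
      by (simp add: horo_def cmod_polar_combination)
    have "horo t r \<phi> \<ge> 0" by (simp add: horo_def)
    then have "(cosh t)\<^sup>2 + 2 * cosh t * sinh t * (r * cos \<phi>) + (sinh t)\<^sup>2 * r\<^sup>2 \<ge> 0"
      by (simp add: horo_def cmod_polar_combination)
    then have "c\<^sup>2 = (cosh t)\<^sup>2 + 2 * cosh t * sinh t * (r * cos \<phi>) + (sinh t)\<^sup>2 * r\<^sup>2" by (simp add: c)
    then show "r \<in> {r. poly ?p r = 0}" by (simp add: power2_eq_square algebra_simps)
  qed
  ultimately show ?thesis by (rule rev_finite_subset)
qed

text \<open>
  The radial part of the measure has a density, so it suffices to exclude a null set of radii for
  each angle.
\<close>

lemma AE_m_measI:
  assumes P[measurable]: "Measurable.pred (borel \<Otimes>\<^sub>M borel) (\<lambda>(r, \<phi>). P r \<phi>)"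
    and ae: "\<And>\<phi>. AE r in lborel. r \<in> {0..1} \<longrightarrow> P r \<phi>" and \<beta>: "\<beta> \<ge> -1/2" "\<alpha> > \<beta>"
  shows "AE (r, \<phi>) in m_meas \<alpha> \<beta>. P r \<phi>"
proof -
  let ?f = "\<lambda>r \<phi>. if P r \<phi> then 0 else 1 :: ennreal"
  have fm[measurable]: "(\<lambda>(r, \<phi>). ?f r \<phi>) \<in> borel_measurable (borel \<Otimes>\<^sub>M borel)"
    using P by (simp add: case_prod_beta')
  have "(\<integral>\<^sup>+(r, \<phi>). ?f r \<phi> \<partial>m_meas \<alpha> \<beta>) = 0"
  proof (cases "\<beta> = -1/2")
    case True
    have "(\<integral>\<^sup>+r. ennreal ((1 - r\<^sup>2) powr (\<alpha> - 1/2)) * indicator {0..1} r * ((?f r 0 + ?f r pi) / 2) \<partial>lborel) = (\<integral>\<^sup>+r. 0 \<partial>(lborel :: real measure))"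
    proof (rule nn_integral_cong_AE)
      show "AE r in lborel. ennreal ((1 - r\<^sup>2) powr (\<alpha> - 1/2)) * indicator {0..1} r * ((?f r 0 + ?f r pi) / 2) = 0"
        using ae[of 0] ae[of pi] by eventually_elim (auto split: split_indicator)
    qed
    then show ?thesis unfolding True by (subst nn_integral_m_meas_real[OF fm]) (use \<beta> True in auto)
  next
    case False
    have "AE \<phi> in (lborel :: real measure). AE r in (lborel :: real measure). r \<in> {0..1} \<longrightarrow> P r \<phi>"
      using ae by simp
    moreover have mset: "{z \<in> space (lborel \<Otimes>\<^sub>M lborel). fst z \<in> {0..1} \<longrightarrow> P (fst z) (snd z)} \<in> sets (lborel \<Otimes>\<^sub>M (lborel :: real measure))"
    proof -
      have [measurable]: "Measurable.pred (borel \<Otimes>\<^sub>M borel) (\<lambda>z. P (fst z) (snd z))" using P by (simp add: case_prod_beta')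
      have "{z \<in> space (borel \<Otimes>\<^sub>M borel). fst z \<in> {0..1} \<longrightarrow> P (fst z) (snd z)} \<in> sets (borel \<Otimes>\<^sub>M (borel :: real measure))"
        by measurable
      then show ?thesis by (simp add: space_pair_measure)
    qed
    ultimately have ae2: "AE r in lborel. AE \<phi> in lborel. r \<in> {0..1} \<longrightarrow> P r \<phi>"
      using iffD2[OF lborel_pair.AE_commute[where P = "\<lambda>r \<phi>. r \<in> {0..1} \<longrightarrow> P r \<phi>", OF mset]] by blast
    have "(\<integral>\<^sup>+r. ennreal ((1 - r\<^sup>2) powr (\<alpha> - \<beta> - 1) * r powr (2 * \<beta> + 1)) * indicator {0..1} r *
      (\<integral>\<^sup>+\<phi>. ennreal (sin \<phi> powr (2 * \<beta>)) * ?f r \<phi> * indicator {0..pi} \<phi> \<partial>lborel) \<partial>lborel) = (\<integral>\<^sup>+r. 0 \<partial>(lborel :: real measure))"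
    proof (rule nn_integral_cong_AE)
      show "AE r in lborel. ennreal ((1 - r\<^sup>2) powr (\<alpha> - \<beta> - 1) * r powr (2 * \<beta> + 1)) * indicator {0..1} r *
        (\<integral>\<^sup>+\<phi>. ennreal (sin \<phi> powr (2 * \<beta>)) * ?f r \<phi> * indicator {0..pi} \<phi> \<partial>lborel) = 0"
        using ae2
      proof eventually_elim
        case (elim r)
        show ?case
        proof (cases "r \<in> {0..1}")
          case True
          have "(\<integral>\<^sup>+\<phi>. ennreal (sin \<phi> powr (2 * \<beta>)) * ?f r \<phi> * indicator {0..pi} \<phi> \<partial>lborel) = (\<integral>\<^sup>+\<phi>. 0 \<partial>(lborel :: real measure))"
          proof (rule nn_integral_cong_AE)
            show "AE \<phi> in lborel. ennreal (sin \<phi> powr (2 * \<beta>)) * ?f r \<phi> * indicator {0..pi} \<phi> = 0"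
              using elim by eventually_elim (use True in auto)
          qed
          then show ?thesis by simp
        qed simp
      qed
    qed
    then show ?thesis using False \<beta> by (subst nn_integral_m_meas[OF fm]) auto
  qed
  then have "AE z in m_meas \<alpha> \<beta>. (case z of (r, \<phi>) \<Rightarrow> ?f r \<phi>) = 0"
    by (subst nn_integral_0_iff_AE[symmetric]) simp_all
  then show ?thesis by eventually_elim (auto split: if_splits)
qed

lemma AE_m_meas_unit:
  assumes "\<beta> \<ge> -1/2" "\<alpha> > \<beta>"
  shows "AE (r, \<phi>) in m_meas \<alpha> \<beta>. 0 \<le> r \<and> r < 1"
proof (rule AE_m_measI[OF _ _ assms])
  show "AE r in (lborel :: real measure). r \<in> {0..1} \<longrightarrow> 0 \<le> r \<and> r < 1" for \<phi> :: real
  proof -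
    have "AE r in lborel. r \<noteq> (1::real)" by (rule AE_lborel_singleton)
    then show ?thesis by eventually_elim auto
  qed
qed measurable

lemma AE_m_meas_horo_neq:
  assumes "\<beta> \<ge> -1/2" "\<alpha> > \<beta>" and t: "t > 0"
  shows "AE (r, \<phi>) in m_meas \<alpha> \<beta>. horo t r \<phi> \<noteq> c"
proof (rule AE_m_measI[OF _ _ assms(1,2)])
  show "AE r in lborel. r \<in> {0..1} \<longrightarrow> horo t r \<phi> \<noteq> c" for \<phi>
  proof -
    have "{r. horo t r \<phi> = c} \<in> null_sets lborel"
      by (rule finite_imp_null_set_lborel[OF finite_horo_level[OF t]])
    from AE_not_in[OF this] show ?thesis by eventually_elim auto
  qed
qed measurable

text \<open>
  The extra factor lowers the exponent of \<open>1 - r\<^sup>2\<close> by 1/4, that is, it replaces \<open>\<alpha>\<close> by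
  \<open>\<alpha> - 1/4\<close>; since \<open>\<alpha> - 1/4 > \<beta>\<close>, the new density is again that of a probability measure up to
  a constant.
\<close>

lemma m_meas_singular_integral:
  assumes \<beta>: "\<beta> \<ge> -1/2" "\<alpha> - \<beta> \<ge> 1/2"
  shows "(\<integral>\<^sup>+(r, \<phi>). ennreal ((1 - r\<^sup>2) powr (-1/4)) \<partial>m_meas \<alpha> \<beta>) < \<infinity>"
proof -
  let ?f = "\<lambda>(r::real) (\<phi>::real). ennreal ((1 - r\<^sup>2) powr (-1/4))"
  have fm: "(\<lambda>(r, \<phi>). ?f r \<phi>) \<in> borel_measurable (borel \<Otimes>\<^sub>M borel)" by measurable
  have om: "(\<lambda>(r::real, \<phi>::real). 1 :: ennreal) \<in> borel_measurable (borel \<Otimes>\<^sub>M borel)" by measurable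
  have fin: "c' * X < \<infinity>" if "c * X = 1" "c' < \<infinity>" for c c' X :: ennreal
  proof -
    have "X \<noteq> \<top>" using that(1) by (cases "c = 0") (auto simp: ennreal_mult_top)
    then show ?thesis using that(2) by (simp add: ennreal_mult_less_top less_top)
  qed
  interpret P: prob_space "m_meas (\<alpha> - 1/4) \<beta>" by (rule prob_space_m_meas) (use \<beta> in auto)
  have one: "(\<integral>\<^sup>+(r, \<phi>). 1 \<partial>m_meas (\<alpha> - 1/4) \<beta>) = 1" using P.emeasure_space_1 by (simp add: case_prod_beta')
  show ?thesis
  proof (cases "\<beta> = -1/2")
    case True
    let ?X = "\<integral>\<^sup>+r. ennreal ((1 - r\<^sup>2) powr (\<alpha> - 1/4 - 1/2)) * indicator {0..1} r * ((1 + 1) / 2) \<partial>lborel"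
    have 1: "ennreal (2 / Beta (1/2) (\<alpha> - 1/4 + 1/2)) * ?X = 1"
      using one unfolding True by (subst (asm) nn_integral_m_meas_real[OF om]) (use \<beta> True in auto)
    have "(\<integral>\<^sup>+r. ennreal ((1 - r\<^sup>2) powr (\<alpha> - 1/2)) * indicator {0..1} r * ((?f r 0 + ?f r pi) / 2) \<partial>lborel) = ?X"
    proof (rule nn_integral_cong)
      fix r :: real
      have "(1 - r\<^sup>2) powr (\<alpha> - 1/4 - 1/2) = (1 - r\<^sup>2) powr (\<alpha> - 1/2) * (1 - r\<^sup>2) powr (-1/4)"
        by (simp flip: powr_add)
      then have e: "ennreal ((1 - r\<^sup>2) powr (\<alpha> - 1/4 - 1/2)) = ennreal ((1 - r\<^sup>2) powr (\<alpha> - 1/2)) * ?f r 0"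
        by (simp add: ennreal_mult)
      have two: "(x + x) / 2 = (x::ennreal)" for x
        by (simp add: mult_2_right[symmetric] ennreal_times_divide[symmetric] ennreal_divide_self)
      show "ennreal ((1 - r\<^sup>2) powr (\<alpha> - 1/2)) * indicator {0..1} r * ((?f r 0 + ?f r pi) / 2) =
        ennreal ((1 - r\<^sup>2) powr (\<alpha> - 1/4 - 1/2)) * indicator {0..1} r * ((1 + 1) / 2)"
        unfolding e two by (simp only: mult.commute mult.left_commute mult.assoc mult_1_right mult_1_left)
    qed
    moreover have "(\<integral>\<^sup>+(r, \<phi>). ?f r \<phi> \<partial>m_meas \<alpha> \<beta>) = ennreal (2 / Beta (1/2) (\<alpha> + 1/2)) *
        (\<integral>\<^sup>+r. ennreal ((1 - r\<^sup>2) powr (\<alpha> - 1/2)) * indicator {0..1} r * ((?f r 0 + ?f r pi) / 2) \<partial>lborel)"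
      unfolding True by (rule nn_integral_m_meas_real[OF fm]) (use \<beta> True in auto)
    ultimately show ?thesis using fin[OF 1, of "ennreal (2 / Beta (1/2) (\<alpha> + 1/2))"] by (simp only: ennreal_less_top infinity_ennreal_def)
  next
    case False
    let ?S = "\<integral>\<^sup>+\<phi>. ennreal (sin \<phi> powr (2 * \<beta>)) * 1 * indicator {0..pi} \<phi> \<partial>lborel"
    let ?X = "\<integral>\<^sup>+r. ennreal ((1 - r\<^sup>2) powr (\<alpha> - 1/4 - \<beta> - 1) * r powr (2 * \<beta> + 1)) * indicator {0..1} r * ?S \<partial>lborel"
    have 1: "ennreal (m_const (\<alpha> - 1/4) \<beta>) * ?X = 1"
      using one by (subst (asm) nn_integral_m_meas[OF om]) (use \<beta> False in auto)
    have "(\<integral>\<^sup>+r. ennreal ((1 - r\<^sup>2) powr (\<alpha> - \<beta> - 1) * r powr (2 * \<beta> + 1)) * indicator {0..1} r *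
      (\<integral>\<^sup>+\<phi>. ennreal (sin \<phi> powr (2 * \<beta>)) * ?f r \<phi> * indicator {0..pi} \<phi> \<partial>lborel) \<partial>lborel) = ?X"
    proof (rule nn_integral_cong)
      fix r :: real
      have "(\<integral>\<^sup>+\<phi>. ennreal (sin \<phi> powr (2 * \<beta>)) * ?f r \<phi> * indicator {0..pi} \<phi> \<partial>lborel)
        = (\<integral>\<^sup>+\<phi>. ?f r 0 * (ennreal (sin \<phi> powr (2 * \<beta>)) * 1 * indicator {0..pi} \<phi>) \<partial>lborel)"
        by (intro nn_integral_cong) (simp only: mult.commute mult.left_commute mult.assoc mult_1_right mult_1_left)
      also have "\<dots> = ?f r 0 * ?S" by (rule nn_integral_cmult) measurable
      finally have s: "(\<integral>\<^sup>+\<phi>. ennreal (sin \<phi> powr (2 * \<beta>)) * ?f r \<phi> * indicator {0..pi} \<phi> \<partial>lborel) = ?f r 0 * ?S" .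
      have "(1 - r\<^sup>2) powr (\<alpha> - 1/4 - \<beta> - 1) = (1 - r\<^sup>2) powr (\<alpha> - \<beta> - 1) * (1 - r\<^sup>2) powr (-1/4)"
        by (simp flip: powr_add)
      then have "ennreal ((1 - r\<^sup>2) powr (\<alpha> - 1/4 - \<beta> - 1) * r powr (2 * \<beta> + 1)) = ennreal ((1 - r\<^sup>2) powr (\<alpha> - \<beta> - 1) * r powr (2 * \<beta> + 1)) * ?f r 0"
        by (simp add: mult_ac flip: ennreal_mult)
      then show "ennreal ((1 - r\<^sup>2) powr (\<alpha> - \<beta> - 1) * r powr (2 * \<beta> + 1)) * indicator {0..1} r *
          (\<integral>\<^sup>+\<phi>. ennreal (sin \<phi> powr (2 * \<beta>)) * ?f r \<phi> * indicator {0..pi} \<phi> \<partial>lborel)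
        = ennreal ((1 - r\<^sup>2) powr (\<alpha> - 1/4 - \<beta> - 1) * r powr (2 * \<beta> + 1)) * indicator {0..1} r * ?S"
        unfolding s by (simp only: mult.commute mult.left_commute mult.assoc)
    qed
    moreover have "(\<integral>\<^sup>+(r, \<phi>). ?f r \<phi> \<partial>m_meas \<alpha> \<beta>) = ennreal (m_const \<alpha> \<beta>) * (\<integral>\<^sup>+r. ennreal ((1 - r\<^sup>2) powr (\<alpha> - \<beta> - 1) * r powr (2 * \<beta> + 1)) * indicator {0..1} r *
      (\<integral>\<^sup>+\<phi>. ennreal (sin \<phi> powr (2 * \<beta>)) * ?f r \<phi> * indicator {0..pi} \<phi> \<partial>lborel) \<partial>lborel)"
      by (rule nn_integral_m_meas[OF fm]) (use \<beta> False in auto)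
    ultimately show ?thesis using fin[OF 1, of "ennreal (m_const \<alpha> \<beta>)"] by (simp only: ennreal_less_top infinity_ennreal_def)
  qed
qed

text \<open>
  By the lower bound \<open>e^t (1 - r\<^sup>2) / 4 \<le> horo t r \<phi>\<close>, the difference between the distance and the
  Busemann function has an exponential moment that is bounded uniformly in the distance.
\<close>

lemma nn_integral_exp_defect:
  assumes \<beta>: "\<beta> \<ge> -1/2" "\<alpha> - \<beta> \<ge> 1/2"
  obtains C where "C \<ge> 0" "\<And>t. t \<ge> 0 \<Longrightarrow> (\<integral>\<^sup>+(r, \<phi>). ennreal (exp ((t - ln (horo t r \<phi>)) / 4)) \<partial>m_meas \<alpha> \<beta>) \<le> ennreal C"
proof -
  let ?I = "\<integral>\<^sup>+(r, \<phi>). ennreal ((1 - r\<^sup>2) powr (-1/4)) \<partial>m_meas \<alpha> \<beta>"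
  have \<alpha>: "\<alpha> > \<beta>" using \<beta> by simp
  obtain I where I: "?I = ennreal I" "I \<ge> 0" using m_meas_singular_integral[OF \<beta>] by (cases ?I) auto
  show ?thesis
  proof (rule that[of "4 powr (1/4) * I"])
    show "4 powr (1/4) * I \<ge> 0" using I by simp
    fix t :: real assume t: "t \<ge> 0"
    have "(\<integral>\<^sup>+(r, \<phi>). ennreal (exp ((t - ln (horo t r \<phi>)) / 4)) \<partial>m_meas \<alpha> \<beta>)
      \<le> (\<integral>\<^sup>+z. ennreal (4 powr (1/4)) * (case z of (r, \<phi>) \<Rightarrow> ennreal ((1 - r\<^sup>2) powr (-1/4))) \<partial>m_meas \<alpha> \<beta>)"
    proof (rule nn_integral_mono_AE)
      show "AE z in m_meas \<alpha> \<beta>. (case z of (r, \<phi>) \<Rightarrow> ennreal (exp ((t - ln (horo t r \<phi>)) / 4))) \<le> ennreal (4 powr (1/4)) * (case z of (r, \<phi>) \<Rightarrow> ennreal ((1 - r\<^sup>2) powr (-1/4)))"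
        using AE_m_meas_unit[OF \<beta>(1) \<alpha>]
      proof eventually_elim
        case (elim z)
        obtain r \<phi> where z: "z = (r, \<phi>)" by (cases z)
        have r: "0 \<le> r" "r < 1" using elim by (simp_all add: z)
        have q: "1 - r\<^sup>2 > 0" using r by (simp add: abs_square_less_1)
        have "t + ln ((1 - r\<^sup>2) / 4) = ln (exp t * ((1 - r\<^sup>2) / 4))" using q by (subst ln_mult) auto
        also have "\<dots> \<le> ln (horo t r \<phi>)"
        proof -
          have g: "exp t * ((1 - r\<^sup>2) / 4) > 0" using q by simp
          have l: "exp t * ((1 - r\<^sup>2) / 4) \<le> horo t r \<phi>" using horo_bounds(3)[OF t r(1), of \<phi>] r by simp
          then have "horo t r \<phi> > 0" by (rule less_le_trans[OF g])
          then show ?thesis using g l by (subst ln_le_cancel_iff) auto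
        qed
        finally have "(t - ln (horo t r \<phi>)) / 4 \<le> (-1/4) * ln ((1 - r\<^sup>2) / 4)" by simp
        then have "exp ((t - ln (horo t r \<phi>)) / 4) \<le> exp ((-1/4) * ln ((1 - r\<^sup>2) / 4))" by simp
        also have "\<dots> = ((1 - r\<^sup>2) / 4) powr (-1/4)" using q by (simp add: powr_def)
        also have "\<dots> = 4 powr (1/4) * (1 - r\<^sup>2) powr (-1/4)" using q by (simp add: powr_divide powr_minus field_simps)
        finally show ?case by (simp add: z flip: ennreal_mult)
      qed
    qed
    also have "\<dots> = ennreal (4 powr (1/4)) * ?I" by (rule nn_integral_cmult) measurable
    also have "\<dots> = ennreal (4 powr (1/4) * I)" using I by (simp add: ennreal_mult)
    finally show "(\<integral>\<^sup>+(r, \<phi>). ennreal (exp ((t - ln (horo t r \<phi>)) / 4)) \<partial>m_meas \<alpha> \<beta>) \<le> ennreal (4 powr (1/4) * I)" .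
  qed
qed

section \<open>The Busemann function along the walk\<close>

locale radial_walk = hyp_geometry F G K HS HB org J \<tau> kk
  for F and G K :: "(quat, 'n::{finite,linorder}) sqmat set" and HS HB org J \<tau> kk +
  fixes M :: "'w measure" and S :: "nat \<Rightarrow> 'w \<Rightarrow> (quat, 'n) sqmat set"
    and \<kappa> :: "(quat, 'n) sqmat set \<Rightarrow> (quat, 'n) sqmat set measure" and \<nu> :: "real measure"
  assumes chain: "markov_chain M HB \<kappa> S" and start: "AE w in M. S 0 w = org"
    and invariant: "\<And>g x A. g \<in> G \<Longrightarrow> x \<in> HS \<Longrightarrow> A \<in> sets HB \<Longrightarrow>
      emeasure (\<kappa> (hyp_act g x)) (hyp_act g ` A) = emeasure (\<kappa> x) A"
    and associated: "\<And>n. distr M borel (\<lambda>w. hyp_dist F (S n w) (S (Suc n) w)) = \<nu>"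
    and nu: "real_distribution \<nu>" and nu_nonneg: "AE t in \<nu>. 0 \<le> t"
    and nontrivial: "\<nu> \<noteq> return borel 0" and second_moment: "integrable \<nu> (\<lambda>t. t ^ 2)"
begin

interpretation M: prob_space M using chain by (simp add: markov_chain_def)
interpretation \<nu>: real_distribution \<nu> by (rule nu)

lemma S_measurable [measurable]: "S n \<in> M \<rightarrow>\<^sub>M HB"
  using chain by (simp add: markov_chain_def)

lemma kernel_measurable [measurable]: "\<kappa> \<in> HB \<rightarrow>\<^sub>M prob_algebra HB"
  using chain by (simp add: markov_chain_def)

lemma kernel:
  assumes "x \<in> HS" shows "prob_space (\<kappa> x)" "sets (\<kappa> x) = sets HB" "space (\<kappa> x) = HS"
proof -
  have "\<kappa> x \<in> space (prob_algebra HB)"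
    using measurable_space[OF kernel_measurable, of x] assms by simp
  then show "prob_space (\<kappa> x)" and s: "sets (\<kappa> x) = sets HB" by (simp_all add: space_prob_algebra)
  show "space (\<kappa> x) = HS" using sets_eq_imp_space_eq[OF s] by simp
qed

lemma kernel_emeasure_measurable [measurable]:
  assumes [measurable]: "A \<in> sets HB" shows "(\<lambda>x. emeasure (\<kappa> x) A) \<in> borel_measurable HB"
  using measurable_prob_algebraD[OF kernel_measurable] by measurable

definition law :: "nat \<Rightarrow> (quat, 'n) sqmat set measure" where
  "law n = distr M HB (S n)"

lemma law: "prob_space (law n)" "sets (law n) = sets HB" "space (law n) = HS"
  unfolding law_def
proof (rule M.prob_space_distr[OF S_measurable])
qed simp_all

lemma org_in [simp]: "org \<in> HS"
  unfolding org_eq by (rule lcoset_in_HS[OF G_1])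

lemma S_in: "w \<in> space M \<Longrightarrow> S n w \<in> HS"
  using measurable_space[OF S_measurable] by simp

text \<open>
  The conditional distribution in the Markov property, integrated over the whole space.
\<close>

lemma law_Suc:
  assumes A[measurable]: "A \<in> sets HB"
  shows "emeasure (law (Suc n)) A = (\<integral>\<^sup>+x. emeasure (\<kappa> x) A \<partial>law n)"
proof -
  let ?H = "history M HB S n" and ?f = "\<lambda>w. \<lambda>i\<in>{..n}. S i w" and ?E = "{v \<in> space M. S (Suc n) v \<in> A}"
  have fm: "?f \<in> M \<rightarrow>\<^sub>M (\<Pi>\<^sub>M i\<in>{..n}. HB)" by measurable
  have "sets ?H = {?f -` B \<inter> space M | B. B \<in> sets (\<Pi>\<^sub>M i\<in>{..n}. HB)}"
    unfolding history_def using measurable_space[OF fm] by (intro sets_vimage_algebra2) auto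
  then have "subalgebra M ?H"
    using measurable_sets[OF fm] by (auto simp: subalgebra_def history_def)
  then have "finite_measure_subalgebra M ?H"
    by (intro finite_measure_subalgebra.intro finite_measure_subalgebra_axioms.intro M.finite_measure_axioms)
  then interpret H: finite_measure_subalgebra M ?H .
  have E[measurable]: "?E \<in> sets M" by measurable
  have km: "(\<lambda>x. measure (\<kappa> x) A) \<in> borel_measurable HB"
    using kernel_emeasure_measurable[OF A] unfolding measure_def by measurable
  have "measure (law (Suc n)) A = measure M ?E"
    unfolding law_def by (subst measure_distr) (auto intro!: arg_cong2[where f = measure])
  also have "\<dots> = (LINT w|M. indicat_real ?E w)" by simp
  also have "\<dots> = (LINT w|M. real_cond_exp M ?H (indicat_real ?E) w)"
    by (rule H.real_cond_exp_int(2)[symmetric]) (simp add: M.emeasure_eq_measure)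
  also have "\<dots> = (LINT w|M. measure (\<kappa> (S n w)) A)"
  proof (rule integral_cong_AE)
    show "AE w in M. real_cond_exp M ?H (indicat_real ?E) w = measure (\<kappa> (S n w)) A"
      using chain A unfolding markov_chain_def by blast
    show "(\<lambda>w. measure (\<kappa> (S n w)) A) \<in> borel_measurable M"
      by (rule measurable_compose[OF S_measurable km])
  qed simp
  also have "\<dots> = (LINT x|law n. measure (\<kappa> x) A)"
    unfolding law_def by (rule integral_distr[OF S_measurable km, symmetric])
  finally have e: "measure (law (Suc n)) A = (LINT x|law n. measure (\<kappa> x) A)" .
  interpret L: prob_space "law n" by (rule law)
  interpret L': prob_space "law (Suc n)" by (rule law)
  have i: "integrable (law n) (\<lambda>x. measure (\<kappa> x) A)"
  proof (rule L.integrable_const_bound[where B = 1])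
    show "AE x in law n. norm (measure (\<kappa> x) A) \<le> 1"
      using prob_space.prob_le_1[OF kernel(1)] by (intro AE_I2) (simp add: law(3))
    show "(\<lambda>x. measure (\<kappa> x) A) \<in> borel_measurable (law n)" using km by (simp add: law_def)
  qed
  have "(\<integral>\<^sup>+x. emeasure (\<kappa> x) A \<partial>law n) = (\<integral>\<^sup>+x. ennreal (measure (\<kappa> x) A) \<partial>law n)"
  proof (rule nn_integral_cong)
    fix x assume "x \<in> space (law n)"
    then interpret k: prob_space "\<kappa> x" using kernel(1) law(3) by blast
    show "emeasure (\<kappa> x) A = ennreal (measure (\<kappa> x) A)" by (rule k.emeasure_eq_measure)
  qed
  also have "\<dots> = ennreal (LINT x|law n. measure (\<kappa> x) A)"
    by (rule nn_integral_eq_integral[OF i]) simp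
  finally show ?thesis by (simp add: L'.emeasure_eq_measure e)
qed

lemma law_1: "law 1 = \<kappa> org"
proof (rule measure_eqI)
  show "sets (law 1) = sets (\<kappa> org)" by (simp add: law(2) kernel(2))
  fix A assume "A \<in> sets (law 1)"
  then have A[measurable]: "A \<in> sets HB" by (simp add: law(2))
  have "emeasure (law (Suc 0)) A = (\<integral>\<^sup>+w. emeasure (\<kappa> (S 0 w)) A \<partial>M)"
    unfolding law_Suc[OF A] unfolding law_def by (rule nn_integral_distr) measurable
  also have "\<dots> = (\<integral>\<^sup>+w. emeasure (\<kappa> org) A \<partial>M)"
    by (rule nn_integral_cong_AE) (use start in \<open>eventually_elim, simp\<close>)
  finally show "emeasure (law 1) A = emeasure (\<kappa> org) A" by (simp add: M.emeasure_space_1)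
qed

lemma hyp_act_comp: "x \<in> HS \<Longrightarrow> hyp_act g (hyp_act h x) = hyp_act (g ** h) x"
proof -
  assume "x \<in> HS"
  then obtain y where "x = lcoset F y" using HS_cases by blast
  then show ?thesis by (simp add: hyp_act_lcoset matrix_mul_assoc)
qed

lemma hyp_act_1: "x \<in> HS \<Longrightarrow> hyp_act (mat 1) x = x"
proof -
  assume "x \<in> HS"
  then obtain y where "x = lcoset F y" using HS_cases by blast
  then show ?thesis by (simp add: hyp_act_lcoset)
qed

lemma hyp_act_org: "k \<in> K \<Longrightarrow> hyp_act k org = org"
  unfolding org_eq hyp_act_lcoset using lcoset_mult_K[of k "mat 1"] by simp

text \<open>
  Invariance of the kernel is assumed for images of sets; the action being bijective, it can be read
  as a statement about image measures.
\<close>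

lemma kernel_hyp_act:
  assumes g: "g \<in> G" and x: "x \<in> HS"
  shows "\<kappa> (hyp_act g x) = distr (\<kappa> x) HB (hyp_act g)"
proof (rule measure_eqI)
  show "sets (\<kappa> (hyp_act g x)) = sets (distr (\<kappa> x) HB (hyp_act g))"
    by (simp add: kernel(2)[OF hyp_act_in[OF g x]])
  fix A assume "A \<in> sets (\<kappa> (hyp_act g x))"
  then have A[measurable]: "A \<in> sets HB" by (simp add: kernel(2)[OF hyp_act_in[OF g x]])
  have m: "hyp_act g \<in> \<kappa> x \<rightarrow>\<^sub>M HB" using hyp_act_measurable[OF g] by (simp add: measurable_cong_sets[OF kernel(2)[OF x] refl])
  let ?B = "hyp_act g -` A \<inter> HS"
  have B: "?B \<in> sets HB" using measurable_sets[OF hyp_act_measurable[OF g] A] by simp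
  obtain h where h: "h \<in> G" "g ** h = mat 1" "h ** g = mat 1" using G_inverse[OF g] by blast
  have "hyp_act g ` ?B = A"
  proof (intro set_eqI iffI)
    fix y assume y: "y \<in> A"
    then have yH: "y \<in> HS" using sets.sets_into_space[OF A] by auto
    have "y = hyp_act g (hyp_act h y)" by (simp add: hyp_act_comp[OF yH] h(2) hyp_act_1[OF yH])
    then show "y \<in> hyp_act g ` ?B" using y hyp_act_in[OF h(1) yH] by (intro image_eqI[of _ _ "hyp_act h y"]) auto
  qed auto
  then show "emeasure (\<kappa> (hyp_act g x)) A = emeasure (distr (\<kappa> x) HB (hyp_act g)) A"
    using invariant[OF g x B] by (simp add: emeasure_distr[OF m A] kernel(3)[OF x])
qed

text \<open>
  The origin is fixed by \<open>K\<close> and the kernel is equivariant.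
\<close>

lemma law_K_invariant:
  assumes k: "k \<in> K" shows "distr (law n) HB (hyp_act k) = law n"
proof (induction n)
  case 0
  have [measurable]: "hyp_act k \<in> HB \<rightarrow>\<^sub>M HB" by (rule hyp_act_measurable[OF KG[OF k]])
  have "distr (law 0) HB (hyp_act k) = distr M HB (hyp_act k \<circ> S 0)"
    unfolding law_def by (rule distr_distr) measurable
  also have "\<dots> = distr M HB (S 0)"
  proof (rule distr_cong_AE[OF refl refl])
    show "AE w in M. (hyp_act k \<circ> S 0) w = S 0 w"
      using start by eventually_elim (simp add: hyp_act_org[OF k])
  qed measurable
  finally show ?case by (simp add: law_def)
next
  case (Suc n)
  have km: "hyp_act k \<in> HB \<rightarrow>\<^sub>M HB" by (rule hyp_act_measurable[OF KG[OF k]])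
  have km': "hyp_act k \<in> law m \<rightarrow>\<^sub>M HB" for m using km by (simp add: measurable_cong_sets[OF law(2) refl])
  show ?case
  proof (rule measure_eqI)
    show "sets (distr (law (Suc n)) HB (hyp_act k)) = sets (law (Suc n))" by (simp add: law(2))
    fix A assume "A \<in> sets (distr (law (Suc n)) HB (hyp_act k))"
    then have A[measurable]: "A \<in> sets HB" by simp
    let ?B = "hyp_act k -` A \<inter> HS"
    have B: "?B \<in> sets HB" using measurable_sets[OF km A] by simp
    have "emeasure (distr (law (Suc n)) HB (hyp_act k)) A = (\<integral>\<^sup>+x. emeasure (\<kappa> x) ?B \<partial>law n)"
      by (simp add: emeasure_distr[OF km' A] law(3) law_Suc[OF B])
    also have "\<dots> = (\<integral>\<^sup>+x. emeasure (\<kappa> (hyp_act k x)) A \<partial>law n)"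
    proof (rule nn_integral_cong)
      fix x assume "x \<in> space (law n)"
      then have x: "x \<in> HS" by (simp add: law(3))
      have m: "hyp_act k \<in> \<kappa> x \<rightarrow>\<^sub>M HB" using km by (simp add: measurable_cong_sets[OF kernel(2)[OF x] refl])
      show "emeasure (\<kappa> x) ?B = emeasure (\<kappa> (hyp_act k x)) A"
        by (simp add: kernel_hyp_act[OF KG[OF k] x] emeasure_distr[OF m A] kernel(3)[OF x])
    qed
    also have "\<dots> = (\<integral>\<^sup>+x. emeasure (\<kappa> x) A \<partial>distr (law n) HB (hyp_act k))"
      by (rule nn_integral_distr[OF km', symmetric]) measurable
    also have "\<dots> = emeasure (law (Suc n)) A" unfolding Suc.IH law_Suc[OF A] ..
    finally show "emeasure (distr (law (Suc n)) HB (hyp_act k)) A = emeasure (law (Suc n)) A" .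
  qed
qed

text \<open>
  The first step starts at the origin almost surely, so its length is the distance of the new position
  from the origin.
\<close>

lemma distr_dist0_kernel: "distr (\<kappa> org) borel dist0 = \<nu>"
proof -
  let ?f = "\<lambda>w. hyp_dist F (S 0 w) (S (Suc 0) w)" and ?g = "\<lambda>w. dist0 (S (Suc 0) w)"
  have g[measurable]: "?g \<in> borel_measurable M" by measurable
  have ae: "AE w in M. ?f w = ?g w"
    using start AE_space
  proof eventually_elim
    case (elim w)
    obtain h where h: "h \<in> G" "S (Suc 0) w = lcoset F h" using HS_cases[OF S_in[OF elim(2)]] by blast
    have "?f w = rad h" using elim(1) hyp_dist_from_origin[OF h(1)] h(2) by (simp add: org_def)
    moreover have "?g w = rad h" using dist0_lcoset[OF h(1)] h(2) by simp
    ultimately show ?case by simp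
  qed
  have le: "emeasure \<nu> A \<le> emeasure (distr M borel ?g) A" if A: "A \<in> sets borel" for A
  proof -
    \<comment> \<open>the step length need not be measured exactly: an inequality for every set is enough, as both sides are probability measures\<close>
    have "emeasure \<nu> A \<le> emeasure M (?f -` A \<inter> space M)"
      unfolding associated[of 0, symmetric] distr_def emeasure_measure_of_conv by simp
    also have "\<dots> \<le> emeasure M (?g -` A \<inter> space M)"
    proof (rule emeasure_mono_AE)
      show "AE w in M. w \<in> ?f -` A \<inter> space M \<longrightarrow> w \<in> ?g -` A \<inter> space M" using ae by eventually_elim auto
      show "?g -` A \<inter> space M \<in> sets M" using measurable_sets[OF g A] .
    qed
    also have "\<dots> = emeasure (distr M borel ?g) A" by (rule emeasure_distr[OF g A, symmetric])
    finally show ?thesis .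
  qed
  interpret D: prob_space "distr M borel ?g" by (rule M.prob_space_distr[OF g])
  have "\<nu> = distr M borel ?g"
  proof (rule measure_eqI)
    fix A assume "A \<in> sets \<nu>"
    then have A: "A \<in> sets borel" by simp
    have l1: "measure \<nu> A \<le> measure (distr M borel ?g) A"
      using le[OF A] by (simp add: \<nu>.emeasure_eq_measure D.emeasure_eq_measure)
    have "measure \<nu> (UNIV - A) \<le> measure (distr M borel ?g) (UNIV - A)"
      using le[of "UNIV - A"] A by (simp add: \<nu>.emeasure_eq_measure D.emeasure_eq_measure)
    then have "measure \<nu> A = measure (distr M borel ?g) A"
      using l1 \<nu>.prob_compl[of A] D.prob_compl[of A] A by simp
    then show "emeasure \<nu> A = emeasure (distr M borel ?g) A" by (simp add: \<nu>.emeasure_eq_measure D.emeasure_eq_measure)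
  qed simp
  also have "distr M borel ?g = distr (law 1) borel dist0"
    unfolding law_def by (subst distr_distr) (simp_all add: comp_def)
  finally show ?thesis unfolding law_1 ..
qed

definition buslaw :: "nat \<Rightarrow> real measure" where
  "buslaw n = distr (law n) borel (\<lambda>x. ln (bus x))"

lemma lb_measurable [measurable]: "(\<lambda>x. ln (bus x)) \<in> borel_measurable HB" by measurable

lemma lb_measurable' [measurable]: "(\<lambda>x. ln (bus x)) \<in> borel_measurable (law n)"
  using lb_measurable by (simp add: measurable_cong_sets[OF law(2) refl])

lemma dist0_measurable' [measurable]: "dist0 \<in> borel_measurable (law n)"
  using dist0_measurable by (simp add: measurable_cong_sets[OF law(2) refl])

lemma buslaw_real_distribution: "real_distribution (buslaw n)"
  unfolding buslaw_def by (rule prob_space.real_distribution_distr[OF law(1)]) measurable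

lemma sets_buslaw [simp, measurable_cong]: "sets (buslaw n) = sets borel"
  by (simp add: buslaw_def)

lemma space_buslaw [simp]: "space (buslaw n) = UNIV"
  by (simp add: buslaw_def)

lemma bus_org: "bus org = 1"
  unfolding org_eq bus_lcoset busn_def using ix01 by (simp add: mat_def)

text \<open>
  Conditionally on \<open>S n = x\<close>, move \<open>x\<close> to the origin by the group element of the cocycle property:
  the next Busemann value is that of \<open>x\<close> plus an increment whose law does not depend on \<open>x\<close>.
\<close>

lemma buslaw_Suc: "buslaw (Suc n) = distr (buslaw n \<Otimes>\<^sub>M buslaw 1) borel (\<lambda>(x, y). x + y)"
proof (rule measure_eqI)
  interpret R: real_distribution "buslaw n" by (rule buslaw_real_distribution)
  interpret R1: real_distribution "buslaw 1" by (rule buslaw_real_distribution)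
  fix A assume "A \<in> sets (buslaw (Suc n))"
  then have A[measurable]: "A \<in> sets borel" by (simp add: buslaw_def)
  have B: "(\<lambda>x. ln (bus x)) -` A \<inter> HS \<in> sets HB" using measurable_sets[OF lb_measurable A] by simp
  have mm: "(\<lambda>a. emeasure (buslaw 1) {b. a + b \<in> A}) \<in> borel_measurable borel"
  proof -
    have mz: "{z. fst z + snd z \<in> A} \<in> sets (borel \<Otimes>\<^sub>M buslaw 1)"
    proof -
      have "{z \<in> space (borel \<Otimes>\<^sub>M buslaw 1). fst z + snd z \<in> A} \<in> sets (borel \<Otimes>\<^sub>M buslaw 1)" by measurable
      then show ?thesis by (simp add: space_pair_measure)
    qed
    show ?thesis using R1.measurable_emeasure_Pair[OF mz] by (simp add: vimage_def)
  qed
  have "emeasure (buslaw (Suc n)) A = (\<integral>\<^sup>+x. emeasure (\<kappa> x) ((\<lambda>x. ln (bus x)) -` A \<inter> HS) \<partial>law n)"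
    unfolding buslaw_def emeasure_distr[OF lb_measurable' A] law(3) by (rule law_Suc[OF B])
  also have "\<dots> = (\<integral>\<^sup>+x. emeasure (buslaw 1) {b. ln (bus x) + b \<in> A} \<partial>law n)"
  proof (rule nn_integral_cong)
    fix x assume "x \<in> space (law n)"
    then have x: "x \<in> HS" by (simp add: law(3))
    obtain g where g: "g \<in> G" "x = hyp_act g org" "\<And>y. y \<in> HS \<Longrightarrow> bus (hyp_act g y) = bus x * bus y"
      using bus_cocycle[OF x] by blast
    have m: "hyp_act g \<in> \<kappa> org \<rightarrow>\<^sub>M HB" using hyp_act_measurable[OF g(1)] by (simp add: measurable_cong_sets[OF kernel(2)[OF org_in] refl])
    have C: "{b. ln (bus x) + b \<in> A} \<in> sets borel"
    proof -
      have "{b \<in> space borel. ln (bus x) + b \<in> A} \<in> sets borel" by measurable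
      then show ?thesis by simp
    qed
    have ad: "ln (bus (hyp_act g y)) = ln (bus x) + ln (bus y)" if "y \<in> HS" for y
      using bus_pos[OF x] bus_pos[OF that] by (simp add: g(3)[OF that] ln_mult)
    have "emeasure (\<kappa> x) ((\<lambda>x. ln (bus x)) -` A \<inter> HS) = emeasure (\<kappa> org) (hyp_act g -` ((\<lambda>x. ln (bus x)) -` A \<inter> HS) \<inter> HS)"
      by (subst g(2), subst kernel_hyp_act[OF g(1) org_in], subst emeasure_distr[OF m B]) (simp add: kernel(3))
    also have "hyp_act g -` ((\<lambda>x. ln (bus x)) -` A \<inter> HS) \<inter> HS = (\<lambda>y. ln (bus y)) -` {b. ln (bus x) + b \<in> A} \<inter> HS"
      using ad hyp_act_in[OF g(1)] by auto
    also have "emeasure (\<kappa> org) ((\<lambda>y. ln (bus y)) -` {b. ln (bus x) + b \<in> A} \<inter> HS) = emeasure (buslaw 1) {b. ln (bus x) + b \<in> A}"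
      unfolding law_1[symmetric] buslaw_def emeasure_distr[OF lb_measurable' C] law(3) ..
    finally show "emeasure (\<kappa> x) ((\<lambda>x. ln (bus x)) -` A \<inter> HS) = emeasure (buslaw 1) {b. ln (bus x) + b \<in> A}" .
  qed
  also have "\<dots> = (\<integral>\<^sup>+a. emeasure (buslaw 1) {b. a + b \<in> A} \<partial>buslaw n)"
    unfolding buslaw_def[of n] by (subst nn_integral_distr[OF lb_measurable']) (use mm in simp_all)
  also have "\<dots> = emeasure (buslaw n \<Otimes>\<^sub>M buslaw 1) {z. fst z + snd z \<in> A}"
  proof (subst R1.emeasure_pair_measure_alt)
    have "{z \<in> space (buslaw n \<Otimes>\<^sub>M buslaw 1). fst z + snd z \<in> A} \<in> sets (buslaw n \<Otimes>\<^sub>M buslaw 1)" by measurable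
    then show "{z. fst z + snd z \<in> A} \<in> sets (buslaw n \<Otimes>\<^sub>M buslaw 1)" by (simp add: space_pair_measure)
  qed (simp add: vimage_def)
  also have "\<dots> = emeasure (distr (buslaw n \<Otimes>\<^sub>M buslaw 1) borel (\<lambda>(x, y). x + y)) A"
    by (subst emeasure_distr) (auto simp: space_pair_measure case_prod_beta' intro!: arg_cong2[where f = emeasure])
  finally show "emeasure (buslaw (Suc n)) A = emeasure (distr (buslaw n \<Otimes>\<^sub>M buslaw 1) borel (\<lambda>(x, y). x + y)) A" .
qed (simp add: buslaw_def)

lemma char_buslaw: "char (buslaw n) t = char (buslaw 1) t ^ n"
proof (induction n)
  case 0
  have "char (buslaw 0) t = (CLINT w|M. iexp (t * ln (bus (S 0 w))))"
    unfolding char_def buslaw_def law_def by (subst integral_distr, measurable, subst integral_distr) simp_all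
  also have "\<dots> = (CLINT w|M. 1)"
    by (rule integral_cong_AE) (use start in \<open>measurable, eventually_elim, simp add: bus_org\<close>)
  finally show ?case by (simp add: M.prob_space)
next
  case (Suc n)
  interpret R: real_distribution "buslaw n" by (rule buslaw_real_distribution)
  interpret R1: real_distribution "buslaw 1" by (rule buslaw_real_distribution)
  interpret P: pair_prob_space "buslaw n" "buslaw 1" ..
  have i: "integrable (buslaw n \<Otimes>\<^sub>M buslaw 1) (\<lambda>z. case z of (x, y) \<Rightarrow> iexp (t * x) * iexp (t * y))"
    by (rule P.integrable_const_bound[where B = 1]) (auto simp: norm_mult)
  have "char (buslaw (Suc n)) t = (CLINT z|buslaw n \<Otimes>\<^sub>M buslaw 1. iexp (t * (fst z + snd z)))"
    unfolding buslaw_Suc char_def by (subst integral_distr) (simp_all add: case_prod_beta')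
  also have "\<dots> = (CLINT z|buslaw n \<Otimes>\<^sub>M buslaw 1. (case z of (x, y) \<Rightarrow> iexp (t * x) * iexp (t * y)))"
    by (intro Bochner_Integration.integral_cong) (auto simp: distrib_left exp_add)
  also have "\<dots> = (CLINT x|buslaw n. (CLINT y|buslaw 1. iexp (t * x) * iexp (t * y)))"
    using P.integral_fst'[OF i, symmetric] by (simp only: prod.case)
  also have "\<dots> = char (buslaw n) t * char (buslaw 1) t"
    by (simp add: char_def)
  finally show ?case by (simp add: Suc.IH mult.commute)
qed

end

context radial_walk
begin

interpretation M: prob_space M using chain by (simp add: markov_chain_def)
interpretation \<nu>: real_distribution \<nu> by (rule nu)

lemma mm_params: "real (real_dim F) / 2 - 1 \<ge> - 1/2"
  "(real (real_dim F) * real kk / 2 - 1) - (real (real_dim F) / 2 - 1) \<ge> 1/2"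
  "real (real_dim F) * real kk / 2 - 1 > real (real_dim F) / 2 - 1"
proof -
  have d: "real (real_dim F) \<ge> 1" by (cases F) simp_all
  have k: "real kk \<ge> 2" using card_J(2) by simp
  have "real (real_dim F) * real kk \<ge> real (real_dim F) * 2" using k by (intro mult_left_mono) auto
  then show "real (real_dim F) / 2 - 1 \<ge> - 1/2"
    and "(real (real_dim F) * real kk / 2 - 1) - (real (real_dim F) / 2 - 1) \<ge> 1/2"
    and "real (real_dim F) * real kk / 2 - 1 > real (real_dim F) / 2 - 1" using d by linarith+
qed

section \<open>The law of one Busemann step\<close>

lemma prob_space_mm: "prob_space mm"
  by (rule prob_space_m_meas[OF mm_params(1,3)])

interpretation mm: prob_space mm by (rule prob_space_mm)
interpretation P: pair_prob_space \<nu> mm ..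

definition X :: "real \<times> real \<times> real \<Rightarrow> real" where
  "X z = ln (horo (fst z) (fst (snd z)) (snd (snd z)))"

lemma X_measurable [measurable]: "X \<in> borel_measurable (\<nu> \<Otimes>\<^sub>M mm)"
  unfolding X_def by measurable

text \<open>
  This is where the measure of the modified moments enters.
\<close>

lemma buslaw_1: "buslaw 1 = distr (\<nu> \<Otimes>\<^sub>M mm) borel X"
proof (rule measure_eqI)
  fix A assume "A \<in> sets (buslaw 1)"
  then have A[measurable]: "A \<in> sets borel" by simp
  interpret L: prob_space "law 1" by (rule law)
  let ?f = "\<lambda>z :: real \<times> real. indicator A (ln (snd z)) :: ennreal"
  have fm: "?f \<in> borel_measurable (borel \<Otimes>\<^sub>M borel)" by measurable
  have hm: "(\<lambda>t. \<integral>\<^sup>+p. indicator A (X (t, p)) \<partial>mm) \<in> borel_measurable borel"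
    by (rule mm.borel_measurable_nn_integral) (simp add: X_def case_prod_beta')
  have "emeasure (buslaw 1) A = (\<integral>\<^sup>+x. indicator A x \<partial>buslaw 1)" by simp
  also have "\<dots> = (\<integral>\<^sup>+x. ?f (dist0 x, bus x) \<partial>law 1)"
    unfolding buslaw_def by (subst nn_integral_distr[OF lb_measurable']) simp_all
  also have "\<dots> = (\<integral>\<^sup>+x. (\<integral>\<^sup>+(r, \<phi>). ?f (dist0 x, horo (dist0 x) r \<phi>) \<partial>mm) \<partial>law 1)"
    by (rule K_average[OF law(1,2) law_K_invariant fm])
  also have "\<dots> = (\<integral>\<^sup>+x. (\<integral>\<^sup>+p. indicator A (X (dist0 x, p)) \<partial>mm) \<partial>law 1)"
    by (simp add: X_def case_prod_beta')
  also have "\<dots> = (\<integral>\<^sup>+t. (\<integral>\<^sup>+p. indicator A (X (t, p)) \<partial>mm) \<partial>distr (law 1) borel dist0)"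
    by (subst nn_integral_distr[OF dist0_measurable']) (use hm in simp_all)
  also have "distr (law 1) borel dist0 = \<nu>" unfolding law_1 by (rule distr_dist0_kernel)
  also have "(\<integral>\<^sup>+t. (\<integral>\<^sup>+p. indicator A (X (t, p)) \<partial>mm) \<partial>\<nu>) = (\<integral>\<^sup>+z. indicator A (X z) \<partial>(\<nu> \<Otimes>\<^sub>M mm))"
    by (rule mm.nn_integral_fst) measurable
  also have "\<dots> = (\<integral>\<^sup>+x. indicator A x \<partial>distr (\<nu> \<Otimes>\<^sub>M mm) borel X)"
    by (subst nn_integral_distr) simp_all
  finally show "emeasure (buslaw 1) A = emeasure (distr (\<nu> \<Otimes>\<^sub>M mm) borel X) A" by simp
qed simp

lemma X_bound: "AE z in \<nu> \<Otimes>\<^sub>M mm. \<bar>X z\<bar> \<le> fst z"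
proof (rule P.AE_pair_measure)
  show "{z \<in> space (\<nu> \<Otimes>\<^sub>M mm). \<bar>X z\<bar> \<le> fst z} \<in> sets (\<nu> \<Otimes>\<^sub>M mm)" by measurable
  show "AE t in \<nu>. AE p in mm. \<bar>X (t, p)\<bar> \<le> fst (t, p)"
    using nu_nonneg
  proof eventually_elim
    case (elim t)
    show ?case using AE_m_meas_unit[OF mm_params(1,3)]
      by eventually_elim (use abs_ln_horo_le[OF elim] in \<open>auto simp: X_def\<close>)
  qed
qed

lemma integrable_abs_X:
  assumes "integrable \<nu> (\<lambda>t. t ^ j)" shows "integrable (\<nu> \<Otimes>\<^sub>M mm) (\<lambda>z. \<bar>X z\<bar> ^ j)"
proof (rule Bochner_Integration.integrable_bound)
  have "integrable (distr (\<nu> \<Otimes>\<^sub>M mm) \<nu> fst) (\<lambda>t. t ^ j)" unfolding mm.distr_pair_fst by (rule assms)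
  then show "integrable (\<nu> \<Otimes>\<^sub>M mm) (\<lambda>z. fst z ^ j)" by (subst (asm) integrable_distr_eq) simp_all
  show "AE z in \<nu> \<Otimes>\<^sub>M mm. norm (\<bar>X z\<bar> ^ j) \<le> norm (fst z ^ j)"
    using X_bound
  proof eventually_elim
    case (elim z)
    then have "\<bar>X z\<bar> ^ j \<le> \<bar>fst z\<bar> ^ j" by (intro power_mono) auto
    then show ?case by (simp add: power_abs)
  qed
qed measurable

lemma integrable_X:
  assumes "integrable \<nu> (\<lambda>t. t ^ j)" shows "integrable (\<nu> \<Otimes>\<^sub>M mm) (\<lambda>z. X z ^ j)"
proof (rule Bochner_Integration.integrable_bound[OF integrable_abs_X[OF assms]])
  show "AE z in \<nu> \<Otimes>\<^sub>M mm. norm (X z ^ j) \<le> norm (\<bar>X z\<bar> ^ j)" by (simp add: power_abs)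
qed measurable

lemma first_moment: "integrable \<nu> (\<lambda>t. t ^ 1)"
proof (rule Bochner_Integration.integrable_bound)
  show "integrable \<nu> (\<lambda>t. 1 + t ^ 2)" using second_moment by simp
  have "\<bar>t\<bar> \<le> 1 + t\<^sup>2" for t :: real
    using sum_squares_ge_zero[of "\<bar>t\<bar> - 1" 0] zero_le_power2[of "\<bar>t\<bar> - 1"] by (simp add: power2_eq_square algebra_simps)
  then show "AE t in \<nu>. norm (t ^ 1) \<le> norm (1 + t ^ 2)" by simp
qed simp

lemma moment_fun_eq: "moment_fun F kk j t = (LINT p|mm. X (t, p) ^ j)"
  by (simp add: moment_fun_def X_def horo_def case_prod_beta')

lemma moments:
  assumes "integrable \<nu> (\<lambda>t. t ^ j)"
  shows "integrable \<nu> (moment_fun F kk j)" "mod_moment F kk \<nu> j = (LINT z|(\<nu> \<Otimes>\<^sub>M mm). X z ^ j)"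
  using P.integrable_fst'[OF integrable_X[OF assms]] P.integral_fst'[OF integrable_X[OF assms]]
  by (simp_all add: mod_moment_def moment_fun_eq[abs_def])

definition M1 :: real where "M1 = mod_moment F kk \<nu> 1"
definition M2 :: real where "M2 = mod_moment F kk \<nu> 2"
definition \<sigma> :: real where "\<sigma> = sqrt (M2 - M1\<^sup>2)"

lemma integrable_centered: "integrable (\<nu> \<Otimes>\<^sub>M mm) (\<lambda>z. X z - M1)" "integrable (\<nu> \<Otimes>\<^sub>M mm) (\<lambda>z. (X z - M1)\<^sup>2)"
  and mean_centered: "(LINT z|(\<nu> \<Otimes>\<^sub>M mm). X z - M1) = 0"
  and var_centered: "(LINT z|(\<nu> \<Otimes>\<^sub>M mm). (X z - M1)\<^sup>2) = M2 - M1\<^sup>2"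
proof -
  have i1: "integrable (\<nu> \<Otimes>\<^sub>M mm) X" using integrable_X[OF first_moment] by simp
  have i2: "integrable (\<nu> \<Otimes>\<^sub>M mm) (\<lambda>z. (X z)\<^sup>2)" by (rule integrable_X[OF second_moment])
  have m1: "(LINT z|(\<nu> \<Otimes>\<^sub>M mm). X z) = M1" using moments(2)[OF first_moment] by (simp add: M1_def)
  have m2: "(LINT z|(\<nu> \<Otimes>\<^sub>M mm). (X z)\<^sup>2) = M2" using moments(2)[OF second_moment] by (simp add: M2_def)
  have e: "(X z - M1)\<^sup>2 = (X z)\<^sup>2 - 2 * M1 * X z + M1\<^sup>2" for z by (simp add: power2_diff)
  show "integrable (\<nu> \<Otimes>\<^sub>M mm) (\<lambda>z. X z - M1)" using i1 by simp
  show "integrable (\<nu> \<Otimes>\<^sub>M mm) (\<lambda>z. (X z - M1)\<^sup>2)" unfolding e using i1 i2 by simp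
  show "(LINT z|(\<nu> \<Otimes>\<^sub>M mm). X z - M1) = 0" using i1 by (simp add: m1 P.prob_space)
  have "(LINT z|(\<nu> \<Otimes>\<^sub>M mm). (X z)\<^sup>2 - 2 * M1 * X z + M1\<^sup>2) = M2 - 2 * M1 * M1 + M1\<^sup>2"
    using i1 i2 by (simp add: m1 m2 P.prob_space)
  then show "(LINT z|(\<nu> \<Otimes>\<^sub>M mm). (X z - M1)\<^sup>2) = M2 - M1\<^sup>2" unfolding e by (simp add: power2_eq_square)
qed

text \<open>
  If the variance were 0, then \<open>horo t r \<phi>\<close> would be almost surely constant for almost every \<open>t\<close>.
  For \<open>t > 0\<close> this is impossible, as each value is taken for finitely many \<open>r\<close> only. So \<open>\<nu>\<close> would be
  concentrated in 0.
\<close>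

lemma variance_pos: "M2 - M1\<^sup>2 > 0"
proof (rule ccontr)
  assume "\<not> M2 - M1\<^sup>2 > 0"
  moreover have "(LINT z|(\<nu> \<Otimes>\<^sub>M mm). (X z - M1)\<^sup>2) \<ge> 0" by simp
  ultimately have "(LINT z|(\<nu> \<Otimes>\<^sub>M mm). (X z - M1)\<^sup>2) = 0" using var_centered by linarith
  then have "AE z in \<nu> \<Otimes>\<^sub>M mm. (X z - M1)\<^sup>2 = 0"
    by (subst (asm) integral_nonneg_eq_0_iff_AE[OF integrable_centered(2)]) simp_all
  then have "AE z in \<nu> \<Otimes>\<^sub>M mm. X z = M1" by eventually_elim simp
  then have "AE t in \<nu>. AE p in mm. X (t, p) = M1" by (rule P.AE_pair)
  then have zero: "AE t in \<nu>. t = 0"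
    using nu_nonneg
  proof eventually_elim
    case (elim t)
    show "t = 0"
    proof (rule ccontr)
      assume "t \<noteq> 0"
      then have t: "t > 0" using elim by simp
      have "AE p in mm. False"
        using elim(1) AE_m_meas_horo_neq[OF mm_params(1,3) t, of "exp M1"] AE_m_meas_unit[OF mm_params(1,3)]
      proof eventually_elim
        case (elim p)
        obtain r \<phi> where p: "p = (r, \<phi>)" by (cases p)
        have "exp (- t) \<le> horo t r \<phi>" using horo_bounds(2)[of t r \<phi>] elim t by (simp add: p)
        then have "horo t r \<phi> > 0" using exp_gt_zero[of "- t"] by linarith
        then have "horo t r \<phi> = exp (X (t, p))" by (simp add: X_def p)
        then show False using elim(1,2) by (simp add: p)
      qed
      then show False by simp
    qed
  qed
  have "\<nu> = return borel 0"
  proof (rule measure_eqI)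
    fix A assume "A \<in> sets \<nu>"
    then have A[measurable]: "A \<in> sets borel" by simp
    have "emeasure \<nu> A = (\<integral>\<^sup>+t. indicator A t \<partial>\<nu>)" by simp
    also have "\<dots> = (\<integral>\<^sup>+t. indicator A 0 \<partial>\<nu>)" by (rule nn_integral_cong_AE) (use zero in \<open>eventually_elim, simp\<close>)
    finally show "emeasure \<nu> A = emeasure (return borel 0) A" using \<nu>.emeasure_space_1 by simp
  qed simp
  then show False using nontrivial by simp
qed

lemma sigma_pos: "\<sigma> > 0" and sigma_sq: "\<sigma>\<^sup>2 = M2 - M1\<^sup>2"
  using variance_pos by (simp_all add: \<sigma>_def)

definition \<rho> :: "real measure" where "\<rho> = distr (\<nu> \<Otimes>\<^sub>M mm) borel (\<lambda>z. X z - M1)"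

definition \<beta> :: "nat \<Rightarrow> real measure" where
  "\<beta> n = distr (law n) borel (\<lambda>x. (ln (bus x) - real n * M1) / sqrt (real n))"

definition \<mu> :: "nat \<Rightarrow> real measure" where
  "\<mu> n = distr M borel (\<lambda>w. (hyp_dist F (S n w) org - real n * M1) / sqrt (real n))"

lemma rho_real_distribution: "real_distribution \<rho>"
  unfolding \<rho>_def by (rule P.real_distribution_distr) measurable

lemma beta_real_distribution: "real_distribution (\<beta> n)"
  unfolding \<beta>_def by (rule prob_space.real_distribution_distr[OF law(1)]) measurable

lemma char_beta:
  assumes n: "n > 0" shows "char (\<beta> n) t = char \<rho> (t / sqrt n) ^ n"
proof -
  let ?s = "t / sqrt n"
  have "char (\<beta> n) t = (CLINT x|law n. iexp (t * ((ln (bus x) - real n * M1) / sqrt (real n))))"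
    unfolding char_def \<beta>_def by (rule integral_distr) measurable
  also have "\<dots> = (CLINT x|law n. iexp (?s * ln (bus x)) * iexp (- ?s * M1) ^ n)"
  proof (intro Bochner_Integration.integral_cong refl)
    fix x
    have "\<i> * complex_of_real (t * ((ln (bus x) - real n * M1) / sqrt (real n))) = \<i> * complex_of_real (?s * ln (bus x)) + of_nat n * (\<i> * complex_of_real (- ?s * M1))"
      by (simp add: field_simps diff_divide_distrib)
    then show "iexp (t * ((ln (bus x) - real n * M1) / sqrt (real n))) = iexp (?s * ln (bus x)) * iexp (- ?s * M1) ^ n"
      by (simp only: exp_add exp_of_nat_mult)
  qed
  also have "\<dots> = (CLINT x|law n. iexp (?s * ln (bus x))) * iexp (- ?s * M1) ^ n"
    by (rule integral_mult_left_zero)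
  also have "(CLINT x|law n. iexp (?s * ln (bus x))) = char (buslaw n) ?s"
    unfolding char_def buslaw_def by (rule integral_distr[symmetric]) measurable
  also have "char (buslaw n) ?s * iexp (- ?s * M1) ^ n = (char (buslaw 1) ?s * iexp (- ?s * M1)) ^ n"
    by (subst char_buslaw) (rule power_mult_distrib[symmetric])
  also have "char (buslaw 1) ?s = (CLINT z|(\<nu> \<Otimes>\<^sub>M mm). iexp (?s * X z))"
    unfolding buslaw_1 char_def by (rule integral_distr) measurable
  also have "(CLINT z|(\<nu> \<Otimes>\<^sub>M mm). iexp (?s * X z)) * iexp (- ?s * M1) = (CLINT z|(\<nu> \<Otimes>\<^sub>M mm). iexp (?s * X z) * iexp (- ?s * M1))"
    by (rule integral_mult_left_zero[symmetric])
  also have "\<dots> = (CLINT z|(\<nu> \<Otimes>\<^sub>M mm). iexp (?s * (X z - M1)))"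
  proof (intro Bochner_Integration.integral_cong refl)
    fix z
    have "\<i> * complex_of_real (?s * X z) + \<i> * complex_of_real (- ?s * M1) = \<i> * complex_of_real (?s * (X z - M1))"
      by (simp only: distrib_left[symmetric] of_real_add[symmetric]) (simp add: right_diff_distrib)
    then show "iexp (?s * X z) * iexp (- ?s * M1) = iexp (?s * (X z - M1))" by (simp only: exp_add[symmetric])
  qed
  also have "\<dots> = char \<rho> ?s"
    unfolding \<rho>_def char_def by (rule integral_distr[symmetric]) measurable
  finally show ?thesis .
qed

lemma rho_moments:
  "integrable \<rho> (\<lambda>x. x)" "integrable \<rho> (\<lambda>x. x\<^sup>2)" "(LINT x|\<rho>. x) = 0" "(LINT x|\<rho>. x\<^sup>2) = \<sigma>\<^sup>2"
  unfolding \<rho>_def using integrable_centered mean_centered var_centered sigma_sq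
  by (simp_all add: integrable_distr_eq integral_distr)

lemma rho_third_moment:
  assumes "integrable \<nu> (\<lambda>t. t ^ 3)" shows "integrable \<rho> (\<lambda>x. \<bar>x\<bar> ^ 3)"
proof -
  have "integrable (\<nu> \<Otimes>\<^sub>M mm) (\<lambda>z. \<bar>X z - M1\<bar> ^ 3)"
  proof (rule Bochner_Integration.integrable_bound)
    show "integrable (\<nu> \<Otimes>\<^sub>M mm) (\<lambda>z. 8 * (\<bar>X z\<bar> ^ 3 + \<bar>M1\<bar> ^ 3))"
      using integrable_abs_X[OF assms] by simp
    show "AE z in \<nu> \<Otimes>\<^sub>M mm. norm (\<bar>X z - M1\<bar> ^ 3) \<le> norm (8 * (\<bar>X z\<bar> ^ 3 + \<bar>M1\<bar> ^ 3))"
    proof (rule AE_I2)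
      fix z
      have "\<bar>X z - M1\<bar> ^ 3 \<le> (2 * max \<bar>X z\<bar> \<bar>M1\<bar>) ^ 3" by (intro power_mono) auto
      also have "\<dots> = 8 * max \<bar>X z\<bar> \<bar>M1\<bar> ^ 3" by (simp add: power_mult_distrib)
      also have "\<dots> \<le> 8 * (\<bar>X z\<bar> ^ 3 + \<bar>M1\<bar> ^ 3)" by (auto simp: max_def)
      finally show "norm (\<bar>X z - M1\<bar> ^ 3) \<le> norm (8 * (\<bar>X z\<bar> ^ 3 + \<bar>M1\<bar> ^ 3))" by simp
    qed
  qed measurable
  then show ?thesis unfolding \<rho>_def by (simp add: integrable_distr_eq)
qed

lemma weak_conv_beta: "weak_conv_m \<beta> (normal0 \<sigma>)"
  by (rule clt_of_char_powers[OF rho_real_distribution beta_real_distribution char_beta rho_moments(1,2,3,4) sigma_pos])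

lemma rate_beta:
  assumes "integrable \<nu> (\<lambda>t. t ^ 3)"
  obtains D where "\<And>n x. n > 0 \<Longrightarrow> \<bar>cdf (\<beta> n) x - cdf (normal0 \<sigma>) x\<bar> \<le> D * real n powr (- 1/3)"
  using rate_of_char_powers[OF rho_real_distribution beta_real_distribution char_beta rho_moments(1,2) rho_third_moment[OF assms] rho_moments(3,4) sigma_pos]
  by blast

section \<open>From the Busemann function to the distance\<close>

lemma mu_eq: "\<mu> n = distr (law n) borel (\<lambda>x. (dist0 x - real n * M1) / sqrt (real n))"
  unfolding \<mu>_def law_def dist0_def[symmetric] by (subst distr_distr) (simp_all add: comp_def)

text \<open>
  Markov's inequality for the exponential moment. The bound is uniform in \<open>n\<close>.
\<close>

lemma defect_tail:
  obtains C where "C \<ge> 0" "\<And>n s. measure (law n) {x \<in> HS. dist0 x - ln (bus x) > s} \<le> C * exp (- s / 4)"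
proof -
  obtain C where C: "C \<ge> 0" "\<And>t. t \<ge> 0 \<Longrightarrow> (\<integral>\<^sup>+(r, \<phi>). ennreal (exp ((t - ln (horo t r \<phi>)) / 4)) \<partial>mm) \<le> ennreal C"
    using nn_integral_exp_defect[OF mm_params(1,2)] by blast
  show ?thesis
  proof (rule that[OF C(1)])
    fix n s
    interpret L: prob_space "law n" by (rule law)
    note [measurable_cong] = law(2)
    let ?E = "{x \<in> HS. dist0 x - ln (bus x) > s}"
    let ?f = "\<lambda>z :: real \<times> real. ennreal (exp ((fst z - ln (snd z)) / 4))"
    have E: "?E \<in> sets (law n)"
    proof -
      have "{x \<in> space (law n). dist0 x - ln (bus x) > s} \<in> sets (law n)" by measurable
      then show ?thesis by (simp add: law(3))
    qed
    have fm: "?f \<in> borel_measurable (borel \<Otimes>\<^sub>M borel)" by measurable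
    have "emeasure (law n) ?E = (\<integral>\<^sup>+x. indicator ?E x \<partial>law n)" using E by simp
    also have "\<dots> \<le> (\<integral>\<^sup>+x. ennreal (exp (- s / 4)) * ?f (dist0 x, bus x) \<partial>law n)"
    proof (rule nn_integral_mono)
      fix x
      have "1 \<le> ennreal (exp (- s / 4)) * ?f (dist0 x, bus x)" if "x \<in> ?E"
      proof -
        have "1 \<le> exp (- s / 4 + (dist0 x - ln (bus x)) / 4)" using that by simp
        then have "1 \<le> exp (- s / 4) * exp ((dist0 x - ln (bus x)) / 4)" by (simp only: exp_add)
        then have "ennreal 1 \<le> ennreal (exp (- s / 4) * exp ((dist0 x - ln (bus x)) / 4))" by (rule ennreal_leI)
        then show ?thesis by (simp only: ennreal_1 ennreal_mult exp_ge_zero fst_conv snd_conv)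
      qed
      then show "indicator ?E x \<le> ennreal (exp (- s / 4)) * ?f (dist0 x, bus x)" by (auto split: split_indicator)
    qed
    also have "\<dots> = ennreal (exp (- s / 4)) * (\<integral>\<^sup>+x. ?f (dist0 x, bus x) \<partial>law n)"
      by (rule nn_integral_cmult) measurable
    also have "(\<integral>\<^sup>+x. ?f (dist0 x, bus x) \<partial>law n) = (\<integral>\<^sup>+x. (\<integral>\<^sup>+(r, \<phi>). ?f (dist0 x, horo (dist0 x) r \<phi>) \<partial>mm) \<partial>law n)"
      by (rule K_average[OF law(1,2) law_K_invariant fm])
    also have "ennreal (exp (- s / 4)) * \<dots> \<le> ennreal (exp (- s / 4)) * (\<integral>\<^sup>+x. ennreal C \<partial>law n)"
      using C(2)[OF dist0_nonneg] by (intro mult_left_mono nn_integral_mono) (simp_all add: law(3))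
    also have "\<dots> = ennreal (C * exp (- s / 4))"
      using C(1) by (simp add: L.emeasure_space_1 mult.commute flip: ennreal_mult)
    finally show "measure (law n) ?E \<le> C * exp (- s / 4)"
      using C(1) by (simp add: L.emeasure_eq_measure)
  qed
qed

text \<open>
  The Busemann function is at most the distance, and it is smaller by more than \<open>n^(1/6)\<close> only with
  probability \<open>O(n^(-1/3))\<close>; after division by \<open>\<surd>n\<close> the shift \<open>n^(1/6)\<close> becomes \<open>n^(-1/3)\<close> too.
\<close>

lemma sandwich:
  obtains C where "C \<ge> 0" "\<And>n x. n > 0 \<Longrightarrow> cdf (\<mu> n) x \<le> cdf (\<beta> n) x"
    "\<And>n x. n > 0 \<Longrightarrow> cdf (\<beta> n) (x - real n powr (- 1/3)) \<le> cdf (\<mu> n) x + C * real n powr (- 1/3)"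
proof -
  obtain C where C: "C \<ge> 0" "\<And>n s. measure (law n) {x \<in> HS. dist0 x - ln (bus x) > s} \<le> C * exp (- s / 4)"
    using defect_tail by blast
  have cm: "cdf (\<mu> n) x = measure (law n) {y \<in> HS. (dist0 y - real n * M1) / sqrt (real n) \<le> x}" for n x
    unfolding mu_eq cdf_def by (subst measure_distr) (auto simp: law(3) intro!: arg_cong2[where f = measure])
  have cb: "cdf (\<beta> n) x = measure (law n) {y \<in> HS. (ln (bus y) - real n * M1) / sqrt (real n) \<le> x}" for n x
    unfolding \<beta>_def cdf_def by (subst measure_distr) (auto simp: law(3) intro!: arg_cong2[where f = measure])
  note [measurable_cong] = law(2)
  have lev: "{y \<in> HS. f y \<le> x} \<in> sets (law n)" "{y \<in> HS. f y > x} \<in> sets (law n)"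
    if f[measurable]: "f \<in> borel_measurable (law n)" for f :: "_ \<Rightarrow> real" and n x
  proof -
    have "{y \<in> space (law n). f y \<le> x} \<in> sets (law n)" "{y \<in> space (law n). f y > x} \<in> sets (law n)" by measurable
    then show "{y \<in> HS. f y \<le> x} \<in> sets (law n)" "{y \<in> HS. f y > x} \<in> sets (law n)" by (simp_all only: law(3))
  qed
  have m1: "{y \<in> HS. (dist0 y - real n * M1) / sqrt (real n) \<le> x} \<in> sets (law n)" for n x
    by (rule lev(1)) measurable
  have m2: "{y \<in> HS. (ln (bus y) - real n * M1) / sqrt (real n) \<le> x} \<in> sets (law n)" for n x
    by (rule lev(1)) measurable
  have m3: "{y \<in> HS. dist0 y - ln (bus y) > x} \<in> sets (law n)" for n x
    by (rule lev(2)) measurable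
  show ?thesis
  proof (rule that[of "32 * C"])
    show "32 * C \<ge> 0" using C by simp
    fix n :: nat and x :: real assume n: "n > 0"
    interpret L: prob_space "law n" by (rule law)
    show "cdf (\<mu> n) x \<le> cdf (\<beta> n) x"
      unfolding cm cb
    proof (rule L.finite_measure_mono)
      show "{y \<in> HS. (dist0 y - real n * M1) / sqrt (real n) \<le> x} \<subseteq> {y \<in> HS. (ln (bus y) - real n * M1) / sqrt (real n) \<le> x}"
      proof
        fix y assume y: "y \<in> {y \<in> HS. (dist0 y - real n * M1) / sqrt (real n) \<le> x}"
        then have "(ln (bus y) - real n * M1) / sqrt (real n) \<le> (dist0 y - real n * M1) / sqrt (real n)"
          using bus_le[of y] by (intro divide_right_mono diff_right_mono) auto
        then show "y \<in> {y \<in> HS. (ln (bus y) - real n * M1) / sqrt (real n) \<le> x}" using y by auto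
      qed
    qed (rule m2)
    \<comment> \<open>the exponent 1/6 makes \<open>s / sqrt n\<close> and \<open>1 / s\<^sup>2\<close> equal\<close>
    define s where "s = real n powr (1/6)"
    have s: "s > 0" using n by (simp add: s_def)
    have sn: "s = real n powr (- 1/3) * sqrt (real n)"
      unfolding s_def using n by (simp add: powr_half_sqrt[symmetric] flip: powr_add)
    have "cdf (\<beta> n) (x - real n powr (- 1/3)) \<le> measure (law n) ({y \<in> HS. (dist0 y - real n * M1) / sqrt (real n) \<le> x} \<union> {y \<in> HS. dist0 y - ln (bus y) > s})"
      unfolding cb
    proof (rule L.finite_measure_mono)
      show "{y \<in> HS. (ln (bus y) - real n * M1) / sqrt (real n) \<le> x - real n powr (- 1/3)} \<subseteq>
        {y \<in> HS. (dist0 y - real n * M1) / sqrt (real n) \<le> x} \<union> {y \<in> HS. dist0 y - ln (bus y) > s}"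
      proof
        fix y assume y: "y \<in> {y \<in> HS. (ln (bus y) - real n * M1) / sqrt (real n) \<le> x - real n powr (- 1/3)}"
        have "(dist0 y - real n * M1) / sqrt (real n) \<le> x" if "dist0 y - ln (bus y) \<le> s"
        proof -
          have "ln (bus y) - real n * M1 \<le> (x - real n powr (- 1/3)) * sqrt (real n)"
            using y n by (simp add: divide_le_eq)
          then have "ln (bus y) - real n * M1 \<le> x * sqrt (real n) - s" unfolding sn by (simp add: left_diff_distrib)
          then have "dist0 y - real n * M1 \<le> x * sqrt (real n)" using that by linarith
          then show ?thesis using n by (simp add: divide_le_eq)
        qed
        then show "y \<in> {y \<in> HS. (dist0 y - real n * M1) / sqrt (real n) \<le> x} \<union> {y \<in> HS. dist0 y - ln (bus y) > s}"
          using y by auto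
      qed
    qed (intro sets.Un m1 m3)
    also have "\<dots> \<le> cdf (\<mu> n) x + measure (law n) {y \<in> HS. dist0 y - ln (bus y) > s}"
      unfolding cm by (rule measure_Un_le[OF m1 m3])
    also have "\<dots> \<le> cdf (\<mu> n) x + C * exp (- s / 4)" by (rule add_left_mono[OF C(2)])
    also have "\<dots> \<le> cdf (\<mu> n) x + C * (32 * real n powr (- 1/3))"
    proof (rule add_left_mono, rule mult_left_mono[OF _ C(1)])
      have "exp (- (s / 4)) \<le> 2 / (s / 4)\<^sup>2" by (rule exp_minus_le_inverse_square) (use s in simp)
      also have "\<dots> = 32 / s\<^sup>2" by (simp add: power_divide)
      also have "s\<^sup>2 = real n powr (1/3)" unfolding s_def using n by (simp add: powr_power)
      also have "32 / real n powr (1/3) = 32 * real n powr (- 1/3)" by (simp add: powr_minus_divide)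
      finally show "exp (- s / 4) \<le> 32 * real n powr (- 1/3)" by simp
    qed
    finally show "cdf (\<beta> n) (x - real n powr (- 1/3)) \<le> cdf (\<mu> n) x + 32 * C * real n powr (- 1/3)"
      by (simp only: mult.commute mult.left_commute)
  qed
qed

text \<open>
  The shift and the error in the sandwich tend to 0, and the limit distribution function is
  Lipschitz.
\<close>

lemma weak_conv_mu: "weak_conv_m \<mu> (normal0 \<sigma>)"
  unfolding weak_conv_m_def weak_conv_def
proof (intro allI impI)
  fix x
  interpret N: real_distribution "normal0 \<sigma>" by (rule normal0_real_distribution[OF sigma_pos])
  have cont: "isCont (cdf (normal0 \<sigma>)) y" for y
  proof -
    have "emeasure (normal0 \<sigma>) {y} = 0"
      by (simp add: emeasure_density nn_integral_null_set[of "{y}"] null_sets_def)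
    then show ?thesis by (simp add: N.isCont_cdf measure_def)
  qed
  have lim: "(\<lambda>n. cdf (\<beta> n) y) \<longlonglongrightarrow> cdf (normal0 \<sigma>) y" for y
    using weak_conv_beta cont unfolding weak_conv_m_def weak_conv_def by blast
  obtain C where C: "C \<ge> 0" "\<And>n x. n > 0 \<Longrightarrow> cdf (\<mu> n) x \<le> cdf (\<beta> n) x"
    "\<And>n x. n > 0 \<Longrightarrow> cdf (\<beta> n) (x - real n powr (- 1/3)) \<le> cdf (\<mu> n) x + C * real n powr (- 1/3)"
    using sandwich by blast
  have small: "(\<lambda>n. real n powr (- 1/3)) \<longlonglongrightarrow> 0"
    by (rule tendsto_neg_powr[OF _ filterlim_real_sequentially]) simp
  show "(\<lambda>n. cdf (\<mu> n) x) \<longlonglongrightarrow> cdf (normal0 \<sigma>) x"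
  proof (rule order_tendstoI)
    fix a assume a: "cdf (normal0 \<sigma>) x < a"
    have "eventually (\<lambda>n. cdf (\<beta> n) x < a) sequentially" by (rule order_tendstoD(2)[OF lim a])
    then show "eventually (\<lambda>n. cdf (\<mu> n) x < a) sequentially"
      using eventually_gt_at_top[of 0] by eventually_elim (use C(2) in \<open>meson le_less_trans\<close>)
  next
    fix a assume a: "a < cdf (normal0 \<sigma>) x"
    let ?e = "(cdf (normal0 \<sigma>) x - a) / 2"
    have e: "?e > 0" using a by simp
    \<comment> \<open>a shift by \<open>\<delta>\<close> changes the normal distribution function by at most \<open>?e\<close>\<close>
    define \<delta> where "\<delta> = \<sigma> * ?e"
    have \<delta>: "\<delta> > 0" using e sigma_pos by (simp add: \<delta>_def)
    have "cdf (normal0 \<sigma>) x - cdf (normal0 \<sigma>) (x - \<delta>) \<le> (x - (x - \<delta>)) / \<sigma>"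
      by (rule cdf_normal0_lipschitz[OF sigma_pos]) (use \<delta> in simp)
    also have "\<dots> = ?e" using sigma_pos by (simp add: \<delta>_def)
    finally have low: "a + ?e \<le> cdf (normal0 \<sigma>) (x - \<delta>)" by (simp add: field_simps)
    have ev1: "eventually (\<lambda>n. a + ?e / 2 < cdf (\<beta> n) (x - \<delta>)) sequentially"
      by (rule order_tendstoD(1)[OF lim]) (use low e in linarith)
    have ev2: "eventually (\<lambda>n. real n powr (- 1/3) < \<delta>) sequentially" by (rule order_tendstoD(2)[OF small \<delta>])
    have ev3: "eventually (\<lambda>n. C * real n powr (- 1/3) < ?e / 2) sequentially"
      by (rule order_tendstoD(2)[OF tendsto_mult_right_zero[OF small]]) (use e in simp)
    show "eventually (\<lambda>n. a < cdf (\<mu> n) x) sequentially"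
      using ev1 ev2 ev3 eventually_gt_at_top[of 0]
    proof eventually_elim
      case (elim n)
      interpret B: real_distribution "\<beta> n" by (rule beta_real_distribution)
      have "cdf (\<beta> n) (x - \<delta>) \<le> cdf (\<beta> n) (x - real n powr (- 1/3))"
        by (rule B.cdf_nondecreasing) (use elim(2) in simp)
      then show ?case using C(3)[OF elim(4), of x] elim(1,3) by linarith
    qed
  qed
qed

lemma rate_mu:
  assumes "integrable \<nu> (\<lambda>t. t ^ 3)"
  shows "(\<lambda>n. SUP x. \<bar>cdf (\<mu> n) x - cdf (normal0 \<sigma>) x\<bar>) \<in> O(\<lambda>n. real n powr (- 1/3))"
proof -
  obtain D where D: "\<And>n x. n > 0 \<Longrightarrow> \<bar>cdf (\<beta> n) x - cdf (normal0 \<sigma>) x\<bar> \<le> D * real n powr (- 1/3)"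
    using rate_beta[OF assms] by blast
  obtain C where C: "C \<ge> 0" "\<And>n x. n > 0 \<Longrightarrow> cdf (\<mu> n) x \<le> cdf (\<beta> n) x"
    "\<And>n x. n > 0 \<Longrightarrow> cdf (\<beta> n) (x - real n powr (- 1/3)) \<le> cdf (\<mu> n) x + C * real n powr (- 1/3)"
    using sandwich by blast
  let ?K = "D + C + 1 / \<sigma>"
  have b: "\<bar>cdf (\<mu> n) x - cdf (normal0 \<sigma>) x\<bar> \<le> ?K * real n powr (- 1/3)" if n: "n > 0" for n x
  proof -
    let ?r = "real n powr (- 1/3)"
    have "cdf (normal0 \<sigma>) x - cdf (normal0 \<sigma>) (x - ?r) \<le> (x - (x - ?r)) / \<sigma>"
      by (rule cdf_normal0_lipschitz[OF sigma_pos]) simp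
    then have l: "cdf (normal0 \<sigma>) x - cdf (normal0 \<sigma>) (x - ?r) \<le> 1 / \<sigma> * ?r" by simp
    have p: "C * ?r \<ge> 0" "1 / \<sigma> * ?r \<ge> 0" using C(1) sigma_pos by simp_all
    have "?K * ?r = D * ?r + C * ?r + 1 / \<sigma> * ?r" by (simp only: distrib_right)
    then show ?thesis using D[OF n, of x] D[OF n, of "x - ?r"] C(2)[OF n, of x] C(3)[OF n, of x] l p by linarith
  qed
  show ?thesis
  proof (rule bigoI[where c = ?K], rule eventually_mono[OF eventually_gt_at_top[of 0]])
    fix n :: nat assume n: "n > 0"
    let ?f = "\<lambda>x. \<bar>cdf (\<mu> n) x - cdf (normal0 \<sigma>) x\<bar>"
    have "bdd_above (range ?f)" by (rule bdd_aboveI2) (rule b[OF n])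
    then have "?f 0 \<le> (SUP x. ?f x)" by (rule cSUP_upper[OF UNIV_I])
    then have "0 \<le> (SUP x. ?f x)" by linarith
    moreover have "(SUP x. ?f x) \<le> ?K * real n powr (- 1/3)" by (rule cSUP_least) (use b[OF n] in auto)
    ultimately show "norm (SUP x. ?f x) \<le> ?K * norm (real n powr (- 1/3))" by simp
  qed
qed

end

theorem theorem1p1:
  fixes F :: base_field and k :: nat and \<nu> :: "real measure"
    and M :: "'w measure" and S :: "nat \<Rightarrow> 'w \<Rightarrow> ((quat, 'n::{finite,linorder}) sqmat) set"
  assumes k: "k \<ge> 2" and card: "CARD('n) = k + 1"
    and nu: "real_distribution \<nu>" "AE t in \<nu>. 0 \<le> t"
    and nontrivial: "\<nu> \<noteq> return borel 0"
    and second_moment: "integrable \<nu> (\<lambda>t. t ^ 2)"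
    and walk: "radial_random_walk F M S" "walk_associated_with F M S \<nu>"
  shows "let M1 = mod_moment F k \<nu> 1; M2 = mod_moment F k \<nu> 2;
             \<mu> = (\<lambda>n. distr M borel
                    (\<lambda>w. (hyp_dist F (S n w) (hyp_origin F) - real n * M1) / sqrt (real n)));
             N = density lborel (\<lambda>x. ennreal (normal_density 0 (sqrt (M2 - M1\<^sup>2)) x))
         in integrable \<nu> (moment_fun F k 1) \<and> integrable \<nu> (moment_fun F k 2) \<and>
            M2 - M1\<^sup>2 > 0 \<and>
            weak_conv_m \<mu> N \<and>
            (integrable \<nu> (\<lambda>t. t ^ 3) \<longrightarrow>
               (\<lambda>n. SUP x. \<bar>cdf (\<mu> n) x - cdf N x\<bar>) \<in> O(\<lambda>n. real n powr (- 1/3)))"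
proof -
  obtain \<kappa> where \<kappa>: "markov_chain M (hyp_borel F) \<kappa> S" "AE w in M. S 0 w = hyp_origin F"
    "\<forall>g\<in>Ggrp F. \<forall>x\<in>hyp_space F. \<forall>A\<in>sets (hyp_borel F). emeasure (\<kappa> (hyp_act g x)) (hyp_act g ` A) = emeasure (\<kappa> x) A"
    using walk(1) unfolding radial_random_walk_def by blast
  have "radial_walk F (Ggrp F) (Kgrp F) (hyp_space F) (hyp_borel F) (hyp_origin F) (- {ix0 :: 'n})
    (sphere_meas (fcoords F (- {ix0}))) k M S \<kappa> \<nu>"
  proof (intro radial_walk.intro hyp_geometry.intro hyp_groups.intro hyp_geometry_axioms.intro radial_walk_axioms.intro)
    show "3 \<le> CARD('n)" "k = CARD('n) - 1" using k card by simp_all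
    show "distr M borel (\<lambda>w. hyp_dist F (S n w) (S (Suc n) w)) = \<nu>" for n
      using walk(2) unfolding walk_associated_with_def by blast
    show "emeasure (\<kappa> (hyp_act g x)) (hyp_act g ` A) = emeasure (\<kappa> x) A"
      if "g \<in> Ggrp F" "x \<in> hyp_space F" "A \<in> sets (hyp_borel F)" for g x A
      using \<kappa>(3) that by blast
  qed (rule refl \<kappa> nu nontrivial second_moment)+
  then interpret R: radial_walk F "Ggrp F" "Kgrp F" "hyp_space F" "hyp_borel F" "hyp_origin F" "- {ix0 :: 'n}"
    "sphere_meas (fcoords F (- {ix0}))" k M S \<kappa> \<nu> .
  note defs = R.\<mu>_def[abs_def] R.\<sigma>_def R.M1_def R.M2_def
  show ?thesis
    unfolding Let_def
  proof (intro conjI impI)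
    show "integrable \<nu> (moment_fun F k 1)" by (rule R.moments(1)[OF R.first_moment])
    show "integrable \<nu> (moment_fun F k 2)" by (rule R.moments(1)[OF second_moment])
  qed (rule R.variance_pos[unfolded defs] R.weak_conv_mu[unfolded defs] R.rate_mu[unfolded defs], assumption?)+
qed

end
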